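(* Let $\Phi$ be a stationary point process on $\mathbb{R}^d$ satisfying the standing assumption (see context) with intensity $\lambda=1$. Assume that $S\in\Theta(\beta,L)$ with $L\in(0,\infty)$ and $\beta\in(0,2]$. Let $R>0$, $W=[-R,R]^d$ and $I=\{i\in\mathbb{N}^d:\ |i|_\infty<i_{\max}\}$ with $i_{\max}\ge1$. Consider, for all $i\in I$, $f_i=r^{-d/2}\psi_i(\cdot/r)$, where $\psi_i$ is the $i$-th Hermite function and $$r=R\big/\sqrt{2i_{\max}+i_{\max}^{1/3+\theta}},$$ where $\theta\in(0,2/3)$. Suppose that $$|I|\Big(|W|^{2\beta/(2\beta+d)}\Big(\frac{\|S\|_\infty}{L}\Big)^{\frac d{2\beta+d}}\Big)^{-1}\in(c_2,c_3)$$ for some constants $0<c_2\le c_3<\infty$. Then the multitaper estimator $\widehat S$ associated with $(f_i)_{i\in I}$ and $W$ satisfies $$\sup_{k_0\in\mathbb{R}^d}\mathbb{E}\big[|\widehat S(k_0)-S(k_0)|^2\big]^{1/2}\le K\left(\frac{(L^d\|S\|_\infty^\beta)^{\frac1{2\beta+d}}}{|W|^{\frac\beta{2\beta+d}}}+\sqrt{\frac{|\gamma^4_{\mathrm{red}}|\log(|W|)^d}{|W|}}+e^{-c|W|^\alpha}\right),$$ where $|\gamma^4_{\mathrm{red}}|:=1+7|\gamma^{(2)}_{\mathrm{red}}|(\mathbb{R}^d)+6|\gamma^{(3)}_{\mathrm{red}}|(\mathbb{R}^{2d})+|\gamma^{(4)}_{\mathrm{red}}|(\mathbb{R}^{3d})$,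 $\alpha=3\beta\theta/(d(2\beta+d))$, and $0<c,K<\infty$ are constants that do not depend on $W$, $r$ and $I$.
   Context: Standing assumption: $\Phi$ is a random locally finite subset of $\mathbb{R}^d$, stationary, of intensity $\lambda>0$ ($\mathbb{E}|\Phi\cap A|=\lambda|A|$), whose second factorial moment measure is $\rho^{(2)}(dx,dy)=\lambda^2g(x-y)dx\,dy$ with $g-1\in L^1(\mathbb{R}^d)\cap L^2(\mathbb{R}^d)$. Structure factor: $S(k)=1+\lambda\int(g(x)-1)e^{-\mathbf{i}k\cdot x}dx$; $\|S\|_\infty=\sup_k|S(k)|$. Multitaper estimator (for $\lambda=1$): $T_i(k_0)=\sum_{x\in\Phi\cap W}e^{-\mathbf{i}k_0\cdot x}f_i(x)$, $C_i(k_0)=T_i(k_0)-\mathbb{E}[T_i(k_0)]$, $\widehat S(k_0)=\frac1{|I|}\sum_{i\in I}|C_i(k_0)|^2$. $|W|$ is the Lebesgue measure of $W$, $|I|$ the cardinality of $I$, $|i|_\infty=\max_s|i_s|$. Hermite functions: for $i\in\mathbb{N}^d$, $\psi_i(x)=e^{-|x|^2/2}\prod_{l=1}^dH_{i_l}(x_l)$ with $H_n(y)=\frac{(-1)^n}{(2^nn!\sqrt\pi)^{1/2}}e^{y^2}\frac{d^n}{dy^n}e^{-y^2}$. Hölder class: for $\beta,L>0$ with $l$ the greatest integer strictly less than $\beta$, $f:\mathbb{R}^d\to\mathbb{R}$ is in $\Theta(\beta,L)$ if $f$ is $l$ times differentiable and $|\partial^l_if(x)-\partial^l_if(y)|\le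 L|x-y|^{\beta-l}$ for all $x,y$ and all multi-indices $i$ with $i_1+\dots+i_d=l$. Cumulant measures: $\rho^{(m)}(A_1\times\dots\times A_m)=\mathbb{E}[\sum^{\ne}_{x_1,\dots,x_m\in\Phi}\mathbf 1\{x_j\in A_j\,\forall j\}]$ (sum over distinct points), $\gamma^{(m)}(A_1\times\dots\times A_m)=\sum_{\sigma\in\Pi[m]}(-1)^{|\sigma|-1}(|\sigma|-1)!\prod_{b\in\sigma}\rho^{(|b|)}(\prod_{s\in b}A_s)$ ($\Pi[m]$: partitions of $\{1,\dots,m\}$), and $\gamma^{(m)}_{\mathrm{red}}$ is the signed measure on $(\mathbb{R}^d)^{m-1}$ with $\gamma^{(m)}(A_1\times\dots\times A_m)=\int_{A_m}\gamma^{(m)}_{\mathrm{red}}(\prod_{i<m}(A_i-x))dx$; $|\gamma^{(m)}_{\mathrm{red}}|$ is its total variation. *)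

theory Defs
  imports "HOL-Probability.Probability"
begin

section \<open>Stationary point processes\<close>

definition loc_finite :: "'a::metric_space set \<Rightarrow> bool" where
  "loc_finite C \<longleftrightarrow> (\<forall>B. bounded B \<longrightarrow> finite (C \<inter> B))"

text \<open>The space of locally finite configurations, with the smallest sigma-algebra for which
  all counts in bounded Borel sets are measurable.\<close>

definition config_space :: "(real ^ 'n) set measure" where
  "config_space = sigma {C. loc_finite C}
     {{C. loc_finite C \<and> card (C \<inter> A) = n} | A n. A \<in> sets borel \<and> bounded A}"

definition stationary_point_process ::
    "'w measure \<Rightarrow> ('w \<Rightarrow> (real ^ 'n) set) \<Rightarrow> bool" where
  "stationary_point_process M \<Phi> \<longleftrightarrow>
     prob_space M \<and> \<Phi> \<in> M \<rightarrow>\<^sub>M config_space \<and>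
     (\<forall>v. distr M config_space (\<lambda>\<omega>. (\<lambda>x. x + v) ` \<Phi> \<omega>) = distr M config_space \<Phi>)"

definition has_intensity :: "'w measure \<Rightarrow> ('w \<Rightarrow> (real ^ 'n) set) \<Rightarrow> real \<Rightarrow> bool" where
  "has_intensity M \<Phi> lam \<longleftrightarrow>
     (\<forall>A\<in>sets borel. (\<integral>\<^sup>+\<omega>. emeasure (count_space UNIV) (\<Phi> \<omega> \<inter> A) \<partial>M)
        = ennreal lam * emeasure lborel A)"

text \<open>\<open>fact_moment M \<Phi> J A\<close> is the factorial moment measure of order \<open>card J\<close>, evaluated on the
  product of the sets \<open>A j\<close> with \<open>j\<close> in the finite index set \<open>J\<close>: the expected number of
  \<open>J\<close>-indexed tuples of pairwise distinct points of the process whose \<open>j\<close>-th entry lies in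
  \<open>A j\<close>.\<close>

definition fact_moment ::
    "'w measure \<Rightarrow> ('w \<Rightarrow> (real ^ 'n) set) \<Rightarrow> nat set \<Rightarrow> (nat \<Rightarrow> (real ^ 'n) set) \<Rightarrow> ennreal" where
  "fact_moment M \<Phi> J A =
     (\<integral>\<^sup>+\<omega>. emeasure (count_space UNIV)
         {x \<in> J \<rightarrow>\<^sub>E \<Phi> \<omega>. inj_on x J \<and> (\<forall>j\<in>J. x j \<in> A j)} \<partial>M)"

text \<open>The positive measure of order two has density \<open>lam\<^sup>2 g (x - y)\<close>; its values on measurable
  rectangles determine it. Nonnegativity of \<open>g\<close> is stated because \<open>ennreal\<close> truncates.\<close>

definition has_pair_correlation ::
    "'w measure \<Rightarrow> ('w \<Rightarrow> (real ^ 'n) set) \<Rightarrow> real \<Rightarrow> (real ^ 'n \<Rightarrow> real) \<Rightarrow> bool" where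
  "has_pair_correlation M \<Phi> lam g \<longleftrightarrow>
     g \<in> borel_measurable borel \<and> (AE x in lborel. 0 \<le> g x) \<and>
     (\<forall>A. (\<forall>j. A j \<in> sets borel) \<longrightarrow>
        fact_moment M \<Phi> {1, 2} A =
          (\<integral>\<^sup>+x\<in>A 1. (\<integral>\<^sup>+y\<in>A 2. ennreal (lam\<^sup>2 * g (x - y)) \<partial>lborel) \<partial>lborel))"

definition standing_assumption ::
    "'w measure \<Rightarrow> ('w \<Rightarrow> (real ^ 'n) set) \<Rightarrow> real \<Rightarrow> (real ^ 'n \<Rightarrow> real) \<Rightarrow> bool" where
  "standing_assumption M \<Phi> lam g \<longleftrightarrow>
     stationary_point_process M \<Phi> \<and> 0 < lam \<and> has_intensity M \<Phi> lam \<and>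
     has_pair_correlation M \<Phi> lam g \<and>
     integrable lborel (\<lambda>x. g x - 1) \<and> integrable lborel (\<lambda>x. (g x - 1)\<^sup>2)"

text \<open>Complex-valued by its formula, but real under the standing assumption, since
  \<open>g (- x) = g x\<close> almost everywhere by symmetry of the second factorial moment measure.\<close>

definition structure_factor :: "real \<Rightarrow> (real ^ 'n \<Rightarrow> real) \<Rightarrow> real ^ 'n \<Rightarrow> complex" where
  "structure_factor lam g k =
     1 + of_real lam * (LINT x|lborel. of_real (g x - 1) * exp (- \<i> * of_real (k \<bullet> x)))"

definition sup_norm :: "(real ^ 'n \<Rightarrow> complex) \<Rightarrow> real" where
  "sup_norm S = (SUP k. cmod (S k))"

section \<open>Reduced cumulant measures\<close>

text \<open>The formula below is meaningful when the factorial moments involved are finite; this is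
  required in \<open>has_reduced_cumulant\<close>.\<close>

definition cumulant ::
    "'w measure \<Rightarrow> ('w \<Rightarrow> (real ^ 'n) set) \<Rightarrow> nat \<Rightarrow> (nat \<Rightarrow> (real ^ 'n) set) \<Rightarrow> real" where
  "cumulant M \<Phi> m A =
     (\<Sum>\<sigma> | partition_on {1..m} \<sigma>.
        (- 1) ^ (card \<sigma> - 1) * fact (card \<sigma> - 1) * (\<Prod>b\<in>\<sigma>. enn2real (fact_moment M \<Phi> b A)))"

text \<open>Points of \<open>(\<real>\<^sup>d)\<^sup>m\<^sup>-\<^sup>1\<close> are extensional functions on \<open>{1..<m}\<close>.\<close>

definition bounded_borel :: "nat \<Rightarrow> (nat \<Rightarrow> real ^ 'n) set set" where
  "bounded_borel m =
     {B \<in> sets (PiM {1..<m} (\<lambda>_. borel)). \<exists>\<rho>. B \<subseteq> ({1..<m} \<rightarrow>\<^sub>E cball 0 \<rho>)}"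

text \<open>Reduced cumulant measures need not have finite total mass, so a signed measure is a
  real-valued set function on the bounded Borel sets, countably additive as long as the union
  stays bounded.\<close>

definition signed_measure :: "nat \<Rightarrow> ((nat \<Rightarrow> real ^ 'n) set \<Rightarrow> real) \<Rightarrow> bool" where
  "signed_measure m \<nu> \<longleftrightarrow>
     (\<forall>B::nat \<Rightarrow> _. range B \<subseteq> bounded_borel m \<longrightarrow> disjoint_family B \<longrightarrow>
        (\<Union>i. B i) \<in> bounded_borel m \<longrightarrow> (\<lambda>i. \<nu> (B i)) sums \<nu> (\<Union>i. B i))"

text \<open>Mass of the total variation of \<open>\<nu>\<close> on the whole space, possibly infinite.\<close>

definition total_variation :: "nat \<Rightarrow> ((nat \<Rightarrow> real ^ 'n) set \<Rightarrow> real) \<Rightarrow> ennreal" where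
  "total_variation m \<nu> =
     (SUP P \<in> {P. finite P \<and> P \<subseteq> bounded_borel m \<and> disjoint P}. \<Sum>B\<in>P. ennreal \<bar>\<nu> B\<bar>)"

definition has_reduced_cumulant ::
    "'w measure \<Rightarrow> ('w \<Rightarrow> (real ^ 'n) set) \<Rightarrow> nat \<Rightarrow> ((nat \<Rightarrow> real ^ 'n) set \<Rightarrow> real) \<Rightarrow> bool" where
  "has_reduced_cumulant M \<Phi> m \<nu> \<longleftrightarrow>
     signed_measure m \<nu> \<and>
     (\<forall>A. (\<forall>j. A j \<in> sets borel \<and> bounded (A j)) \<longrightarrow>
        (\<forall>b \<subseteq> {1..m}. fact_moment M \<Phi> b A < \<infinity>) \<and>
        cumulant M \<Phi> m A =
          (LINT x:A m|lborel. \<nu> (\<Pi>\<^sub>E j\<in>{1..<m}. (\<lambda>a. a - x) ` A j)))"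

text \<open>Here \<open>\<gamma> m\<close> is the reduced cumulant measure of order \<open>m\<close>.\<close>

definition gamma4_red :: "(nat \<Rightarrow> (nat \<Rightarrow> real ^ 'n) set \<Rightarrow> real) \<Rightarrow> ennreal" where
  "gamma4_red \<gamma> =
     1 + 7 * total_variation 2 (\<gamma> 2) + 6 * total_variation 3 (\<gamma> 3) + total_variation 4 (\<gamma> 4)"

section \<open>Hoelder class\<close>

definition partial_deriv :: "'n \<Rightarrow> (real ^ 'n \<Rightarrow> real) \<Rightarrow> real ^ 'n \<Rightarrow> real" where
  "partial_deriv s f x = frechet_derivative f (at x) (axis s 1)"

primrec times_differentiable :: "nat \<Rightarrow> (real ^ 'n \<Rightarrow> real) \<Rightarrow> bool" where
  "times_differentiable 0 f \<longleftrightarrow> True"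
| "times_differentiable (Suc l) f \<longleftrightarrow>
     (\<forall>x. f differentiable (at x)) \<and> (\<forall>s. times_differentiable l (partial_deriv s f))"

text \<open>A partial derivative of order \<open>l\<close> is given by the list \<open>ss\<close> of its \<open>l\<close> directions. The
  multi-index \<open>i\<close> corresponds to the lists that contain each direction \<open>s\<close> exactly \<open>i $ s\<close>
  times; for an \<open>l\<close> times differentiable function they all give the same derivative.\<close>

definition Holder_class :: "real \<Rightarrow> real \<Rightarrow> (real ^ 'n \<Rightarrow> real) set" where
  "Holder_class \<beta> L =
     {f. let l = (GREATEST l::nat. real l < \<beta>) in
           times_differentiable l f \<and>
           (\<forall>ss. length ss = l \<longrightarrow>
              (\<forall>x y. \<bar>foldr partial_deriv ss f x - foldr partial_deriv ss f y\<bar>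
                       \<le> L * norm (x - y) powr (\<beta> - real l)))}"

section \<open>Hermite tapers and the multitaper estimator\<close>

definition hermite1 :: "nat \<Rightarrow> real \<Rightarrow> real" where
  "hermite1 n y =
     (- 1) ^ n / sqrt (2 ^ n * fact n * sqrt pi) * exp (y\<^sup>2) * (deriv ^^ n) (\<lambda>t. exp (- t\<^sup>2)) y"

definition hermite_fun :: "nat ^ 'n \<Rightarrow> real ^ 'n \<Rightarrow> real" where
  "hermite_fun i x = exp (- (norm x)\<^sup>2 / 2) * (\<Prod>s\<in>UNIV. hermite1 (i $ s) (x $ s))"

definition hermite_taper :: "real \<Rightarrow> nat ^ 'n \<Rightarrow> real ^ 'n \<Rightarrow> real" where
  "hermite_taper r i x = r powr (- real CARD('n) / 2) * hermite_fun i ((1 / r) *\<^sub>R x)"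

definition taper_indices :: "nat \<Rightarrow> (nat ^ 'n) set" where
  "taper_indices imax = {i. (MAX s. i $ s) < imax}"

definition window :: "real \<Rightarrow> (real ^ 'n) set" where
  "window R = cbox (\<chi> s. - R) (\<chi> s. R)"

definition taper_sum ::
    "('w \<Rightarrow> (real ^ 'n) set) \<Rightarrow> (real ^ 'n) set \<Rightarrow> (real ^ 'n \<Rightarrow> real) \<Rightarrow> real ^ 'n \<Rightarrow> 'w \<Rightarrow> complex" where
  "taper_sum \<Phi> W f k \<omega> = (\<Sum>x \<in> \<Phi> \<omega> \<inter> W. exp (- \<i> * of_real (k \<bullet> x)) * of_real (f x))"

definition centered_taper_sum ::
    "'w measure \<Rightarrow> ('w \<Rightarrow> (real ^ 'n) set) \<Rightarrow> (real ^ 'n) set \<Rightarrow> (real ^ 'n \<Rightarrow> real) \<Rightarrow>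
      real ^ 'n \<Rightarrow> 'w \<Rightarrow> complex" where
  "centered_taper_sum M \<Phi> W f k \<omega> =
     taper_sum \<Phi> W f k \<omega> - (LINT \<omega>'|M. taper_sum \<Phi> W f k \<omega>')"

definition multitaper ::
    "'w measure \<Rightarrow> ('w \<Rightarrow> (real ^ 'n) set) \<Rightarrow> (real ^ 'n) set \<Rightarrow> 'i set \<Rightarrow>
      ('i \<Rightarrow> real ^ 'n \<Rightarrow> real) \<Rightarrow> real ^ 'n \<Rightarrow> 'w \<Rightarrow> real" where
  "multitaper M \<Phi> W I f k \<omega> =
     1 / real (card I) * (\<Sum>i\<in>I. (cmod (centered_taper_sum M \<Phi> W (f i) k \<omega>))\<^sup>2)"

section \<open>Mean square error\<close>

definition ennreal_sqrt :: "ennreal \<Rightarrow> ennreal" where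
  "ennreal_sqrt x = (if x = \<infinity> then \<infinity> else ennreal (sqrt (enn2real x)))"

definition L2_error ::
    "'w measure \<Rightarrow> ('w \<Rightarrow> real) \<Rightarrow> complex \<Rightarrow> ennreal" where
  "L2_error M X s = ennreal_sqrt (\<integral>\<^sup>+\<omega>. ennreal ((cmod (of_real (X \<omega>) - s))\<^sup>2) \<partial>M)"

end

theory Submission
  imports Defs "HOL-Computational_Algebra.Polynomial" "HOL-Real_Asymp.Real_Asymp"
begin

text \<open>
  Write \<open>V\<close> for the volume of the window, \<open>d\<close> for the dimension, \<open>N\<close> for \<open>imax\<close> and \<open>T\<close> for
  \<open>V powr (- \<beta> / (2 * \<beta> + d))\<close>. The constants \<open>c\<close> and \<open>K\<close> may depend on everything except the window,
  the scale and the number of tapers, so it is enough to bound the mean square error by a constant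
  times \<open>T\<^sup>2\<close>; the first term of the bound is a constant times \<open>T\<close>. The error is the sum of a squared bias
  and a variance.

  Bias. The mean of one squared taper sum is the covariance form of the process at the windowed taper
  (\<open>square_moment\<close>). For the taper on the whole space this form is an average of the structure factor
  against a rescaled squared Hermite function, because the autocorrelation of a Hermite function is
  the Fourier transform of its own square (\<open>hermite_fourier_eq_autocorr\<close>, \<open>corr_form_mtaper\<close>). By
  symmetry only second differences of the structure factor enter the average, these are \<open>O(\<bar>x\<bar>\<^sup>\<beta>)\<close> for
  all \<open>\<beta> \<le> 2\<close>, and the squared Hermite functions have second moment of order \<open>N\<close>; this gives
  \<open>O((sqrt N / r)\<^sup>\<beta>)\<close> (\<open>sfac_average_bias\<close>). Cutting the taper at the window costs the square root of its
  mass outside. The scale is such that the window reaches beyond the turning point \<open>sqrt (2 * N)\<close> of the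
  Hermite equation, where convexity forces decay, and this mass is a stretched exponential in \<open>N\<close>
  (\<open>hermite_tail\<close>).

  Variance. The fourth moment of the taper sums is a sum over the pairings of four factors plus a joint
  cumulant (\<open>expectation_centered_4\<close>). The tapers are orthonormal and the covariance form is bounded on
  \<open>L\<^sup>2\<close>, so a Bessel inequality bounds the two nontrivial pairings by a constant times \<open>\<bar>I\<bar>\<close>
  (\<open>gaussian_part\<close>); after division by \<open>\<bar>I\<bar>\<^sup>2\<close> they contribute \<open>O(1 / \<bar>I\<bar>)\<close>. In the joint cumulant the sum
  over the tapers is done first: the sum of the squared tapers is at most \<open>(sqrt (2 * N) / r) ^ d\<close> at
  every point (\<open>sum_hermite_square_le\<close>), and what remains is a total variation times the volume
  (\<open>sum_joint_cumulant_le\<close>); this contributes \<open>O(1 / V)\<close>. Cumulant measures are given through product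
  sets, so all moment formulas are first proved for functions constant on finitely many disjoint cells
  and then carried over to continuous functions, dominated by the fourth power of the number of points.

  The rate. The condition on \<open>\<bar>I\<bar>\<close> makes \<open>N ^ d\<close> comparable to \<open>V powr (2 * \<beta> / (2 * \<beta> + d))\<close>, and with
  \<open>N \<ge> 1\<close> it keeps \<open>V\<close> away from \<open>0\<close>. Then \<open>1 / \<bar>I\<bar>\<close>, \<open>1 / V\<close> and the squared bias are all \<open>O(T\<^sup>2)\<close>. If the
  total variations are infinite, the bound is infinite as soon as \<open>V > 1\<close>; for \<open>V \<le> 1\<close> the window lies in
  a unit cube, the fourth moment of the number of points there bounds the error, and \<open>T \<ge> 1\<close>
  (\<open>mean_square_small_window\<close>).
\<close>

section \<open>Hermite functions on the line\<close>

fun hermite_poly :: "nat \<Rightarrow> real poly" where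
  "hermite_poly 0 = 1"
| "hermite_poly (Suc 0) = [:0, 2:]"
| "hermite_poly (Suc (Suc n)) =
     [:0, 2:] * hermite_poly (Suc n) - smult (2 * real (Suc n)) (hermite_poly n)"

lemma pderiv_hermite_poly: "pderiv (hermite_poly (Suc n)) = smult (2 * real (Suc n)) (hermite_poly n)"
proof (induction n rule: hermite_poly.induct)
  case 1
  show ?case by (simp add: pderiv_pCons one_pCons)
next
  case 2
  show ?case by (simp add: pderiv_pCons pderiv_diff pderiv_mult one_pCons)
next
  case (3 n)
  have "pderiv (hermite_poly (Suc (Suc (Suc n)))) =
      [:0, 2:] * smult (2 * real (Suc (Suc n))) (hermite_poly (Suc n)) + hermite_poly (Suc (Suc n)) * [:2:]
      - smult (2 * real (Suc (Suc n))) (smult (2 * real (Suc n)) (hermite_poly n))"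
    unfolding hermite_poly.simps(3)[of "Suc n"]
    by (simp only: pderiv_diff pderiv_mult pderiv_smult 3) (simp add: pderiv_pCons)
  also have "\<dots> = smult (2 * real (Suc (Suc n))) (hermite_poly (Suc (Suc n))) + smult 2 (hermite_poly (Suc (Suc n)))"
    unfolding hermite_poly.simps(3)[of n]
    by (simp add: smult_diff_right algebra_simps)
  also have "\<dots> = smult (2 * real (Suc (Suc (Suc n)))) (hermite_poly (Suc (Suc n)))"
    by (simp add: smult_add_left[symmetric] del: hermite_poly.simps)
  finally show ?case .
qed

lemma hermite_poly_Suc: "hermite_poly (Suc n) = [:0, 2:] * hermite_poly n - pderiv (hermite_poly n)"
  by (cases n) (simp_all add: pderiv_hermite_poly one_pCons del: hermite_poly.simps(3), simp add: hermite_poly.simps(3))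

lemma funpow_deriv_exp_neg_square:
  "(deriv ^^ n) (\<lambda>t::real. exp (- t\<^sup>2)) = (\<lambda>t. (- 1) ^ n * (poly (hermite_poly n) t * exp (- t\<^sup>2)))"
proof (induction n)
  case (Suc n)
  have "((\<lambda>t. (- 1) ^ n * (poly (hermite_poly n) t * exp (- t\<^sup>2))) has_real_derivative
      (- 1) ^ Suc n * (poly (hermite_poly (Suc n)) t * exp (- t\<^sup>2))) (at t)" for t :: real
    unfolding hermite_poly_Suc
    by (auto intro!: derivative_eq_intros simp: algebra_simps)
  then have "deriv (\<lambda>t. (- 1) ^ n * (poly (hermite_poly n) t * exp (- t\<^sup>2))) t =
      (- 1) ^ Suc n * (poly (hermite_poly (Suc n)) t * exp (- t\<^sup>2))" for t :: real
    by (rule DERIV_imp_deriv)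
  then show ?case by (simp add: Suc fun_eq_iff)
qed simp

text \<open>The one-dimensional factor of \<open>hermite_fun\<close>: Gaussian weight and Hermite polynomial, with the
  polynomial kept explicit.\<close>

definition hermite_fun1 :: "nat \<Rightarrow> real \<Rightarrow> real" where
  "hermite_fun1 n t = poly (hermite_poly n) t * exp (- t\<^sup>2 / 2) / sqrt (2 ^ n * fact n * sqrt pi)"

lemma exp_times_hermite1: "exp (- t\<^sup>2 / 2) * hermite1 n t = hermite_fun1 n t"
proof -
  have "exp (- t\<^sup>2 / 2) * hermite1 n t =
      ((- 1) ^ n * (- 1) ^ n) * (exp (t\<^sup>2) * exp (- t\<^sup>2)) * (poly (hermite_poly n) t * exp (- t\<^sup>2 / 2)) / sqrt (2 ^ n * fact n * sqrt pi)"
    unfolding hermite1_def funpow_deriv_exp_neg_square by simp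
  also have "(- 1 :: real) ^ n * (- 1) ^ n = 1"
    by (simp add: power_add[symmetric])
  also have "exp (t\<^sup>2) * exp (- t\<^sup>2) = 1"
    by (simp add: exp_minus)
  finally show ?thesis by (simp add: hermite_fun1_def)
qed

lemma hermite_fun1_normalization:
  "sqrt (2 ^ Suc n * fact (Suc n) * sqrt pi) = sqrt (2 * real (Suc n)) * sqrt (2 ^ n * fact n * sqrt pi)"
  by (simp add: real_sqrt_mult[symmetric] algebra_simps)

lemma hermite_three_term_aux:
  fixes a b c s :: real
  assumes "a > 0" "b > 0" "c > 0" "s > 0" "s * s = 2"
  shows "t * (Q * e / (s * a * c)) = a / s * (P * e / c) + b / s * ((2 * t * Q - 2 * (a * a) * P) * e / (s * b * (s * a * c)))"
proof -
  have "b / s * (X / (s * b * (s * a * c))) = X / ((s * s) * s * a * c)" for X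
    using assms(1-4) by (simp add: field_simps)
  then have "b / s * (X / (s * b * (s * a * c))) = X / (2 * s * a * c)" for X
    by (simp only: assms(5))
  then have "a / s * (P * e / c) + b / s * ((2 * t * Q - 2 * (a * a) * P) * e / (s * b * (s * a * c)))
      = a / s * (P * e / c) + (2 * t * Q - 2 * (a * a) * P) * e / (2 * s * a * c)" by (simp only:)
  also have "\<dots> = t * (Q * e / (s * a * c))"
    using assms(1-4) by (simp add: divide_simps) (simp add: algebra_simps)
  finally show ?thesis by simp
qed

text \<open>The three-term recurrence in the normalisation of an orthonormal system: multiplication by the
  position is the sum of a lowering and a raising operator.\<close>

lemma hermite_fun1_times_id:
  "t * hermite_fun1 n t =
    sqrt (real n / 2) * hermite_fun1 (n - 1) t + sqrt (real (Suc n) / 2) * hermite_fun1 (Suc n) t"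
proof (cases n)
  case 0
  show ?thesis unfolding 0
    by (simp add: hermite_fun1_def real_sqrt_mult real_sqrt_divide field_simps)
next
  case (Suc m)
  have h: "poly (hermite_poly (Suc (Suc m))) t =
      2 * t * poly (hermite_poly (Suc m)) t - 2 * (sqrt (real (Suc m)) * sqrt (real (Suc m))) * poly (hermite_poly m) t"
    by simp
  show ?thesis unfolding Suc hermite_fun1_def hermite_fun1_normalization diff_Suc_1 h
    unfolding real_sqrt_mult[of 2 "real _"] real_sqrt_divide
    by (rule hermite_three_term_aux) auto
qed

text \<open>Differentiation is the difference of the same two ladder operators. With the previous identity,
  every relation between Hermite functions below becomes algebra with ladder coefficients.\<close>

lemma has_derivative_hermite_fun1:
  "(hermite_fun1 n has_real_derivative
    sqrt (real n / 2) * hermite_fun1 (n - 1) t - sqrt (real (Suc n) / 2) * hermite_fun1 (Suc n) t) (at t)"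
proof -
  let ?c = "sqrt (2 ^ n * fact n * sqrt pi)"
  have "((\<lambda>t. poly (hermite_poly n) t * exp (- t\<^sup>2 / 2)) has_real_derivative
      poly (pderiv (hermite_poly n)) t * exp (- t\<^sup>2 / 2) - t * (poly (hermite_poly n) t * exp (- t\<^sup>2 / 2))) (at t)"
    by (auto intro!: derivative_eq_intros simp: algebra_simps)
  from DERIV_cdivide[OF this, of ?c]
  have "(hermite_fun1 n has_real_derivative
      poly (pderiv (hermite_poly n)) t * exp (- t\<^sup>2 / 2) / ?c - t * hermite_fun1 n t) (at t)"
    unfolding hermite_fun1_def[abs_def] diff_divide_distrib times_divide_eq_right .
  moreover have "poly (pderiv (hermite_poly n)) t * exp (- t\<^sup>2 / 2) / ?c = 2 * sqrt (real n / 2) * hermite_fun1 (n - 1) t"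
  proof (cases n)
    case (Suc m)
    have aux: "(2 * (a * a) * P) * e / (s * a * c) = 2 * (a / s) * (P * e / c)" if "a > 0" "s > 0" "c > 0" for a s c P e :: real
      using that by (simp add: field_simps)
    have "poly (pderiv (hermite_poly (Suc m))) t = 2 * (sqrt (real (Suc m)) * sqrt (real (Suc m))) * poly (hermite_poly m) t"
      by (simp add: pderiv_hermite_poly)
    then show ?thesis unfolding Suc hermite_fun1_def hermite_fun1_normalization diff_Suc_1
      unfolding real_sqrt_mult[of 2 "real _"] real_sqrt_divide
      by (simp only:) (rule aux; simp)
  qed simp
  ultimately show ?thesis
    unfolding hermite_fun1_times_id[of t n] by (simp add: algebra_simps)
qed

lemma hermite_fun1_minus: "hermite_fun1 n (- t) = (- 1) ^ n * hermite_fun1 n t"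
proof -
  have "poly (hermite_poly n) (- t) = (- 1) ^ n * poly (hermite_poly n) t"
    by (induction n rule: hermite_poly.induct) (simp_all add: algebra_simps)
  then show ?thesis by (simp add: hermite_fun1_def)
qed

subsection \<open>Decay and integrability\<close>

lemma power_times_gauss_tendsto_0:
  "((\<lambda>t::real. t ^ k * exp (- t\<^sup>2 / 2)) \<longlongrightarrow> 0) at_top"
  "((\<lambda>t::real. t ^ k * exp (- t\<^sup>2 / 2)) \<longlongrightarrow> 0) at_bot"
proof -
  show *: "((\<lambda>t::real. t ^ k * exp (- t\<^sup>2 / 2)) \<longlongrightarrow> 0) at_top" by real_asymp
  have "((\<lambda>t::real. (-1)^k * (t ^ k * exp (- t\<^sup>2 / 2))) \<longlongrightarrow> (-1)^k * 0) at_top"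
    by (intro tendsto_intros *)
  moreover have "(-1)^k * (t ^ k * exp (- t\<^sup>2 / 2)) = (- t) ^ k * exp (- (- t)\<^sup>2 / 2)" for t :: real
    using power_minus[of t k] by simp
  ultimately show "((\<lambda>t::real. t ^ k * exp (- t\<^sup>2 / 2)) \<longlongrightarrow> 0) at_bot"
    unfolding filterlim_at_bot_mirror by (simp only: mult_zero_right)
qed

lemma poly_times_gauss_tendsto_0:
  "((\<lambda>t::real. poly p t * exp (- t\<^sup>2 / 2)) \<longlongrightarrow> 0) at_top"
  "((\<lambda>t::real. poly p t * exp (- t\<^sup>2 / 2)) \<longlongrightarrow> 0) at_bot"
  unfolding poly_altdef sum_distrib_right mult.assoc
  by (rule tendsto_null_sum tendsto_mult_right_zero power_times_gauss_tendsto_0)+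

lemma hermite_fun1_tendsto_0:
  "(hermite_fun1 n \<longlongrightarrow> 0) at_top" "(hermite_fun1 n \<longlongrightarrow> 0) at_bot"
  unfolding hermite_fun1_def[abs_def]
  by (rule tendsto_divide_zero poly_times_gauss_tendsto_0)+

lemma continuous_hermite_fun1[continuous_intros]:
  "continuous_on A f \<Longrightarrow> continuous_on A (\<lambda>x. hermite_fun1 n (f x))"
  unfolding hermite_fun1_def[abs_def] by (intro continuous_intros) auto

lemma measurable_hermite_fun1[measurable]: "hermite_fun1 n \<in> borel_measurable borel"
  by (intro borel_measurable_continuous_onI continuous_intros)

lemma integrable_hermite_fun1: "integrable lborel (hermite_fun1 n)"
proof -
  have "integrable lborel (\<lambda>t::real. t ^ k * exp (- t\<^sup>2 / 2))" for k
    using integrable_mult_left[OF integrable_std_normal_moment[of k], of "sqrt (2 * pi)"]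
    by (simp add: std_normal_density_def mult_ac)
  then show ?thesis
    unfolding hermite_fun1_def[abs_def] poly_altdef sum_distrib_right mult.assoc
    by (auto intro!: integrable_sum integrable_divide integrable_mult_right)
qed

lemma hermite_fun1_bounded: "\<exists>B. \<forall>t. \<bar>hermite_fun1 n t\<bar> \<le> B"
proof -
  obtain a where a: "\<And>t. t \<ge> a \<Longrightarrow> \<bar>hermite_fun1 n t\<bar> < 1"
    using tendstoD[OF hermite_fun1_tendsto_0(1), of 1 n] by (auto simp: eventually_at_top_linorder)
  obtain b where b: "\<And>t. t \<le> b \<Longrightarrow> \<bar>hermite_fun1 n t\<bar> < 1"
    using tendstoD[OF hermite_fun1_tendsto_0(2), of 1 n] by (auto simp: eventually_at_bot_linorder)
  have "bounded (hermite_fun1 n ` {b..a})"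
    by (intro compact_imp_bounded compact_continuous_image continuous_intros) auto
  then obtain c where c: "\<And>t. t \<in> {b..a} \<Longrightarrow> \<bar>hermite_fun1 n t\<bar> \<le> c"
    unfolding bounded_iff by fastforce
  have "\<bar>hermite_fun1 n t\<bar> \<le> max 1 c" for t
    using a[of t] b[of t] c[of t] by fastforce
  then show ?thesis by blast
qed

lemma integrable_hermite_fun1_times_bounded:
  fixes f :: "real \<Rightarrow> 'a::{real_normed_algebra,banach,second_countable_topology}"
  assumes [measurable]: "f \<in> borel_measurable borel" and "\<And>t. norm (f t) \<le> B"
  shows "integrable lborel (\<lambda>t. hermite_fun1 n t *\<^sub>R f t)"
proof (rule Bochner_Integration.integrable_bound[OF integrable_mult_right[OF integrable_hermite_fun1[of n], of B]])
  show "AE t in lborel. norm (hermite_fun1 n t *\<^sub>R f t) \<le> norm (B * hermite_fun1 n t)"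
  proof (rule AE_I2)
    fix t
    have "0 \<le> B" using order_trans[OF norm_ge_zero assms(2)[of 0]] .
    then show "norm (hermite_fun1 n t *\<^sub>R f t) \<le> norm (B * hermite_fun1 n t)"
      using mult_left_mono[OF assms(2)[of t], of "\<bar>hermite_fun1 n t\<bar>"] by (simp add: abs_mult mult_ac)
  qed
qed simp

lemma integral_derivative_eq_0:
  fixes F f :: "real \<Rightarrow> 'a::euclidean_space"
  assumes F: "\<And>x. (F has_vector_derivative f x) (at x)"
    and f: "continuous_on UNIV f" "integrable lborel f"
    and lim: "(F \<longlongrightarrow> 0) at_top" "(F \<longlongrightarrow> 0) at_bot"
  shows "(LINT x|lborel. f x) = 0"
proof -
  have "(LBINT x=-\<infinity>..\<infinity>. f x) = 0 - 0"
  proof (rule interval_integral_FTC_integrable)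
    show "isCont f x" for x using f(1) by (simp add: continuous_on_eq_continuous_at)
    show "set_integrable lborel (einterval (- \<infinity>) \<infinity>) f"
      using f(2) by (simp add: set_integrable_def einterval_def)
    show "((F \<circ> real_of_ereal) \<longlongrightarrow> 0) (at_right (- \<infinity>))"
      using lim(2) unfolding ereal_tendsto_simps1 .
    show "((F \<circ> real_of_ereal) \<longlongrightarrow> 0) (at_left \<infinity>)"
      using lim(1) unfolding ereal_tendsto_simps1 .
  qed (use F in auto)
  then show ?thesis
    by (simp add: interval_lebesgue_integral_def einterval_def set_lebesgue_integral_def)
qed

subsection \<open>Autocorrelation\<close>

definition ladder_coeff :: "nat \<Rightarrow> real" where
  "ladder_coeff n = sqrt (real n / 2)"

lemma ladder_coeff_0 [simp]: "ladder_coeff 0 = 0"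
  and ladder_coeff_pos: "ladder_coeff (Suc n) > 0"
  and ladder_coeff_sq: "ladder_coeff n * ladder_coeff n = real n / 2"
  by (simp_all add: ladder_coeff_def)

lemmas hermite_fun1_ladder = hermite_fun1_times_id[folded ladder_coeff_def]

lemmas hermite_fun1_deriv = has_derivative_hermite_fun1[folded ladder_coeff_def]

lemma abs_diff_scaled_le:
  fixes a b f g B C :: real
  assumes "0 \<le> a" "0 \<le> b" "\<bar>f\<bar> \<le> B" "\<bar>g\<bar> \<le> C"
  shows "\<bar>a * f - b * g\<bar> \<le> a * B + b * C"
  using mult_left_mono[OF assms(3,1)] mult_left_mono[OF assms(4,2)] abs_triangle_ineq4[of "a * f" "b * g"] assms(1,2)
  by (simp add: abs_mult)

lemma hermite_fun1_integration_by_parts: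
  fixes G G' :: "real \<Rightarrow> 'a::{real_normed_algebra,euclidean_space}"
  assumes G: "\<And>x. (G has_vector_derivative G' x) (at x)" "continuous_on UNIV G'"
    and B: "\<And>x. norm (G x) \<le> B" "\<And>x. norm (G' x) \<le> B'"
  shows "(LINT x|lborel. (ladder_coeff n * hermite_fun1 (n - 1) x - ladder_coeff (Suc n) * hermite_fun1 (Suc n) x) *\<^sub>R G x
      + hermite_fun1 n x *\<^sub>R G' x) = 0"
proof (rule integral_derivative_eq_0[where F = "\<lambda>x. hermite_fun1 n x *\<^sub>R G x"])
  have cG: "continuous_on UNIV G"
    using G(1) by (intro continuous_at_imp_continuous_on ballI) (rule has_vector_derivative_continuous)
  have [measurable]: "G \<in> borel_measurable borel" "G' \<in> borel_measurable borel"
    using cG G(2) by (auto intro: borel_measurable_continuous_onI)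
  show "((\<lambda>x. hermite_fun1 n x *\<^sub>R G x) has_vector_derivative
     (ladder_coeff n * hermite_fun1 (n - 1) x - ladder_coeff (Suc n) * hermite_fun1 (Suc n) x) *\<^sub>R G x
      + hermite_fun1 n x *\<^sub>R G' x) (at x)" for x
    using has_vector_derivative_scaleR[OF hermite_fun1_deriv G(1)] by (simp add: add.commute)
  show "continuous_on UNIV (\<lambda>x. (ladder_coeff n * hermite_fun1 (n - 1) x - ladder_coeff (Suc n) * hermite_fun1 (Suc n) x) *\<^sub>R G x
      + hermite_fun1 n x *\<^sub>R G' x)"
    by (intro continuous_intros cG G(2))
  show "integrable lborel (\<lambda>x. (ladder_coeff n * hermite_fun1 (n - 1) x - ladder_coeff (Suc n) * hermite_fun1 (Suc n) x) *\<^sub>R G x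
      + hermite_fun1 n x *\<^sub>R G' x)"
    unfolding scaleR_diff_left scaleR_scaleR[symmetric]
    by (intro Bochner_Integration.integrable_add Bochner_Integration.integrable_diff integrable_scaleR_right
        integrable_hermite_fun1_times_bounded[where B=B] integrable_hermite_fun1_times_bounded[where B=B'] B) auto
  have le: "norm (hermite_fun1 n x *\<^sub>R G x) \<le> norm (hermite_fun1 n x) * B" for x
    using mult_left_mono[OF B(1)[of x], of "\<bar>hermite_fun1 n x\<bar>"] by simp
  show "((\<lambda>x. hermite_fun1 n x *\<^sub>R G x) \<longlongrightarrow> 0) at_top" "((\<lambda>x. hermite_fun1 n x *\<^sub>R G x) \<longlongrightarrow> 0) at_bot"
    by (rule Lim_null_comparison[OF always_eventually[OF allI[OF le]]],
        rule tendsto_mult_left_zero, rule tendsto_norm_zero, rule hermite_fun1_tendsto_0)+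
qed

definition hermite_autocorr :: "nat \<Rightarrow> nat \<Rightarrow> real \<Rightarrow> real" where
  "hermite_autocorr m n z = (LINT x|lborel. hermite_fun1 m x * hermite_fun1 n (x + z))"

definition hermite_fourier :: "nat \<Rightarrow> nat \<Rightarrow> real \<Rightarrow> complex" where
  "hermite_fourier m n z = (LINT x|lborel. hermite_fun1 m x *\<^sub>R (of_real (hermite_fun1 n x) * exp (\<i> * of_real (z * x))))"

lemma integrable_hermite_autocorr [simp]:
  "integrable lborel (\<lambda>x. hermite_fun1 m x * hermite_fun1 n (x + z))"
proof -
  obtain B where "\<And>t. \<bar>hermite_fun1 n t\<bar> \<le> B" using hermite_fun1_bounded[of n] by blast
  then show ?thesis
    using integrable_hermite_fun1_times_bounded[of "\<lambda>x. hermite_fun1 n (x + z)" B m] by simp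
qed

lemma integrable_hermite_mult [simp]: "integrable lborel (\<lambda>x. hermite_fun1 m x * hermite_fun1 n x)"
  using integrable_hermite_autocorr[of m n 0] by simp

lemma integrable_hermite_fourier [simp]:
  "integrable lborel (\<lambda>x. hermite_fun1 m x *\<^sub>R (of_real (hermite_fun1 n x) * exp (\<i> * of_real (z * x))))"
proof -
  obtain B where "\<And>t. \<bar>hermite_fun1 n t\<bar> \<le> B" using hermite_fun1_bounded[of n] by blast
  then show ?thesis
    by (intro integrable_hermite_fun1_times_bounded[where B=B]) (auto simp: norm_mult simp del: of_real_mult)
qed

text \<open>Shifting commutes with differentiation, so the derivative can be moved from one factor to the other.\<close>

lemma hermite_autocorr_by_parts:
  "ladder_coeff m * hermite_autocorr (m - 1) n z - ladder_coeff (Suc m) * hermite_autocorr (Suc m) n z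
    + (ladder_coeff n * hermite_autocorr m (n - 1) z - ladder_coeff (Suc n) * hermite_autocorr m (Suc n) z) = 0"
proof -
  let ?G' = "\<lambda>x. ladder_coeff n * hermite_fun1 (n - 1) (x + z) - ladder_coeff (Suc n) * hermite_fun1 (Suc n) (x + z)"
  obtain B where B: "\<And>t. \<bar>hermite_fun1 n t\<bar> \<le> B" using hermite_fun1_bounded[of n] by blast
  obtain B1 where B1: "\<And>t. \<bar>hermite_fun1 (n - 1) t\<bar> \<le> B1" using hermite_fun1_bounded[of "n - 1"] by blast
  obtain B2 where B2: "\<And>t. \<bar>hermite_fun1 (Suc n) t\<bar> \<le> B2" using hermite_fun1_bounded[of "Suc n"] by blast
  have der: "((\<lambda>x. hermite_fun1 n (x + z)) has_vector_derivative ?G' x) (at x)" for x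
    using DERIV_shift[of "hermite_fun1 n" _ x z] hermite_fun1_deriv[of n "x + z"]
    by (simp add: has_real_derivative_iff_has_vector_derivative[symmetric])
  have bd: "norm (?G' x) \<le> ladder_coeff n * B1 + ladder_coeff (Suc n) * B2" for x
    unfolding real_norm_def by (intro abs_diff_scaled_le B1 B2) (simp_all add: ladder_coeff_def)
  have "0 = (LINT x|lborel. (ladder_coeff m * hermite_fun1 (m - 1) x - ladder_coeff (Suc m) * hermite_fun1 (Suc m) x) *\<^sub>R hermite_fun1 n (x + z)
      + hermite_fun1 m x *\<^sub>R ?G' x)"
    using B bd by (intro hermite_fun1_integration_by_parts[OF der, symmetric, where B=B]) (auto intro!: continuous_intros)
  also have "\<dots> = (LINT x|lborel. ladder_coeff m * (hermite_fun1 (m - 1) x * hermite_fun1 n (x + z))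
        - ladder_coeff (Suc m) * (hermite_fun1 (Suc m) x * hermite_fun1 n (x + z))
      + (ladder_coeff n * (hermite_fun1 m x * hermite_fun1 (n - 1) (x + z))
        - ladder_coeff (Suc n) * (hermite_fun1 m x * hermite_fun1 (Suc n) (x + z))))"
    by (intro Bochner_Integration.integral_cong refl) (simp add: algebra_simps)
  finally show ?thesis by (simp add: hermite_autocorr_def)
qed

lemma hermite_autocorr_position:
  "ladder_coeff m * hermite_autocorr (m - 1) n z + ladder_coeff (Suc m) * hermite_autocorr (Suc m) n z
    = ladder_coeff n * hermite_autocorr m (n - 1) z + ladder_coeff (Suc n) * hermite_autocorr m (Suc n) z - z * hermite_autocorr m n z"
proof -
  have "ladder_coeff m * (hermite_fun1 (m - 1) x * hermite_fun1 n (x + z)) + ladder_coeff (Suc m) * (hermite_fun1 (Suc m) x * hermite_fun1 n (x + z))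
    = ladder_coeff n * (hermite_fun1 m x * hermite_fun1 (n - 1) (x + z)) + ladder_coeff (Suc n) * (hermite_fun1 m x * hermite_fun1 (Suc n) (x + z))
      - z * (hermite_fun1 m x * hermite_fun1 n (x + z))" (is "?l x = ?r x") for x
  proof -
    have "?l x = (x * hermite_fun1 m x) * hermite_fun1 n (x + z)"
      unfolding hermite_fun1_ladder by (simp add: algebra_simps)
    also have "\<dots> = hermite_fun1 m x * ((x + z) * hermite_fun1 n (x + z)) - z * (hermite_fun1 m x * hermite_fun1 n (x + z))"
      by (simp add: algebra_simps)
    also have "\<dots> = ?r x"
      unfolding hermite_fun1_ladder by (simp add: algebra_simps)
    finally show ?thesis .
  qed
  then have "(LINT x|lborel. ?l x) = (LINT x|lborel. ?r x)" by simp
  then show ?thesis by (simp add: hermite_autocorr_def)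
qed

lemma hermite_autocorr_Suc_left:
  "2 * ladder_coeff (Suc m) * hermite_autocorr (Suc m) n z = 2 * ladder_coeff n * hermite_autocorr m (n - 1) z - z * hermite_autocorr m n z"
  using hermite_autocorr_by_parts[of m n z] hermite_autocorr_position[of m n z] by simp

lemma hermite_autocorr_Suc_right:
  "2 * ladder_coeff (Suc n) * hermite_autocorr m (Suc n) z = 2 * ladder_coeff m * hermite_autocorr (m - 1) n z + z * hermite_autocorr m n z"
  using hermite_autocorr_by_parts[of m n z] hermite_autocorr_position[of m n z] by simp

lemma hermite_fourier_commute: "hermite_fourier m n z = hermite_fourier n m z"
  unfolding hermite_fourier_def by (intro Bochner_Integration.integral_cong refl) (simp add: scaleR_conv_of_real mult_ac)

definition hermite_fourier_integrand :: "real \<Rightarrow> nat \<Rightarrow> nat \<Rightarrow> real \<Rightarrow> complex" where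
  "hermite_fourier_integrand z m n x = hermite_fun1 m x *\<^sub>R (of_real (hermite_fun1 n x) * exp (\<i> * of_real (z * x)))"

lemma integrable_hermite_fourier_integrand [simp]: "integrable lborel (hermite_fourier_integrand z m n)"
  using integrable_hermite_fourier[of m n z] by (simp only: hermite_fourier_integrand_def[abs_def])

lemma hermite_fourier_eq: "hermite_fourier m n z = (LINT x|lborel. hermite_fourier_integrand z m n x)"
  by (simp only: hermite_fourier_def hermite_fourier_integrand_def)

lemma hermite_fourier_by_parts:
  "ladder_coeff m * hermite_fourier (m - 1) n z - ladder_coeff (Suc m) * hermite_fourier (Suc m) n z
    + (ladder_coeff n * hermite_fourier m (n - 1) z - ladder_coeff (Suc n) * hermite_fourier m (Suc n) z)
    + \<i> * of_real z * hermite_fourier m n z = 0"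
proof -
  let ?e = "\<lambda>x. exp (\<i> * of_real (z * x))"
  let ?G = "\<lambda>x. of_real (hermite_fun1 n x) * ?e x"
  let ?G' = "\<lambda>x. of_real (ladder_coeff n * hermite_fun1 (n - 1) x - ladder_coeff (Suc n) * hermite_fun1 (Suc n) x) * ?e x
    + of_real (hermite_fun1 n x) * (\<i> * of_real z * ?e x)"
  obtain B where B: "\<And>t. \<bar>hermite_fun1 n t\<bar> \<le> B" using hermite_fun1_bounded[of n] by blast
  obtain B1 where B1: "\<And>t. \<bar>hermite_fun1 (n - 1) t\<bar> \<le> B1" using hermite_fun1_bounded[of "n - 1"] by blast
  obtain B2 where B2: "\<And>t. \<bar>hermite_fun1 (Suc n) t\<bar> \<le> B2" using hermite_fun1_bounded[of "Suc n"] by blast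
  have "((\<lambda>x. exp (\<i> * of_real z * of_real x)) has_vector_derivative exp (\<i> * of_real z * of_real x) * (\<i> * of_real z)) (at x)" for x
    by (rule has_vector_derivative_real_field) (auto intro!: derivative_eq_intros)
  then have e: "(?e has_vector_derivative \<i> * of_real z * ?e x) (at x)" for x
    by (simp add: mult_ac)
  have der: "(?G has_vector_derivative ?G' x) (at x)" for x
    using has_vector_derivative_mult[OF has_vector_derivative_of_real[OF hermite_fun1_deriv] e]
    by (simp add: add.commute)
  have bd: "norm (?G' x) \<le> (ladder_coeff n * B1 + ladder_coeff (Suc n) * B2) + B * \<bar>z\<bar>" for x
  proof (rule order_trans[OF norm_triangle_ineq add_mono])
    show "norm (of_real (ladder_coeff n * hermite_fun1 (n - 1) x - ladder_coeff (Suc n) * hermite_fun1 (Suc n) x) * ?e x)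
      \<le> ladder_coeff n * B1 + ladder_coeff (Suc n) * B2"
      using abs_diff_scaled_le[OF _ _ B1 B2, of "ladder_coeff n" "ladder_coeff (Suc n)" x x]
      by (simp add: norm_mult ladder_coeff_def del: of_real_diff of_real_mult)
    show "norm (of_real (hermite_fun1 n x) * (\<i> * of_real z * ?e x)) \<le> B * \<bar>z\<bar>"
      using mult_right_mono[OF B[of x], of "\<bar>z\<bar>"] by (simp add: norm_mult del: of_real_mult)
  qed
  have "0 = (LINT x|lborel. (ladder_coeff m * hermite_fun1 (m - 1) x - ladder_coeff (Suc m) * hermite_fun1 (Suc m) x) *\<^sub>R ?G x
      + hermite_fun1 m x *\<^sub>R ?G' x)"
    using B bd
    by (intro hermite_fun1_integration_by_parts[OF der, symmetric, where B=B])
      (auto intro!: continuous_intros simp: norm_mult simp del: of_real_diff of_real_mult)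
  also have "\<dots> = (LINT x|lborel. ladder_coeff m * hermite_fourier_integrand z (m - 1) n x
        - ladder_coeff (Suc m) * hermite_fourier_integrand z (Suc m) n x
      + (ladder_coeff n * hermite_fourier_integrand z m (n - 1) x
        - ladder_coeff (Suc n) * hermite_fourier_integrand z m (Suc n) x)
      + \<i> * of_real z * hermite_fourier_integrand z m n x)"
    unfolding hermite_fourier_integrand_def
    by (intro Bochner_Integration.integral_cong refl) (simp add: scaleR_conv_of_real algebra_simps)
  finally show ?thesis by (simp add: hermite_fourier_eq)
qed

lemma hermite_fourier_position:
  "ladder_coeff m * hermite_fourier (m - 1) n z + ladder_coeff (Suc m) * hermite_fourier (Suc m) n z
    = ladder_coeff n * hermite_fourier m (n - 1) z + ladder_coeff (Suc n) * hermite_fourier m (Suc n) z"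
proof -
  let ?H = "hermite_fourier_integrand z"
  have "ladder_coeff m * ?H (m - 1) n x + ladder_coeff (Suc m) * ?H (Suc m) n x
    = ladder_coeff n * ?H m (n - 1) x + ladder_coeff (Suc n) * ?H m (Suc n) x" (is "?l x = ?r x") for x
  proof -
    have "?l x = of_real ((x * hermite_fun1 m x) * hermite_fun1 n x) * exp (\<i> * of_real (z * x))"
      unfolding hermite_fun1_ladder hermite_fourier_integrand_def by (simp add: scaleR_conv_of_real algebra_simps)
    also have "\<dots> = of_real (hermite_fun1 m x * (x * hermite_fun1 n x)) * exp (\<i> * of_real (z * x))"
      by (simp add: algebra_simps)
    also have "\<dots> = ?r x"
      unfolding hermite_fun1_ladder hermite_fourier_integrand_def by (simp add: scaleR_conv_of_real algebra_simps)
    finally show ?thesis .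
  qed
  then have "(LINT x|lborel. ?l x) = (LINT x|lborel. ?r x)" by (simp only:)
  then show ?thesis by (simp add: hermite_fourier_eq)
qed

lemma hermite_fourier_Suc_left:
  "2 * ladder_coeff (Suc m) * hermite_fourier (Suc m) n z =
    2 * ladder_coeff n * hermite_fourier m (n - 1) z + \<i> * of_real z * hermite_fourier m n z"
proof -
  define a b c d e where "a = ladder_coeff m * hermite_fourier (m - 1) n z"
    and "b = ladder_coeff (Suc m) * hermite_fourier (Suc m) n z"
    and "c = ladder_coeff n * hermite_fourier m (n - 1) z"
    and "d = ladder_coeff (Suc n) * hermite_fourier m (Suc n) z"
    and "e = \<i> * of_real z * hermite_fourier m n z"
  have 1: "a - b + (c - d) + e = 0"
    unfolding a_def b_def c_def d_def e_def by (rule hermite_fourier_by_parts)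
  have 2: "a + b = c + d"
    unfolding a_def b_def c_def d_def by (rule hermite_fourier_position)
  have "2 * b = 2 * c + e" using 1 2 by algebra
  then show ?thesis unfolding b_def c_def e_def by (simp add: mult.assoc)
qed

lemma hermite_fourier_0_0: "hermite_fourier 0 0 z = of_real (exp (- z\<^sup>2 / 4))"
proof -
  have "of_real (exp (- (z / sqrt 2)\<^sup>2 / 2)) = char std_normal_distribution (z / sqrt 2)"
    by (simp add: char_std_normal_distribution)
  also have "\<dots> = (LINT x|lborel. std_normal_density x *\<^sub>R iexp (z / sqrt 2 * x))"
    unfolding char_def by (subst integral_density) auto
  also have "\<dots> = sqrt 2 *\<^sub>R (LINT x|lborel. std_normal_density (sqrt 2 * x) *\<^sub>R iexp (z / sqrt 2 * (sqrt 2 * x)))"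
    by (subst lborel_integral_real_affine[where c="sqrt 2" and t=0]) auto
  also have "\<dots> = (LINT x|lborel. sqrt 2 *\<^sub>R (std_normal_density (sqrt 2 * x) *\<^sub>R iexp (z / sqrt 2 * (sqrt 2 * x))))"
    by (rule integral_scaleR_right[symmetric]) 
  also have "\<dots> = hermite_fourier 0 0 z"
    unfolding hermite_fourier_def
  proof (intro Bochner_Integration.integral_cong refl)
    fix x :: real
    have "sqrt 2 * std_normal_density (sqrt 2 * x) = exp (- x\<^sup>2) / sqrt pi"
      by (simp add: std_normal_density_def real_sqrt_mult power_mult_distrib)
    also have "\<dots> = hermite_fun1 0 x * hermite_fun1 0 x"
      by (simp add: hermite_fun1_def exp_add[symmetric] field_simps)
    finally have *: "sqrt 2 * std_normal_density (sqrt 2 * x) = hermite_fun1 0 x * hermite_fun1 0 x" .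
    show "sqrt 2 *\<^sub>R (std_normal_density (sqrt 2 * x) *\<^sub>R iexp (z / sqrt 2 * (sqrt 2 * x)))
      = hermite_fun1 0 x *\<^sub>R (of_real (hermite_fun1 0 x) * exp (\<i> * of_real (z * x)))"
      unfolding scaleR_scaleR * by (simp add: scaleR_conv_of_real)
  qed
  finally show ?thesis by (simp add: power_divide)
qed

lemma hermite_fun1_0_norm: "(LINT x|lborel. hermite_fun1 0 x * hermite_fun1 0 x) = 1"
proof -
  have "of_real (LINT x|lborel. hermite_fun1 0 x * hermite_fun1 0 x) = hermite_fourier 0 0 0"
    unfolding hermite_fourier_def by (simp add: scaleR_conv_of_real flip: of_real_mult)
  then show ?thesis unfolding hermite_fourier_0_0 by (simp only: of_real_eq_iff) simp
qed

lemma hermite_autocorr_0_0: "hermite_autocorr 0 0 z = exp (- z\<^sup>2 / 4)"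
proof -
  have "hermite_fun1 0 x * hermite_fun1 0 (x + z) = exp (- z\<^sup>2 / 4) * (hermite_fun1 0 (z / 2 + 1 * x) * hermite_fun1 0 (z / 2 + 1 * x))" for x
    unfolding hermite_fun1_def by (simp add: exp_add[symmetric] power2_eq_square field_simps)
  then have "hermite_autocorr 0 0 z = exp (- z\<^sup>2 / 4) * (LINT x|lborel. hermite_fun1 0 (z / 2 + 1 * x) * hermite_fun1 0 (z / 2 + 1 * x))"
    unfolding hermite_autocorr_def by simp
  also have "(LINT x|lborel. hermite_fun1 0 (z / 2 + 1 * x) * hermite_fun1 0 (z / 2 + 1 * x)) = 1"
    using lborel_integral_real_affine[of 1 "\<lambda>x. hermite_fun1 0 x * hermite_fun1 0 x" "z / 2"] hermite_fun1_0_norm by simp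
  finally show ?thesis by simp
qed

text \<open>Integration by parts and multiplication by the position give both families the same two-term
  recursion in \<open>m\<close>, up to factors \<open>\<i>\<close>, and both start from the Gaussian \<open>exp (- z\<^sup>2 / 4)\<close>. For \<open>m = n\<close> the
  powers of \<open>\<i>\<close> cancel: the autocorrelation is the Fourier transform of the square.\<close>

lemma hermite_fourier_eq_autocorr: "\<i> ^ m * hermite_fourier m n z = \<i> ^ n * of_real (hermite_autocorr m n z)"
proof (induction m arbitrary: n)
  case 0
  show ?case
  proof (induction n)
    case 0
    show ?case by (simp add: hermite_fourier_0_0 hermite_autocorr_0_0)
  next
    case (Suc n)
    have F: "2 * ladder_coeff (Suc n) * hermite_fourier 0 (Suc n) z = \<i> * of_real z * hermite_fourier 0 n z"
      using hermite_fourier_Suc_left[of n 0 z] by (simp add: hermite_fourier_commute[of _ 0])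
    have A: "2 * complex_of_real (ladder_coeff (Suc n)) * of_real (hermite_autocorr 0 (Suc n) z) = of_real z * of_real (hermite_autocorr 0 n z)"
      using arg_cong[OF hermite_autocorr_Suc_right[of n 0 z], of complex_of_real] by simp
    have "2 * complex_of_real (ladder_coeff (Suc n)) * hermite_fourier 0 (Suc n) z
        = 2 * complex_of_real (ladder_coeff (Suc n)) * (\<i> ^ Suc n * of_real (hermite_autocorr 0 (Suc n) z))"
      using F A Suc by (simp add: mult_ac)
    then show ?case using ladder_coeff_pos[of n] by simp
  qed
next
  case (Suc m)
  have F: "2 * ladder_coeff (Suc m) * hermite_fourier (Suc m) n z =
    2 * ladder_coeff n * hermite_fourier m (n - 1) z + \<i> * of_real z * hermite_fourier m n z"
    by (rule hermite_fourier_Suc_left)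
  have A: "2 * complex_of_real (ladder_coeff (Suc m)) * of_real (hermite_autocorr (Suc m) n z)
      = 2 * of_real (ladder_coeff n) * of_real (hermite_autocorr m (n - 1) z) - of_real z * of_real (hermite_autocorr m n z)"
    using arg_cong[OF hermite_autocorr_Suc_left[of m n z], of complex_of_real] by simp
  have n: "complex_of_real (ladder_coeff n) * (\<i> * \<i> ^ (n - 1)) = of_real (ladder_coeff n) * \<i> ^ n"
    by (cases n) auto
  have "2 * complex_of_real (ladder_coeff (Suc m)) * (\<i> ^ Suc m * hermite_fourier (Suc m) n z)
      = \<i> ^ Suc m * (2 * ladder_coeff (Suc m) * hermite_fourier (Suc m) n z)"
    by (simp add: mult_ac)
  also have "\<dots> = 2 * ladder_coeff n * \<i> * (\<i> ^ m * hermite_fourier m (n - 1) z) + \<i> * \<i> * of_real z * (\<i> ^ m * hermite_fourier m n z)"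
    unfolding F by (simp add: algebra_simps)
  also have "\<dots> = 2 * (complex_of_real (ladder_coeff n) * (\<i> * \<i> ^ (n - 1))) * of_real (hermite_autocorr m (n - 1) z)
      - of_real z * (\<i> ^ n * of_real (hermite_autocorr m n z))"
    unfolding Suc.IH by (simp add: mult_ac)
  also have "\<dots> = \<i> ^ n * (2 * of_real (ladder_coeff n) * of_real (hermite_autocorr m (n - 1) z) - of_real z * of_real (hermite_autocorr m n z))"
    unfolding n by (simp add: algebra_simps)
  also have "\<dots> = 2 * complex_of_real (ladder_coeff (Suc m)) * (\<i> ^ n * of_real (hermite_autocorr (Suc m) n z))"
    unfolding A[symmetric] by (simp add: mult_ac)
  finally show ?case using ladder_coeff_pos[of m] by simp
qed

lemma hermite_autocorr_eq_fourier: "of_real (hermite_autocorr n n z) = hermite_fourier n n z"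
  using hermite_fourier_eq_autocorr[of n n z] by simp

text \<open>At \<open>z = 0\<close> the recursions for the autocorrelation lower both indices at once.\<close>

lemma hermite_orthonormal:
  "(LINT x|lborel. hermite_fun1 m x * hermite_fun1 n x) = (if m = n then 1 else 0)"
proof -
  have "hermite_autocorr m n 0 = (if m = n then 1 else 0)"
  proof (induction m arbitrary: n)
    case 0
    show ?case
    proof (cases n)
      case (Suc k)
      then show ?thesis using hermite_autocorr_Suc_right[of k 0 0] ladder_coeff_pos[of k] by simp
    qed (simp add: hermite_autocorr_0_0)
  next
    case (Suc m)
    show ?case
    proof (cases n)
      case 0
      then show ?thesis using hermite_autocorr_Suc_left[of m 0 0] ladder_coeff_pos[of m] by simp
    next
      case (Suc k)
      then show ?thesis using hermite_autocorr_Suc_left[of m n 0] Suc.IH[of k] ladder_coeff_pos[of m]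
        by (cases "m = k") auto
    qed
  qed
  then show ?thesis by (simp add: hermite_autocorr_def)
qed

subsection \<open>Second moment, supremum and tails\<close>

text \<open>The ladder identity writes \<open>x * hermite_fun1 n x\<close> as a combination of two orthogonal functions.\<close>

lemma hermite_second_moment:
  "integrable lborel (\<lambda>x. x\<^sup>2 * (hermite_fun1 n x)\<^sup>2)"
  "(LINT x|lborel. x\<^sup>2 * (hermite_fun1 n x)\<^sup>2) = real n + 1 / 2"
proof -
  have eq: "x\<^sup>2 * (hermite_fun1 n x)\<^sup>2 =
      ladder_coeff n ^ 2 * (hermite_fun1 (n - 1) x * hermite_fun1 (n - 1) x)
      + 2 * ladder_coeff n * ladder_coeff (Suc n) * (hermite_fun1 (n - 1) x * hermite_fun1 (Suc n) x)
      + ladder_coeff (Suc n) ^ 2 * (hermite_fun1 (Suc n) x * hermite_fun1 (Suc n) x)" for x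
    unfolding power_mult_distrib[symmetric] hermite_fun1_ladder by (simp add: power2_eq_square algebra_simps)
  show "integrable lborel (\<lambda>x. x\<^sup>2 * (hermite_fun1 n x)\<^sup>2)"
    unfolding eq by (intro Bochner_Integration.integrable_add integrable_mult_right integrable_hermite_mult)
  show "(LINT x|lborel. x\<^sup>2 * (hermite_fun1 n x)\<^sup>2) = real n + 1 / 2"
    unfolding eq by (simp add: hermite_orthonormal) (simp add: power2_eq_square ladder_coeff_sq field_simps)
qed

text \<open>The derivatives telescope to a single product.\<close>

lemma sum_hermite_square_deriv:
  "((\<lambda>x. \<Sum>n<N. (hermite_fun1 n x)\<^sup>2) has_real_derivative
     - (2 * ladder_coeff N * (hermite_fun1 N x * hermite_fun1 (N - 1) x))) (at x)"
proof (induction N)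
  case (Suc N)
  have "((\<lambda>x. (hermite_fun1 N x)\<^sup>2) has_real_derivative
      2 * hermite_fun1 N x * (ladder_coeff N * hermite_fun1 (N - 1) x - ladder_coeff (Suc N) * hermite_fun1 (Suc N) x)) (at x)"
    by (rule derivative_eq_intros hermite_fun1_deriv refl | simp)+
  from DERIV_add[OF Suc this] show ?case by (simp add: algebra_simps)
qed simp

text \<open>By orthonormality the integral of \<open>2 * \<bar>hermite_fun1 N t * hermite_fun1 (N - 1) t\<bar>\<close> over any interval
  is at most \<open>2\<close>. So the derivative of the sum bounds its oscillation, and the sum vanishes at
  infinity.\<close>

lemma sum_hermite_square_le: "(\<Sum>n<N. (hermite_fun1 n x)\<^sup>2) \<le> sqrt (2 * real N)"
proof -
  let ?s = "\<lambda>x. \<Sum>n<N. (hermite_fun1 n x)\<^sup>2"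
  let ?f = "\<lambda>x. - (2 * ladder_coeff N * (hermite_fun1 N x * hermite_fun1 (N - 1) x))"
  have der: "(?s has_vector_derivative ?f t) (at t within A)" for t A
    unfolding has_real_derivative_iff_has_vector_derivative[symmetric]
    by (rule has_field_derivative_at_within[OF sum_hermite_square_deriv])
  have le: "?s x \<le> ?s y + 2 * ladder_coeff N" if "x \<le> y" for y
  proof -
    have "(LINT t|lborel. indicator {x..y} t *\<^sub>R ?f t) = ?s y - ?s x"
      by (rule integral_FTC_atLeastAtMost[OF that der]) (intro continuous_intros)
    then have "?s x = ?s y + (LINT t|lborel. indicator {x..y} t *\<^sub>R (2 * ladder_coeff N * (hermite_fun1 N t * hermite_fun1 (N - 1) t)))"
      by simp
    also have "(LINT t|lborel. indicator {x..y} t *\<^sub>R (2 * ladder_coeff N * (hermite_fun1 N t * hermite_fun1 (N - 1) t)))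
      \<le> (LINT t|lborel. ladder_coeff N * (hermite_fun1 N t * hermite_fun1 N t) + ladder_coeff N * (hermite_fun1 (N - 1) t * hermite_fun1 (N - 1) t))"
    proof (rule integral_mono)
      show "integrable lborel (\<lambda>t. indicator {x..y} t *\<^sub>R (2 * ladder_coeff N * (hermite_fun1 N t * hermite_fun1 (N - 1) t)))"
        using integrable_mult_indicator[of "{x..y}" lborel "\<lambda>t. 2 * ladder_coeff N * (hermite_fun1 N t * hermite_fun1 (N - 1) t)"] by simp
      fix t
      have "2 * (a * b) \<le> a * a + b * b" for a b :: real
        using sum_squares_bound[of a b] by (simp add: power2_eq_square)
      moreover have "0 \<le> a * a + b * b" for a b :: real by simp
      moreover have "0 \<le> ladder_coeff N" by (simp add: ladder_coeff_def)
      ultimately show "indicator {x..y} t *\<^sub>R (2 * ladder_coeff N * (hermite_fun1 N t * hermite_fun1 (N - 1) t))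
        \<le> ladder_coeff N * (hermite_fun1 N t * hermite_fun1 N t) + ladder_coeff N * (hermite_fun1 (N - 1) t * hermite_fun1 (N - 1) t)"
        unfolding distrib_left[symmetric]
        by (auto simp: indicator_def mult.assoc mult.left_commute[of 2] intro!: mult_left_mono mult_nonneg_nonneg)
    qed simp
    finally show ?thesis by (simp add: hermite_orthonormal)
  qed
  have "((\<lambda>y. ?s y + 2 * ladder_coeff N) \<longlongrightarrow> (\<Sum>n<N. 0\<^sup>2) + 2 * ladder_coeff N) at_top"
    by (intro tendsto_intros hermite_fun1_tendsto_0)
  moreover have "eventually (\<lambda>y. ?s x \<le> ?s y + 2 * ladder_coeff N) at_top"
    using le eventually_ge_at_top[of x] by (rule eventually_mono[rotated])
  ultimately have "?s x \<le> (\<Sum>n<N. 0\<^sup>2) + 2 * ladder_coeff N"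
    by (rule tendsto_lowerbound) simp
  also have "(\<Sum>n<N. 0\<^sup>2) + 2 * ladder_coeff N = sqrt (4 * (real N / 2))"
    unfolding ladder_coeff_def real_sqrt_mult by simp
  finally show ?thesis by simp
qed

text \<open>The Hermite equation \<open>h'' = (t\<^sup>2 - (2 * n + 1)) * h\<close>, with \<open>h'\<close> written through the ladder.\<close>

lemma hermite_ode:
  "((\<lambda>t. ladder_coeff n * hermite_fun1 (n - 1) t - ladder_coeff (Suc n) * hermite_fun1 (Suc n) t)
    has_real_derivative (t\<^sup>2 - (2 * real n + 1)) * hermite_fun1 n t) (at t)"
proof -
  have "t * (t * hermite_fun1 n t) = ladder_coeff n * (t * hermite_fun1 (n - 1) t) + ladder_coeff (Suc n) * (t * hermite_fun1 (Suc n) t)"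
    unfolding hermite_fun1_ladder[of t n] by (simp add: algebra_simps)
  also have "\<dots> = ladder_coeff n * (ladder_coeff (n - 1) * hermite_fun1 (n - 1 - 1) t + ladder_coeff n * hermite_fun1 n t)
    + ladder_coeff (Suc n) * (ladder_coeff (Suc n) * hermite_fun1 n t + ladder_coeff (Suc (Suc n)) * hermite_fun1 (Suc (Suc n)) t)"
    unfolding hermite_fun1_ladder[of t "n - 1"] hermite_fun1_ladder[of t "Suc n"] by (cases n) auto
  finally have x2: "t\<^sup>2 * hermite_fun1 n t = ladder_coeff n * ladder_coeff (n - 1) * hermite_fun1 (n - 1 - 1) t
      + (ladder_coeff n * ladder_coeff n + ladder_coeff (Suc n) * ladder_coeff (Suc n)) * hermite_fun1 n t
      + ladder_coeff (Suc n) * ladder_coeff (Suc (Suc n)) * hermite_fun1 (Suc (Suc n)) t"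
    by (simp add: power2_eq_square algebra_simps)
  have "((\<lambda>t. ladder_coeff n * hermite_fun1 (n - 1) t - ladder_coeff (Suc n) * hermite_fun1 (Suc n) t) has_real_derivative
     ladder_coeff n * (ladder_coeff (n - 1) * hermite_fun1 (n - 1 - 1) t - ladder_coeff (Suc (n - 1)) * hermite_fun1 (Suc (n - 1)) t)
     - ladder_coeff (Suc n) * (ladder_coeff (Suc n) * hermite_fun1 n t - ladder_coeff (Suc (Suc n)) * hermite_fun1 (Suc (Suc n)) t)) (at t)"
    using DERIV_diff[OF DERIV_cmult[OF hermite_fun1_deriv[of "n - 1" t], of "ladder_coeff n"] DERIV_cmult[OF hermite_fun1_deriv[of "Suc n" t], of "ladder_coeff (Suc n)"]]
    by simp
  moreover have "ladder_coeff n * (ladder_coeff (n - 1) * hermite_fun1 (n - 1 - 1) t - ladder_coeff (Suc (n - 1)) * hermite_fun1 (Suc (n - 1)) t)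
     - ladder_coeff (Suc n) * (ladder_coeff (Suc n) * hermite_fun1 n t - ladder_coeff (Suc (Suc n)) * hermite_fun1 (Suc (Suc n)) t)
     = (t\<^sup>2 - (2 * real n + 1)) * hermite_fun1 n t"
  proof -
    have "ladder_coeff n * (ladder_coeff (Suc (n - 1)) * hermite_fun1 (Suc (n - 1)) t) = ladder_coeff n * ladder_coeff n * hermite_fun1 n t"
      by (cases n) auto
    moreover have "(t\<^sup>2 - (2 * real n + 1)) * hermite_fun1 n t
       = ladder_coeff n * ladder_coeff (n - 1) * hermite_fun1 (n - 1 - 1) t
        - (ladder_coeff n * ladder_coeff n + ladder_coeff (Suc n) * ladder_coeff (Suc n)) * hermite_fun1 n t
        + ladder_coeff (Suc n) * ladder_coeff (Suc (Suc n)) * hermite_fun1 (Suc (Suc n)) t"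
      unfolding left_diff_distrib x2 by (simp add: ladder_coeff_sq algebra_simps)
    ultimately show ?thesis
      unfolding right_diff_distrib by (simp only:) (simp add: algebra_simps)
  qed
  ultimately show ?thesis by (simp only:)
qed

text \<open>The function \<open>(e' + \<mu> * e) * exp (- \<mu> * x)\<close> is nondecreasing with limit \<open>0\<close>, hence nonpositive; this
  is the differential inequality \<open>e' \<le> - \<mu> * e\<close>.\<close>

lemma exp_decay_of_convexity:
  fixes e e' e'' :: "real \<Rightarrow> real"
  assumes e: "\<And>x. b \<le> x \<Longrightarrow> (e has_real_derivative e' x) (at x)"
    and e': "\<And>x. b \<le> x \<Longrightarrow> (e' has_real_derivative e'' x) (at x)"
    and le: "\<And>x. b \<le> x \<Longrightarrow> \<mu>\<^sup>2 * e x \<le> e'' x"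
    and lim: "(e \<longlongrightarrow> 0) at_top" "(e' \<longlongrightarrow> 0) at_top"
    and "0 \<le> \<mu>" "b \<le> x" "0 \<le> \<delta>"
  shows "e (x + \<delta>) \<le> exp (- \<mu> * \<delta>) * e x"
proof -
  let ?w = "\<lambda>x. (e' x + \<mu> * e x) * exp (- \<mu> * x)"
  have w: "?w y \<le> 0" if "b \<le> y" for y
  proof -
    have mono: "?w y \<le> ?w z" if "y \<le> z" for z
    proof (rule DERIV_nonneg_imp_nondecreasing[OF that])
      fix t assume t: "y \<le> t" "t \<le> z"
      then have "b \<le> t" using \<open>b \<le> y\<close> by simp
      have "(?w has_real_derivative (e'' t - \<mu>\<^sup>2 * e t) * exp (- \<mu> * t)) (at t)"
        by (rule derivative_eq_intros e[OF \<open>b \<le> t\<close>] e'[OF \<open>b \<le> t\<close>] refl | simp)+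
          (simp add: algebra_simps power2_eq_square)
      moreover have "0 \<le> (e'' t - \<mu>\<^sup>2 * e t) * exp (- \<mu> * t)" using le[OF \<open>b \<le> t\<close>] by simp
      ultimately show "\<exists>d. (?w has_real_derivative d) (at t) \<and> 0 \<le> d" by blast
    qed
    have "(?w \<longlongrightarrow> 0) at_top"
    proof (rule Lim_null_comparison)
      show "((\<lambda>t. \<bar>e' t + \<mu> * e t\<bar>) \<longlongrightarrow> 0) at_top"
        using tendsto_add[OF lim(2) tendsto_mult_right_zero[OF lim(1), of \<mu>]] by (intro tendsto_rabs_zero) simp
      show "eventually (\<lambda>t. norm (?w t) \<le> \<bar>e' t + \<mu> * e t\<bar>) at_top"
        using eventually_ge_at_top[of 0]
      proof eventually_elim
        case (elim t)
        then have "exp (- \<mu> * t) \<le> 1" using \<open>0 \<le> \<mu>\<close> by simp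
        then show ?case using mult_left_mono[of "exp (- \<mu> * t)" 1 "\<bar>e' t + \<mu> * e t\<bar>"] by (simp add: abs_mult)
      qed
    qed
    then show ?thesis
      by (rule tendsto_lowerbound) (use mono in \<open>auto intro: eventually_mono[OF eventually_ge_at_top[of y]]\<close>)
  qed
  have "e (x + \<delta>) * exp (\<mu> * (x + \<delta>)) \<le> e x * exp (\<mu> * x)"
  proof (rule DERIV_nonpos_imp_nonincreasing[where f="\<lambda>x. e x * exp (\<mu> * x)"])
    fix t assume "x \<le> t"
    then have "b \<le> t" using \<open>b \<le> x\<close> by simp
    have "((\<lambda>x. e x * exp (\<mu> * x)) has_real_derivative (e' t + \<mu> * e t) * exp (\<mu> * t)) (at t)"
      by (rule derivative_eq_intros e[OF \<open>b \<le> t\<close>] refl | simp)+ (simp add: algebra_simps)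
    moreover have "(e' t + \<mu> * e t) \<le> 0"
      using w[OF \<open>b \<le> t\<close>] by (simp add: mult_le_0_iff)
    then have "(e' t + \<mu> * e t) * exp (\<mu> * t) \<le> 0" by (simp add: mult_le_0_iff)
    ultimately show "\<exists>d. ((\<lambda>x. e x * exp (\<mu> * x)) has_real_derivative d) (at t) \<and> d \<le> 0" by blast
  qed (use \<open>0 \<le> \<delta>\<close> in simp)
  then have "e (x + \<delta>) * exp (\<mu> * (x + \<delta>)) * exp (- \<mu> * (x + \<delta>)) \<le> e x * exp (\<mu> * x) * exp (- \<mu> * (x + \<delta>))"
    by (rule mult_right_mono) simp
  then show ?thesis by (simp add: mult.assoc exp_add[symmetric] algebra_simps)
qed

text \<open>Where the potential \<open>t\<^sup>2 - (2 * n + 1)\<close> is at least \<open>\<kappa>\<^sup>2\<close>, the second derivative of the square is at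
  least \<open>2 * \<kappa>\<^sup>2\<close> times the square.\<close>

lemma hermite_square_decay:
  assumes "0 \<le> \<kappa>" "0 \<le> b" "\<kappa>\<^sup>2 + (2 * real n + 1) \<le> b\<^sup>2" "b \<le> x" "0 \<le> \<delta>"
  shows "(hermite_fun1 n (x + \<delta>))\<^sup>2 \<le> exp (- (sqrt 2 * \<kappa>) * \<delta>) * (hermite_fun1 n x)\<^sup>2"
proof -
  let ?D = "\<lambda>t. ladder_coeff n * hermite_fun1 (n - 1) t - ladder_coeff (Suc n) * hermite_fun1 (Suc n) t"
  have D0: "(?D \<longlongrightarrow> 0) at_top"
    using tendsto_diff[OF tendsto_mult_right_zero[OF hermite_fun1_tendsto_0(1)[of "n - 1"], of "ladder_coeff n"]
      tendsto_mult_right_zero[OF hermite_fun1_tendsto_0(1)[of "Suc n"], of "ladder_coeff (Suc n)"]] by simp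
  show ?thesis
  proof (rule exp_decay_of_convexity[where e' = "\<lambda>t. 2 * (hermite_fun1 n t * ?D t)"
        and e'' = "\<lambda>t. 2 * (?D t * ?D t + hermite_fun1 n t * ((t\<^sup>2 - (2 * real n + 1)) * hermite_fun1 n t))" and b = b])
    fix t assume t: "b \<le> t"
    show "((\<lambda>t. (hermite_fun1 n t)\<^sup>2) has_real_derivative 2 * (hermite_fun1 n t * ?D t)) (at t)"
      by (rule derivative_eq_intros hermite_fun1_deriv refl | simp)+
    show "((\<lambda>t. 2 * (hermite_fun1 n t * ?D t)) has_real_derivative
        2 * (?D t * ?D t + hermite_fun1 n t * ((t\<^sup>2 - (2 * real n + 1)) * hermite_fun1 n t))) (at t)"
      by (rule DERIV_cmult, rule DERIV_cong[OF DERIV_mult[OF hermite_fun1_deriv hermite_ode]]) (simp add: algebra_simps)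
    have "b\<^sup>2 \<le> t\<^sup>2" using t assms(2) by (intro power_mono)
    then have "\<kappa>\<^sup>2 * (hermite_fun1 n t)\<^sup>2 \<le> (t\<^sup>2 - (2 * real n + 1)) * (hermite_fun1 n t)\<^sup>2"
      using assms(3) by (intro mult_right_mono) auto
    moreover have "(sqrt 2 * k)\<^sup>2 * h\<^sup>2 \<le> 2 * (D * D + h * (q * h))" if "k\<^sup>2 * h\<^sup>2 \<le> q * h\<^sup>2" for k h q D :: real
    proof -
      have "2 * (D * D + h * (q * h)) = 2 * (D * D) + 2 * (q * h\<^sup>2)"
        by (simp add: power2_eq_square algebra_simps)
      moreover have "(sqrt 2 * k)\<^sup>2 * h\<^sup>2 = 2 * (k\<^sup>2 * h\<^sup>2)" by (simp add: power_mult_distrib)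
      moreover have "0 \<le> D * D" by simp
      ultimately show ?thesis using that by linarith
    qed
    ultimately show "(sqrt 2 * \<kappa>)\<^sup>2 * (hermite_fun1 n t)\<^sup>2 \<le> 2 * (?D t * ?D t + hermite_fun1 n t * ((t\<^sup>2 - (2 * real n + 1)) * hermite_fun1 n t))"
      by blast
  next
    show "((\<lambda>t. (hermite_fun1 n t)\<^sup>2) \<longlongrightarrow> 0) at_top"
      using tendsto_power[OF hermite_fun1_tendsto_0(1)[of n], of 2] by simp
    show "((\<lambda>t. 2 * (hermite_fun1 n t * ?D t)) \<longlongrightarrow> 0) at_top"
      by (rule tendsto_mult_right_zero, rule tendsto_mult_zero[OF hermite_fun1_tendsto_0(1) D0])
  qed (use assms in auto)
qed

lemma hermite_square_minus: "(hermite_fun1 n (- t))\<^sup>2 = (hermite_fun1 n t)\<^sup>2"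
  by (simp add: hermite_fun1_minus power_mult_distrib minus_one_power_iff)

lemma integrable_hermite_square [simp]: "integrable lborel (\<lambda>x. (hermite_fun1 n x)\<^sup>2)"
  using integrable_hermite_mult[of n n] by (simp add: power2_eq_square)

lemma integral_hermite_square [simp]: "(LINT x|lborel. (hermite_fun1 n x)\<^sup>2) = 1"
  using hermite_orthonormal[of n n] by (simp add: power2_eq_square)

text \<open>Beyond \<open>b + \<delta>\<close> the square is dominated by a small factor times its translate by \<open>\<delta>\<close>, and the
  translate has total mass \<open>1\<close>; the other half-line follows by symmetry.\<close>

lemma hermite_tail_shift:
  assumes "0 \<le> \<kappa>" "0 \<le> b" "\<kappa>\<^sup>2 + (2 * real n + 1) \<le> b\<^sup>2" "0 \<le> \<delta>"
  shows "(LINT x|lborel. indicator {x. b + \<delta> < \<bar>x\<bar>} x * (hermite_fun1 n x)\<^sup>2) \<le> 2 * exp (- (sqrt 2 * \<kappa>) * \<delta>)"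
proof -
  let ?h = "\<lambda>x. (hermite_fun1 n x)\<^sup>2"
  have int: "integrable lborel (\<lambda>x. indicator A x * ?h x)" if "A \<in> sets borel" for A
    using integrable_mult_indicator[of A lborel ?h] that by simp
  have "(LINT x|lborel. indicator {b + \<delta><..} x * ?h x) = (LINT x|lborel. indicator {b + \<delta><..} (\<delta> + 1 * x) * ?h (\<delta> + 1 * x))"
    by (subst lborel_integral_real_affine[where c=1 and t=\<delta>]) auto
  also have "\<dots> \<le> (LINT x|lborel. exp (- (sqrt 2 * \<kappa>) * \<delta>) * ?h x)"
  proof (rule integral_mono)
    show "integrable lborel (\<lambda>x. indicator {b + \<delta><..} (\<delta> + 1 * x) * ?h (\<delta> + 1 * x))"
      by (rule lborel_integrable_real_affine[where f="\<lambda>x. indicator {b + \<delta><..} x * ?h x"]) (auto intro: int)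
    show "indicator {b + \<delta><..} (\<delta> + 1 * x) * ?h (\<delta> + 1 * x) \<le> exp (- (sqrt 2 * \<kappa>) * \<delta>) * ?h x" for x
      using hermite_square_decay[OF assms(1-3) _ assms(4), of x] by (auto simp: indicator_def add.commute)
  qed simp
  finally have right: "(LINT x|lborel. indicator {b + \<delta><..} x * ?h x) \<le> exp (- (sqrt 2 * \<kappa>) * \<delta>)" by simp
  have "(LINT x|lborel. indicator {..< - (b + \<delta>)} x * ?h x) = (LINT x|lborel. indicator {..< - (b + \<delta>)} (0 + (-1) * x) * ?h (0 + (-1) * x))"
    by (subst lborel_integral_real_affine[where c="-1" and t=0]) auto
  also have "\<dots> = (LINT x|lborel. indicator {b + \<delta><..} x * ?h x)"
    by (intro Bochner_Integration.integral_cong refl) (auto simp: indicator_def hermite_square_minus)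
  finally have left: "(LINT x|lborel. indicator {..< - (b + \<delta>)} x * ?h x) \<le> exp (- (sqrt 2 * \<kappa>) * \<delta>)" using right by simp
  have "(LINT x|lborel. indicator {x. b + \<delta> < \<bar>x\<bar>} x * ?h x)
      = (LINT x|lborel. indicator {b + \<delta><..} x * ?h x + indicator {..< - (b + \<delta>)} x * ?h x)"
    using assms(2,4) by (intro Bochner_Integration.integral_cong refl) (auto simp: indicator_def)
  also have "\<dots> = (LINT x|lborel. indicator {b + \<delta><..} x * ?h x) + (LINT x|lborel. indicator {..< - (b + \<delta>)} x * ?h x)"
    by (intro Bochner_Integration.integral_add int) auto
  finally show ?thesis using left right by simp
qed

definition hermite_cutoff :: "real \<Rightarrow> nat \<Rightarrow> real" where
  "hermite_cutoff \<theta> N = sqrt (2 * real N + real N powr (1 / 3 + \<theta>))"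

text \<open>The gap between the turning point \<open>a = sqrt (2 * N)\<close> and the cutoff is split into two halves \<open>\<delta>\<close>.
  The first half makes the potential at least \<open>2 * a * \<delta>\<close>, the second half collects decay, so the
  exponent is of order \<open>sqrt (a * \<delta>\<^sup>3)\<close>. Since \<open>\<delta>\<close> is of order \<open>N powr (\<theta> - 1 / 6)\<close>, this is
  \<open>N powr (3 * \<theta> / 2)\<close>.\<close>

lemma hermite_tail:
  assumes "n < N" "0 < \<theta>" "\<theta> < 2 / 3"
  shows "(LINT x|lborel. indicator {x. hermite_cutoff \<theta> N < \<bar>x\<bar>} x * (hermite_fun1 n x)\<^sup>2)
     \<le> 2 * exp (- (real N powr (3 * \<theta> / 2)) / 12)"
proof -
  define v where "v = real N"
  define c where "c = hermite_cutoff \<theta> N"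
  define a where "a = sqrt (2 * v)"
  define p where "p = v powr (1 / 3 + \<theta>)"
  define \<delta> where "\<delta> = (c - a) / 2"
  define b where "b = a + \<delta>"
  define \<kappa> where "\<kappa> = sqrt (2 * a * \<delta>)"
  have v1: "1 \<le> v" using assms(1) by (simp add: v_def)
  have p0: "0 < p" using v1 by (simp add: p_def)
  have pv: "p \<le> v" using powr_mono[of "1 / 3 + \<theta>" 1 v] assms(3) v1 by (simp add: p_def)
  have c: "c = sqrt (2 * v + p)" by (simp add: c_def hermite_cutoff_def v_def p_def)
  have ac: "a < c" unfolding a_def c using p0 by simp
  have a0: "0 < a" using v1 by (simp add: a_def)
  have a2: "a * a = 2 * v" and c2: "c * c = 2 * v + p" using v1 p0 by (simp_all add: a_def c)
  have \<delta>0: "0 < \<delta>" using ac by (simp add: \<delta>_def)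
  have \<kappa>2: "\<kappa>\<^sup>2 = 2 * a * \<delta>" unfolding \<kappa>_def using a0 \<delta>0 by simp
  have n1: "2 * real n + 1 \<le> 2 * v" using assms(1) by (simp add: v_def)
  have "\<kappa>\<^sup>2 + (2 * real n + 1) \<le> b\<^sup>2"
    unfolding \<kappa>2 b_def power2_sum using n1 a2 zero_le_square[of \<delta>] by (simp only: power2_eq_square)
  then have tail: "(LINT x|lborel. indicator {x. b + \<delta> < \<bar>x\<bar>} x * (hermite_fun1 n x)\<^sup>2) \<le> 2 * exp (- (sqrt 2 * \<kappa>) * \<delta>)"
    using a0 \<delta>0 by (intro hermite_tail_shift) (auto simp: \<kappa>_def b_def)
  have bc: "b + \<delta> = c" by (simp add: b_def \<delta>_def)
  have "c \<le> sqrt (4 * v)" unfolding c using pv v1 by simp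
  then have c_le: "c \<le> 2 * sqrt v" by (simp add: real_sqrt_mult)
  have "a \<le> sqrt (4 * v)" unfolding a_def using v1 by simp
  then have a_le: "a \<le> 2 * sqrt v" by (simp add: real_sqrt_mult)
  have "p = (c - a) * (c + a)" using a2 c2 by (simp add: algebra_simps)
  also have "\<dots> \<le> (c - a) * (4 * sqrt v)" using c_le a_le ac by (intro mult_left_mono) auto
  finally have p_le: "p \<le> 8 * \<delta> * sqrt v" by (simp add: \<delta>_def algebra_simps)
  have a_ge: "sqrt v \<le> a" unfolding a_def using v1 by simp
  have v32: "sqrt v * sqrt v = v" using v1 by simp
  have "p ^ 3 \<le> (8 * \<delta> * sqrt v) ^ 3" using p_le p0 by (intro power_mono) auto
  also have "\<dots> = 512 * \<delta> ^ 3 * (sqrt v * v)" unfolding power_mult_distrib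
    using v32 by (simp add: power3_eq_cube mult_ac)
  also have "\<dots> \<le> 512 * \<delta> ^ 3 * (a * v)"
    using a_ge \<delta>0 v1 by (intro mult_left_mono mult_right_mono) auto
  finally have "p ^ 3 \<le> 512 * (\<delta> ^ 3 * a) * v" by (simp add: mult_ac)
  moreover have "p ^ 3 = v powr (3 * \<theta>) * v"
  proof -
    have "p ^ 3 = p powr 3" using p0 by (simp add: powr_numeral)
    also have "\<dots> = v powr ((1 / 3 + \<theta>) * 3)" unfolding p_def powr_powr ..
    also have "(1 / 3 + \<theta>) * 3 = 3 * \<theta> + 1" by simp
    finally show ?thesis using v1 unfolding powr_add by simp
  qed
  ultimately have "v powr (3 * \<theta>) * v \<le> 512 * (\<delta> ^ 3 * a) * v" by simp
  then have key: "v powr (3 * \<theta>) \<le> 512 * (\<delta> ^ 3 * a)" using v1 by simp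
  have "(v powr (3 * \<theta> / 2) / 12)\<^sup>2 = v powr (3 * \<theta>) / 144"
  proof -
    have "(v powr (3 * \<theta> / 2))\<^sup>2 = v powr (3 * \<theta> / 2 * 2)"
      unfolding powr_powr[symmetric] using v1 by (simp add: powr_numeral)
    then show ?thesis by (simp add: power_divide)
  qed
  also have "\<dots> \<le> 4 * (\<delta> ^ 3 * a)"
    using key mult_pos_pos[OF zero_less_power[OF \<delta>0, of 3] a0] by linarith
  also have "\<dots> = ((sqrt 2 * \<kappa>) * \<delta>)\<^sup>2"
    unfolding power_mult_distrib \<kappa>2 by (simp add: power2_eq_square power3_eq_cube)
  finally have "v powr (3 * \<theta> / 2) / 12 \<le> (sqrt 2 * \<kappa>) * \<delta>"
    by (rule power2_le_imp_le) (use a0 \<delta>0 in \<open>simp add: \<kappa>_def\<close>)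
  then have "exp (- (sqrt 2 * \<kappa>) * \<delta>) \<le> exp (- (v powr (3 * \<theta> / 2)) / 12)" by simp
  then show ?thesis using tail unfolding bc c_def v_def by linarith
qed

section \<open>Hermite tapers\<close>

subsection \<open>Product integrals and affine substitutions\<close>

lemma Basis_vec_bij: "bij_betw (\<lambda>s::'n::finite. axis s (1::real)) UNIV Basis"
  unfolding bij_betw_def
proof
  show "inj (\<lambda>s::'n. axis s (1::real))" by (rule injI) (simp add: axis_eq_axis)
  show "range (\<lambda>s::'n. axis s (1::real)) = Basis" unfolding Basis_vec_def by fastforce
qed

text \<open>Lebesgue measure is the image of a product measure indexed by basis vectors; the bijection \<open>axis\<close>
  turns that index set into the coordinates.\<close>

lemma lborel_vec_prod_integral:
  fixes f :: "'n::finite \<Rightarrow> real \<Rightarrow> 'a::{real_normed_field,banach,second_countable_topology}"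
  assumes int: "\<And>s. integrable lborel (f s)"
  shows "integrable lborel (\<lambda>x::real^'n. \<Prod>s\<in>UNIV. f s (x $ s))"
    and "(LINT (x::real^'n)|lborel. (\<Prod>s\<in>UNIV. f s (x $ s))) = (\<Prod>s\<in>UNIV. LINT x|lborel. f s x)"
proof -
  interpret product_sigma_finite "\<lambda>_::real^'n. lborel :: real measure" by standard
  have [measurable]: "f s \<in> borel_measurable borel" for s
    using borel_measurable_integrable[OF int] by simp
  let ?P = "\<Pi>\<^sub>M b\<in>(Basis::(real^'n) set). (lborel :: real measure)"
  let ?T = "\<lambda>g. \<Sum>b\<in>(Basis::(real^'n) set). g b *\<^sub>R b"
  define F where "F b = f (the_inv_into UNIV (\<lambda>s. axis s 1) b)" for b :: "real^'n"
  have F: "F (axis s 1) = f s" for s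
    unfolding F_def using Basis_vec_bij by (subst the_inv_into_f_f) (auto simp: bij_betw_def)
  have FB: "integrable lborel (F b)" for b
    by (simp add: F_def int)
  have comp: "?T g $ s = g (axis s 1)" for g s
  proof -
    have "?T g $ s = ?T g \<bullet> axis s 1" by (simp add: inner_axis)
    also have "\<dots> = g (axis s 1)" by (subst inner_sum_left_Basis) (auto simp: Basis_vec_def)
    finally show ?thesis .
  qed
  have pr: "(\<Prod>s\<in>UNIV. f s (?T g $ s)) = (\<Prod>b\<in>Basis. F b (g b))" for g
    unfolding comp by (subst prod.reindex_bij_betw[OF Basis_vec_bij, symmetric]) (simp add: F)
  have pr2: "(\<Prod>s\<in>UNIV. LINT x|lborel. f s x) = (\<Prod>b\<in>Basis. LINT x|lborel. F b x)"
    by (subst prod.reindex_bij_betw[OF Basis_vec_bij, symmetric]) (simp add: F)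
  have T: "?T \<in> measurable ?P borel" by measurable
  have m: "(\<lambda>x::real^'n. \<Prod>s\<in>UNIV. f s (x $ s)) \<in> borel_measurable borel" by measurable
  show "integrable lborel (\<lambda>x::real^'n. \<Prod>s\<in>UNIV. f s (x $ s))"
    unfolding lborel_eq[where 'a="real^'n"] integrable_distr_eq[OF T m] pr
    by (rule product_integrable_prod) (auto simp: FB)
  show "(LINT (x::real^'n)|lborel. (\<Prod>s\<in>UNIV. f s (x $ s))) = (\<Prod>s\<in>UNIV. LINT x|lborel. f s x)"
    unfolding lborel_eq[where 'a="real^'n"] integral_distr[OF T m] pr pr2
    by (rule product_integral_prod) (auto simp: FB)
qed

lemma integrable_scaleR_right_iff:
  fixes f :: "'b \<Rightarrow> 'a::{banach,second_countable_topology}"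
  assumes "c \<noteq> 0"
  shows "integrable M (\<lambda>x. c *\<^sub>R f x) \<longleftrightarrow> integrable M f"
proof
  assume "integrable M (\<lambda>x. c *\<^sub>R f x)"
  then have "integrable M (\<lambda>x. inverse c *\<^sub>R (c *\<^sub>R f x))" by (rule integrable_scaleR_right)
  then show "integrable M f" by (simp only: scaleR_scaleR left_inverse[OF assms] scaleR_one)
qed simp

lemma lborel_integral_affine:
  fixes f :: "'b::euclidean_space \<Rightarrow> 'a::{banach,second_countable_topology}"
  assumes c: "c \<noteq> 0" and [measurable]: "f \<in> borel_measurable borel"
  shows "(LINT x|lborel. f x) = \<bar>c\<bar> ^ DIM('b) *\<^sub>R (LINT x|lborel. f (t + c *\<^sub>R x))"
    and "integrable lborel (\<lambda>x. f (t + c *\<^sub>R x)) \<longleftrightarrow> integrable lborel f"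
proof -
  have p: "(\<lambda>_::'b. ennreal \<bar>c\<bar> ^ DIM('b)) = (\<lambda>_. ennreal (\<bar>c\<bar> ^ DIM('b)))" by (simp add: ennreal_power)
  show "(LINT x|lborel. f x) = \<bar>c\<bar> ^ DIM('b) *\<^sub>R (LINT x|lborel. f (t + c *\<^sub>R x))"
    by (subst lborel_affine[OF c, of t], subst integral_density) (simp_all add: integral_distr)
  show "integrable lborel (\<lambda>x. f (t + c *\<^sub>R x)) \<longleftrightarrow> integrable lborel f"
    by (subst (2) lborel_affine[OF c, of t], subst integrable_density)
      (simp_all add: integrable_distr_eq c integrable_scaleR_right_iff)
qed

lemma nn_integral_lborel_translate:
  fixes f :: "'b::euclidean_space \<Rightarrow> ennreal"
  assumes [measurable]: "f \<in> borel_measurable borel"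
  shows "(\<integral>\<^sup>+x. f (x + t) \<partial>lborel) = (\<integral>\<^sup>+x. f x \<partial>lborel)"
  by (subst (2) lborel_affine[of 1 t]) (simp_all add: nn_integral_density nn_integral_distr add.commute)

subsection \<open>Index set\<close>

lemma taper_indices_eq: "taper_indices N = {i::nat^'n. \<forall>s. i $ s < N}"
  unfolding taper_indices_def by (subst Max_less_iff) auto

lemma taper_indices_bij: "bij_betw vec_lambda (UNIV \<rightarrow>\<^sub>E {..<N}) (taper_indices N :: (nat^'n) set)"
  unfolding taper_indices_eq
  by (rule bij_betwI[where g = vec_nth]) auto

lemma finite_taper_indices [simp]: "finite (taper_indices N :: (nat^'n) set)"
  using bij_betw_finite[OF taper_indices_bij[of N]] by (simp add: finite_PiE)

lemma card_taper_indices: "card (taper_indices N :: (nat^'n) set) = N ^ CARD('n)"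
  using bij_betw_same_card[OF taper_indices_bij[where 'n='n, of N]] by (simp add: card_PiE)

lemma sum_prod_taper_indices:
  fixes a :: "'n::finite \<Rightarrow> nat \<Rightarrow> real"
  shows "(\<Sum>i\<in>(taper_indices N :: (nat^'n) set). \<Prod>s\<in>UNIV. a s (i $ s)) = (\<Prod>s\<in>UNIV. \<Sum>n<N. a s n)"
  by (subst sum.reindex_bij_betw[OF taper_indices_bij, symmetric], subst prod_sum_PiE) auto

subsection \<open>Hermite functions on Euclidean space\<close>

lemma hermite_fun_eq: "hermite_fun i x = (\<Prod>s\<in>UNIV. hermite_fun1 (i $ s) (x $ s))"
proof -
  have "(norm x)\<^sup>2 = (\<Sum>s\<in>UNIV. (x $ s)\<^sup>2)"
    unfolding norm_vec_def L2_set_def by (simp add: sum_nonneg)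
  then have "exp (- (norm x)\<^sup>2 / 2) = (\<Prod>s\<in>UNIV. exp (- (x $ s)\<^sup>2 / 2))"
    by (simp add: exp_sum[symmetric] sum_divide_distrib sum_negf)
  then show ?thesis
    unfolding hermite_fun_def by (simp only: prod.distrib[symmetric] exp_times_hermite1)
qed

lemma continuous_hermite_fun: "continuous_on A (hermite_fun i)"
  unfolding hermite_fun_eq[abs_def] by (intro continuous_intros)

lemma measurable_hermite_fun [measurable]: "hermite_fun i \<in> borel_measurable borel"
  by (rule borel_measurable_continuous_onI[OF continuous_hermite_fun])

lemma hermite_fun_mult:
  "hermite_fun i x * hermite_fun j x = (\<Prod>s\<in>UNIV. hermite_fun1 (i $ s) (x $ s) * hermite_fun1 (j $ s) (x $ s))"
  by (simp add: hermite_fun_eq prod.distrib)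

lemma hermite_fun_square: "(hermite_fun i x)\<^sup>2 = (\<Prod>s\<in>UNIV. (hermite_fun1 (i $ s) (x $ s))\<^sup>2)"
  by (simp add: hermite_fun_eq prod_power_distrib)

lemma hermite_fun_orthonormal:
  "integrable lborel (\<lambda>x. hermite_fun i x * hermite_fun j x)"
  "(LINT x|lborel. hermite_fun i x * hermite_fun j x) = (if i = j then 1 else 0)"
proof -
  show "integrable lborel (\<lambda>x. hermite_fun i x * hermite_fun j x)"
    unfolding hermite_fun_mult by (rule lborel_vec_prod_integral) simp
  have "(LINT x|lborel. hermite_fun i x * hermite_fun j x) = (\<Prod>s\<in>UNIV. if i $ s = j $ s then 1 else 0)"
    unfolding hermite_fun_mult by (subst lborel_vec_prod_integral) (simp_all add: hermite_orthonormal)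
  also have "\<dots> = (if i = j then 1 else 0)"
    by (auto simp: vec_eq_iff)
  finally show "(LINT x|lborel. hermite_fun i x * hermite_fun j x) = (if i = j then 1 else 0)" .
qed

lemma hermite_fun_square_minus: "(hermite_fun i (- x))\<^sup>2 = (hermite_fun i x)\<^sup>2"
  by (simp add: hermite_fun_square hermite_square_minus)

lemma hermite_fun_square_integral:
  "integrable lborel (\<lambda>x. (hermite_fun i x)\<^sup>2)" "(LINT x|lborel. (hermite_fun i x)\<^sup>2) = 1"
  using hermite_fun_orthonormal[of i i] by (simp_all add: power2_eq_square)

lemma sum_hermite_fun_square_le:
  "(\<Sum>i\<in>taper_indices N. (hermite_fun i (x::real^'n))\<^sup>2) \<le> sqrt (2 * real N) ^ CARD('n)"
proof -
  have "(\<Sum>i\<in>taper_indices N. (hermite_fun i x)\<^sup>2) = (\<Prod>s\<in>UNIV. \<Sum>n<N. (hermite_fun1 n (x $ s))\<^sup>2)"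
    unfolding hermite_fun_square by (rule sum_prod_taper_indices)
  also have "\<dots> \<le> (\<Prod>s\<in>(UNIV::'n set). sqrt (2 * real N))"
    by (intro prod_mono conjI sum_nonneg sum_hermite_square_le) auto
  finally show ?thesis by simp
qed

lemma prod_one_special:
  fixes f :: "'n::finite \<Rightarrow> 'a::comm_monoid_mult"
  shows "(\<Prod>s\<in>UNIV. if s = t then g else f s) = g * (\<Prod>s\<in>UNIV - {t}. f s)"
  by (subst prod.remove[of _ t]) (auto intro!: arg_cong2[where f="(*)"] prod.cong)

lemma hermite_fun_weighted_integral:
  fixes w :: "real \<Rightarrow> real"
  assumes w: "integrable lborel (\<lambda>x. w x * (hermite_fun1 (i $ t) x)\<^sup>2)"
  shows "integrable lborel (\<lambda>x. w (x $ t) * (hermite_fun i x)\<^sup>2)"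
    and "(LINT x|lborel. w (x $ t) * (hermite_fun i x)\<^sup>2) = (LINT x|lborel. w x * (hermite_fun1 (i $ t) x)\<^sup>2)"
proof -
  let ?f = "\<lambda>s x. (if s = t then w x else 1) * (hermite_fun1 (i $ s) x)\<^sup>2"
  have eq: "w (x $ t) * (hermite_fun i x)\<^sup>2 = (\<Prod>s\<in>UNIV. ?f s (x $ s))" for x
  proof -
    have "(\<Prod>s\<in>UNIV. if s = t then w (x $ s) else 1) = (\<Prod>s\<in>UNIV. if s = t then w (x $ t) else 1)"
      by (intro prod.cong) auto
    then show ?thesis
      unfolding prod.distrib hermite_fun_square by (simp add: prod_one_special)
  qed
  have int: "integrable lborel (?f s)" for s using w by (cases "s = t") auto
  show "integrable lborel (\<lambda>x. w (x $ t) * (hermite_fun i x)\<^sup>2)"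
    unfolding eq by (rule lborel_vec_prod_integral[OF int])
  have "(LINT x|lborel. w (x $ t) * (hermite_fun i x)\<^sup>2) = (\<Prod>s\<in>UNIV. LINT x|lborel. ?f s x)"
    unfolding eq by (rule lborel_vec_prod_integral[OF int])
  also have "\<dots> = (\<Prod>s\<in>UNIV. if s = t then (LINT x|lborel. w x * (hermite_fun1 (i $ t) x)\<^sup>2) else 1)"
    by (intro prod.cong) auto
  finally show "(LINT x|lborel. w (x $ t) * (hermite_fun i x)\<^sup>2) = (LINT x|lborel. w x * (hermite_fun1 (i $ t) x)\<^sup>2)"
    by (simp add: prod_one_special)
qed

lemma hermite_fun_second_moment:
  assumes "i \<in> taper_indices N"
  shows "integrable lborel (\<lambda>x::real^'n. (norm x)\<^sup>2 * (hermite_fun i x)\<^sup>2)"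
    and "(LINT (x::real^'n)|lborel. (norm x)\<^sup>2 * (hermite_fun i x)\<^sup>2) \<le> real (CARD('n) * N)"
proof -
  have eq: "(norm x)\<^sup>2 * (hermite_fun i x)\<^sup>2 = (\<Sum>s\<in>UNIV. (x $ s)\<^sup>2 * (hermite_fun i x)\<^sup>2)" for x :: "real^'n"
    unfolding norm_vec_def L2_set_def by (simp add: sum_nonneg sum_distrib_right)
  have int: "integrable lborel (\<lambda>x::real^'n. (x $ s)\<^sup>2 * (hermite_fun i x)\<^sup>2)"
    and val: "(LINT (x::real^'n)|lborel. (x $ s)\<^sup>2 * (hermite_fun i x)\<^sup>2) = real (i $ s) + 1 / 2" for s
    using hermite_fun_weighted_integral[of "\<lambda>x. x\<^sup>2" i s] hermite_second_moment[of "i $ s"] by simp_all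
  show "integrable lborel (\<lambda>x::real^'n. (norm x)\<^sup>2 * (hermite_fun i x)\<^sup>2)"
    unfolding eq by (intro Bochner_Integration.integrable_sum int)
  have "(LINT (x::real^'n)|lborel. (norm x)\<^sup>2 * (hermite_fun i x)\<^sup>2) = (\<Sum>s\<in>UNIV. real (i $ s) + 1 / 2)"
    unfolding eq by (subst Bochner_Integration.integral_sum) (simp_all add: int val)
  also have "\<dots> \<le> (\<Sum>s\<in>(UNIV::'n set). real N)"
  proof (rule sum_mono)
    fix s
    have "Suc (i $ s) \<le> N" using assms by (simp add: taper_indices_eq Suc_le_eq)
    then have "real (i $ s) + 1 \<le> real N" by linarith
    then show "real (i $ s) + 1 / 2 \<le> real N" by simp
  qed
  finally show "(LINT (x::real^'n)|lborel. (norm x)\<^sup>2 * (hermite_fun i x)\<^sup>2) \<le> real (CARD('n) * N)" by simp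
qed

text \<open>Outside a cube some coordinate is large, and the other coordinates integrate to \<open>1\<close>.\<close>

lemma hermite_fun_tail:
  assumes "i \<in> taper_indices N" "0 < \<theta>" "\<theta> < 2 / 3" and a: "hermite_cutoff \<theta> N \<le> a"
  shows "(LINT (x::real^'n)|lborel. indicator (- window a) x * (hermite_fun i x)\<^sup>2)
     \<le> 2 * real CARD('n) * exp (- (real N powr (3 * \<theta> / 2)) / 12)"
proof -
  let ?T = "{x::real. hermite_cutoff \<theta> N < \<bar>x\<bar>}"
  have T: "?T \<in> sets borel" by measurable
  have int1: "integrable lborel (\<lambda>x. indicator ?T x * (hermite_fun1 n x)\<^sup>2)" for n
    using integrable_mult_indicator[of ?T lborel "\<lambda>x. (hermite_fun1 n x)\<^sup>2"] T by simp
  have int: "integrable lborel (\<lambda>x::real^'n. indicator ?T (x $ s) * (hermite_fun i x)\<^sup>2)" for s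
    by (rule hermite_fun_weighted_integral(1)[OF int1])
  have val: "(LINT (x::real^'n)|lborel. indicator ?T (x $ s) * (hermite_fun i x)\<^sup>2) \<le> 2 * exp (- (real N powr (3 * \<theta> / 2)) / 12)" for s
    using hermite_tail[of "i $ s" N \<theta>] assms by (subst hermite_fun_weighted_integral(2)[OF int1]) (simp add: taper_indices_eq)
  have W: "window a \<in> sets (borel :: (real^'n) measure)" by (simp add: window_def)
  have "(LINT (x::real^'n)|lborel. indicator (- window a) x * (hermite_fun i x)\<^sup>2)
      \<le> (LINT (x::real^'n)|lborel. (\<Sum>s\<in>UNIV. indicator ?T (x $ s) * (hermite_fun i x)\<^sup>2))"
  proof (rule integral_mono)
    show "integrable lborel (\<lambda>x::real^'n. indicator (- window a) x * (hermite_fun i x)\<^sup>2)"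
      using integrable_mult_indicator[of "- window a" lborel "\<lambda>x::real^'n. (hermite_fun i x)\<^sup>2"] W hermite_fun_square_integral[of i] by simp
    show "integrable lborel (\<lambda>x::real^'n. \<Sum>s\<in>UNIV. indicator ?T (x $ s) * (hermite_fun i x)\<^sup>2)"
      by (intro Bochner_Integration.integrable_sum int)
    fix x :: "real^'n"
    show "indicator (- window a) x * (hermite_fun i x)\<^sup>2 \<le> (\<Sum>s\<in>UNIV. indicator ?T (x $ s) * (hermite_fun i x)\<^sup>2)"
    proof (cases "x \<in> window a")
      case False
      then obtain s where "x $ s < - a \<or> a < x $ s" by (auto simp: window_def mem_box_cart not_le)
      then have "a < \<bar>x $ s\<bar>" by linarith
      then have "x $ s \<in> ?T" using a by simp
      then have "indicator (- window a) x * (hermite_fun i x)\<^sup>2 \<le> indicator ?T (x $ s) * (hermite_fun i x)\<^sup>2"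
        using False by simp
      also have "\<dots> \<le> (\<Sum>s\<in>UNIV. indicator ?T (x $ s) * (hermite_fun i x)\<^sup>2)"
        by (rule member_le_sum[where f="\<lambda>s. indicator ?T (x $ s) * (hermite_fun i x)\<^sup>2"]) auto
      finally show ?thesis .
    qed (auto intro!: sum_nonneg)
  qed
  also have "\<dots> = (\<Sum>s\<in>UNIV. LINT (x::real^'n)|lborel. indicator ?T (x $ s) * (hermite_fun i x)\<^sup>2)"
    by (intro Bochner_Integration.integral_sum int)
  also have "\<dots> \<le> (\<Sum>s\<in>(UNIV::'n set). 2 * exp (- (real N powr (3 * \<theta> / 2)) / 12))"
    by (intro sum_mono val)
  finally show ?thesis by simp
qed

lemma hermite_fun_autocorr:
  fixes z :: "real^'n"
  shows "of_real (LINT x|lborel. hermite_fun i (x + z) * hermite_fun i x)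
    = (LINT \<xi>|lborel. of_real ((hermite_fun i \<xi>)\<^sup>2) * exp (\<i> * of_real (z \<bullet> \<xi>)))"
proof -
  let ?F = "\<lambda>s x. hermite_fun1 (i $ s) x *\<^sub>R (of_real (hermite_fun1 (i $ s) x) * exp (\<i> * of_real (z $ s * x)))"
  have "(LINT x|lborel. hermite_fun i (x + z) * hermite_fun i x)
      = (LINT x|lborel. (\<Prod>s\<in>UNIV. hermite_fun1 (i $ s) (x $ s) * hermite_fun1 (i $ s) (x $ s + z $ s)))"
    by (simp add: hermite_fun_eq prod.distrib mult.commute)
  also have "\<dots> = (\<Prod>s\<in>UNIV. hermite_autocorr (i $ s) (i $ s) (z $ s))"
    by (subst lborel_vec_prod_integral) (auto simp: hermite_autocorr_def)
  finally have "of_real (LINT x|lborel. hermite_fun i (x + z) * hermite_fun i x) = (\<Prod>s\<in>UNIV. LINT x|lborel. ?F s x)"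
    by (simp add: hermite_autocorr_eq_fourier hermite_fourier_def)
  also have "\<dots> = (LINT \<xi>|lborel. (\<Prod>s\<in>UNIV. ?F s (\<xi> $ s)))"
    by (rule lborel_vec_prod_integral(2)[symmetric]) (rule integrable_hermite_fourier)
  also have "\<dots> = (LINT \<xi>|lborel. of_real ((hermite_fun i \<xi>)\<^sup>2) * exp (\<i> * of_real (z \<bullet> \<xi>)))"
  proof (intro Bochner_Integration.integral_cong refl)
    fix \<xi> :: "real^'n"
    have "exp (\<i> * of_real (z \<bullet> \<xi>)) = (\<Prod>s\<in>UNIV. exp (\<i> * of_real (z $ s * \<xi> $ s)))"
      by (simp add: inner_vec_def exp_sum[symmetric] sum_distrib_left)
    then show "(\<Prod>s\<in>UNIV. ?F s (\<xi> $ s)) = of_real ((hermite_fun i \<xi>)\<^sup>2) * exp (\<i> * of_real (z \<bullet> \<xi>))"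
      by (simp add: hermite_fun_eq prod.distrib scaleR_conv_of_real power2_eq_square mult.assoc)
  qed
  finally show ?thesis .
qed

subsection \<open>Rescaling\<close>

lemma hermite_taper_mult:
  fixes x y :: "real^'n"
  assumes "0 < r"
  shows "hermite_taper r i x * hermite_taper r j y = (hermite_fun i ((1 / r) *\<^sub>R x) * hermite_fun j ((1 / r) *\<^sub>R y)) / r ^ CARD('n)"
proof -
  have "r powr (- real CARD('n) / 2) * r powr (- real CARD('n) / 2) = r powr (- real CARD('n))"
    by (simp add: powr_add[symmetric])
  also have "\<dots> = 1 / r ^ CARD('n)" using assms by (simp add: powr_minus powr_realpow field_simps)
  finally show ?thesis unfolding hermite_taper_def
    by (metis (no_types, lifting) mult.assoc mult.left_commute mult.commute times_divide_eq_left mult_1)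
qed

lemma hermite_taper_square:
  fixes x :: "real^'n"
  assumes "0 < r"
  shows "(hermite_taper r i x)\<^sup>2 = (hermite_fun i ((1 / r) *\<^sub>R x))\<^sup>2 / r ^ CARD('n)"
  unfolding power2_eq_square by (rule hermite_taper_mult[OF assms])

lemma continuous_hermite_taper [continuous_intros]: "continuous_on A (hermite_taper r i)"
  unfolding hermite_taper_def[abs_def]
  by (intro continuous_intros continuous_on_compose2[OF continuous_hermite_fun[of UNIV]]) auto

lemma measurable_hermite_taper [measurable]: "hermite_taper r i \<in> borel_measurable borel"
  by (rule borel_measurable_continuous_onI[OF continuous_hermite_taper])

lemma scaled_integral:
  fixes f :: "real^'n \<Rightarrow> 'a::{banach,second_countable_topology}"
  assumes "0 < r" and [measurable]: "f \<in> borel_measurable borel"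
  shows "(LINT x|lborel. f ((1 / r) *\<^sub>R x) /\<^sub>R r ^ CARD('n)) = (LINT x|lborel. f x)"
    and "integrable lborel (\<lambda>x. f ((1 / r) *\<^sub>R x) /\<^sub>R r ^ CARD('n)) \<longleftrightarrow> integrable lborel f"
proof -
  have "(LINT x|lborel. f x) = (1 / r) ^ CARD('n) *\<^sub>R (LINT x|lborel. f (0 + (1 / r) *\<^sub>R x))"
    using lborel_integral_affine(1)[of "1 / r" f 0] assms by simp
  then show "(LINT x|lborel. f ((1 / r) *\<^sub>R x) /\<^sub>R r ^ CARD('n)) = (LINT x|lborel. f x)"
    by (simp add: power_divide inverse_eq_divide)
  show "integrable lborel (\<lambda>x. f ((1 / r) *\<^sub>R x) /\<^sub>R r ^ CARD('n)) \<longleftrightarrow> integrable lborel f"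
    using lborel_integral_affine(2)[of "1 / r" f 0] assms by (simp add: integrable_scaleR_right_iff)
qed

lemma hermite_taper_orthonormal:
  assumes r: "0 < r"
  shows "integrable lborel (\<lambda>x::real^'n. hermite_taper r i x * hermite_taper r j x)"
    and "(LINT (x::real^'n)|lborel. hermite_taper r i x * hermite_taper r j x) = (if i = j then 1 else 0)"
proof -
  have eq: "hermite_taper r i x * hermite_taper r j x
    = (\<lambda>x. hermite_fun i x * hermite_fun j x) ((1 / r) *\<^sub>R x) /\<^sub>R r ^ CARD('n)" for x :: "real^'n"
    by (simp add: hermite_taper_mult[OF r] divide_inverse mult.commute)
  show "integrable lborel (\<lambda>x::real^'n. hermite_taper r i x * hermite_taper r j x)"
    unfolding eq by (subst scaled_integral(2)[OF r]) (simp_all add: hermite_fun_orthonormal)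
  show "(LINT (x::real^'n)|lborel. hermite_taper r i x * hermite_taper r j x) = (if i = j then 1 else 0)"
    unfolding eq by (subst scaled_integral(1)[OF r]) (simp_all add: hermite_fun_orthonormal)
qed

lemma sum_hermite_taper_square_le:
  assumes "0 < r"
  shows "(\<Sum>i\<in>taper_indices N. (hermite_taper r i (x::real^'n))\<^sup>2) \<le> (sqrt (2 * real N) / r) ^ CARD('n)"
  unfolding hermite_taper_square[OF assms] sum_divide_distrib[symmetric] power_divide
  using assms by (intro divide_right_mono sum_hermite_fun_square_le) auto

lemma window_scale:
  assumes "0 < r"
  shows "(1 / r) *\<^sub>R x \<in> window a \<longleftrightarrow> x \<in> window (r * a)"
  using assms by (simp add: window_def mem_box_cart field_simps)

lemma hermite_taper_tail:
  assumes "i \<in> taper_indices N" "0 < \<theta>" "\<theta> < 2 / 3" "0 < r" "r * hermite_cutoff \<theta> N \<le> R"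
  shows "(LINT (x::real^'n)|lborel. indicator (- window R) x * (hermite_taper r i x)\<^sup>2)
     \<le> 2 * real CARD('n) * exp (- (real N powr (3 * \<theta> / 2)) / 12)"
proof -
  have W: "window a \<in> sets (borel :: (real^'n) measure)" for a by (simp add: window_def)
  have eq: "indicator (- window R) x * (hermite_taper r i x)\<^sup>2
    = (\<lambda>x. indicator (- window (R / r)) x * (hermite_fun i x)\<^sup>2) ((1 / r) *\<^sub>R x) /\<^sub>R r ^ CARD('n)" for x :: "real^'n"
  proof -
    have w: "((1 / r) *\<^sub>R x \<in> window (R / r)) = (x \<in> window R)"
      using window_scale[OF assms(4), of x "R / r"] assms(4) by simp
    show ?thesis
      by (cases "x \<in> window R") (simp_all only: indicator_def Compl_iff w hermite_taper_square[OF assms(4)], simp_all add: divide_inverse)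
  qed
  have "(LINT (x::real^'n)|lborel. indicator (- window R) x * (hermite_taper r i x)\<^sup>2)
    = (LINT (x::real^'n)|lborel. indicator (- window (R / r)) x * (hermite_fun i x)\<^sup>2)"
    unfolding eq using W by (intro scaled_integral(1) assms) auto
  also have "\<dots> \<le> 2 * real CARD('n) * exp (- (real N powr (3 * \<theta> / 2)) / 12)"
    using assms by (intro hermite_fun_tail) (auto simp: field_simps)
  finally show ?thesis .
qed

lemma hermite_taper_autocorr:
  fixes z :: "real^'n"
  assumes r: "0 < r"
  shows "of_real (LINT x|lborel. hermite_taper r i (x + z) * hermite_taper r i x)
    = (LINT \<xi>|lborel. of_real ((hermite_fun i \<xi>)\<^sup>2) * exp (\<i> * of_real (z \<bullet> \<xi> / r)))"
proof -
  have eq: "hermite_taper r i (x + z) * hermite_taper r i x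
    = (\<lambda>x. hermite_fun i (x + (1 / r) *\<^sub>R z) * hermite_fun i x) ((1 / r) *\<^sub>R x) /\<^sub>R r ^ CARD('n)" for x :: "real^'n"
    by (simp add: hermite_taper_mult[OF r] divide_inverse mult.commute scaleR_add_right)
  have "(LINT x|lborel. hermite_taper r i (x + z) * hermite_taper r i x)
      = (LINT x|lborel. hermite_fun i (x + (1 / r) *\<^sub>R z) * hermite_fun i x)"
    unfolding eq by (intro scaled_integral(1) r) measurable
  then show ?thesis by (simp add: hermite_fun_autocorr)
qed

section \<open>Cumulants of counts in disjoint cells\<close>

subsection \<open>Sums over set partitions\<close>

text \<open>The offset \<open>k\<close> counts blocks that are already split off, which makes the recursion below possible.\<close>

definition partition_sum :: "(nat \<Rightarrow> real) \<Rightarrow> (nat set \<Rightarrow> real) \<Rightarrow> nat \<Rightarrow> nat set \<Rightarrow> real" where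
  "partition_sum c w k A = (\<Sum>\<tau> | partition_on A \<tau>. c (card \<tau> + k) * (\<Prod>b\<in>\<tau>. w b))"

lemma partition_sum_empty: "partition_sum c w k {} = c k"
  by (simp add: partition_sum_def partition_on_empty)

text \<open>The partitions of \<open>insert a A\<close> are sorted by the block \<open>insert a B\<close> that contains \<open>a\<close>.\<close>

lemma partition_sum_insert:
  assumes "finite A" "a \<notin> A"
  shows "partition_sum c w k (insert a A) = (\<Sum>B\<in>Pow A. w (insert a B) * partition_sum c w (Suc k) (A - B))"
proof -
  let ?D = "SIGMA B:Pow A. {\<tau>. partition_on (A - B) \<tau>}"
  let ?f = "\<lambda>(B, \<tau>). insert (insert a B) \<tau>"
  have fresh: "a \<notin> \<Union>\<tau>" "insert a B \<notin> \<tau>" if "(B, \<tau>) \<in> ?D" for B \<tau>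
    using that assms(2) partition_onD1[of "A - B" \<tau>] by auto
  have inj: "inj_on ?f ?D"
  proof (rule inj_onI, clarsimp)
    fix B \<tau> B' \<tau>'
    assume *: "B \<subseteq> A" "partition_on (A - B) \<tau>" "B' \<subseteq> A" "partition_on (A - B') \<tau>'"
      and eq: "insert (insert a B) \<tau> = insert (insert a B') \<tau>'"
    have f: "a \<notin> \<Union>\<tau>" "a \<notin> \<Union>\<tau>'" using fresh[of B \<tau>] fresh[of B' \<tau>'] * by auto
    have "insert a B \<in> insert (insert a B') \<tau>'" using eq by blast
    then have i: "insert a B = insert a B'" using f by blast
    have "\<tau> = \<tau>'" using eq i f by (metis Diff_insert_absorb UnionI insertI1)
    moreover have "B = B'" using i *(1,3) assms(2) by auto
    ultimately show "B = B' \<and> \<tau> = \<tau>'" by simp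
  qed
  have img: "?f ` ?D = {\<sigma>. partition_on (insert a A) \<sigma>}"
  proof safe
    fix B \<tau> assume *: "B \<subseteq> A" "partition_on (A - B) \<tau>"
    have "disjnt (insert a B) (\<Union>\<tau>)"
      using partition_onD1[OF *(2)] assms(2) by (auto simp: disjnt_def)
    then show "partition_on (insert a A) (insert (insert a B) \<tau>)"
      using * assms(2) by (subst partition_on_insert) (auto simp: insert_Diff_if)
  next
    fix \<sigma> assume \<sigma>: "partition_on (insert a A) \<sigma>"
    then obtain p where p: "p \<in> \<sigma>" "a \<in> p" using partition_onD1 by blast
    let ?\<tau> = "\<sigma> - {p}"
    have dis: "disjnt p (\<Union>?\<tau>)"
      using partition_onD2[OF \<sigma>] p by (auto simp: disjnt_def disjoint_def)
    have "insert p ?\<tau> = \<sigma>" using p by auto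
    then have "partition_on (insert a A - p) ?\<tau>" "p \<subseteq> insert a A"
      using partition_on_insert[OF dis, of "insert a A"] \<sigma> by auto
    moreover have "insert a A - p = A - (p - {a})" "insert a (p - {a}) = p" using p assms(2) by auto
    ultimately have "(p - {a}, ?\<tau>) \<in> ?D" "?f (p - {a}, ?\<tau>) = \<sigma>" using p by auto
    then show "\<sigma> \<in> ?f ` ?D" by (intro rev_image_eqI) auto
  qed
  have fin: "finite {\<tau>. partition_on (A - B) \<tau>}" for B
    using finitely_many_partition_on[of "A - B"] assms(1) by simp
  have "partition_sum c w k (insert a A) = (\<Sum>\<sigma>\<in>?f ` ?D. c (card \<sigma> + k) * (\<Prod>b\<in>\<sigma>. w b))"
    unfolding partition_sum_def img ..
  also have "\<dots> = (\<Sum>(B, \<tau>)\<in>?D. w (insert a B) * (c (card \<tau> + Suc k) * (\<Prod>b\<in>\<tau>. w b)))"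
  proof (subst sum.reindex[OF inj], rule sum.cong[OF refl], clarsimp)
    fix B \<tau> assume *: "B \<subseteq> A" "partition_on (A - B) \<tau>"
    have "finite \<tau>" using finite_elements[OF _ *(2)] assms(1) by simp
    then show "c (card (insert (insert a B) \<tau>) + k) * prod w (insert (insert a B) \<tau>) = w (insert a B) * (c (Suc (card \<tau> + k)) * prod w \<tau>)"
      using fresh[of B \<tau>] * by simp
  qed
  also have "\<dots> = (\<Sum>B\<in>Pow A. \<Sum>\<tau> | partition_on (A - B) \<tau>. w (insert a B) * (c (card \<tau> + Suc k) * (\<Prod>b\<in>\<tau>. w b)))"
    using assms(1) fin by (intro sum.Sigma[symmetric]) auto
  finally show ?thesis by (simp add: partition_sum_def sum_distrib_left)
qed

lemma sum_Pow_insert: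
  fixes f :: "'a set \<Rightarrow> 'b::comm_monoid_add"
  assumes "finite A" "a \<notin> A"
  shows "sum f (Pow (insert a A)) = (\<Sum>B\<in>Pow A. f B) + (\<Sum>B\<in>Pow A. f (insert a B))"
proof -
  have "inj_on (insert a) (Pow A)" using assms(2) by (auto simp: inj_on_def)
  then show ?thesis
    unfolding Pow_insert using assms
    by (subst sum.union_disjoint) (auto simp: sum.reindex)
qed

definition cumulant_coeff :: "nat \<Rightarrow> real" where
  "cumulant_coeff n = (- 1) ^ (n - 1) * fact (n - 1)"

lemma cumulant_eq_partition_sum:
  "cumulant M \<Phi> m A = partition_sum cumulant_coeff (\<lambda>b. enn2real (fact_moment M \<Phi> b A)) 0 {1..m}"
  by (simp add: cumulant_def partition_sum_def cumulant_coeff_def mult.assoc)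

lemma partition_sum_2:
  "partition_sum cumulant_coeff w 0 {1..2} = w {1, 2} - w {1} * w {2}"
proof -
  have "{1..2} = {1, 2::nat}" by auto
  then show ?thesis
    by (simp add: partition_sum_insert sum_Pow_insert partition_sum_empty insert_Diff_if cumulant_coeff_def fact_numeral)
qed

lemma partition_sum_3:
  "partition_sum cumulant_coeff w 0 {1..3} =
    w {1, 2, 3} - w {1} * w {2, 3} - w {2} * w {1, 3} - w {3} * w {1, 2} + 2 * (w {1} * w {2} * w {3})"
proof -
  have "{1..3} = {1, 2, 3::nat}" by auto
  then show ?thesis
    by (simp add: partition_sum_insert sum_Pow_insert partition_sum_empty insert_Diff_if cumulant_coeff_def fact_numeral algebra_simps)
qed

lemma partition_sum_4:
  "partition_sum cumulant_coeff w 0 {1..4} =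
    w {1, 2, 3, 4}
    - w {1} * w {2, 3, 4} - w {2} * w {1, 3, 4} - w {3} * w {1, 2, 4} - w {4} * w {1, 2, 3}
    - w {1, 2} * w {3, 4} - w {1, 3} * w {2, 4} - w {1, 4} * w {2, 3}
    + 2 * (w {1, 2} * w {3} * w {4} + w {1, 3} * w {2} * w {4} + w {1, 4} * w {2} * w {3}
         + w {2, 3} * w {1} * w {4} + w {2, 4} * w {1} * w {3} + w {3, 4} * w {1} * w {2})
    - 6 * (w {1} * w {2} * w {3} * w {4})"
proof -
  have "{1..4} = {1, 2, 3, 4::nat}" by auto
  then show ?thesis
    by (simp add: partition_sum_insert sum_Pow_insert partition_sum_empty insert_Diff_if cumulant_coeff_def fact_numeral algebra_simps)
qed

subsection \<open>Injective tuples in cells\<close>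

definition cell_tuples :: "'a set \<Rightarrow> nat set \<Rightarrow> (nat \<Rightarrow> 'a set) \<Rightarrow> (nat \<Rightarrow> 'a) set" where
  "cell_tuples C J A = {x \<in> J \<rightarrow>\<^sub>E C. inj_on x J \<and> (\<forall>j\<in>J. x j \<in> A j)}"

lemma cell_tuples_subset: "cell_tuples C J A \<subseteq> (\<Pi>\<^sub>E j\<in>J. C \<inter> A j)"
  by (auto simp: cell_tuples_def PiE_def Pi_def)

lemma finite_cell_tuples:
  "finite J \<Longrightarrow> (\<And>j. j \<in> J \<Longrightarrow> finite (C \<inter> A j)) \<Longrightarrow> finite (cell_tuples C J A)"
  by (rule finite_subset[OF cell_tuples_subset]) (rule finite_PiE)

lemma cell_tuples_empty: "cell_tuples C {} A = {\<lambda>_. undefined}"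
  by (auto simp: cell_tuples_def)

text \<open>The new entry may be any point of its cell that is not used before, and the used points of the cell
  are those of the entries with the same label, since cells with other labels are disjoint from it.\<close>

lemma card_cell_tuples_insert:
  assumes J: "finite J" "j \<notin> J"
    and fin: "\<And>k. k \<in> insert j J \<Longrightarrow> finite (C \<inter> A (l k))"
    and cells: "\<And>k. k \<in> J \<Longrightarrow> l k \<noteq> l j \<Longrightarrow> A (l k) \<inter> A (l j) = {}"
  shows "real (card (cell_tuples C (insert j J) (\<lambda>k. A (l k)))) =
    real (card (cell_tuples C J (\<lambda>k. A (l k)))) * (real (card (C \<inter> A (l j))) - real (card {k \<in> J. l k = l j}))"
proof -
  let ?T = "cell_tuples C J (\<lambda>k. A (l k))" and ?T' = "cell_tuples C (insert j J) (\<lambda>k. A (l k))"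
  let ?D = "SIGMA x:?T. C \<inter> A (l j) - x ` J"
  let ?f = "\<lambda>(x, y). x(j := y)"
  have inj: "inj_on ?f ?D"
  proof (rule inj_onI, clarsimp)
    fix x y x' y'
    assume *: "x \<in> ?T" "x' \<in> ?T" "x(j := y) = x'(j := y')"
    have "y = y'" using fun_cong[OF *(3), of j] by simp
    moreover have "x = x'"
    proof
      fix k
      have "x j = undefined" "x' j = undefined"
        using * J(2) by (auto simp: cell_tuples_def PiE_def extensional_def)
      then show "x k = x' k" using fun_cong[OF *(3), of k] by (cases "k = j") auto
    qed
    ultimately show "x = x' \<and> y = y'" by simp
  qed
  have img: "?f ` ?D = ?T'"
  proof safe
    fix x y assume x: "x \<in> ?T" and y: "y \<in> C" "y \<in> A (l j)" "y \<notin> x ` J"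
    have "inj_on (x(j := y)) (insert j J)"
      using x y(3) J(2) by (auto simp: cell_tuples_def inj_on_def)
    then show "x(j := y) \<in> ?T'" using x y J(2) by (auto simp: cell_tuples_def PiE_def Pi_def extensional_def)
  next
    fix z assume z: "z \<in> ?T'"
    have inj: "inj_on z (insert j J)" using z by (simp add: cell_tuples_def)
    let ?x = "restrict z J"
    have "?x \<in> ?T" using z inj by (auto simp: cell_tuples_def inj_on_def)
    moreover have "z j \<in> C \<inter> A (l j)" using z by (auto simp: cell_tuples_def)
    moreover have "z j \<notin> ?x ` J" using inj J(2) by (auto simp: inj_on_def)
    moreover have "?x(j := z j) = z" using z by (auto simp: cell_tuples_def fun_eq_iff PiE_def extensional_def)
    ultimately have "(?x, z j) \<in> ?D" "?f (?x, z j) = z" by auto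
    then show "z \<in> ?f ` ?D" by (intro rev_image_eqI) auto
  qed
  have finT: "finite ?T" using J fin by (intro finite_cell_tuples) auto
  have card: "real (card (C \<inter> A (l j) - x ` J)) = real (card (C \<inter> A (l j))) - real (card {k \<in> J. l k = l j})" if x: "x \<in> ?T" for x
  proof -
    have "x ` {k \<in> J. l k = l j} = x ` J \<inter> (C \<inter> A (l j))"
    proof safe
      fix k assume "k \<in> J" "x k \<in> A (l j)"
      moreover have "x k \<in> A (l k)" using x \<open>k \<in> J\<close> by (simp add: cell_tuples_def)
      ultimately show "x k \<in> x ` {k \<in> J. l k = l j}" using cells[of k] by auto
    qed (use x in \<open>auto simp: cell_tuples_def\<close>)
    moreover have "inj_on x {k \<in> J. l k = l j}" using x by (auto simp: cell_tuples_def inj_on_def)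
    ultimately have "card (C \<inter> A (l j) \<inter> x ` J) = card {k \<in> J. l k = l j}"
      by (metis card_image inf_commute)
    moreover have "C \<inter> A (l j) - x ` J = C \<inter> A (l j) - (C \<inter> A (l j) \<inter> x ` J)" by auto
    moreover have "card (C \<inter> A (l j) \<inter> x ` J) \<le> card (C \<inter> A (l j))" using fin by (intro card_mono) auto
    moreover have "card (C \<inter> A (l j) - (C \<inter> A (l j) \<inter> x ` J)) = card (C \<inter> A (l j)) - card (C \<inter> A (l j) \<inter> x ` J)"
      using fin by (intro card_Diff_subset) auto
    ultimately show ?thesis by simp
  qed
  have "real (card ?T') = real (card ?D)" using card_image[OF inj] img by simp
  also have "\<dots> = (\<Sum>x\<in>?T. real (card (C \<inter> A (l j) - x ` J)))"
    using finT fin by (subst card_SigmaI) auto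
  also have "\<dots> = (\<Sum>x\<in>?T. real (card (C \<inter> A (l j))) - real (card {k \<in> J. l k = l j}))"
    by (intro sum.cong refl card)
  finally show ?thesis by simp
qed

subsection \<open>Fourth order joint cumulants of a symmetric moment functional\<close>

definition same :: "'p \<Rightarrow> 'p \<Rightarrow> real" where "same p q = (if p = q then 1 else 0)"

text \<open>The functions \<open>m1\<close>, \<dots>, \<open>m4\<close> stand for the mixed moments of counts in disjoint cells and
  \<open>F2\<close>, \<open>F3\<close>, \<open>F4\<close> for the factorial moments. The fourth order cumulant of the counts is the sum,
  over the partitions of the four indices into blocks of equal cells, of factorial cumulants. Once
  it is decided which of the four cells coincide, this is a polynomial identity in the moments.\<close>

lemma count_cumulant_identity:
  fixes m1 :: "'p \<Rightarrow> real" and m2 m3 m4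
  assumes s2: "\<And>p q. m2 p q = m2 q p"
    and s3: "\<And>p q r. m3 p q r = m3 q p r" "\<And>p q r. m3 p q r = m3 p r q"
    and s4: "\<And>p q r s. m4 p q r s = m4 q p r s" "\<And>p q r s. m4 p q r s = m4 p r q s" "\<And>p q r s. m4 p q r s = m4 p q s r"
  defines "F2 \<equiv> \<lambda>p q. m2 p q - same p q * m1 p"
  defines "F3 \<equiv> \<lambda>p q r. m3 p q r - (same p r + same q r) * m2 p q - same p q * m2 p r + same p q * (same p r + same q r) * m1 p"
  defines "F4 \<equiv> \<lambda>p q r s. m4 p q r s - (same p s + same q s + same r s) * m3 p q r - (same p r + same q r) * m3 p q s
     - same p q * m3 p r s + (same p r + same q r) * (same p s + same q s + same r s) * m2 p q
     + same p q * (same p s + same q s + same r s) * m2 p r + same p q * (same p r + same q r) * m2 p s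
     - same p q * (same p r + same q r) * (same p s + same q s + same r s) * m1 p"
  defines "k2 \<equiv> \<lambda>p q. F2 p q - m1 p * m1 q"
  defines "k3 \<equiv> \<lambda>p q r. F3 p q r - m1 p * F2 q r - m1 q * F2 p r - m1 r * F2 p q + 2 * (m1 p * m1 q * m1 r)"
  defines "k4 \<equiv> \<lambda>p q r s. F4 p q r s - m1 p * F3 q r s - m1 q * F3 p r s - m1 r * F3 p q s - m1 s * F3 p q r
     - F2 p q * F2 r s - F2 p r * F2 q s - F2 p s * F2 q r
     + 2 * (F2 p q * m1 r * m1 s + F2 p r * m1 q * m1 s + F2 p s * m1 q * m1 r
        + F2 q r * m1 p * m1 s + F2 q s * m1 p * m1 r + F2 r s * m1 p * m1 q)
     - 6 * (m1 p * m1 q * m1 r * m1 s)"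
  defines "c \<equiv> \<lambda>p q. m2 p q - m1 p * m1 q"
  shows "m4 p q r s - m1 p * m3 q r s - m1 q * m3 p r s - m1 r * m3 p q s - m1 s * m3 p q r
      + m1 p * m1 q * m2 r s + m1 p * m1 r * m2 q s + m1 p * m1 s * m2 q r
      + m1 q * m1 r * m2 p s + m1 q * m1 s * m2 p r + m1 r * m1 s * m2 p q
      - 3 * (m1 p * m1 q * m1 r * m1 s)
      - c p q * c r s - c p r * c q s - c p s * c q r
    = k4 p q r s
      + (same p q * k3 p r s + same p r * k3 p q s + same p s * k3 p q r
         + same q r * k3 p q s + same q s * k3 p q r + same r s * k3 p q r)
      + (same p q * same r s * k2 p r + same p r * same q s * k2 p q + same p s * same q r * k2 p q
         + same p q * same p r * k2 p s + same p q * same p s * k2 p r + same p r * same p s * k2 p q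
         + same q r * same q s * k2 p q)
      + same p q * same p r * same p s * m1 p"
  unfolding k4_def k3_def k2_def c_def F4_def F3_def F2_def same_def
  apply (cases "p = q"; cases "p = r"; cases "p = s"; cases "q = r"; cases "q = s"; cases "r = s")
  apply (simp_all add: s2 s3 s4)
  apply (simp_all add: s2 s3 s4 algebra_simps)
  done

section \<open>Counts of the point process\<close>

locale point_process =
  fixes M :: "'w measure" and \<Phi> :: "'w \<Rightarrow> (real ^ 'n) set" and g :: "real ^ 'n \<Rightarrow> real"
    and \<gamma> :: "nat \<Rightarrow> (nat \<Rightarrow> real ^ 'n) set \<Rightarrow> real"
  assumes standing: "standing_assumption M \<Phi> 1 g"
    and cumulants: "\<And>m. m \<in> {2, 3, 4} \<Longrightarrow> has_reduced_cumulant M \<Phi> m (\<gamma> m)"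
begin

lemma prob_space_M: "prob_space M"
  using standing by (simp add: standing_assumption_def stationary_point_process_def)

sublocale prob_space M by (rule prob_space_M)

lemma space_config: "space config_space = {C :: (real^'n) set. loc_finite C}"
  unfolding config_space_def by (rule space_measure_of) auto

lemma sets_config: "A \<in> sets borel \<Longrightarrow> bounded A \<Longrightarrow> {C :: (real^'n) set. loc_finite C \<and> card (C \<inter> A) = n} \<in> sets config_space"
  unfolding config_space_def by (subst sets_measure_of) auto

lemma Phi_measurable: "\<Phi> \<in> M \<rightarrow>\<^sub>M config_space"
  using standing by (simp add: standing_assumption_def stationary_point_process_def)

lemma finite_Phi: "\<omega> \<in> space M \<Longrightarrow> bounded A \<Longrightarrow> finite (\<Phi> \<omega> \<inter> A)"
  using measurable_space[OF Phi_measurable, of \<omega>] by (simp add: space_config loc_finite_def)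

definition npts :: "(real^'n) set \<Rightarrow> 'w \<Rightarrow> real" where
  "npts A \<omega> = real (card (\<Phi> \<omega> \<inter> A))"

lemma npts_nonneg [simp]: "0 \<le> npts A \<omega>" by (simp add: npts_def)

lemma npts_mono: "\<omega> \<in> space M \<Longrightarrow> A \<subseteq> B \<Longrightarrow> bounded B \<Longrightarrow> npts A \<omega> \<le> npts B \<omega>"
  unfolding npts_def using finite_Phi[of \<omega> B] by (auto intro!: card_mono)

lemma measurable_npts:
  assumes "A \<in> sets borel" "bounded A"
  shows "npts A \<in> borel_measurable M"
proof -
  have "(\<lambda>C. card (C \<inter> A)) \<in> config_space \<rightarrow>\<^sub>M count_space UNIV"
  proof (subst measurable_count_space_eq2_countable, simp, safe)
    fix n
    have "(\<lambda>C. card (C \<inter> A)) -` {n} \<inter> space config_space = {C. loc_finite C \<and> card (C \<inter> A) = n}"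
      by (auto simp: space_config)
    then show "(\<lambda>C. card (C \<inter> A)) -` {n} \<inter> space config_space \<in> sets config_space"
      using sets_config[OF assms] by simp
  qed
  from measurable_compose[OF measurable_compose[OF Phi_measurable this], of real borel]
  show ?thesis by (simp add: npts_def[abs_def])
qed

lemma expectation_npts:
  assumes "A \<in> sets borel" "bounded A"
  shows "expectation (npts A) = measure lborel A"
proof -
  have "(\<integral>\<^sup>+\<omega>. ennreal (npts A \<omega>) \<partial>M) = (\<integral>\<^sup>+\<omega>. emeasure (count_space UNIV) (\<Phi> \<omega> \<inter> A) \<partial>M)"
    using finite_Phi assms(2)
    by (intro nn_integral_cong) (simp add: npts_def emeasure_count_space_finite ennreal_of_nat_eq_real_of_nat)
  also have "\<dots> = emeasure lborel A"
    using standing assms(1) by (simp add: standing_assumption_def has_intensity_def)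
  finally show ?thesis
    using measurable_npts[OF assms] by (subst integral_eq_nn_integral) (auto simp: measure_def)
qed

lemma fact_moment_eq:
  assumes "finite J" "\<And>j. j \<in> J \<Longrightarrow> bounded (A j)"
  shows "fact_moment M \<Phi> J A = (\<integral>\<^sup>+\<omega>. ennreal (real (card (cell_tuples (\<Phi> \<omega>) J A))) \<partial>M)"
  unfolding fact_moment_def
proof (rule nn_integral_cong)
  fix \<omega> assume "\<omega> \<in> space M"
  then have "finite (cell_tuples (\<Phi> \<omega>) J A)"
    using assms finite_Phi by (intro finite_cell_tuples) auto
  then show "emeasure (count_space UNIV) {x \<in> J \<rightarrow>\<^sub>E \<Phi> \<omega>. inj_on x J \<and> (\<forall>j\<in>J. x j \<in> A j)} = ennreal (real (card (cell_tuples (\<Phi> \<omega>) J A)))"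
    unfolding cell_tuples_def[symmetric] by (simp add: emeasure_count_space_finite ennreal_of_nat_eq_real_of_nat)
qed

lemma card_filter_insert:
  "finite J \<Longrightarrow> a \<notin> J \<Longrightarrow> real (card {k \<in> insert a J. l k = (l j :: 'p)}) = same (l a) (l j) + real (card {k \<in> J. l k = l j})"
proof -
  assume J: "finite J" "a \<notin> J"
  have "{k \<in> insert a J. l k = l j} = (if l a = l j then insert a {k \<in> J. l k = l j} else {k \<in> J. l k = l j})"
    by auto
  then show ?thesis using J by (simp add: same_def)
qed

lemma power4_le_falling: "real n ^ 4 \<le> 256 * (1 + real n * (real n - 1) * (real n - 2) * (real n - 3))"
proof (cases "n < 4")
  case True
  then have "n \<in> {0, 1, 2, 3}" by auto
  then show ?thesis by auto
next
  case False
  then obtain m where n: "n = m + 4" by (metis add.commute le_Suc_ex not_less)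
  have "real n ^ 4 = (real m + 4) * (real m + 4) * (real m + 4) * (real m + 4)"
    by (simp add: n power4_eq_xxxx mult.assoc)
  also have "\<dots> \<le> (real m + 4) * (4 * (real m + 3)) * (4 * (real m + 2)) * (4 * (real m + 1))"
    by (intro mult_mono) auto
  also have "\<dots> \<le> 256 * ((real m + 4) * (real m + 3) * (real m + 2) * (real m + 1))"
    by (simp add: algebra_simps)
  also have "\<dots> \<le> 256 * (1 + real n * (real n - 1) * (real n - 2) * (real n - 3))"
    by (simp add: n algebra_simps)
  finally show ?thesis .
qed

text \<open>The existence of the fourth cumulant includes finite fourth factorial moments on bounded sets, and
  \<open>n ^ 4\<close> is controlled by the fourth falling factorial of \<open>n\<close>.\<close>

lemma integrable_npts_power4:
  assumes W: "W \<in> sets borel" "bounded W"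
  shows "integrable M (\<lambda>\<omega>. npts W \<omega> ^ 4)"
proof -
  note [measurable] = measurable_npts[OF W]
  let ?F = "\<lambda>\<omega>. npts W \<omega> * (npts W \<omega> - 1) * (npts W \<omega> - 2) * (npts W \<omega> - 3)"
  have card: "real (card (cell_tuples (\<Phi> \<omega>) {1, 2, 3, 4} (\<lambda>_. W))) = ?F \<omega>" if "\<omega> \<in> space M" for \<omega>
  proof -
    have fin: "finite (\<Phi> \<omega> \<inter> W)" using finite_Phi[OF that W(2)] .
    have step: "real (card (cell_tuples (\<Phi> \<omega>) (insert j J) (\<lambda>_. W)))
      = real (card (cell_tuples (\<Phi> \<omega>) J (\<lambda>_. W))) * (npts W \<omega> - real (card J))" if "finite J" "j \<notin> J" for j J
      using card_cell_tuples_insert[of J j "\<Phi> \<omega>" "\<lambda>_. W" "\<lambda>_. ()"] that fin by (simp add: npts_def)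
    have "{1, 2, 3, 4::nat} = insert 4 (insert 3 (insert 2 (insert 1 {})))" by auto
    then show ?thesis by (simp add: step cell_tuples_empty)
  qed
  have "has_reduced_cumulant M \<Phi> 4 (\<gamma> 4)" using cumulants by simp
  then have "(\<forall>b\<subseteq>{1..4}. fact_moment M \<Phi> b (\<lambda>_. W) < \<infinity>)"
    using W unfolding has_reduced_cumulant_def by (elim conjE allE[of _ "\<lambda>_. W"]) auto
  moreover have "{1, 2, 3, 4} \<subseteq> {1..4::nat}" by auto
  ultimately have "fact_moment M \<Phi> {1, 2, 3, 4} (\<lambda>_. W) < \<infinity>" by blast
  also have "fact_moment M \<Phi> {1, 2, 3, 4} (\<lambda>_. W) = (\<integral>\<^sup>+\<omega>. ennreal (?F \<omega>) \<partial>M)"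
    using W by (subst fact_moment_eq) (simp_all only: finite.intros cong: nn_integral_cong add: card)
  finally have fin: "(\<integral>\<^sup>+\<omega>. ennreal (?F \<omega>) \<partial>M) < \<infinity>" .
  have nonneg: "AE \<omega> in M. 0 \<le> ?F \<omega>"
    by (rule AE_I2) (simp flip: card)
  have F: "integrable M ?F"
    using fin nonneg by (intro integrableI_nonneg) auto
  show ?thesis
  proof (rule Bochner_Integration.integrable_bound[where f="\<lambda>\<omega>. 256 * (1 + ?F \<omega>)"])
    show "integrable M (\<lambda>\<omega>. 256 * (1 + ?F \<omega>))"
      using F by (intro integrable_mult_right Bochner_Integration.integrable_add) auto
    show "AE \<omega> in M. norm (npts W \<omega> ^ 4) \<le> norm (256 * (1 + ?F \<omega>))"
    proof (rule AE_I2)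
      fix \<omega>
      have "npts W \<omega> ^ 4 \<le> 256 * (1 + ?F \<omega>)" using power4_le_falling[of "card (\<Phi> \<omega> \<inter> W)"] by (simp add: npts_def)
      then show "norm (npts W \<omega> ^ 4) \<le> norm (256 * (1 + ?F \<omega>))" by simp
    qed
  qed simp
qed

lemma integrable_npts_polynomial:
  assumes W: "W \<in> sets borel" "bounded W"
    and [measurable]: "f \<in> borel_measurable M"
    and le: "\<And>\<omega>. \<omega> \<in> space M \<Longrightarrow> norm (f \<omega>) \<le> c * (1 + npts W \<omega>) ^ 4"
  shows "integrable M (f :: 'w \<Rightarrow> 'a::{banach,second_countable_topology})"
proof -
  note [measurable] = measurable_npts[OF W]
  have *: "(1 + x) ^ 4 \<le> 16 * (1 + x ^ 4)" if "0 \<le> x" for x :: real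
  proof (cases "x \<le> 1")
    case True
    then have "(1 + x) ^ 4 \<le> 2 ^ 4" using that by (intro power_mono) auto
    then have le: "(1 + x) ^ 4 \<le> 16" by simp
    have "0 \<le> x ^ 4" by simp
    then show ?thesis using le unfolding distrib_left by linarith
  next
    case False
    then have "(1 + x) ^ 4 \<le> (2 * x) ^ 4" by (intro power_mono) auto
    then show ?thesis by (simp add: power_mult_distrib)
  qed
  show ?thesis
  proof (rule Bochner_Integration.integrable_bound[where f="\<lambda>\<omega>. \<bar>c\<bar> * (16 * (1 + npts W \<omega> ^ 4))"])
    show "integrable M (\<lambda>\<omega>. \<bar>c\<bar> * (16 * (1 + npts W \<omega> ^ 4)))"
      using integrable_npts_power4[OF W] by (intro integrable_mult_right Bochner_Integration.integrable_add) auto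
    show "AE \<omega> in M. norm (f \<omega>) \<le> norm (\<bar>c\<bar> * (16 * (1 + npts W \<omega> ^ 4)))"
    proof (rule AE_I2)
      fix \<omega> assume "\<omega> \<in> space M"
      note le[OF this]
      also have "c * (1 + npts W \<omega>) ^ 4 \<le> \<bar>c\<bar> * (1 + npts W \<omega>) ^ 4" by (intro mult_right_mono) auto
      also have "\<dots> \<le> \<bar>c\<bar> * (16 * (1 + npts W \<omega> ^ 4))" by (intro mult_left_mono *) auto
      finally show "norm (f \<omega>) \<le> norm (\<bar>c\<bar> * (16 * (1 + npts W \<omega> ^ 4)))" by simp
    qed
  qed simp
qed

text \<open>The value of \<open>enn2real\<close> at infinity is \<open>0\<close>, so \<open>tv\<close> and the next constant carry information only where
  \<open>gamma4_red \<gamma>\<close> is finite.\<close>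

definition tv :: "nat \<Rightarrow> real" where "tv m = enn2real (total_variation m (\<gamma> m))"

definition cumulant_mass :: real where "cumulant_mass = 1 + 7 * tv 2 + 6 * tv 3 + tv 4"

end

subsection \<open>Disjoint cells\<close>

locale cell_partition = point_process M \<Phi> g \<gamma>
  for M :: "'w measure" and \<Phi> :: "'w \<Rightarrow> (real ^ 'n) set" and g :: "real ^ 'n \<Rightarrow> real"
    and \<gamma> :: "nat \<Rightarrow> (nat \<Rightarrow> real ^ 'n) set \<Rightarrow> real" +
  fixes W :: "(real ^ 'n) set" and A :: "'p \<Rightarrow> (real ^ 'n) set"
  assumes W: "W \<in> sets borel" "bounded W"
    and A: "\<And>p. A p \<in> sets borel" "\<And>p. A p \<subseteq> W"
    and disjoint: "\<And>p q. p \<noteq> q \<Longrightarrow> A p \<inter> A q = {}"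
begin

lemma bounded_A [simp]: "bounded (A p)" using bounded_subset[OF W(2) A(2)] .

abbreviation N :: "'p \<Rightarrow> 'w \<Rightarrow> real" where "N p \<equiv> npts (A p)"

lemma measurable_N [measurable]: "N p \<in> borel_measurable M"
  by (rule measurable_npts[OF A(1) bounded_A])

lemma N_le: "\<omega> \<in> space M \<Longrightarrow> N p \<omega> \<le> 1 + npts W \<omega>"
  using npts_mono[OF _ A(2) W(2), of \<omega> p] by simp

lemma integrable_N_prod:
  assumes "finite J" "card J \<le> 4"
  shows "integrable M (\<lambda>\<omega>. \<Prod>j\<in>J. N (l j) \<omega>)"
proof (rule integrable_npts_polynomial[OF W, where c=1])
  fix \<omega> assume \<omega>: "\<omega> \<in> space M"
  have "(\<Prod>j\<in>J. N (l j) \<omega>) \<le> (\<Prod>j\<in>J. 1 + npts W \<omega>)"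
    using \<omega> by (intro prod_mono conjI npts_nonneg N_le)
  also have "\<dots> \<le> (1 + npts W \<omega>) ^ 4"
    using assms by (simp add: power_increasing)
  finally show "norm (\<Prod>j\<in>J. N (l j) \<omega>) \<le> 1 * (1 + npts W \<omega>) ^ 4"
    by (simp add: prod_nonneg)
qed measurable

lemma integrable_N_1 [simp]: "integrable M (N p)"
  using integrable_N_prod[of "{0::nat}" "\<lambda>_. p"] by simp

lemma integrable_N_2 [simp]: "integrable M (\<lambda>\<omega>. N p \<omega> * N q \<omega>)"
  using integrable_N_prod[of "{0::nat, 1}" "\<lambda>j. if j = 0 then p else q"] by simp

lemma integrable_N_3 [simp]: "integrable M (\<lambda>\<omega>. N p \<omega> * N q \<omega> * N r \<omega>)"
  using integrable_N_prod[of "{0::nat, 1, 2}" "\<lambda>j. if j = 0 then p else if j = 1 then q else r"] by (simp add: mult.assoc)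

lemma integrable_N_4 [simp]: "integrable M (\<lambda>\<omega>. N p \<omega> * N q \<omega> * N r \<omega> * N s \<omega>)"
  using integrable_N_prod[of "{0::nat, 1, 2, 3}" "\<lambda>j. if j = 0 then p else if j = 1 then q else if j = 2 then r else s"]
  by (simp add: mult.assoc)

definition m1 :: "'p \<Rightarrow> real" where "m1 p = expectation (N p)"
definition m2 :: "'p \<Rightarrow> 'p \<Rightarrow> real" where "m2 p q = expectation (\<lambda>\<omega>. N p \<omega> * N q \<omega>)"
definition m3 :: "'p \<Rightarrow> 'p \<Rightarrow> 'p \<Rightarrow> real" where "m3 p q r = expectation (\<lambda>\<omega>. N p \<omega> * N q \<omega> * N r \<omega>)"
definition m4 :: "'p \<Rightarrow> 'p \<Rightarrow> 'p \<Rightarrow> 'p \<Rightarrow> real" where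
  "m4 p q r s = expectation (\<lambda>\<omega>. N p \<omega> * N q \<omega> * N r \<omega> * N s \<omega>)"

lemma m1_eq: "m1 p = measure lborel (A p)"
  unfolding m1_def by (rule expectation_npts[OF A(1) bounded_A])

text \<open>Factorial moments of the counts, by inclusion and exclusion of coinciding points: tuples of distinct
  points in cells are counted by products of falling factors.\<close>

definition F2 :: "'p \<Rightarrow> 'p \<Rightarrow> real" where "F2 p q = m2 p q - same p q * m1 p"
definition F3 :: "'p \<Rightarrow> 'p \<Rightarrow> 'p \<Rightarrow> real" where
  "F3 p q r = m3 p q r - (same p r + same q r) * m2 p q - same p q * m2 p r + same p q * (same p r + same q r) * m1 p"
definition F4 :: "'p \<Rightarrow> 'p \<Rightarrow> 'p \<Rightarrow> 'p \<Rightarrow> real" where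
  "F4 p q r s = m4 p q r s - (same p s + same q s + same r s) * m3 p q r - (same p r + same q r) * m3 p q s
     - same p q * m3 p r s + (same p r + same q r) * (same p s + same q s + same r s) * m2 p q
     + same p q * (same p s + same q s + same r s) * m2 p r + same p q * (same p r + same q r) * m2 p s
     - same p q * (same p r + same q r) * (same p s + same q s + same r s) * m1 p"

lemma fact_moment_expectation:
  assumes "finite J" and f: "\<And>\<omega>. \<omega> \<in> space M \<Longrightarrow> real (card (cell_tuples (\<Phi> \<omega>) J (\<lambda>j. A (l j)))) = f \<omega>"
    and [measurable]: "f \<in> borel_measurable M"
  shows "enn2real (fact_moment M \<Phi> J (\<lambda>j. A (l j))) = expectation f"
proof -
  have "fact_moment M \<Phi> J (\<lambda>j. A (l j)) = (\<integral>\<^sup>+\<omega>. ennreal (f \<omega>) \<partial>M)"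
    by (subst fact_moment_eq) (auto simp: assms intro!: nn_integral_cong)
  moreover have "AE \<omega> in M. 0 \<le> f \<omega>" by (rule AE_I2) (simp flip: f)
  ultimately show ?thesis by (simp add: integral_eq_nn_integral)
qed

lemma cell_tuples_step:
  assumes "\<omega> \<in> space M" "finite J" "j \<notin> J"
  shows "real (card (cell_tuples (\<Phi> \<omega>) (insert j J) (\<lambda>k. A (l k)))) =
    real (card (cell_tuples (\<Phi> \<omega>) J (\<lambda>k. A (l k)))) * (N (l j) \<omega> - real (card {k \<in> J. l k = l j}))"
  unfolding npts_def using assms finite_Phi disjoint by (intro card_cell_tuples_insert) auto

lemma cell_tuples_counts:
  assumes \<omega>: "\<omega> \<in> space M"
  shows "real (card (cell_tuples (\<Phi> \<omega>) {a} (\<lambda>k. A (l k)))) = N (l a) \<omega>"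
    and "distinct [a, b] \<Longrightarrow> real (card (cell_tuples (\<Phi> \<omega>) {a, b} (\<lambda>k. A (l k)))) = N (l a) \<omega> * (N (l b) \<omega> - same (l a) (l b))"
    and "distinct [a, b, c] \<Longrightarrow> real (card (cell_tuples (\<Phi> \<omega>) {a, b, c} (\<lambda>k. A (l k))))
      = N (l a) \<omega> * (N (l b) \<omega> - same (l a) (l b)) * (N (l c) \<omega> - (same (l a) (l c) + same (l b) (l c)))"
    and "distinct [a, b, c, d] \<Longrightarrow> real (card (cell_tuples (\<Phi> \<omega>) {a, b, c, d} (\<lambda>k. A (l k))))
      = N (l a) \<omega> * (N (l b) \<omega> - same (l a) (l b)) * (N (l c) \<omega> - (same (l a) (l c) + same (l b) (l c)))
        * (N (l d) \<omega> - (same (l a) (l d) + same (l b) (l d) + same (l c) (l d)))"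
proof -
  show 1: "real (card (cell_tuples (\<Phi> \<omega>) {a} (\<lambda>k. A (l k)))) = N (l a) \<omega>" for a
    using cell_tuples_step[OF \<omega>, of "{}" a l] by (simp add: cell_tuples_empty)
  show 2: "real (card (cell_tuples (\<Phi> \<omega>) {a, b} (\<lambda>k. A (l k)))) = N (l a) \<omega> * (N (l b) \<omega> - same (l a) (l b))"
    if "distinct [a, b]" for a b
    using that cell_tuples_step[OF \<omega>, of "{a}" b l] 1[of a] card_filter_insert[of "{}" a l b]
    by (simp add: insert_commute[of a b])
  show 3: "real (card (cell_tuples (\<Phi> \<omega>) {a, b, c} (\<lambda>k. A (l k))))
      = N (l a) \<omega> * (N (l b) \<omega> - same (l a) (l b)) * (N (l c) \<omega> - (same (l a) (l c) + same (l b) (l c)))"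
    if "distinct [a, b, c]" for a b c
  proof -
    have "{a, b, c} = insert c {a, b}" by auto
    then show ?thesis
      using that cell_tuples_step[OF \<omega>, of "{a, b}" c l] 2[of a b] card_filter_insert[of "{b}" a l c] card_filter_insert[of "{}" b l c]
      by simp
  qed
  show "real (card (cell_tuples (\<Phi> \<omega>) {a, b, c, d} (\<lambda>k. A (l k))))
      = N (l a) \<omega> * (N (l b) \<omega> - same (l a) (l b)) * (N (l c) \<omega> - (same (l a) (l c) + same (l b) (l c)))
        * (N (l d) \<omega> - (same (l a) (l d) + same (l b) (l d) + same (l c) (l d)))"
    if "distinct [a, b, c, d]"
  proof -
    have "{a, b, c, d} = insert d {a, b, c}" by auto
    then show ?thesis
      using that cell_tuples_step[OF \<omega>, of "{a, b, c}" d l] 3[of a b c] card_filter_insert[of "{b, c}" a l d]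
        card_filter_insert[of "{c}" b l d] card_filter_insert[of "{}" c l d]
      by simp
  qed
qed

lemma fact_moments:
  "enn2real (fact_moment M \<Phi> {a} (\<lambda>k. A (l k))) = m1 (l a)"
  "distinct [a, b] \<Longrightarrow> enn2real (fact_moment M \<Phi> {a, b} (\<lambda>k. A (l k))) = F2 (l a) (l b)"
  "distinct [a, b, c] \<Longrightarrow> enn2real (fact_moment M \<Phi> {a, b, c} (\<lambda>k. A (l k))) = F3 (l a) (l b) (l c)"
  "distinct [a, b, c, d] \<Longrightarrow> enn2real (fact_moment M \<Phi> {a, b, c, d} (\<lambda>k. A (l k))) = F4 (l a) (l b) (l c) (l d)"
proof -
  show "enn2real (fact_moment M \<Phi> {a} (\<lambda>k. A (l k))) = m1 (l a)"
    unfolding m1_def by (rule fact_moment_expectation) (auto simp: cell_tuples_counts)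
  show "enn2real (fact_moment M \<Phi> {a, b} (\<lambda>k. A (l k))) = F2 (l a) (l b)" if d: "distinct [a, b]"
  proof -
    have "enn2real (fact_moment M \<Phi> {a, b} (\<lambda>k. A (l k))) = expectation (\<lambda>\<omega>. N (l a) \<omega> * N (l b) \<omega> - same (l a) (l b) * N (l a) \<omega>)"
      by (rule fact_moment_expectation) (auto simp: cell_tuples_counts(2)[OF _ d] algebra_simps)
    then show ?thesis by (simp add: F2_def m2_def m1_def)
  qed
  show "enn2real (fact_moment M \<Phi> {a, b, c} (\<lambda>k. A (l k))) = F3 (l a) (l b) (l c)" if d: "distinct [a, b, c]"
  proof -
    let ?p = "l a" and ?q = "l b" and ?r = "l c"
    have "enn2real (fact_moment M \<Phi> {a, b, c} (\<lambda>k. A (l k))) = expectation (\<lambda>\<omega>. N ?p \<omega> * N ?q \<omega> * N ?r \<omega>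
       - (same ?p ?r + same ?q ?r) * (N ?p \<omega> * N ?q \<omega>) - same ?p ?q * (N ?p \<omega> * N ?r \<omega>) + same ?p ?q * (same ?p ?r + same ?q ?r) * N ?p \<omega>)"
      by (rule fact_moment_expectation) (auto simp: cell_tuples_counts(3)[OF _ d] algebra_simps)
    then show ?thesis by (simp add: F3_def m3_def m2_def m1_def)
  qed
  show "enn2real (fact_moment M \<Phi> {a, b, c, d} (\<lambda>k. A (l k))) = F4 (l a) (l b) (l c) (l d)" if d: "distinct [a, b, c, d]"
  proof -
    let ?p = "l a" and ?q = "l b" and ?r = "l c" and ?s = "l d"
    have "enn2real (fact_moment M \<Phi> {a, b, c, d} (\<lambda>k. A (l k))) = expectation (\<lambda>\<omega>. N ?p \<omega> * N ?q \<omega> * N ?r \<omega> * N ?s \<omega>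
       - (same ?p ?s + same ?q ?s + same ?r ?s) * (N ?p \<omega> * N ?q \<omega> * N ?r \<omega>) - (same ?p ?r + same ?q ?r) * (N ?p \<omega> * N ?q \<omega> * N ?s \<omega>)
       - same ?p ?q * (N ?p \<omega> * N ?r \<omega> * N ?s \<omega>) + (same ?p ?r + same ?q ?r) * (same ?p ?s + same ?q ?s + same ?r ?s) * (N ?p \<omega> * N ?q \<omega>)
       + same ?p ?q * (same ?p ?s + same ?q ?s + same ?r ?s) * (N ?p \<omega> * N ?r \<omega>) + same ?p ?q * (same ?p ?r + same ?q ?r) * (N ?p \<omega> * N ?s \<omega>)
       - same ?p ?q * (same ?p ?r + same ?q ?r) * (same ?p ?s + same ?q ?s + same ?r ?s) * N ?p \<omega>)"
      by (rule fact_moment_expectation) (auto simp: cell_tuples_counts(4)[OF _ d] algebra_simps)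
    then show ?thesis by (simp add: F4_def m4_def m3_def m2_def m1_def)
  qed
qed

text \<open>Labels beyond the third entry repeat the last one, so that one definition serves the cumulants of
  orders two, three and four.\<close>

definition tuple :: "'p \<Rightarrow> 'p \<Rightarrow> 'p \<Rightarrow> 'p \<Rightarrow> nat \<Rightarrow> 'p" where
  "tuple p q r s j = (if j = 1 then p else if j = 2 then q else if j = 3 then r else s)"

definition k2 :: "'p \<Rightarrow> 'p \<Rightarrow> real" where "k2 p q = cumulant M \<Phi> 2 (\<lambda>j. A (tuple p q q q j))"
definition k3 :: "'p \<Rightarrow> 'p \<Rightarrow> 'p \<Rightarrow> real" where "k3 p q r = cumulant M \<Phi> 3 (\<lambda>j. A (tuple p q r r j))"
definition k4 :: "'p \<Rightarrow> 'p \<Rightarrow> 'p \<Rightarrow> 'p \<Rightarrow> real" where "k4 p q r s = cumulant M \<Phi> 4 (\<lambda>j. A (tuple p q r s j))"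

lemma k2_eq: "k2 p q = F2 p q - m1 p * m1 q"
  unfolding k2_def cumulant_eq_partition_sum partition_sum_2 by (simp add: fact_moments tuple_def)

lemma k3_eq: "k3 p q r = F3 p q r - m1 p * F2 q r - m1 q * F2 p r - m1 r * F2 p q + 2 * (m1 p * m1 q * m1 r)"
  unfolding k3_def cumulant_eq_partition_sum partition_sum_3 by (simp add: fact_moments tuple_def)

lemma k4_eq: "k4 p q r s = F4 p q r s - m1 p * F3 q r s - m1 q * F3 p r s - m1 r * F3 p q s - m1 s * F3 p q r
     - F2 p q * F2 r s - F2 p r * F2 q s - F2 p s * F2 q r
     + 2 * (F2 p q * m1 r * m1 s + F2 p r * m1 q * m1 s + F2 p s * m1 q * m1 r
        + F2 q r * m1 p * m1 s + F2 q s * m1 p * m1 r + F2 r s * m1 p * m1 q)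
     - 6 * (m1 p * m1 q * m1 r * m1 s)"
  unfolding k4_def cumulant_eq_partition_sum partition_sum_4 by (simp add: fact_moments tuple_def)

definition covar :: "'p \<Rightarrow> 'p \<Rightarrow> real" where "covar p q = m2 p q - m1 p * m1 q"

text \<open>The fourth joint cumulant of the counts, expanded into factorial cumulants: one term for each
  partition of the four positions, whose blocks of size at least two carry the factors \<open>same\<close>.\<close>

definition joint_cumulant :: "'p \<Rightarrow> 'p \<Rightarrow> 'p \<Rightarrow> 'p \<Rightarrow> real" where
  "joint_cumulant p q r s = k4 p q r s
      + (same p q * k3 p r s + same p r * k3 p q s + same p s * k3 p q r
         + same q r * k3 p q s + same q s * k3 p q r + same r s * k3 p q r)
      + (same p q * same r s * k2 p r + same p r * same q s * k2 p q + same p s * same q r * k2 p q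
         + same p q * same p r * k2 p s + same p q * same p s * k2 p r + same p r * same p s * k2 p q
         + same q r * same q s * k2 p q)
      + same p q * same p r * same p s * m1 p"

lemma expectation_centered_2: "expectation (\<lambda>\<omega>. (N p \<omega> - m1 p) * (N q \<omega> - m1 q)) = covar p q"
proof -
  have "expectation (\<lambda>\<omega>. (N p \<omega> - m1 p) * (N q \<omega> - m1 q))
    = expectation (\<lambda>\<omega>. N p \<omega> * N q \<omega> - m1 p * N q \<omega> - m1 q * N p \<omega> + m1 p * m1 q)"
    by (intro Bochner_Integration.integral_cong refl) (simp add: algebra_simps)
  also have "\<dots> = m2 p q - m1 p * expectation (N q) - m1 q * expectation (N p) + m1 p * m1 q"
    by (simp add: m2_def prob_space)
  finally show ?thesis by (simp add: covar_def m1_def)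
qed

text \<open>The fourth centered moment is expanded into moments; subtracting the three products of covariances
  leaves the joint cumulant by \<open>count_cumulant_identity\<close>.\<close>

lemma expectation_centered_4:
  "expectation (\<lambda>\<omega>. (N p \<omega> - m1 p) * (N q \<omega> - m1 q) * (N r \<omega> - m1 r) * (N s \<omega> - m1 s))
    = covar p q * covar r s + covar p r * covar q s + covar p s * covar q r + joint_cumulant p q r s"
proof -
  have "expectation (\<lambda>\<omega>. (N p \<omega> - m1 p) * (N q \<omega> - m1 q) * (N r \<omega> - m1 r) * (N s \<omega> - m1 s))
    = expectation (\<lambda>\<omega>. N p \<omega> * N q \<omega> * N r \<omega> * N s \<omega> - m1 p * (N q \<omega> * N r \<omega> * N s \<omega>) - m1 q * (N p \<omega> * N r \<omega> * N s \<omega>)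
      - m1 r * (N p \<omega> * N q \<omega> * N s \<omega>) - m1 s * (N p \<omega> * N q \<omega> * N r \<omega>)
      + m1 p * m1 q * (N r \<omega> * N s \<omega>) + m1 p * m1 r * (N q \<omega> * N s \<omega>) + m1 p * m1 s * (N q \<omega> * N r \<omega>)
      + m1 q * m1 r * (N p \<omega> * N s \<omega>) + m1 q * m1 s * (N p \<omega> * N r \<omega>) + m1 r * m1 s * (N p \<omega> * N q \<omega>)
      - m1 p * m1 q * m1 r * N s \<omega> - m1 p * m1 q * m1 s * N r \<omega> - m1 p * m1 r * m1 s * N q \<omega> - m1 q * m1 r * m1 s * N p \<omega>
      + m1 p * m1 q * m1 r * m1 s)"
    by (intro Bochner_Integration.integral_cong refl) (simp add: algebra_simps)
  also have "\<dots> = m4 p q r s - m1 p * m3 q r s - m1 q * m3 p r s - m1 r * m3 p q s - m1 s * m3 p q r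
      + m1 p * m1 q * m2 r s + m1 p * m1 r * m2 q s + m1 p * m1 s * m2 q r
      + m1 q * m1 r * m2 p s + m1 q * m1 s * m2 p r + m1 r * m1 s * m2 p q
      - m1 p * m1 q * m1 r * m1 s - m1 p * m1 q * m1 s * m1 r - m1 p * m1 r * m1 s * m1 q - m1 q * m1 r * m1 s * m1 p
      + m1 p * m1 q * m1 r * m1 s"
    unfolding m4_def m3_def m2_def by (simp add: prob_space flip: m1_def)
  also have "\<dots> = (m4 p q r s - m1 p * m3 q r s - m1 q * m3 p r s - m1 r * m3 p q s - m1 s * m3 p q r
      + m1 p * m1 q * m2 r s + m1 p * m1 r * m2 q s + m1 p * m1 s * m2 q r
      + m1 q * m1 r * m2 p s + m1 q * m1 s * m2 p r + m1 r * m1 s * m2 p q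
      - 3 * (m1 p * m1 q * m1 r * m1 s)
      - covar p q * covar r s - covar p r * covar q s - covar p s * covar q r)
      + (covar p q * covar r s + covar p r * covar q s + covar p s * covar q r)"
    by (simp add: algebra_simps)
  also have "(m4 p q r s - m1 p * m3 q r s - m1 q * m3 p r s - m1 r * m3 p q s - m1 s * m3 p q r
      + m1 p * m1 q * m2 r s + m1 p * m1 r * m2 q s + m1 p * m1 s * m2 q r
      + m1 q * m1 r * m2 p s + m1 q * m1 s * m2 p r + m1 r * m1 s * m2 p q
      - 3 * (m1 p * m1 q * m1 r * m1 s)
      - covar p q * covar r s - covar p r * covar q s - covar p s * covar q r) = joint_cumulant p q r s"
    unfolding joint_cumulant_def covar_def k4_eq k3_eq k2_eq F4_def F3_def F2_def
    by (rule count_cumulant_identity) (auto simp: m2_def m3_def m4_def mult_ac)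
  finally show ?thesis by simp
qed

end

context cell_partition
begin

subsection \<open>Total variation\<close>

definition shifted_cells :: "nat \<Rightarrow> (nat \<Rightarrow> 'p) \<Rightarrow> real ^ 'n \<Rightarrow> (nat \<Rightarrow> real ^ 'n) set" where
  "shifted_cells m l x = (\<Pi>\<^sub>E j\<in>{1..<m}. (\<lambda>a. a - x) ` A (l j))"

lemma shifted_cells_bounded_borel: "shifted_cells m l x \<in> bounded_borel m"
proof -
  obtain \<rho> where "\<forall>x\<in>W. norm x \<le> \<rho>" using W(2) by (auto simp: bounded_iff)
  then have \<rho>: "W \<subseteq> cball 0 \<rho>" by auto
  have img: "(\<lambda>a. a - x) ` B = (\<lambda>a. a + x) -` B" for B by force
  have "(\<lambda>a. a - x) ` A p \<in> sets borel" for p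
    unfolding img using measurable_sets_borel[of "\<lambda>a. a + x" borel "A p"] A(1) by simp
  then have "shifted_cells m l x \<in> sets (PiM {1..<m} (\<lambda>_. borel))"
    unfolding shifted_cells_def by (intro sets_PiM_I_finite) auto
  moreover have "(\<lambda>a. a - x) ` A p \<subseteq> cball 0 (\<rho> + norm x)" for p
    using A(2)[of p] \<rho> by (auto simp: subset_eq intro!: norm_triangle_le_diff)
  then have "shifted_cells m l x \<subseteq> ({1..<m} \<rightarrow>\<^sub>E cball 0 (\<rho> + norm x))"
    unfolding shifted_cells_def by (intro PiE_mono) auto
  ultimately show ?thesis unfolding bounded_borel_def by blast
qed

lemma gamma_empty:
  assumes "m \<in> {2, 3, 4}" shows "\<gamma> m {} = 0"
proof -
  have b: "{} \<in> bounded_borel m" by (auto simp: bounded_borel_def)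
  have "signed_measure m (\<gamma> m)" using cumulants[OF assms] by (simp add: has_reduced_cumulant_def)
  then have "(\<lambda>i::nat. \<gamma> m {}) sums \<gamma> m {}"
    unfolding signed_measure_def using b
    by (elim allE[of _ "\<lambda>_. {}"]) (auto simp: disjoint_family_on_def)
  then have "(\<lambda>i::nat. \<gamma> m {}) \<longlonglongrightarrow> 0" by (intro summable_LIMSEQ_zero) (auto simp: sums_iff)
  then show ?thesis by (simp add: LIMSEQ_const_iff)
qed

text \<open>A cumulant on cells is an integral, over the last cell, of the reduced cumulant of a shifted product.
  For a fixed last point \<open>x\<close> the products belonging to different labels are disjoint, so the sum of the
  integrands is at most the total variation, and \<open>x\<close> ranges over \<open>W\<close> only.\<close>

lemma sum_cumulant_le:
  assumes m: "m \<in> {2, 3, 4}" and K: "finite K"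
    and inj: "\<And>l l'. l \<in> K \<Longrightarrow> l' \<in> K \<Longrightarrow> (\<And>j. j \<in> {1..m} \<Longrightarrow> l j = l' j) \<Longrightarrow> l = l'"
  shows "(\<Sum>l\<in>K. ennreal \<bar>cumulant M \<Phi> m (\<lambda>j. A (l j))\<bar>) \<le> total_variation m (\<gamma> m) * emeasure lborel W"
proof -
  let ?B = "shifted_cells m"
  let ?h = "\<lambda>l x. indicator (A (l m)) x *\<^sub>R \<gamma> m (?B l x)"
  \<comment> \<open>The value \<open>0\<close> for a non-integrable integrand agrees with the value of its integral.\<close>
  define \<phi> where "\<phi> l = (\<lambda>x. if integrable lborel (?h l) then ennreal \<bar>?h l x\<bar> else 0)" for l
  have \<phi>_meas [measurable]: "\<phi> l \<in> borel_measurable lborel" for l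
    unfolding \<phi>_def by (cases "integrable lborel (?h l)") (auto dest: borel_measurable_integrable)
  have le: "ennreal \<bar>cumulant M \<Phi> m (\<lambda>j. A (l j))\<bar> \<le> (\<integral>\<^sup>+x. \<phi> l x \<partial>lborel)" for l
  proof -
    have "cumulant M \<Phi> m (\<lambda>j. A (l j)) = (LINT x|lborel. ?h l x)"
      using cumulants[OF m] A(1) unfolding has_reduced_cumulant_def shifted_cells_def set_lebesgue_integral_def
      by (elim conjE allE[of _ "\<lambda>j. A (l j)"]) simp
    then show ?thesis
      using integral_norm_bound_ennreal[of lborel "?h l"]
      by (cases "integrable lborel (?h l)") (auto simp: \<phi>_def not_integrable_integral_eq)
  qed
  have pt: "(\<Sum>l\<in>K. \<phi> l x) \<le> total_variation m (\<gamma> m) * indicator W x" for x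
  proof (cases "x \<in> W")
    case False
    then have "\<phi> l x = 0" for l using A(2)[of "l m"] by (auto simp: \<phi>_def indicator_def)
    then show ?thesis by simp
  next
    case True
    let ?K = "{l \<in> K. x \<in> A (l m) \<and> ?B l x \<noteq> {}}"
    have dj: "?B l x \<inter> ?B l' x = {}" if "l \<in> ?K" "l' \<in> ?K" "l \<noteq> l'" for l l'
    proof -
      have "\<not> (\<forall>j\<in>{1..m}. l j = l' j)"
      proof
        assume "\<forall>j\<in>{1..m}. l j = l' j"
        then have "l = l'" using that by (intro inj) auto
        with that(3) show False ..
      qed
      then obtain j where j: "j \<in> {1..m}" "l j \<noteq> l' j" by blast
      have "l m = l' m" using that disjoint[of "l m" "l' m"] by auto
      then have jm: "j \<in> {1..<m}" using j by (cases "j = m") auto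
      have dA: "(\<lambda>a. a - x) ` A (l j) \<inter> (\<lambda>a. a - x) ` A (l' j) = {}" using disjoint[OF j(2)] by auto
      have mem: "z j \<in> (\<lambda>a. a - x) ` A (k j)" if "z \<in> ?B k x" for z k
        using that jm unfolding shifted_cells_def by (rule PiE_mem)
      show ?thesis
      proof (rule equals0I)
        fix z assume "z \<in> ?B l x \<inter> ?B l' x"
        then have "z j \<in> (\<lambda>a. a - x) ` A (l j) \<inter> (\<lambda>a. a - x) ` A (l' j)" using mem[of z l] mem[of z l'] by simp
        then show False unfolding dA by simp
      qed
    qed
    have injB: "inj_on (\<lambda>l. ?B l x) ?K"
    proof (rule inj_onI, rule ccontr)
      fix l l' assume l: "l \<in> ?K" "l' \<in> ?K" "?B l x = ?B l' x" "l \<noteq> l'"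
      then have "?B l x = {}" using dj[OF l(1,2,4)] by simp
      then show False using l(1) by simp
    qed
    have "(\<Sum>l\<in>K. \<phi> l x) \<le> (\<Sum>l\<in>K. if l \<in> ?K then ennreal \<bar>\<gamma> m (?B l x)\<bar> else 0)"
      by (rule sum_mono) (auto simp: \<phi>_def indicator_def gamma_empty[OF m])
    also have "\<dots> = (\<Sum>l\<in>?K. ennreal \<bar>\<gamma> m (?B l x)\<bar>)" using K by (simp add: sum.If_cases Int_def conj_commute)
    also have "\<dots> = (\<Sum>B\<in>(\<lambda>l. ?B l x) ` ?K. ennreal \<bar>\<gamma> m B\<bar>)" by (simp add: sum.reindex[OF injB])
    also have "\<dots> \<le> total_variation m (\<gamma> m)" unfolding total_variation_def
    proof (rule SUP_upper, safe)
      show "disjoint ((\<lambda>l. ?B l x) ` ?K)" using dj by (auto simp: disjoint_def)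
    qed (use K shifted_cells_bounded_borel in auto)
    finally show ?thesis using True by simp
  qed
  have "(\<Sum>l\<in>K. ennreal \<bar>cumulant M \<Phi> m (\<lambda>j. A (l j))\<bar>) \<le> (\<Sum>l\<in>K. \<integral>\<^sup>+x. \<phi> l x \<partial>lborel)"
    by (intro sum_mono le)
  also have "\<dots> = (\<integral>\<^sup>+x. (\<Sum>l\<in>K. \<phi> l x) \<partial>lborel)" by (rule nn_integral_sum[symmetric]) simp
  also have "\<dots> \<le> (\<integral>\<^sup>+x. total_variation m (\<gamma> m) * indicator W x \<partial>lborel)" by (intro nn_integral_mono pt)
  also have "\<dots> = total_variation m (\<gamma> m) * emeasure lborel W" using W(1) by (simp add: nn_integral_cmult_indicator)
  finally show ?thesis .
qed

abbreviation vol :: real where "vol \<equiv> measure lborel W"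

lemma vol_finite: "emeasure lborel W < \<infinity>"
  using emeasure_bounded_finite[OF W(2)] .

lemma sum_cumulant_le_real:
  assumes m: "m \<in> {2, 3, 4}" and K: "finite K"
    and inj: "\<And>l l'. l \<in> K \<Longrightarrow> l' \<in> K \<Longrightarrow> (\<And>j. j \<in> {1..m} \<Longrightarrow> l j = l' j) \<Longrightarrow> l = l'"
    and fin: "total_variation m (\<gamma> m) < \<infinity>"
  shows "(\<Sum>l\<in>K. \<bar>cumulant M \<Phi> m (\<lambda>j. A (l j))\<bar>) \<le> tv m * vol"
proof -
  have "ennreal (\<Sum>l\<in>K. \<bar>cumulant M \<Phi> m (\<lambda>j. A (l j))\<bar>) = (\<Sum>l\<in>K. ennreal \<bar>cumulant M \<Phi> m (\<lambda>j. A (l j))\<bar>)"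
    by (simp add: sum_ennreal)
  also have "\<dots> \<le> total_variation m (\<gamma> m) * emeasure lborel W" by (rule sum_cumulant_le[OF m K inj])
  also have "\<dots> = ennreal (tv m * vol)"
    using fin vol_finite by (simp add: tv_def ennreal_mult ennreal_enn2real emeasure_eq_ennreal_measure less_top)
  finally show ?thesis by (simp add: tv_def)
qed

lemma sum_k2_le:
  assumes "finite P" "total_variation 2 (\<gamma> 2) < \<infinity>"
  shows "(\<Sum>p\<in>P. \<Sum>q\<in>P. \<bar>k2 p q\<bar>) \<le> tv 2 * vol"
proof -
  let ?f = "\<lambda>(p, q). tuple p q q q"
  have inj: "inj_on ?f (P \<times> P)"
  proof (rule inj_onI, clarsimp)
    fix p q p' q' assume *: "tuple p q q q = tuple p' q' q' q'"
    show "p = p' \<and> q = q'" using fun_cong[OF *, of 1] fun_cong[OF *, of 2] by (simp add: tuple_def)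
  qed
  have "(\<Sum>p\<in>P. \<Sum>q\<in>P. \<bar>k2 p q\<bar>) = (\<Sum>l\<in>?f ` (P \<times> P). \<bar>cumulant M \<Phi> 2 (\<lambda>j. A (l j))\<bar>)"
    unfolding sum.reindex[OF inj] by (simp add: k2_def sum.cartesian_product split_def)
  also have "\<dots> \<le> tv 2 * vol"
  proof (rule sum_cumulant_le_real)
    fix l l' assume l: "l \<in> ?f ` (P \<times> P)" "l' \<in> ?f ` (P \<times> P)" and eq: "\<And>j. j \<in> {1..2} \<Longrightarrow> l j = l' j"
    have "l 1 = l' 1" "l 2 = l' 2" by (auto intro: eq)
    then show "l = l'" using l by (auto simp: tuple_def fun_eq_iff)
  qed (use assms in auto)
  finally show ?thesis .
qed

lemma sum_k3_le:
  assumes "finite P" "total_variation 3 (\<gamma> 3) < \<infinity>"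
  shows "(\<Sum>p\<in>P. \<Sum>q\<in>P. \<Sum>r\<in>P. \<bar>k3 p q r\<bar>) \<le> tv 3 * vol"
proof -
  let ?f = "\<lambda>(p, q, r). tuple p q r r"
  have inj: "inj_on ?f (P \<times> P \<times> P)"
  proof (rule inj_onI, clarsimp)
    fix p q r p' q' r' assume *: "tuple p q r r = tuple p' q' r' r'"
    show "p = p' \<and> q = q' \<and> r = r'" using fun_cong[OF *, of 1] fun_cong[OF *, of 2] fun_cong[OF *, of 3] by (simp add: tuple_def)
  qed
  have "(\<Sum>p\<in>P. \<Sum>q\<in>P. \<Sum>r\<in>P. \<bar>k3 p q r\<bar>) = (\<Sum>l\<in>?f ` (P \<times> P \<times> P). \<bar>cumulant M \<Phi> 3 (\<lambda>j. A (l j))\<bar>)"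
    unfolding sum.reindex[OF inj] by (simp add: k3_def sum.cartesian_product split_def)
  also have "\<dots> \<le> tv 3 * vol"
  proof (rule sum_cumulant_le_real)
    fix l l' assume l: "l \<in> ?f ` (P \<times> P \<times> P)" "l' \<in> ?f ` (P \<times> P \<times> P)" and eq: "\<And>j. j \<in> {1..3} \<Longrightarrow> l j = l' j"
    have "l 1 = l' 1" "l 2 = l' 2" "l 3 = l' 3" by (auto intro: eq)
    then show "l = l'" using l by (auto simp: tuple_def fun_eq_iff)
  qed (use assms in auto)
  finally show ?thesis .
qed

lemma sum_k4_le:
  assumes "finite P" "total_variation 4 (\<gamma> 4) < \<infinity>"
  shows "(\<Sum>p\<in>P. \<Sum>q\<in>P. \<Sum>r\<in>P. \<Sum>s\<in>P. \<bar>k4 p q r s\<bar>) \<le> tv 4 * vol"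
proof -
  let ?f = "\<lambda>(p, q, r, s). tuple p q r s"
  have inj: "inj_on ?f (P \<times> P \<times> P \<times> P)"
  proof (rule inj_onI, clarsimp)
    fix p q r s p' q' r' s' assume *: "tuple p q r s = tuple p' q' r' s'"
    show "p = p' \<and> q = q' \<and> r = r' \<and> s = s'"
      using fun_cong[OF *, of 1] fun_cong[OF *, of 2] fun_cong[OF *, of 3] fun_cong[OF *, of 4] by (simp add: tuple_def)
  qed
  have "(\<Sum>p\<in>P. \<Sum>q\<in>P. \<Sum>r\<in>P. \<Sum>s\<in>P. \<bar>k4 p q r s\<bar>) = (\<Sum>l\<in>?f ` (P \<times> P \<times> P \<times> P). \<bar>cumulant M \<Phi> 4 (\<lambda>j. A (l j))\<bar>)"
    unfolding sum.reindex[OF inj] by (simp add: k4_def sum.cartesian_product split_def)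
  also have "\<dots> \<le> tv 4 * vol"
  proof (rule sum_cumulant_le_real)
    fix l l' assume l: "l \<in> ?f ` (P \<times> P \<times> P \<times> P)" "l' \<in> ?f ` (P \<times> P \<times> P \<times> P)" and eq: "\<And>j. j \<in> {1..4} \<Longrightarrow> l j = l' j"
    have "l 1 = l' 1" "l 2 = l' 2" "l 3 = l' 3" "l 4 = l' 4" by (auto intro: eq)
    then show "l = l'" using l by (auto simp: tuple_def fun_eq_iff)
  qed (use assms in auto)
  finally show ?thesis .
qed

lemma sum_m1_le:
  assumes "finite P" shows "(\<Sum>p\<in>P. m1 p) \<le> vol"
proof -
  have "emeasure lborel (A p) \<noteq> \<infinity>" for p
    using emeasure_bounded_finite[OF bounded_A, of p] by simp
  then have "(\<Sum>p\<in>P. m1 p) = measure lborel (\<Union>p\<in>P. A p)"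
    unfolding m1_eq using assms A(1) disjoint
    by (intro measure_finite_Union[symmetric]) (auto simp: disjoint_family_on_def)
  also have "\<dots> \<le> vol"
  proof (rule measure_mono_fmeasurable)
    show "(\<Union>p\<in>P. A p) \<subseteq> W" using A(2) by blast
    show "(\<Union>p\<in>P. A p) \<in> sets lborel" using assms A(1) by (auto intro!: sets.finite_UN)
    show "W \<in> fmeasurable lborel" using vol_finite W(1) by (simp add: fmeasurable_def)
  qed
  finally show ?thesis .
qed

lemma sum_same: "finite P \<Longrightarrow> p \<in> P \<Longrightarrow> (\<Sum>q\<in>P. same p q * f q) = f p" "finite P \<Longrightarrow> p \<in> P \<Longrightarrow> (\<Sum>q\<in>P. same q p * f q) = f p"
  for f :: "'p \<Rightarrow> real"
  by (simp_all add: same_def of_bool_def if_distrib[of "\<lambda>x. x * _"] cong: if_cong)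

text \<open>Every factor \<open>same\<close> collapses one of the four sums. The coefficients of \<open>cumulant_mass\<close> count
  partitions of four positions: six into three blocks, seven into two blocks (three of type 2+2 and
  four of type 3+1), and one into a single block, whose contribution is the mean number of points.\<close>

lemma sum_joint_cumulant_le:
  assumes P: "finite P" and fin: "gamma4_red \<gamma> < \<infinity>"
  shows "(\<Sum>p\<in>P. \<Sum>q\<in>P. \<Sum>r\<in>P. \<Sum>s\<in>P. \<bar>joint_cumulant p q r s\<bar>) \<le> cumulant_mass * vol"
proof -
  have f: "total_variation 2 (\<gamma> 2) < \<infinity>" "total_variation 3 (\<gamma> 3) < \<infinity>" "total_variation 4 (\<gamma> 4) < \<infinity>"
    using fin by (auto simp: gamma4_red_def ennreal_mult_less_top)
  have s: "same p q = \<bar>same p q\<bar>" for p q :: 'p by (simp add: same_def)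
  let ?b = "\<lambda>p q r s. \<bar>k4 p q r s\<bar>
      + same p q * \<bar>k3 p r s\<bar> + same p r * \<bar>k3 p q s\<bar> + same p s * \<bar>k3 p q r\<bar>
         + same q r * \<bar>k3 p q s\<bar> + same q s * \<bar>k3 p q r\<bar> + same r s * \<bar>k3 p q r\<bar>
      + same r s * (same p q * \<bar>k2 p r\<bar>) + same q s * (same p r * \<bar>k2 p q\<bar>) + same p s * (same q r * \<bar>k2 p q\<bar>)
         + same p r * (same p q * \<bar>k2 p s\<bar>) + same p s * (same p q * \<bar>k2 p r\<bar>) + same p s * (same p r * \<bar>k2 p q\<bar>)
         + same q s * (same q r * \<bar>k2 p q\<bar>)
      + same p s * (same p r * (same p q * m1 p))"
  have m1: "0 \<le> m1 p" for p by (simp add: m1_eq)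
  have tri: "\<bar>joint_cumulant p q r s\<bar> \<le> ?b p q r s" for p q r s
    unfolding joint_cumulant_def same_def using m1[of p]
    by (cases "p = q"; cases "p = r"; cases "p = s"; cases "q = r"; cases "q = s"; cases "r = s"; simp)
  have "(\<Sum>p\<in>P. \<Sum>q\<in>P. \<Sum>r\<in>P. \<Sum>s\<in>P. \<bar>joint_cumulant p q r s\<bar>) \<le> (\<Sum>p\<in>P. \<Sum>q\<in>P. \<Sum>r\<in>P. \<Sum>s\<in>P. ?b p q r s)"
    by (intro sum_mono tri)
  also have "\<dots> = (\<Sum>p\<in>P. \<Sum>q\<in>P. \<Sum>r\<in>P. \<Sum>s\<in>P. \<bar>k4 p q r s\<bar>) + 6 * (\<Sum>p\<in>P. \<Sum>q\<in>P. \<Sum>r\<in>P. \<bar>k3 p q r\<bar>)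
      + 7 * (\<Sum>p\<in>P. \<Sum>q\<in>P. \<bar>k2 p q\<bar>) + (\<Sum>p\<in>P. m1 p)"
  proof -
    have c: "(\<Sum>s\<in>P. same p s * h) = h" if "p \<in> P" for p and h :: real
      by (rule sum_same(1)[OF P that])
    have b: "(\<Sum>r\<in>P. \<Sum>s\<in>P. same p r * h s) = (\<Sum>s\<in>P. h s)" if "p \<in> P" for p and h :: "'p \<Rightarrow> real"
      using sum_same(1)[OF P that, of "\<lambda>_. \<Sum>s\<in>P. h s"] by (simp only: sum_distrib_left)
    have a: "(\<Sum>q\<in>P. \<Sum>r\<in>P. \<Sum>s\<in>P. same p q * h r s) = (\<Sum>r\<in>P. \<Sum>s\<in>P. h r s)" if "p \<in> P" for p and h :: "'p \<Rightarrow> 'p \<Rightarrow> real"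
      using sum_same(1)[OF P that, of "\<lambda>_. \<Sum>r\<in>P. \<Sum>s\<in>P. h r s"] by (simp only: sum_distrib_left)
    have 3: "(\<Sum>p\<in>P. \<Sum>q\<in>P. \<Sum>r\<in>P. \<Sum>s\<in>P. same p q * f p r s) = (\<Sum>p\<in>P. \<Sum>q\<in>P. \<Sum>r\<in>P. f p q r)"
      "(\<Sum>p\<in>P. \<Sum>q\<in>P. \<Sum>r\<in>P. \<Sum>s\<in>P. same p r * f p q s) = (\<Sum>p\<in>P. \<Sum>q\<in>P. \<Sum>r\<in>P. f p q r)"
      "(\<Sum>p\<in>P. \<Sum>q\<in>P. \<Sum>r\<in>P. \<Sum>s\<in>P. same p s * f p q r) = (\<Sum>p\<in>P. \<Sum>q\<in>P. \<Sum>r\<in>P. f p q r)"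
      "(\<Sum>p\<in>P. \<Sum>q\<in>P. \<Sum>r\<in>P. \<Sum>s\<in>P. same q r * f p q s) = (\<Sum>p\<in>P. \<Sum>q\<in>P. \<Sum>r\<in>P. f p q r)"
      "(\<Sum>p\<in>P. \<Sum>q\<in>P. \<Sum>r\<in>P. \<Sum>s\<in>P. same q s * f p q r) = (\<Sum>p\<in>P. \<Sum>q\<in>P. \<Sum>r\<in>P. f p q r)"
      "(\<Sum>p\<in>P. \<Sum>q\<in>P. \<Sum>r\<in>P. \<Sum>s\<in>P. same r s * f p q r) = (\<Sum>p\<in>P. \<Sum>q\<in>P. \<Sum>r\<in>P. f p q r)"
      for f :: "'p \<Rightarrow> 'p \<Rightarrow> 'p \<Rightarrow> real"
      by (simp_all only: a b c cong: sum.cong)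
    have 2: "(\<Sum>p\<in>P. \<Sum>q\<in>P. \<Sum>r\<in>P. \<Sum>s\<in>P. same r s * (same p q * f p r)) = (\<Sum>p\<in>P. \<Sum>q\<in>P. f p q)"
      "(\<Sum>p\<in>P. \<Sum>q\<in>P. \<Sum>r\<in>P. \<Sum>s\<in>P. same q s * (same p r * f p q)) = (\<Sum>p\<in>P. \<Sum>q\<in>P. f p q)"
      "(\<Sum>p\<in>P. \<Sum>q\<in>P. \<Sum>r\<in>P. \<Sum>s\<in>P. same p s * (same q r * f p q)) = (\<Sum>p\<in>P. \<Sum>q\<in>P. f p q)"
      "(\<Sum>p\<in>P. \<Sum>q\<in>P. \<Sum>r\<in>P. \<Sum>s\<in>P. same p r * (same p q * f p s)) = (\<Sum>p\<in>P. \<Sum>q\<in>P. f p q)"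
      "(\<Sum>p\<in>P. \<Sum>q\<in>P. \<Sum>r\<in>P. \<Sum>s\<in>P. same p s * (same p q * f p r)) = (\<Sum>p\<in>P. \<Sum>q\<in>P. f p q)"
      "(\<Sum>p\<in>P. \<Sum>q\<in>P. \<Sum>r\<in>P. \<Sum>s\<in>P. same p s * (same p r * f p q)) = (\<Sum>p\<in>P. \<Sum>q\<in>P. f p q)"
      "(\<Sum>p\<in>P. \<Sum>q\<in>P. \<Sum>r\<in>P. \<Sum>s\<in>P. same q s * (same q r * f p q)) = (\<Sum>p\<in>P. \<Sum>q\<in>P. f p q)"
      for f :: "'p \<Rightarrow> 'p \<Rightarrow> real"
      by (simp_all only: a b c cong: sum.cong)
    have 1: "(\<Sum>p\<in>P. \<Sum>q\<in>P. \<Sum>r\<in>P. \<Sum>s\<in>P. same p s * (same p r * (same p q * f p))) = (\<Sum>p\<in>P. f p)"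
      for f :: "'p \<Rightarrow> real"
      by (simp only: a b c cong: sum.cong)
    show ?thesis unfolding sum.distrib 1 2 3 by simp
  qed
  also have "\<dots> \<le> tv 4 * vol + 6 * (tv 3 * vol) + 7 * (tv 2 * vol) + vol"
    using sum_k4_le[OF P f(3)] sum_k3_le[OF P f(2)] sum_k2_le[OF P f(1)] sum_m1_le[OF P] by linarith
  finally show ?thesis by (simp add: cumulant_mass_def algebra_simps)
qed

end

section \<open>The covariance form\<close>

definition sq_int :: "('a::euclidean_space \<Rightarrow> complex) \<Rightarrow> bool" where
  "sq_int u \<longleftrightarrow> u \<in> borel_measurable borel \<and> integrable lborel (\<lambda>x. (cmod (u x))\<^sup>2)"

definition l2 :: "('a::euclidean_space \<Rightarrow> complex) \<Rightarrow> real" where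
  "l2 u = sqrt (LINT x|lborel. (cmod (u x))\<^sup>2)"

text \<open>The covariance of the sums of \<open>u\<close> and of \<open>v\<close> over a process of intensity one whose pair correlation is
  \<open>1 + q\<close>; the first integral comes from the pairs of equal points.\<close>

definition corr_form :: "('a::euclidean_space \<Rightarrow> real) \<Rightarrow> ('a \<Rightarrow> complex) \<Rightarrow> ('a \<Rightarrow> complex) \<Rightarrow> complex" where
  "corr_form q u v = (LINT x|lborel. u x * v x)
     + (LINT z|(lborel \<Otimes>\<^sub>M lborel). of_real (q (fst z - snd z)) * (u (fst z) * v (snd z)))"

lemma l2_nonneg [simp]: "0 \<le> l2 u" by (simp add: l2_def)

lemma l2_square: "(l2 u)\<^sup>2 = (LINT x|lborel. (cmod (u x))\<^sup>2)"
  unfolding l2_def by (simp add: integral_nonneg_AE)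

lemma nn_integral_sq_int: "sq_int u \<Longrightarrow> (\<integral>\<^sup>+x. ennreal ((cmod (u x))\<^sup>2) \<partial>lborel) = ennreal ((l2 u)\<^sup>2)"
  unfolding sq_int_def l2_square by (subst nn_integral_eq_integral) auto

lemma weighted_Young:
  fixes a b x y :: real
  assumes ab: "0 < a" "0 < b"
  shows "x * y \<le> b / (2 * a) * x\<^sup>2 + a / (2 * b) * y\<^sup>2"
proof -
  have "0 \<le> (b * x - a * y)\<^sup>2" by simp
  then have "2 * a * b * (x * y) \<le> b\<^sup>2 * x\<^sup>2 + a\<^sup>2 * y\<^sup>2"
    by (simp add: power2_diff power_mult_distrib mult_ac)
  then have "x * y \<le> (b\<^sup>2 * x\<^sup>2 + a\<^sup>2 * y\<^sup>2) / (2 * a * b)"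
    using ab by (simp add: pos_le_divide_eq mult_ac)
  also have "\<dots> = b / (2 * a) * x\<^sup>2 + a / (2 * b) * y\<^sup>2"
    using ab by (simp add: power2_eq_square field_simps)
  finally show ?thesis .
qed

text \<open>The inequality between means is used with the weights that balance \<open>l2 u\<close> and \<open>l2 v\<close>; both norms are
  raised by \<open>e > 0\<close> so that the weights make sense when a norm vanishes.\<close>

lemma Cauchy_Schwarz_nn_integral_l2:
  assumes u: "sq_int u" and v: "sq_int v"
  shows "(\<integral>\<^sup>+x. ennreal (cmod (u x) * cmod (v x)) \<partial>lborel) \<le> ennreal (l2 u * l2 v)"
proof -
  have [measurable]: "u \<in> borel_measurable borel" "v \<in> borel_measurable borel"
    using u v by (auto simp: sq_int_def)
  have balanced: "b / (2 * a) * a\<^sup>2 + a / (2 * b) * b\<^sup>2 = a * b" if "0 < a" "0 < b" for a b :: real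
    using that by (simp add: power2_eq_square)
  have le: "(\<integral>\<^sup>+x. ennreal (cmod (u x) * cmod (v x)) \<partial>lborel) \<le> ennreal ((l2 u + e) * (l2 v + e))" if "0 < e" for e
  proof -
    let ?a = "l2 u + e" and ?b = "l2 v + e"
    have ab: "0 < ?a" "0 < ?b" using that by (auto intro: add_nonneg_pos)
    have "x * y \<le> ?b / (2 * ?a) * x\<^sup>2 + ?a / (2 * ?b) * y\<^sup>2" for x y :: real
      using weighted_Young[OF ab] .
    then have "(\<integral>\<^sup>+x. ennreal (cmod (u x) * cmod (v x)) \<partial>lborel)
      \<le> (\<integral>\<^sup>+x. ennreal (?b / (2 * ?a)) * ennreal ((cmod (u x))\<^sup>2) + ennreal (?a / (2 * ?b)) * ennreal ((cmod (v x))\<^sup>2) \<partial>lborel)"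
      using ab by (intro nn_integral_mono) (simp add: ennreal_mult[symmetric] flip: ennreal_plus)
    also have "\<dots> = ennreal (?b / (2 * ?a)) * ennreal ((l2 u)\<^sup>2) + ennreal (?a / (2 * ?b)) * ennreal ((l2 v)\<^sup>2)"
      by (subst nn_integral_add) (simp_all add: nn_integral_cmult nn_integral_sq_int[OF u] nn_integral_sq_int[OF v])
    also have "\<dots> = ennreal (?b / (2 * ?a) * (l2 u)\<^sup>2 + ?a / (2 * ?b) * (l2 v)\<^sup>2)"
      using ab by (simp add: ennreal_mult[symmetric] flip: ennreal_plus)
    also have "\<dots> \<le> ennreal (?b / (2 * ?a) * ?a\<^sup>2 + ?a / (2 * ?b) * ?b\<^sup>2)"
      using ab that by (intro ennreal_leI add_mono mult_left_mono power_mono) auto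
    also have "?b / (2 * ?a) * ?a\<^sup>2 + ?a / (2 * ?b) * ?b\<^sup>2 = ?a * ?b"
      by (rule balanced[OF ab])
    finally show ?thesis .
  qed
  have "((\<lambda>e. ennreal ((l2 u + e) * (l2 v + e))) \<longlongrightarrow> ennreal ((l2 u + 0) * (l2 v + 0))) (at_right 0)"
    by (intro tendsto_ennrealI tendsto_intros)
  moreover have "eventually (\<lambda>e. (\<integral>\<^sup>+x. ennreal (cmod (u x) * cmod (v x)) \<partial>lborel) \<le> ennreal ((l2 u + e) * (l2 v + e))) (at_right 0)"
    using eventually_at_right_less[of 0] by (rule eventually_mono) (rule le)
  ultimately show ?thesis
    using tendsto_lowerbound[of _ _ "at_right (0::real)"] by fastforce
qed

lemma nn_integral_difference_kernel:
  fixes Q a b :: "'a::euclidean_space \<Rightarrow> ennreal"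
  assumes [measurable]: "Q \<in> borel_measurable borel" "a \<in> borel_measurable borel" "b \<in> borel_measurable borel"
  shows "(\<integral>\<^sup>+z. Q (fst z - snd z) * (a (fst z) * b (snd z)) \<partial>(lborel \<Otimes>\<^sub>M lborel))
    = (\<integral>\<^sup>+w. Q w * (\<integral>\<^sup>+y. a (y + w) * b y \<partial>lborel) \<partial>lborel)"
proof -
  have "(\<integral>\<^sup>+z. Q (fst z - snd z) * (a (fst z) * b (snd z)) \<partial>(lborel \<Otimes>\<^sub>M lborel))
    = (\<integral>\<^sup>+y. \<integral>\<^sup>+x. Q (x - y) * (a x * b y) \<partial>lborel \<partial>lborel)"
    by (subst lborel_pair.nn_integral_snd[symmetric]) simp_all
  also have "\<dots> = (\<integral>\<^sup>+y. \<integral>\<^sup>+w. Q w * (a (y + w) * b y) \<partial>lborel \<partial>lborel)"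
  proof (rule nn_integral_cong)
    fix y :: 'a
    show "(\<integral>\<^sup>+x. Q (x - y) * (a x * b y) \<partial>lborel) = (\<integral>\<^sup>+w. Q w * (a (y + w) * b y) \<partial>lborel)"
      using nn_integral_lborel_translate[of "\<lambda>x. Q (x - y) * (a x * b y)" y] by (simp add: add.commute)
  qed
  also have "\<dots> = (\<integral>\<^sup>+w. \<integral>\<^sup>+y. Q w * (a (y + w) * b y) \<partial>lborel \<partial>lborel)"
    by (rule lborel_pair.Fubini') measurable
  also have "\<dots> = (\<integral>\<^sup>+w. Q w * (\<integral>\<^sup>+y. a (y + w) * b y \<partial>lborel) \<partial>lborel)"
    by (intro nn_integral_cong nn_integral_cmult) measurable
  finally show ?thesis .
qed

lemma sq_int_translate: "sq_int u \<Longrightarrow> sq_int (\<lambda>x. u (x + w))" "sq_int u \<Longrightarrow> l2 (\<lambda>x. u (x + w)) = l2 u"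
proof -
  assume u: "sq_int u"
  then have [measurable]: "u \<in> borel_measurable borel" by (simp add: sq_int_def)
  show "sq_int (\<lambda>x. u (x + w))"
    using u lborel_integral_affine(2)[of 1 "\<lambda>x. (cmod (u x))\<^sup>2" w] by (simp add: sq_int_def add.commute)
  show "l2 (\<lambda>x. u (x + w)) = l2 u"
    unfolding l2_def using lborel_integral_affine(1)[of 1 "\<lambda>x. (cmod (u x))\<^sup>2" w] by (simp add: add.commute)
qed

text \<open>Convolution with an integrable kernel is bounded on \<open>L\<^sup>2\<close>: for every shift \<open>w\<close> the inner integral
  is at most \<open>l2 u * l2 v\<close>, because translations preserve the norm.\<close>

lemma kernel_nn_bound:
  assumes q: "integrable lborel q" and u: "sq_int u" and v: "sq_int v"
  shows "(\<integral>\<^sup>+z. ennreal (cmod (of_real (q (fst z - snd z)) * (u (fst z) * v (snd z)))) \<partial>(lborel \<Otimes>\<^sub>M lborel))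
    \<le> ennreal ((LINT x|lborel. \<bar>q x\<bar>) * (l2 u * l2 v))"
proof -
  have [measurable]: "u \<in> borel_measurable borel" "v \<in> borel_measurable borel" "q \<in> borel_measurable borel"
    using u v borel_measurable_integrable[OF q] by (auto simp: sq_int_def)
  have "(\<integral>\<^sup>+z. ennreal (cmod (of_real (q (fst z - snd z)) * (u (fst z) * v (snd z)))) \<partial>(lborel \<Otimes>\<^sub>M lborel))
    = (\<integral>\<^sup>+z. ennreal \<bar>q (fst z - snd z)\<bar> * (ennreal (cmod (u (fst z))) * ennreal (cmod (v (snd z)))) \<partial>(lborel \<Otimes>\<^sub>M lborel))"
    by (intro nn_integral_cong) (simp add: norm_mult ennreal_mult)
  also have "\<dots> = (\<integral>\<^sup>+w. ennreal \<bar>q w\<bar> * (\<integral>\<^sup>+y. ennreal (cmod (u (y + w))) * ennreal (cmod (v y)) \<partial>lborel) \<partial>lborel)"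
    by (rule nn_integral_difference_kernel) measurable
  also have "\<dots> \<le> (\<integral>\<^sup>+w. ennreal \<bar>q w\<bar> * ennreal (l2 u * l2 v) \<partial>lborel)"
    using Cauchy_Schwarz_nn_integral_l2[OF sq_int_translate(1)[OF u] v]
    by (intro nn_integral_mono mult_left_mono) (simp_all add: sq_int_translate(2)[OF u] ennreal_mult)
  also have "\<dots> = (\<integral>\<^sup>+w. ennreal \<bar>q w\<bar> \<partial>lborel) * ennreal (l2 u * l2 v)"
    by (rule nn_integral_multc) measurable
  also have "(\<integral>\<^sup>+w. ennreal \<bar>q w\<bar> \<partial>lborel) = ennreal (LINT x|lborel. \<bar>q x\<bar>)"
    using q by (intro nn_integral_eq_integral) auto
  finally show ?thesis by (simp add: ennreal_mult)
qed

lemma integrable_mult_sq_int: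
  assumes u: "sq_int u" and v: "sq_int v"
  shows "integrable lborel (\<lambda>x. u x * v x)"
proof -
  have [measurable]: "u \<in> borel_measurable borel" "v \<in> borel_measurable borel"
    using u v by (auto simp: sq_int_def)
  show ?thesis
    using Cauchy_Schwarz_nn_integral_l2[OF u v]
    by (intro integrableI_bounded) (auto simp: norm_mult intro: le_less_trans)
qed

lemma integrable_kernel:
  assumes q: "integrable lborel q" and u: "sq_int u" and v: "sq_int v"
  shows "integrable (lborel \<Otimes>\<^sub>M lborel) (\<lambda>z. of_real (q (fst z - snd z)) * (u (fst z) * v (snd z)))"
proof -
  have [measurable]: "u \<in> borel_measurable borel" "v \<in> borel_measurable borel" "q \<in> borel_measurable borel"
    using u v borel_measurable_integrable[OF q] by (auto simp: sq_int_def)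
  show ?thesis
    using kernel_nn_bound[OF assms]
    by (intro integrableI_bounded) (auto intro: le_less_trans)
qed

lemma corr_form_bound:
  assumes q: "integrable lborel q" and u: "sq_int u" and v: "sq_int v"
  shows "cmod (corr_form q u v) \<le> (1 + (LINT x|lborel. \<bar>q x\<bar>)) * (l2 u * l2 v)"
proof -
  have "ennreal (cmod (LINT x|lborel. u x * v x)) \<le> (\<integral>\<^sup>+x. ennreal (cmod (u x) * cmod (v x)) \<partial>lborel)"
    using integral_norm_bound_ennreal[OF integrable_mult_sq_int[OF u v]] by (simp add: norm_mult)
  also note Cauchy_Schwarz_nn_integral_l2[OF u v]
  finally have 1: "cmod (LINT x|lborel. u x * v x) \<le> l2 u * l2 v"
    by (simp add: ennreal_le_iff)
  have "ennreal (cmod (LINT z|(lborel \<Otimes>\<^sub>M lborel). of_real (q (fst z - snd z)) * (u (fst z) * v (snd z))))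
      \<le> ennreal ((LINT x|lborel. \<bar>q x\<bar>) * (l2 u * l2 v))"
    by (rule order_trans[OF integral_norm_bound_ennreal[OF integrable_kernel[OF assms]] kernel_nn_bound[OF assms]])
  then have 2: "cmod (LINT z|(lborel \<Otimes>\<^sub>M lborel). of_real (q (fst z - snd z)) * (u (fst z) * v (snd z)))
      \<le> (LINT x|lborel. \<bar>q x\<bar>) * (l2 u * l2 v)"
    by (subst (asm) ennreal_le_iff) (auto intro!: mult_nonneg_nonneg integral_nonneg_AE)
  show ?thesis
    unfolding corr_form_def distrib_right mult_1 by (rule norm_triangle_le[OF add_mono[OF 1 2]])
qed

lemma sq_int_cmult: "sq_int u \<Longrightarrow> sq_int (\<lambda>x. c * u x)"
  by (auto simp: sq_int_def norm_mult power_mult_distrib)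

lemma sq_int_add: assumes "sq_int u" "sq_int v" shows "sq_int (\<lambda>x. u x + v x)"
proof -
  have [measurable]: "u \<in> borel_measurable borel" "v \<in> borel_measurable borel"
    using assms by (auto simp: sq_int_def)
  have "integrable lborel (\<lambda>x. (cmod (u x + v x))\<^sup>2)"
  proof (rule Bochner_Integration.integrable_bound[where f = "\<lambda>x. 2 * (cmod (u x))\<^sup>2 + 2 * (cmod (v x))\<^sup>2"])
    show "integrable lborel (\<lambda>x. 2 * (cmod (u x))\<^sup>2 + 2 * (cmod (v x))\<^sup>2)"
      using assms by (auto simp: sq_int_def)
    show "AE x in lborel. norm ((cmod (u x + v x))\<^sup>2) \<le> norm (2 * (cmod (u x))\<^sup>2 + 2 * (cmod (v x))\<^sup>2)"
    proof (rule AE_I2)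
      fix x
      have "(cmod (u x + v x))\<^sup>2 \<le> (cmod (u x) + cmod (v x))\<^sup>2" by (intro power_mono norm_triangle_ineq) simp
      also have "\<dots> \<le> 2 * (cmod (u x))\<^sup>2 + 2 * (cmod (v x))\<^sup>2"
        using sum_squares_bound[of "cmod (u x)" "cmod (v x)"] by (simp add: power2_sum)
      finally show "norm ((cmod (u x + v x))\<^sup>2) \<le> norm (2 * (cmod (u x))\<^sup>2 + 2 * (cmod (v x))\<^sup>2)" by simp
    qed
  qed simp
  then show ?thesis by (simp add: sq_int_def)
qed

lemma sq_int_sum: "finite J \<Longrightarrow> (\<And>j. j \<in> J \<Longrightarrow> sq_int (v j)) \<Longrightarrow> sq_int (\<lambda>x. \<Sum>j\<in>J. v j x)"
  by (induction J rule: finite_induct) (auto intro: sq_int_add, simp add: sq_int_def)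

lemma measurable_cnj [measurable]: "cnj \<in> borel_measurable borel"
  by (intro borel_measurable_continuous_onI continuous_intros)

lemma sq_int_cnj: "sq_int (\<lambda>x. cnj (u x)) \<longleftrightarrow> sq_int u" for u :: "'a::euclidean_space \<Rightarrow> complex"
proof -
  have imp: "(\<lambda>x. cnj (w x)) \<in> borel_measurable borel" if "w \<in> borel_measurable borel" for w :: "'a \<Rightarrow> complex"
    using measurable_compose[OF that measurable_cnj] .
  have "u \<in> borel_measurable borel" if "(\<lambda>x. cnj (u x)) \<in> borel_measurable borel"
    using imp[OF that] by (simp only: complex_cnj_cnj)
  then show ?thesis unfolding sq_int_def complex_mod_cnj using imp by blast
qed

lemma l2_cnj: "l2 (\<lambda>x. cnj (u x)) = l2 u" by (simp add: l2_def)

lemma corr_form_sum_right: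
  assumes q: "integrable lborel q" and u: "sq_int u" and J: "finite J" and v: "\<And>j. j \<in> J \<Longrightarrow> sq_int (v j)"
  shows "corr_form q u (\<lambda>x. \<Sum>j\<in>J. c j * v j x) = (\<Sum>j\<in>J. c j * corr_form q u (v j))"
proof -
  have "(LINT x|lborel. u x * (\<Sum>j\<in>J. c j * v j x)) = (LINT x|lborel. (\<Sum>j\<in>J. c j * (u x * v j x)))"
    by (simp add: sum_distrib_left mult_ac)
  also have "\<dots> = (\<Sum>j\<in>J. c j * (LINT x|lborel. u x * v j x))"
    by (simp add: integral_sum integrable_mult_sq_int[OF u v])
  finally have 1: "(LINT x|lborel. u x * (\<Sum>j\<in>J. c j * v j x)) = (\<Sum>j\<in>J. c j * (LINT x|lborel. u x * v j x))" .
  have "(LINT z|(lborel \<Otimes>\<^sub>M lborel). of_real (q (fst z - snd z)) * (u (fst z) * (\<Sum>j\<in>J. c j * v j (snd z))))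
    = (LINT z|(lborel \<Otimes>\<^sub>M lborel). (\<Sum>j\<in>J. c j * (of_real (q (fst z - snd z)) * (u (fst z) * v j (snd z)))))"
    by (simp add: sum_distrib_left mult_ac)
  also have "\<dots> = (\<Sum>j\<in>J. c j * (LINT z|(lborel \<Otimes>\<^sub>M lborel). of_real (q (fst z - snd z)) * (u (fst z) * v j (snd z))))"
    by (simp add: integral_sum integrable_kernel[OF q u v])
  finally show ?thesis
    unfolding corr_form_def 1 by (simp add: sum.distrib distrib_left)
qed

lemma corr_form_sum_left:
  assumes q: "integrable lborel q" and u: "sq_int u" and J: "finite J" and v: "\<And>j. j \<in> J \<Longrightarrow> sq_int (v j)"
  shows "corr_form q (\<lambda>x. \<Sum>j\<in>J. c j * v j x) u = (\<Sum>j\<in>J. c j * corr_form q (v j) u)"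
proof -
  have "(LINT x|lborel. (\<Sum>j\<in>J. c j * v j x) * u x) = (LINT x|lborel. (\<Sum>j\<in>J. c j * (v j x * u x)))"
    by (simp add: sum_distrib_right sum_distrib_left mult_ac)
  also have "\<dots> = (\<Sum>j\<in>J. c j * (LINT x|lborel. v j x * u x))"
    by (simp add: integral_sum integrable_mult_sq_int[OF v u])
  finally have 1: "(LINT x|lborel. (\<Sum>j\<in>J. c j * v j x) * u x) = (\<Sum>j\<in>J. c j * (LINT x|lborel. v j x * u x))" .
  have "(LINT z|(lborel \<Otimes>\<^sub>M lborel). of_real (q (fst z - snd z)) * ((\<Sum>j\<in>J. c j * v j (fst z)) * u (snd z)))
    = (LINT z|(lborel \<Otimes>\<^sub>M lborel). (\<Sum>j\<in>J. c j * (of_real (q (fst z - snd z)) * (v j (fst z) * u (snd z)))))"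
    by (simp add: sum_distrib_right sum_distrib_left mult_ac)
  also have "\<dots> = (\<Sum>j\<in>J. c j * (LINT z|(lborel \<Otimes>\<^sub>M lborel). of_real (q (fst z - snd z)) * (v j (fst z) * u (snd z))))"
    by (simp add: integral_sum integrable_kernel[OF q v u])
  finally show ?thesis
    unfolding corr_form_def 1 by (simp add: sum.distrib distrib_left)
qed

text \<open>Duality: the conjugates of the values themselves are used as coefficients, which turns the sum of
  squares into one value of the form, linear in the square root of that sum.\<close>

lemma sum_corr_form_square_le:
  assumes q: "integrable lborel q" and u: "sq_int u" and J: "finite J" and v: "\<And>j. j \<in> J \<Longrightarrow> sq_int (v j)"
    and bessel: "\<And>c. (l2 (\<lambda>x. \<Sum>j\<in>J. c j * v j x))\<^sup>2 \<le> (\<Sum>j\<in>J. (cmod (c j))\<^sup>2)"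
  shows "(\<Sum>j\<in>J. (cmod (corr_form q u (v j)))\<^sup>2) \<le> ((1 + (LINT x|lborel. \<bar>q x\<bar>)) * l2 u)\<^sup>2"
proof -
  let ?c = "\<lambda>j. cnj (corr_form q u (v j))"
  define X where "X = (\<Sum>j\<in>J. (cmod (corr_form q u (v j)))\<^sup>2)"
  have X0: "0 \<le> X" by (simp add: X_def sum_nonneg)
  let ?A = "(1 + (LINT x|lborel. \<bar>q x\<bar>)) * l2 u"
  have A0: "0 \<le> ?A" by (intro mult_nonneg_nonneg add_nonneg_nonneg integral_nonneg_AE) auto
  have "corr_form q u (\<lambda>x. \<Sum>j\<in>J. ?c j * v j x) = (\<Sum>j\<in>J. ?c j * corr_form q u (v j))"
    by (rule corr_form_sum_right[OF q u J v])
  also have "\<dots> = of_real X"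
    unfolding X_def of_real_sum by (intro sum.cong refl) (subst complex_norm_square, rule mult.commute)
  finally have "of_real X = corr_form q u (\<lambda>x. \<Sum>j\<in>J. ?c j * v j x)" ..
  then have "X = cmod (corr_form q u (\<lambda>x. \<Sum>j\<in>J. ?c j * v j x))"
    using X0 by (metis abs_of_nonneg norm_of_real)
  also have "\<dots> \<le> (1 + (LINT x|lborel. \<bar>q x\<bar>)) * (l2 u * l2 (\<lambda>x. \<Sum>j\<in>J. ?c j * v j x))"
    using J v by (intro corr_form_bound q u sq_int_sum sq_int_cmult) auto
  also have "\<dots> \<le> (1 + (LINT x|lborel. \<bar>q x\<bar>)) * (l2 u * sqrt X)"
  proof (intro mult_left_mono)
    show "l2 (\<lambda>x. \<Sum>j\<in>J. ?c j * v j x) \<le> sqrt X"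
      using bessel[of ?c] by (intro real_le_rsqrt) (simp add: X_def)
  qed (auto intro!: add_nonneg_nonneg integral_nonneg_AE)
  finally have le: "X \<le> ?A * sqrt X" by (simp add: mult.assoc)
  have "sqrt X \<le> ?A"
  proof (cases "X = 0")
    case False
    then have "0 < sqrt X" using X0 by simp
    moreover have "sqrt X * sqrt X \<le> ?A * sqrt X" using le X0 by simp
    ultimately show ?thesis by (rule mult_right_le_imp_le[rotated])
  qed (use A0 in simp)
  then have "(sqrt X)\<^sup>2 \<le> ?A\<^sup>2" using X0 by (intro power_mono) auto
  then show ?thesis using X0 by (simp add: X_def)
qed

lemma sq_int_bounded_support:
  assumes W: "W \<in> sets borel" "bounded W" and [measurable]: "u \<in> borel_measurable borel" and le: "\<And>x. cmod (u x) \<le> B * indicator W x"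
  shows "sq_int u"
proof -
  have "integrable lborel (\<lambda>x. (cmod (u x))\<^sup>2)"
  proof (rule Bochner_Integration.integrable_bound[where f = "\<lambda>x. B\<^sup>2 * indicator W x"])
    show "integrable lborel (\<lambda>x. B\<^sup>2 * indicator W x)"
      using W emeasure_bounded_finite[OF W(2)] by (intro integrable_mult_right integrable_real_indicator) auto
    show "AE x in lborel. norm ((cmod (u x))\<^sup>2) \<le> norm (B\<^sup>2 * indicator W x)"
    proof (rule AE_I2)
      fix x
      have "(cmod (u x))\<^sup>2 \<le> (B * indicator W x)\<^sup>2" using le by (intro power_mono) auto
      then show "norm ((cmod (u x))\<^sup>2) \<le> norm (B\<^sup>2 * indicator W x)" by (cases "x \<in> W") auto
    qed
  qed simp
  then show ?thesis by (simp add: sq_int_def)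
qed

lemma corr_form_tendsto:
  assumes q: "integrable lborel q" and W: "W \<in> sets borel" "bounded W"
    and m: "\<And>k. u k \<in> borel_measurable borel" "\<And>k. v k \<in> borel_measurable borel"
    and b: "\<And>k x. cmod (u k x) \<le> B * indicator W x" "\<And>k x. cmod (v k x) \<le> B * indicator W x"
    and lim: "\<And>x. (\<lambda>k. u k x) \<longlonglongrightarrow> u' x" "\<And>x. (\<lambda>k. v k x) \<longlonglongrightarrow> v' x"
  shows "(\<lambda>k. corr_form q (u k) (v k)) \<longlonglongrightarrow> corr_form q u' v'"
proof -
  note [measurable] = m
  have [measurable]: "u' \<in> borel_measurable borel" "v' \<in> borel_measurable borel"
    using borel_measurable_LIMSEQ_metric[OF m(1) lim(1)] borel_measurable_LIMSEQ_metric[OF m(2) lim(2)] by auto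
  have [measurable]: "q \<in> borel_measurable borel" "W \<in> sets borel"
    using borel_measurable_integrable[OF q] W by auto
  have u'b: "cmod (u' x) \<le> B * indicator W x" for x
    by (rule LIMSEQ_le_const2[OF tendsto_norm[OF lim(1)]]) (use b(1) in blast)
  have v'b: "cmod (v' x) \<le> B * indicator W x" for x
    by (rule LIMSEQ_le_const2[OF tendsto_norm[OF lim(2)]]) (use b(2) in blast)
  have u'm: "u' \<in> borel_measurable borel" and v'm: "v' \<in> borel_measurable borel" by measurable
  note sq = sq_int_bounded_support[OF W u'm u'b] sq_int_bounded_support[OF W v'm v'b]
    sq_int_bounded_support[OF W m(1) b(1)] sq_int_bounded_support[OF W m(2) b(2)]
  let ?B = "\<lambda>x. complex_of_real (B * indicator W x)"
  have B: "sq_int ?B" by (rule sq_int_bounded_support[OF W, where B="\<bar>B\<bar>"]) (auto simp: indicator_def)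
  have uv: "cmod (u k x) * cmod (v k y) \<le> (B * indicator W x) * (B * indicator W y)" for k x y
    by (rule mult_mono[OF b(1) b(2) order_trans[OF norm_ge_zero b(1)[of k x]] norm_ge_zero])
  have intB: "integrable lborel (\<lambda>x. B\<^sup>2 * indicator W x)"
    using W emeasure_bounded_finite[OF W(2)] by (intro integrable_mult_right integrable_real_indicator) auto
  have "(\<lambda>k. LINT x|lborel. u k x * v k x) \<longlonglongrightarrow> (LINT x|lborel. u' x * v' x)"
  proof (rule integral_dominated_convergence[OF _ _ intB])
    show "AE x in lborel. norm (u k x * v k x) \<le> B\<^sup>2 * indicator W x" for k
    proof (rule AE_I2)
      fix x show "norm (u k x * v k x) \<le> B\<^sup>2 * indicator W x"
        using uv[of k x x] by (cases "x \<in> W") (auto simp: norm_mult power2_eq_square)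
    qed
    show "AE x in lborel. (\<lambda>k. u k x * v k x) \<longlonglongrightarrow> u' x * v' x"
      by (intro AE_I2 tendsto_mult lim)
  qed measurable
  moreover have "(\<lambda>k. LINT z|(lborel \<Otimes>\<^sub>M lborel). of_real (q (fst z - snd z)) * (u k (fst z) * v k (snd z)))
     \<longlonglongrightarrow> (LINT z|(lborel \<Otimes>\<^sub>M lborel). of_real (q (fst z - snd z)) * (u' (fst z) * v' (snd z)))"
  proof (rule integral_dominated_convergence[OF _ _ integrable_norm[OF integrable_kernel[OF q B B]]])
    show "AE z in lborel \<Otimes>\<^sub>M lborel. norm (of_real (q (fst z - snd z)) * (u k (fst z) * v k (snd z)))
      \<le> cmod (of_real (q (fst z - snd z)) * (?B (fst z) * ?B (snd z)))" for k
    proof (rule AE_I2)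
      fix z
      have "cmod (u k (fst z) * v k (snd z)) \<le> \<bar>(B * indicator W (fst z)) * (B * indicator W (snd z))\<bar>"
        unfolding norm_mult by (rule order_trans[OF uv abs_ge_self])
      also have "\<dots> = cmod (?B (fst z) * ?B (snd z))" by (simp only: norm_of_real flip: of_real_mult)
      finally show "norm (of_real (q (fst z - snd z)) * (u k (fst z) * v k (snd z)))
        \<le> cmod (of_real (q (fst z - snd z)) * (?B (fst z) * ?B (snd z)))"
        unfolding norm_mult[of "of_real _"] by (rule mult_left_mono) simp
    qed
    show "AE z in lborel \<Otimes>\<^sub>M lborel. (\<lambda>k. of_real (q (fst z - snd z)) * (u k (fst z) * v k (snd z)))
      \<longlonglongrightarrow> of_real (q (fst z - snd z)) * (u' (fst z) * v' (snd z))"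
      by (intro AE_I2 tendsto_mult tendsto_const lim)
    show "(\<lambda>z. of_real (q (fst z - snd z)) * (u' (fst z) * v' (snd z))) \<in> borel_measurable (lborel \<Otimes>\<^sub>M lborel)"
      by (rule borel_measurable_integrable[OF integrable_kernel[OF q sq(1,2)]])
    show "(\<lambda>z. of_real (q (fst z - snd z)) * (u k (fst z) * v k (snd z))) \<in> borel_measurable (lborel \<Otimes>\<^sub>M lborel)" for k
      by (rule borel_measurable_integrable[OF integrable_kernel[OF q sq(3,4)]])
  qed
  ultimately show ?thesis unfolding corr_form_def by (rule tendsto_add)
qed

section \<open>Second and fourth moments of linear statistics\<close>

context point_process
begin

text \<open>Truncating \<open>g\<close> at \<open>0\<close> changes it on a null set only and makes \<open>1 + q\<close> nonnegative everywhere,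
  so that its \<open>ennreal\<close> image carries the same information.\<close>

definition q :: "real ^ 'n \<Rightarrow> real" where "q x = max 0 (g x) - 1"

lemma q_AE: "AE x in lborel. q x = g x - 1"
proof -
  have "AE x in lborel. 0 \<le> g x"
    using standing by (simp add: standing_assumption_def has_pair_correlation_def)
  then show ?thesis by eventually_elim (simp add: q_def)
qed

lemma q_measurable [measurable]: "q \<in> borel_measurable borel"
proof -
  have [measurable]: "g \<in> borel_measurable borel"
    using standing by (simp add: standing_assumption_def has_pair_correlation_def)
  show ?thesis unfolding q_def by measurable
qed

lemma integrable_q: "integrable lborel q"
proof -
  have "integrable lborel (\<lambda>x. g x - 1)" using standing by (simp add: standing_assumption_def)
  then show ?thesis
    by (rule integrable_cong_AE_imp) (use q_AE in \<open>auto elim: eventually_mono\<close>)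
qed

end

context cell_partition
begin

abbreviation ind :: "'p \<Rightarrow> real ^ 'n \<Rightarrow> complex" where "ind p \<equiv> \<lambda>x. complex_of_real (indicator (A p) x)"

lemma sq_int_ind: "sq_int (ind p)"
proof (rule sq_int_bounded_support[OF A(1) bounded_A])
  show "ind p \<in> borel_measurable borel"
    by (rule measurable_compose[OF borel_measurable_indicator borel_measurable_of_real]) (simp add: A(1))
  show "cmod (ind p x) \<le> 1 * indicator (A p) x" for x by (cases "x \<in> A p") simp_all
qed

lemma emeasure_A_finite: "emeasure lborel (A p) < \<infinity>"
  by (rule emeasure_bounded_finite[OF bounded_A])

text \<open>The pair correlation determines the second factorial moment of two cells, the part \<open>1\<close> of \<open>1 + q\<close> is
  the product of the means, and the diagonal term \<open>m1\<close> occurs only for equal cells.\<close>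

lemma covar_eq: "complex_of_real (covar p r) = corr_form q (ind p) (ind r)"
proof -
  note [measurable] = A(1)
  let ?L = "lborel \<Otimes>\<^sub>M lborel :: ((real^'n) \<times> (real^'n)) measure"
  let ?i = "\<lambda>z. indicator (A p) (fst z) * indicator (A r) (snd z) :: real"
  let ?k = "\<lambda>z. q (fst z - snd z) * ?i z"
  let ?f = "\<lambda>z. ?i z + ?k z"
  have i_eq: "?i = indicator (A p \<times> A r)" by (auto simp: indicator_def fun_eq_iff)
  have em: "emeasure ?L (A p \<times> A r) = emeasure lborel (A p) * emeasure lborel (A r)"
    by (rule lborel.emeasure_pair_measure_Times) (simp_all add: A(1))
  have int_i: "integrable ?L ?i"
    unfolding i_eq using emeasure_A_finite A(1)
    by (intro integrable_real_indicator) (simp_all add: em ennreal_mult_less_top)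
  have val_i: "(LINT z|?L. ?i z) = m1 p * m1 r"
    unfolding i_eq using A(1) by (simp add: measure_def em enn2real_mult m1_eq)
  have cint: "integrable ?L (\<lambda>z. of_real (q (fst z - snd z)) * (ind p (fst z) * ind r (snd z)))"
    by (rule integrable_kernel[OF integrable_q sq_int_ind sq_int_ind])
  have ceq: "of_real (q (fst z - snd z)) * (ind p (fst z) * ind r (snd z)) = complex_of_real (?k z)" for z
    by simp
  have int_k: "integrable ?L ?k"
    using integrable_bounded_linear[OF bounded_linear_Re cint] unfolding ceq by (simp only: Re_complex_of_real)
  have val_k: "(LINT z|?L. of_real (q (fst z - snd z)) * (ind p (fst z) * ind r (snd z))) = complex_of_real (LINT z|?L. ?k z)"
    unfolding ceq by (rule integral_complex_of_real)
  have f_nonneg: "0 \<le> ?f z" for z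
  proof -
    have "?f z = (1 + q (fst z - snd z)) * ?i z" by (simp add: algebra_simps)
    then show ?thesis by (simp add: q_def)
  qed
  let ?l = "tuple p r r r"
  have "fact_moment M \<Phi> {1, 2} (\<lambda>j. A (?l j))
     = (\<integral>\<^sup>+x\<in>A (?l 1). (\<integral>\<^sup>+y\<in>A (?l 2). ennreal (1\<^sup>2 * g (x - y)) \<partial>lborel) \<partial>lborel)"
    using standing A(1) unfolding standing_assumption_def has_pair_correlation_def
    by (elim conjE allE[of _ "\<lambda>j. A (?l j)"]) simp
  also have "\<dots> = (\<integral>\<^sup>+x. \<integral>\<^sup>+y. ennreal (?f (x, y)) \<partial>lborel \<partial>lborel)"
  proof (rule nn_integral_cong)
    fix x
    have g: "ennreal (g z) = ennreal (1 + q z)" for z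
      unfolding q_def by (cases "0 \<le> g z") (auto simp: ennreal_neg max_def)
    have "ennreal (1\<^sup>2 * g (x - y)) * indicator (A r) y * indicator (A p) x = ennreal (?f (x, y))" for y
      by (auto simp: indicator_def g algebra_simps)
    then have "(\<integral>\<^sup>+y. ennreal (?f (x, y)) \<partial>lborel) = (\<integral>\<^sup>+y. (ennreal (1\<^sup>2 * g (x - y)) * indicator (A r) y) * indicator (A p) x \<partial>lborel)"
      by simp
    also have "\<dots> = (\<integral>\<^sup>+y. ennreal (1\<^sup>2 * g (x - y)) * indicator (A r) y \<partial>lborel) * indicator (A p) x"
      by (cases "x \<in> A p") auto
    finally show "(\<integral>\<^sup>+y\<in>A (?l 2). ennreal (1\<^sup>2 * g (x - y)) \<partial>lborel) * indicator (A (?l 1)) x = (\<integral>\<^sup>+y. ennreal (?f (x, y)) \<partial>lborel)"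
      by (simp add: tuple_def)
  qed
  also have "\<dots> = (\<integral>\<^sup>+z. ennreal (?f z) \<partial>?L)"
    by (rule lborel.nn_integral_fst) measurable
  finally have "F2 p r = enn2real (\<integral>\<^sup>+z. ennreal (?f z) \<partial>?L)"
    using fact_moments(2)[of 1 2 ?l] by (simp add: tuple_def)
  also have "\<dots> = (LINT z|?L. ?f z)"
    using f_nonneg int_i int_k by (subst integral_eq_nn_integral) (auto intro: borel_measurable_integrable)
  also have "\<dots> = m1 p * m1 r + (LINT z|?L. ?k z)"
    using int_i int_k val_i by simp
  finally have cov: "covar p r = same p r * m1 p + (LINT z|?L. ?k z)"
    by (simp add: covar_def F2_def)
  have "(LINT x|lborel. ind p x * ind r x) = (LINT x|lborel. complex_of_real (same p r * indicator (A p) x))"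
    using disjoint[of p r] by (intro Bochner_Integration.integral_cong refl) (auto simp: indicator_def same_def)
  also have "\<dots> = complex_of_real (same p r * m1 p)"
    unfolding integral_complex_of_real using A(1) emeasure_A_finite[of p] by (simp add: m1_eq)
  finally show ?thesis unfolding corr_form_def val_k cov by simp
qed

lemma m1_nonneg: "0 \<le> m1 p" by (simp add: m1_eq)

lemma integrable_centered_prod:
  assumes "finite J" "card J \<le> 4"
  shows "integrable M (\<lambda>\<omega>. \<Prod>j\<in>J. N (l j) \<omega> - m1 (l j))"
proof (rule integrable_npts_polynomial[OF W, where c="\<Prod>j\<in>J. 1 + m1 (l j)"])
  fix \<omega> assume \<omega>: "\<omega> \<in> space M"
  have le: "\<bar>N (l j) \<omega> - m1 (l j)\<bar> \<le> (1 + m1 (l j)) * (1 + npts W \<omega>)" for j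
  proof -
    have "\<bar>N (l j) \<omega> - m1 (l j)\<bar> \<le> N (l j) \<omega> + m1 (l j)" using m1_nonneg[of "l j"] npts_nonneg[of "A (l j)" \<omega>] by linarith
    also have "\<dots> \<le> 1 * (1 + npts W \<omega>) + m1 (l j) * (1 + npts W \<omega>)"
      using N_le[OF \<omega>, of "l j"] mult_left_mono[of 1 "1 + npts W \<omega>" "m1 (l j)"] m1_nonneg[of "l j"] by simp
    finally show ?thesis by (simp only: distrib_right)
  qed
  have "norm (\<Prod>j\<in>J. N (l j) \<omega> - m1 (l j)) \<le> (\<Prod>j\<in>J. (1 + m1 (l j)) * (1 + npts W \<omega>))"
    unfolding real_norm_def abs_prod by (intro prod_mono conjI le) simp
  also have "\<dots> = (\<Prod>j\<in>J. 1 + m1 (l j)) * (1 + npts W \<omega>) ^ card J" by (simp add: prod.distrib)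
  also have "\<dots> \<le> (\<Prod>j\<in>J. 1 + m1 (l j)) * (1 + npts W \<omega>) ^ 4"
    using assms m1_nonneg by (intro mult_left_mono power_increasing prod_nonneg) auto
  finally show "norm (\<Prod>j\<in>J. N (l j) \<omega> - m1 (l j)) \<le> (\<Prod>j\<in>J. 1 + m1 (l j)) * (1 + npts W \<omega>) ^ 4" .
qed measurable

abbreviation D :: "'p \<Rightarrow> 'w \<Rightarrow> complex" where "D p \<omega> \<equiv> complex_of_real (N p \<omega> - m1 p)"

lemma expectation_D_2:
  "integrable M (\<lambda>\<omega>. D p \<omega> * D r \<omega>)" "(LINT \<omega>|M. D p \<omega> * D r \<omega>) = of_real (covar p r)"
proof -
  have int: "integrable M (\<lambda>\<omega>. (N p \<omega> - m1 p) * (N r \<omega> - m1 r))"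
    using integrable_centered_prod[of "{0::nat, 1}" "\<lambda>j. if j = 0 then p else r"] by simp
  show "integrable M (\<lambda>\<omega>. D p \<omega> * D r \<omega>)"
    unfolding of_real_mult[symmetric] by (rule integrable_of_real[OF int])
  show "(LINT \<omega>|M. D p \<omega> * D r \<omega>) = of_real (covar p r)"
    unfolding of_real_mult[symmetric] integral_complex_of_real expectation_centered_2 ..
qed

lemma expectation_D_4:
  "integrable M (\<lambda>\<omega>. D p \<omega> * D r \<omega> * (D s \<omega> * D t \<omega>))"
  "(LINT \<omega>|M. D p \<omega> * D r \<omega> * (D s \<omega> * D t \<omega>))
    = of_real (covar p r * covar s t + covar p s * covar r t + covar p t * covar r s + joint_cumulant p r s t)"
proof -
  have int: "integrable M (\<lambda>\<omega>. (N p \<omega> - m1 p) * (N r \<omega> - m1 r) * ((N s \<omega> - m1 s) * (N t \<omega> - m1 t)))"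
    using integrable_centered_prod[of "{0::nat, 1, 2, 3}" "\<lambda>j. if j = 0 then p else if j = 1 then r else if j = 2 then s else t"]
    by (simp add: mult.assoc)
  show "integrable M (\<lambda>\<omega>. D p \<omega> * D r \<omega> * (D s \<omega> * D t \<omega>))"
    unfolding of_real_mult[symmetric] by (rule integrable_of_real[OF int])
  show "(LINT \<omega>|M. D p \<omega> * D r \<omega> * (D s \<omega> * D t \<omega>))
    = of_real (covar p r * covar s t + covar p s * covar r t + covar p t * covar r s + joint_cumulant p r s t)"
    unfolding of_real_mult[symmetric] integral_complex_of_real expectation_centered_4[symmetric]
    by (simp add: mult.assoc)
qed

definition lin :: "'p set \<Rightarrow> ('p \<Rightarrow> complex) \<Rightarrow> 'w \<Rightarrow> complex" where
  "lin P u \<omega> = (\<Sum>p\<in>P. u p * D p \<omega>)"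

definition cov_form :: "'p set \<Rightarrow> ('p \<Rightarrow> complex) \<Rightarrow> ('p \<Rightarrow> complex) \<Rightarrow> complex" where
  "cov_form P u v = (\<Sum>p\<in>P. \<Sum>r\<in>P. u p * v r * of_real (covar p r))"

lemma lin_mult: "lin P u \<omega> * lin P v \<omega> = (\<Sum>p\<in>P. \<Sum>r\<in>P. u p * v r * (D p \<omega> * D r \<omega>))"
  unfolding lin_def sum_product by (intro sum.cong refl) (simp only: mult_ac)

lemma expectation_lin_2:
  "integrable M (\<lambda>\<omega>. lin P u \<omega> * lin P v \<omega>)" "(LINT \<omega>|M. lin P u \<omega> * lin P v \<omega>) = cov_form P u v"
  unfolding lin_mult cov_form_def
  by (intro Bochner_Integration.integrable_sum integrable_mult_right expectation_D_2(1))
     (simp add: integral_sum integrable_mult_right expectation_D_2 del: of_real_diff)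

lemma sum_product4:
  fixes F G :: "'p \<Rightarrow> 'p \<Rightarrow> complex"
  shows "(\<Sum>p\<in>P. \<Sum>r\<in>P. F p r) * (\<Sum>s\<in>P. \<Sum>t\<in>P. G s t) = (\<Sum>p\<in>P. \<Sum>r\<in>P. \<Sum>s\<in>P. \<Sum>t\<in>P. F p r * G s t)"
  unfolding sum_distrib_right unfolding sum_distrib_left ..

definition cumulant_form :: "'p set \<Rightarrow> ('p \<Rightarrow> complex) \<Rightarrow> ('p \<Rightarrow> complex) \<Rightarrow> ('p \<Rightarrow> complex) \<Rightarrow> ('p \<Rightarrow> complex) \<Rightarrow> complex" where
  "cumulant_form P a b c d = (\<Sum>p\<in>P. \<Sum>r\<in>P. \<Sum>s\<in>P. \<Sum>t\<in>P. (a p * b r) * (c s * d t) * of_real (joint_cumulant p r s t))"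

text \<open>By multilinearity the pairing formula for counts extends to linear statistics.\<close>

lemma expectation_lin_4:
  "integrable M (\<lambda>\<omega>. lin P a \<omega> * lin P b \<omega> * (lin P c \<omega> * lin P d \<omega>))"
  "(LINT \<omega>|M. lin P a \<omega> * lin P b \<omega> * (lin P c \<omega> * lin P d \<omega>))
     = cov_form P a b * cov_form P c d + cov_form P a c * cov_form P b d + cov_form P a d * cov_form P b c
       + cumulant_form P a b c d"
proof -
  have eq: "lin P a \<omega> * lin P b \<omega> * (lin P c \<omega> * lin P d \<omega>)
    = (\<Sum>p\<in>P. \<Sum>r\<in>P. \<Sum>s\<in>P. \<Sum>t\<in>P. (a p * b r) * (c s * d t) * (D p \<omega> * D r \<omega> * (D s \<omega> * D t \<omega>)))" for \<omega>
    unfolding lin_mult sum_product4 by (intro sum.cong refl) (simp only: mult_ac)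
  show "integrable M (\<lambda>\<omega>. lin P a \<omega> * lin P b \<omega> * (lin P c \<omega> * lin P d \<omega>))"
    unfolding eq by (intro Bochner_Integration.integrable_sum integrable_mult_right expectation_D_4(1))
  have "(LINT \<omega>|M. lin P a \<omega> * lin P b \<omega> * (lin P c \<omega> * lin P d \<omega>))
    = (\<Sum>p\<in>P. \<Sum>r\<in>P. \<Sum>s\<in>P. \<Sum>t\<in>P. (a p * b r) * (c s * d t) *
       of_real (covar p r * covar s t + covar p s * covar r t + covar p t * covar r s + joint_cumulant p r s t))"
    unfolding eq expectation_D_4(2)[symmetric]
    by (simp add: integral_sum integrable_mult_right expectation_D_4(1) Bochner_Integration.integrable_sum del: of_real_diff)
  also have "\<dots> = (\<Sum>p\<in>P. \<Sum>r\<in>P. \<Sum>s\<in>P. \<Sum>t\<in>P. (a p * b r * covar p r) * (c s * d t * covar s t))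
      + (\<Sum>p\<in>P. \<Sum>r\<in>P. \<Sum>s\<in>P. \<Sum>t\<in>P. (a p * c s * covar p s) * (b r * d t * covar r t))
      + (\<Sum>p\<in>P. \<Sum>r\<in>P. \<Sum>s\<in>P. \<Sum>t\<in>P. (a p * d t * covar p t) * (b r * c s * covar r s))
      + cumulant_form P a b c d"
    unfolding cumulant_form_def sum.distrib[symmetric]
    by (intro sum.cong refl) (simp add: algebra_simps)
  also have "(\<Sum>p\<in>P. \<Sum>r\<in>P. \<Sum>s\<in>P. \<Sum>t\<in>P. (a p * b r * covar p r) * (c s * d t * covar s t)) = cov_form P a b * cov_form P c d"
    unfolding cov_form_def sum_product4 ..
  also have "(\<Sum>p\<in>P. \<Sum>r\<in>P. \<Sum>s\<in>P. \<Sum>t\<in>P. (a p * c s * covar p s) * (b r * d t * covar r t)) = cov_form P a c * cov_form P b d"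
    unfolding cov_form_def sum_product4 by (rule sum.cong[OF refl], rule sum.swap)
  also have "(\<Sum>p\<in>P. \<Sum>r\<in>P. \<Sum>s\<in>P. \<Sum>t\<in>P. (a p * d t * covar p t) * (b r * c s * covar r s)) = cov_form P a d * cov_form P b c"
  proof -
    have "(\<Sum>r\<in>P. \<Sum>s\<in>P. \<Sum>t\<in>P. (a p * d t * covar p t) * (b r * c s * covar r s))
       = (\<Sum>t\<in>P. \<Sum>r\<in>P. \<Sum>s\<in>P. (a p * d t * covar p t) * (b r * c s * covar r s))" for p
      by (subst (2) sum.swap, subst sum.swap) simp
    then show ?thesis unfolding cov_form_def sum_product4 by simp
  qed
  finally show "(LINT \<omega>|M. lin P a \<omega> * lin P b \<omega> * (lin P c \<omega> * lin P d \<omega>))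
     = cov_form P a b * cov_form P c d + cov_form P a c * cov_form P b d + cov_form P a d * cov_form P b c
       + cumulant_form P a b c d" .
qed

lemma cnj_lin: "cnj (lin P u \<omega>) = lin P (\<lambda>p. cnj (u p)) \<omega>"
  by (simp add: lin_def)

lemma cnj_cov_form: "cnj (cov_form P u v) = cov_form P (\<lambda>p. cnj (u p)) (\<lambda>p. cnj (v p))"
  by (simp add: cov_form_def)

text \<open>Summing over the index of the tapers first gives the kernels \<open>\<Sum>i\<in>I. u i p * cnj (u i r)\<close>, which the
  Cauchy-Schwarz inequality bounds by \<open>\<rho>\<close> uniformly; the size of \<open>I\<close> does not appear.\<close>

lemma sum_cumulant_form_le:
  assumes P: "finite P" and fin: "gamma4_red \<gamma> < \<infinity>"
    and \<rho>: "\<And>p. (\<Sum>i\<in>I. (cmod (u i p))\<^sup>2) \<le> \<rho>"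
  shows "cmod (\<Sum>i\<in>I. \<Sum>j\<in>I. cumulant_form P (u i) (\<lambda>p. cnj (u i p)) (u j) (\<lambda>p. cnj (u j p))) \<le> \<rho>\<^sup>2 * (cumulant_mass * vol)"
proof -
  let ?B = "\<lambda>p r. \<Sum>i\<in>I. u i p * cnj (u i r)"
  have B: "cmod (?B p r) \<le> \<rho>" for p r
  proof -
    have "cmod (?B p r) \<le> (\<Sum>i\<in>I. cmod (u i p) * cmod (u i r))"
      by (rule order_trans[OF norm_sum]) (simp add: norm_mult)
    also have "\<dots> \<le> (\<Sum>i\<in>I. ((cmod (u i p))\<^sup>2 + (cmod (u i r))\<^sup>2) / 2)"
    proof (intro sum_mono)
      fix i show "cmod (u i p) * cmod (u i r) \<le> ((cmod (u i p))\<^sup>2 + (cmod (u i r))\<^sup>2) / 2"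
        using sum_squares_bound[of "cmod (u i p)" "cmod (u i r)"] by simp
    qed
    also have "\<dots> = ((\<Sum>i\<in>I. (cmod (u i p))\<^sup>2) + (\<Sum>i\<in>I. (cmod (u i r))\<^sup>2)) / 2"
      by (simp add: sum.distrib sum_divide_distrib[symmetric])
    also have "\<dots> \<le> \<rho>" using \<rho>[of p] \<rho>[of r] by simp
    finally show ?thesis .
  qed
  have \<rho>0: "0 \<le> \<rho>" using order_trans[OF norm_ge_zero B] .
  have "(\<Sum>i\<in>I. \<Sum>j\<in>I. cumulant_form P (u i) (\<lambda>p. cnj (u i p)) (u j) (\<lambda>p. cnj (u j p)))
    = (\<Sum>p\<in>P. \<Sum>r\<in>P. \<Sum>s\<in>P. \<Sum>t\<in>P. \<Sum>i\<in>I. \<Sum>j\<in>I. (u i p * cnj (u i r)) * (u j s * cnj (u j t)) * of_real (joint_cumulant p r s t))"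
    unfolding cumulant_form_def
    by (simp only: sum.swap[of _ P I])
  also have "\<dots> = (\<Sum>p\<in>P. \<Sum>r\<in>P. \<Sum>s\<in>P. \<Sum>t\<in>P. ?B p r * ?B s t * of_real (joint_cumulant p r s t))"
    by (simp only: sum_product) (simp only: sum_distrib_right)
  also have "cmod \<dots> \<le> (\<Sum>p\<in>P. \<Sum>r\<in>P. \<Sum>s\<in>P. \<Sum>t\<in>P. \<rho>\<^sup>2 * \<bar>joint_cumulant p r s t\<bar>)"
  proof (intro order_trans[OF norm_sum sum_mono])
    fix p r s t
    have "cmod (?B p r) * cmod (?B s t) \<le> \<rho> * \<rho>" by (intro mult_mono B \<rho>0 norm_ge_zero)
    then show "cmod (?B p r * ?B s t * of_real (joint_cumulant p r s t)) \<le> \<rho>\<^sup>2 * \<bar>joint_cumulant p r s t\<bar>"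
      unfolding norm_mult norm_of_real power2_eq_square by (rule mult_right_mono) simp
  qed
  also have "\<dots> = \<rho>\<^sup>2 * (\<Sum>p\<in>P. \<Sum>r\<in>P. \<Sum>s\<in>P. \<Sum>t\<in>P. \<bar>joint_cumulant p r s t\<bar>)"
    by (simp only: sum_distrib_left)
  also have "\<dots> \<le> \<rho>\<^sup>2 * (cumulant_mass * vol)"
    by (intro mult_left_mono sum_joint_cumulant_le P fin) simp
  finally show ?thesis .
qed

lemma expectation_lin_square:
  "integrable M (\<lambda>\<omega>. (cmod (lin P u \<omega>))\<^sup>2)"
  "complex_of_real (LINT \<omega>|M. (cmod (lin P u \<omega>))\<^sup>2) = cov_form P u (\<lambda>p. cnj (u p))"
proof -
  have eq: "complex_of_real ((cmod (lin P u \<omega>))\<^sup>2) = lin P u \<omega> * lin P (\<lambda>p. cnj (u p)) \<omega>" for \<omega>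
    unfolding cnj_lin[symmetric] by (rule complex_norm_square)
  have int: "integrable M (\<lambda>\<omega>. complex_of_real ((cmod (lin P u \<omega>))\<^sup>2))"
    unfolding eq by (rule expectation_lin_2)
  show "integrable M (\<lambda>\<omega>. (cmod (lin P u \<omega>))\<^sup>2)"
    using integrable_bounded_linear[OF bounded_linear_Re int] by (simp only: Re_complex_of_real)
  show "complex_of_real (LINT \<omega>|M. (cmod (lin P u \<omega>))\<^sup>2) = cov_form P u (\<lambda>p. cnj (u p))"
    unfolding integral_complex_of_real[symmetric] eq by (rule expectation_lin_2)
qed

text \<open>The pairing of each factor with its own conjugate gives the squared mean. The other two pairings are
  squares of moduli of covariances.\<close>

lemma quartic_bound:
  assumes P: "finite P" and I: "finite I" and fin: "gamma4_red \<gamma> < \<infinity>"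
    and \<rho>: "\<And>p. (\<Sum>i\<in>I. (cmod (u i p))\<^sup>2) \<le> \<rho>"
  shows "(LINT \<omega>|M. (\<Sum>i\<in>I. (cmod (lin P (u i) \<omega>))\<^sup>2)\<^sup>2)
    \<le> (\<Sum>i\<in>I. LINT \<omega>|M. (cmod (lin P (u i) \<omega>))\<^sup>2)\<^sup>2
      + (\<Sum>i\<in>I. \<Sum>j\<in>I. (cmod (cov_form P (u i) (u j)))\<^sup>2 + (cmod (cov_form P (u i) (\<lambda>p. cnj (u j p))))\<^sup>2)
      + \<rho>\<^sup>2 * (cumulant_mass * vol)" (is "?L \<le> ?X\<^sup>2 + ?G + _")
proof -
  let ?c = "\<lambda>i p. cnj (u i p)"
  let ?K = "\<Sum>i\<in>I. \<Sum>j\<in>I. cumulant_form P (u i) (?c i) (u j) (?c j)"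
  have eq: "complex_of_real ((\<Sum>i\<in>I. (cmod (lin P (u i) \<omega>))\<^sup>2)\<^sup>2)
     = (\<Sum>i\<in>I. \<Sum>j\<in>I. lin P (u i) \<omega> * lin P (?c i) \<omega> * (lin P (u j) \<omega> * lin P (?c j) \<omega>))" for \<omega>
    unfolding cnj_lin[symmetric] complex_norm_square[symmetric] power2_eq_square[of "\<Sum>i\<in>I. _ i"] sum_product
    by (simp only: of_real_sum of_real_mult)
  have "complex_of_real ?L = (LINT \<omega>|M. (\<Sum>i\<in>I. \<Sum>j\<in>I. lin P (u i) \<omega> * lin P (?c i) \<omega> * (lin P (u j) \<omega> * lin P (?c j) \<omega>)))"
    unfolding integral_complex_of_real[symmetric] eq ..
  also have "\<dots> = (\<Sum>i\<in>I. \<Sum>j\<in>I. cov_form P (u i) (?c i) * cov_form P (u j) (?c j)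
      + cov_form P (u i) (u j) * cov_form P (?c i) (?c j) + cov_form P (u i) (?c j) * cov_form P (?c i) (u j)
      + cumulant_form P (u i) (?c i) (u j) (?c j))"
    unfolding expectation_lin_4(2)[symmetric]
    by (simp add: integral_sum expectation_lin_4(1) Bochner_Integration.integrable_sum)
  also have "\<dots> = (\<Sum>i\<in>I. \<Sum>j\<in>I. cov_form P (u i) (?c i) * cov_form P (u j) (?c j))
      + (\<Sum>i\<in>I. \<Sum>j\<in>I. cov_form P (u i) (u j) * cov_form P (?c i) (?c j) + cov_form P (u i) (?c j) * cov_form P (?c i) (u j))
      + ?K"
    by (simp only: sum.distrib add.assoc)
  also have "(\<Sum>i\<in>I. \<Sum>j\<in>I. cov_form P (u i) (?c i) * cov_form P (u j) (?c j)) = complex_of_real (?X\<^sup>2)"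
    unfolding expectation_lin_square(2)[symmetric] sum_product[symmetric] power2_eq_square[of "\<Sum>i\<in>I. _ i"]
    by (simp only: of_real_sum of_real_mult)
  also have "(\<Sum>i\<in>I. \<Sum>j\<in>I. cov_form P (u i) (u j) * cov_form P (?c i) (?c j) + cov_form P (u i) (?c j) * cov_form P (?c i) (u j))
     = complex_of_real ?G"
  proof -
    have "cov_form P (?c i) (?c j) = cnj (cov_form P (u i) (u j))" "cov_form P (?c i) (u j) = cnj (cov_form P (u i) (?c j))" for i j
      by (simp_all add: cnj_cov_form)
    then show ?thesis by (simp only: complex_norm_square of_real_sum of_real_add)
  qed
  finally have "complex_of_real ?L = complex_of_real (?X\<^sup>2) + complex_of_real ?G + ?K" .
  from arg_cong[OF this, of Re] have "?L = ?X\<^sup>2 + ?G + Re ?K"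
    by (simp only: plus_complex.sel Re_complex_of_real)
  moreover have "Re ?K \<le> \<rho>\<^sup>2 * (cumulant_mass * vol)"
    using complex_Re_le_cmod sum_cumulant_form_le[OF P fin \<rho>] by (rule order_trans)
  ultimately show ?thesis by simp
qed

end

section \<open>Passage to continuous functions\<close>

context point_process
begin

definition tsum :: "(real ^ 'n) set \<Rightarrow> (real ^ 'n \<Rightarrow> complex) \<Rightarrow> 'w \<Rightarrow> complex" where
  "tsum W v \<omega> = (\<Sum>x\<in>\<Phi> \<omega> \<inter> W. v x)"

definition ctr :: "(real ^ 'n) set \<Rightarrow> (real ^ 'n \<Rightarrow> complex) \<Rightarrow> 'w \<Rightarrow> complex" where
  "ctr W v \<omega> = tsum W v \<omega> - (LINT \<omega>'|M. tsum W v \<omega>')"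

definition wind :: "(real ^ 'n) set \<Rightarrow> (real ^ 'n \<Rightarrow> complex) \<Rightarrow> real ^ 'n \<Rightarrow> complex" where
  "wind W v x = of_real (indicator W x) * v x"

lemma sq_int_wind:
  fixes u :: "real ^ 'n \<Rightarrow> complex"
  assumes W: "W \<in> sets borel" and u: "sq_int u"
  shows "sq_int (wind W u)" "l2 (wind W u) \<le> l2 u"
proof -
  have [measurable]: "W \<in> sets borel" "u \<in> borel_measurable borel" using W u by (auto simp: sq_int_def)
  have le: "(cmod (wind W u x))\<^sup>2 \<le> (cmod (u x))\<^sup>2" for x by (cases "x \<in> W") (simp_all add: wind_def)
  have m: "wind W u \<in> borel_measurable borel" unfolding wind_def by measurable
  have int: "integrable lborel (\<lambda>x. (cmod (u x))\<^sup>2)" using u by (simp add: sq_int_def)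
  have intw: "integrable lborel (\<lambda>x. (cmod (wind W u x))\<^sup>2)"
    by (rule Bochner_Integration.integrable_bound[OF int]) (use m le in auto)
  show "sq_int (wind W u)" using m intw by (simp add: sq_int_def)
  show "l2 (wind W u) \<le> l2 u"
    unfolding l2_def by (intro real_sqrt_le_mono integral_mono intw int le)
qed

lemma tsum_bound:
  assumes "\<And>x. cmod (v x) \<le> B"
  shows "cmod (tsum W v \<omega>) \<le> B * npts W \<omega>"
proof -
  have "cmod (tsum W v \<omega>) \<le> (\<Sum>x\<in>\<Phi> \<omega> \<inter> W. B)"
    unfolding tsum_def by (rule sum_norm_le) (rule assms)
  then show ?thesis by (simp add: npts_def mult.commute)
qed

text \<open>If a function factors through a simple function \<open>G\<close>, the level sets of \<open>G\<close> cut \<open>W\<close> into finitely many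
  cells, and its sums over the process are linear statistics of the counts.\<close>

lemma quantized_statistics:
  fixes G :: "real ^ 'n \<Rightarrow> real ^ 'n"
  assumes W: "W \<in> sets borel" "bounded W" and G: "simple_function borel G"
  shows "tsum W (\<lambda>x. v (G x)) \<in> borel_measurable M"
    and "(LINT \<omega>|M. ctr W (\<lambda>x. u (G x)) \<omega> * ctr W (\<lambda>x. v (G x)) \<omega>)
       = corr_form q (wind W (\<lambda>x. u (G x))) (wind W (\<lambda>x. v (G x)))"
    and "finite I \<Longrightarrow> gamma4_red \<gamma> < \<infinity> \<Longrightarrow> (\<And>y. (\<Sum>i\<in>I. (cmod (w i y))\<^sup>2) \<le> \<rho>) \<Longrightarrow>
      (LINT \<omega>|M. (\<Sum>i\<in>I. (cmod (ctr W (\<lambda>x. w i (G x)) \<omega>))\<^sup>2)\<^sup>2)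
      \<le> (\<Sum>i\<in>I. LINT \<omega>|M. (cmod (ctr W (\<lambda>x. w i (G x)) \<omega>))\<^sup>2)\<^sup>2
      + (\<Sum>i\<in>I. \<Sum>j\<in>I. (cmod (corr_form q (wind W (\<lambda>x. w i (G x))) (wind W (\<lambda>x. w j (G x)))))\<^sup>2
          + (cmod (corr_form q (wind W (\<lambda>x. w i (G x))) (wind W (\<lambda>x. cnj (w j (G x))))))\<^sup>2)
      + \<rho>\<^sup>2 * (cumulant_mass * measure lborel W)"
proof -
  define A where "A y = W \<inter> G -` {y}" for y
  have Gm: "G \<in> borel_measurable borel" by (rule borel_measurable_simple_function[OF G])
  have Ab: "A y \<in> sets borel" for y
    unfolding A_def using W(1) measurable_sets_borel[OF Gm, of "{y}"] by auto
  interpret c: cell_partition M \<Phi> g \<gamma> W A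
    by standard (use W Ab in \<open>auto simp: A_def\<close>)
  let ?P = "range G"
  have P: "finite ?P" using simple_functionD(1)[OF G] by simp
  have tsum_eq: "tsum W (\<lambda>x. v (G x)) \<omega> = (\<Sum>y\<in>?P. v y * of_real (npts (A y) \<omega>))" if \<omega>: "\<omega> \<in> space M" for v \<omega>
  proof -
    have "tsum W (\<lambda>x. v (G x)) \<omega> = (\<Sum>y\<in>?P. \<Sum>x\<in>{x \<in> \<Phi> \<omega> \<inter> W. G x = y}. v (G x))"
      unfolding tsum_def by (rule sum.group[symmetric]) (use finite_Phi[OF \<omega> W(2)] P in auto)
    also have "\<dots> = (\<Sum>y\<in>?P. v y * of_real (npts (A y) \<omega>))"
    proof (rule sum.cong[OF refl])
      fix y
      have "(\<Sum>x\<in>{x \<in> \<Phi> \<omega> \<inter> W. G x = y}. v (G x)) = (\<Sum>x\<in>\<Phi> \<omega> \<inter> A y. v y)"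
        by (rule sum.cong) (auto simp: A_def)
      also have "\<dots> = v y * of_real (npts (A y) \<omega>)" by (simp add: npts_def mult.commute)
      finally show "(\<Sum>x\<in>{x \<in> \<Phi> \<omega> \<inter> W. G x = y}. v (G x)) = v y * of_real (npts (A y) \<omega>)" .
    qed
    finally show ?thesis .
  qed
  have meas: "(\<lambda>\<omega>. \<Sum>y\<in>?P. v y * of_real (npts (A y) \<omega>)) \<in> borel_measurable M" for v :: "real^'n \<Rightarrow> complex"
    by measurable
  show "tsum W (\<lambda>x. v (G x)) \<in> borel_measurable M"
    using meas[of v] by (subst measurable_cong[OF tsum_eq])
  have mean: "(LINT \<omega>|M. tsum W (\<lambda>x. v (G x)) \<omega>) = (\<Sum>y\<in>?P. v y * of_real (c.m1 y))" for v
  proof -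
    have "(LINT \<omega>|M. tsum W (\<lambda>x. v (G x)) \<omega>) = (LINT \<omega>|M. (\<Sum>y\<in>?P. v y * of_real (npts (A y) \<omega>)))"
      by (intro Bochner_Integration.integral_cong refl tsum_eq)
    also have "\<dots> = (\<Sum>y\<in>?P. v y * of_real (c.m1 y))"
      using integrable_of_real[OF c.integrable_N_1] by (simp add: integral_sum c.m1_def)
    finally show ?thesis .
  qed
  have ctr_eq: "ctr W (\<lambda>x. v (G x)) \<omega> = c.lin ?P v \<omega>" if "\<omega> \<in> space M" for v \<omega>
    unfolding ctr_def mean tsum_eq[OF that] c.lin_def by (simp add: sum_subtractf algebra_simps)
  have wind_eq: "wind W (\<lambda>x. v (G x)) = (\<lambda>x. \<Sum>y\<in>?P. v y * of_real (indicator (A y) x))" for v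
  proof
    fix x
    have "(\<Sum>y\<in>?P. v y * of_real (indicator (A y) x)) = (\<Sum>y\<in>?P. if y = G x then of_real (indicator W x) * v (G x) else 0)"
      by (intro sum.cong refl) (auto simp: A_def indicator_def)
    then show "wind W (\<lambda>x. v (G x)) x = (\<Sum>y\<in>?P. v y * of_real (indicator (A y) x))"
      using P by (simp add: wind_def)
  qed
  have cov_eq: "c.cov_form ?P u v = corr_form q (wind W (\<lambda>x. u (G x))) (wind W (\<lambda>x. v (G x)))" for u v
  proof -
    have sq: "sq_int (\<lambda>x. \<Sum>y\<in>?P. v y * of_real (indicator (A y) x))"
      by (intro sq_int_sum[OF P] sq_int_cmult c.sq_int_ind)
    have "corr_form q (wind W (\<lambda>x. u (G x))) (wind W (\<lambda>x. v (G x)))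
      = (\<Sum>y\<in>?P. u y * corr_form q (c.ind y) (\<lambda>x. \<Sum>y\<in>?P. v y * of_real (indicator (A y) x)))"
      unfolding wind_eq by (rule corr_form_sum_left[OF integrable_q sq P c.sq_int_ind])
    also have "\<dots> = (\<Sum>y\<in>?P. u y * (\<Sum>z\<in>?P. v z * corr_form q (c.ind y) (c.ind z)))"
      by (intro sum.cong refl arg_cong2[where f="(*)"] corr_form_sum_right[OF integrable_q c.sq_int_ind P c.sq_int_ind])
    also have "\<dots> = c.cov_form ?P u v"
      unfolding c.cov_form_def c.covar_eq[symmetric] by (simp add: sum_distrib_left mult.assoc)
    finally show ?thesis ..
  qed
  show "(LINT \<omega>|M. ctr W (\<lambda>x. u (G x)) \<omega> * ctr W (\<lambda>x. v (G x)) \<omega>)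
       = corr_form q (wind W (\<lambda>x. u (G x))) (wind W (\<lambda>x. v (G x)))"
    unfolding cov_eq[symmetric] c.expectation_lin_2(2)[symmetric]
    by (intro Bochner_Integration.integral_cong refl) (simp add: ctr_eq)
  assume I: "finite I" "gamma4_red \<gamma> < \<infinity>" "\<And>y. (\<Sum>i\<in>I. (cmod (w i y))\<^sup>2) \<le> \<rho>"
  have E4: "(LINT \<omega>|M. (\<Sum>i\<in>I. (cmod (ctr W (\<lambda>x. w i (G x)) \<omega>))\<^sup>2)\<^sup>2) = (LINT \<omega>|M. (\<Sum>i\<in>I. (cmod (c.lin ?P (w i) \<omega>))\<^sup>2)\<^sup>2)"
    by (intro Bochner_Integration.integral_cong refl) (simp add: ctr_eq)
  have E2: "(LINT \<omega>|M. (cmod (ctr W (\<lambda>x. w i (G x)) \<omega>))\<^sup>2) = (LINT \<omega>|M. (cmod (c.lin ?P (w i) \<omega>))\<^sup>2)" for i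
    by (intro Bochner_Integration.integral_cong refl) (simp add: ctr_eq)
  have cc: "c.cov_form ?P (w i) (\<lambda>y. cnj (w j y)) = corr_form q (wind W (\<lambda>x. w i (G x))) (wind W (\<lambda>x. cnj (w j (G x))))" for i j
    by (rule cov_eq)
  show "(LINT \<omega>|M. (\<Sum>i\<in>I. (cmod (ctr W (\<lambda>x. w i (G x)) \<omega>))\<^sup>2)\<^sup>2)
      \<le> (\<Sum>i\<in>I. LINT \<omega>|M. (cmod (ctr W (\<lambda>x. w i (G x)) \<omega>))\<^sup>2)\<^sup>2
      + (\<Sum>i\<in>I. \<Sum>j\<in>I. (cmod (corr_form q (wind W (\<lambda>x. w i (G x))) (wind W (\<lambda>x. w j (G x)))))\<^sup>2
          + (cmod (corr_form q (wind W (\<lambda>x. w i (G x))) (wind W (\<lambda>x. cnj (w j (G x))))))\<^sup>2)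
      + \<rho>\<^sup>2 * (cumulant_mass * measure lborel W)"
    unfolding E4 E2 cc[symmetric] cov_eq[symmetric]
    by (rule c.quartic_bound[OF P I])
qed

lemma exists_quantizer:
  "\<exists>G :: nat \<Rightarrow> real ^ 'n \<Rightarrow> real ^ 'n. (\<forall>k. simple_function borel (G k)) \<and> (\<forall>x. (\<lambda>k. G k x) \<longlonglongrightarrow> x)"
proof -
  have "(\<lambda>x :: real ^ 'n. x) \<in> borel_measurable borel" by simp
  from borel_measurable_implies_sequence_metric[OF this, of 0] show ?thesis by auto
qed

text \<open>Composing a continuous function with the maps \<open>quantizer k\<close> approximates it by functions with
  finitely many values.\<close>

definition quantizer :: "nat \<Rightarrow> real ^ 'n \<Rightarrow> real ^ 'n" where
  "quantizer = (SOME G. (\<forall>k. simple_function borel (G k)) \<and> (\<forall>x. (\<lambda>k. G k x) \<longlonglongrightarrow> x))"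

lemma quantizer: "simple_function borel (quantizer k)" "(\<lambda>k. quantizer k x) \<longlonglongrightarrow> x"
  using someI_ex[OF exists_quantizer] unfolding quantizer_def by blast+

context
  fixes W :: "(real ^ 'n) set"
  assumes W: "W \<in> sets borel" "bounded W"
begin

lemma integrable_npts: "integrable M (npts W)"
  by (rule integrable_npts_polynomial[OF W measurable_npts[OF W], where c=1])
    (auto intro!: order_trans[OF _ self_le_power])

lemma tsum_tendsto:
  assumes v: "continuous_on UNIV v" and \<omega>: "\<omega> \<in> space M"
  shows "(\<lambda>k. tsum W (\<lambda>x. v (quantizer k x)) \<omega>) \<longlonglongrightarrow> tsum W v \<omega>"
  unfolding tsum_def
proof (rule tendsto_sum)
  fix x show "(\<lambda>k. v (quantizer k x)) \<longlonglongrightarrow> v x"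
    by (rule continuous_on_tendsto_compose[OF v quantizer(2)]) auto
qed

lemma measurable_tsum:
  assumes v: "continuous_on UNIV v" shows "tsum W v \<in> borel_measurable M"
  by (rule borel_measurable_LIMSEQ_metric[OF quantized_statistics(1)[OF W quantizer(1)] tsum_tendsto[OF v]])

lemma measurable_ctr [measurable]: "continuous_on UNIV v \<Longrightarrow> ctr W v \<in> borel_measurable M"
  unfolding ctr_def[abs_def] using measurable_tsum by measurable

lemma ctr_tendsto:
  assumes v: "continuous_on UNIV v" "\<And>x. cmod (v x) \<le> B" and \<omega>: "\<omega> \<in> space M"
  shows "(\<lambda>k. ctr W (\<lambda>x. v (quantizer k x)) \<omega>) \<longlonglongrightarrow> ctr W v \<omega>"
  unfolding ctr_def
proof (intro tendsto_diff tsum_tendsto v \<omega>)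
  show "(\<lambda>k. LINT \<omega>'|M. tsum W (\<lambda>x. v (quantizer k x)) \<omega>') \<longlonglongrightarrow> (LINT \<omega>'|M. tsum W v \<omega>')"
  proof (rule integral_dominated_convergence[where w = "\<lambda>\<omega>. B * npts W \<omega>"])
    show "integrable M (\<lambda>\<omega>. B * npts W \<omega>)" using integrable_npts by (rule integrable_mult_right)
    show "AE x in M. (\<lambda>k. tsum W (\<lambda>xa. v (quantizer k xa)) x) \<longlonglongrightarrow> tsum W v x"
      using tsum_tendsto[OF v(1)] by (rule AE_I2)
    show "AE x in M. norm (tsum W (\<lambda>xa. v (quantizer k xa)) x) \<le> B * npts W x" for k
      by (rule AE_I2, rule tsum_bound, rule v(2))
  qed (rule measurable_tsum[OF v(1)], rule quantized_statistics(1)[OF W quantizer(1)])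
qed

lemma ctr_bound:
  assumes v: "\<And>x. cmod (v x) \<le> B" and m: "tsum W v \<in> borel_measurable M"
  shows "cmod (ctr W v \<omega>) \<le> B * (1 + measure lborel W) * (1 + npts W \<omega>)"
proof -
  have B: "0 \<le> B" using order_trans[OF norm_ge_zero v] .
  have "integrable M (tsum W v)"
    by (rule Bochner_Integration.integrable_bound[OF integrable_mult_right[OF integrable_npts, of B] m])
      (use tsum_bound[OF v] B in \<open>auto intro!: AE_I2 simp: abs_mult\<close>)
  then have "cmod (LINT \<omega>'|M. tsum W v \<omega>') \<le> (LINT \<omega>'|M. B * npts W \<omega>')"
    by (intro order_trans[OF integral_norm_bound] integral_mono integrable_norm integrable_mult_right integrable_npts tsum_bound v)
  also have "\<dots> = B * measure lborel W" using expectation_npts[OF W] by simp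
  finally have "cmod (ctr W v \<omega>) \<le> B * npts W \<omega> + B * measure lborel W"
    unfolding ctr_def using tsum_bound[of v B W \<omega>, OF v] by (intro order_trans[OF norm_triangle_ineq4] add_mono)
  also have "\<dots> \<le> B * (1 + measure lborel W) * (1 + npts W \<omega>)"
    using B npts_nonneg[of W \<omega>] measure_nonneg[of lborel W] by (simp add: algebra_simps mult_nonneg_nonneg)
  finally show ?thesis .
qed

lemma wind_facts:
  assumes v: "continuous_on UNIV v" "\<And>x. cmod (v x) \<le> B"
  shows "wind W (\<lambda>x. v (quantizer k x)) \<in> borel_measurable borel"
    and "cmod (wind W (\<lambda>x. v (quantizer k x)) x) \<le> B * indicator W x"
    and "(\<lambda>k. wind W (\<lambda>x. v (quantizer k x)) x) \<longlonglongrightarrow> wind W v x"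
proof -
  have [measurable]: "v \<in> borel_measurable borel" "quantizer k \<in> borel_measurable borel" "W \<in> sets borel"
    using v(1) W borel_measurable_simple_function[OF quantizer(1)] by (auto intro: borel_measurable_continuous_onI)
  show "wind W (\<lambda>x. v (quantizer k x)) \<in> borel_measurable borel" unfolding wind_def by measurable
  show "cmod (wind W (\<lambda>x. v (quantizer k x)) x) \<le> B * indicator W x"
    using v(2) by (cases "x \<in> W") (simp_all add: wind_def)
  show "(\<lambda>k. wind W (\<lambda>x. v (quantizer k x)) x) \<longlonglongrightarrow> wind W v x"
    unfolding wind_def by (intro tendsto_mult tendsto_const continuous_on_tendsto_compose[OF v(1) quantizer(2)]) auto
qed

lemma corr_form_wind_tendsto:
  assumes u: "continuous_on UNIV u" "\<And>x. cmod (u x) \<le> B" and v: "continuous_on UNIV v" "\<And>x. cmod (v x) \<le> B"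
  shows "(\<lambda>k. corr_form q (wind W (\<lambda>x. u (quantizer k x))) (wind W (\<lambda>x. v (quantizer k x)))) \<longlonglongrightarrow> corr_form q (wind W u) (wind W v)"
  by (rule corr_form_tendsto[OF integrable_q W wind_facts(1)[OF u] wind_facts(1)[OF v] wind_facts(2)[OF u] wind_facts(2)[OF v] wind_facts(3)[OF u] wind_facts(3)[OF v]])

text \<open>A centered sum of a function bounded by \<open>B\<close> is at most a constant times \<open>1 + npts W\<close>, whose fourth power
  is integrable. So every continuous functional of growth at most four passes to the limit along
  the quantizers.\<close>

lemma ctr_dominated_convergence:
  fixes F :: "('i \<Rightarrow> complex) \<Rightarrow> 'c::{banach,second_countable_topology}"
  assumes v: "\<And>i. i \<in> I \<Longrightarrow> continuous_on UNIV (v i)" "\<And>i x. i \<in> I \<Longrightarrow> cmod (v i x) \<le> B"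
    and m: "\<And>f. (\<And>i. i \<in> I \<Longrightarrow> f i \<in> borel_measurable M) \<Longrightarrow> (\<lambda>\<omega>. F (\<lambda>i. f i \<omega>)) \<in> borel_measurable M"
    and lim: "\<And>z z'. (\<And>i. i \<in> I \<Longrightarrow> (\<lambda>k. z k i) \<longlonglongrightarrow> z' i) \<Longrightarrow> (\<lambda>k. F (z k)) \<longlonglongrightarrow> F z'"
    and le: "\<And>z b. 1 \<le> b \<Longrightarrow> (\<And>i. i \<in> I \<Longrightarrow> cmod (z i) \<le> B * (1 + measure lborel W) * b) \<Longrightarrow> norm (F z) \<le> C * b ^ 4"
  shows "integrable M (\<lambda>\<omega>. F (\<lambda>i. ctr W (v i) \<omega>))"
    and "(\<lambda>k. LINT \<omega>|M. F (\<lambda>i. ctr W (\<lambda>x. v i (quantizer k x)) \<omega>)) \<longlonglongrightarrow> (LINT \<omega>|M. F (\<lambda>i. ctr W (v i) \<omega>))"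
proof -
  have m1: "(\<lambda>\<omega>. F (\<lambda>i. ctr W (v i) \<omega>)) \<in> borel_measurable M"
    by (rule m) (rule measurable_ctr[OF v(1)])
  have b1: "norm (F (\<lambda>i. ctr W (v i) \<omega>)) \<le> C * (1 + npts W \<omega>) ^ 4" for \<omega>
    by (rule le) (auto intro!: ctr_bound v measurable_tsum)
  show "integrable M (\<lambda>\<omega>. F (\<lambda>i. ctr W (v i) \<omega>))"
    by (rule integrable_npts_polynomial[OF W m1 b1])
  have mq: "ctr W (\<lambda>x. v i (quantizer k x)) \<in> borel_measurable M" for i k
    unfolding ctr_def[abs_def] using quantized_statistics(1)[OF W quantizer(1)[of k], of "v i"] by measurable
  have bq: "norm (F (\<lambda>i. ctr W (\<lambda>x. v i (quantizer k x)) \<omega>)) \<le> C * (1 + npts W \<omega>) ^ 4" for \<omega> k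
    by (rule le) (auto intro!: ctr_bound v quantized_statistics(1)[OF W quantizer(1)])
  have C: "integrable M (\<lambda>\<omega>. C * (1 + npts W \<omega>) ^ 4)"
    by (rule integrable_npts_polynomial[OF W, where c="\<bar>C\<bar>"]) (use measurable_npts[OF W] in \<open>auto simp: abs_mult\<close>)
  show "(\<lambda>k. LINT \<omega>|M. F (\<lambda>i. ctr W (\<lambda>x. v i (quantizer k x)) \<omega>)) \<longlonglongrightarrow> (LINT \<omega>|M. F (\<lambda>i. ctr W (v i) \<omega>))"
  proof (rule integral_dominated_convergence[OF m1 _ C])
    show "(\<lambda>\<omega>. F (\<lambda>i. ctr W (\<lambda>x. v i (quantizer k x)) \<omega>)) \<in> borel_measurable M" for k
      by (rule m) (rule mq)
    show "AE \<omega> in M. (\<lambda>k. F (\<lambda>i. ctr W (\<lambda>x. v i (quantizer k x)) \<omega>)) \<longlonglongrightarrow> F (\<lambda>i. ctr W (v i) \<omega>)"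
      by (rule AE_I2, rule lim, rule ctr_tendsto[OF v])
    show "AE \<omega> in M. norm (F (\<lambda>i. ctr W (\<lambda>x. v i (quantizer k x)) \<omega>)) \<le> C * (1 + npts W \<omega>) ^ 4" for k
      by (rule AE_I2, rule bq)
  qed
qed

lemma sum_square_dominated:
  assumes I: "finite I" and b: "1 \<le> b" and z: "\<And>i. i \<in> I \<Longrightarrow> cmod (z i) \<le> K * b"
  shows "norm ((\<Sum>i\<in>I. (cmod (z i))\<^sup>2)\<^sup>2) \<le> (real (card I) * K\<^sup>2)\<^sup>2 * b ^ 4"
proof -
  have "(\<Sum>i\<in>I. (cmod (z i))\<^sup>2) \<le> (\<Sum>i\<in>I. (K * b)\<^sup>2)" by (intro sum_mono power_mono z) auto
  then have "(\<Sum>i\<in>I. (cmod (z i))\<^sup>2)\<^sup>2 \<le> (\<Sum>i\<in>I. (K * b)\<^sup>2)\<^sup>2" by (intro power_mono sum_nonneg) auto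
  also have "\<dots> = (real (card I) * K\<^sup>2)\<^sup>2 * b ^ 4" by (simp add: power_mult_distrib mult_ac flip: power_mult)
  finally show ?thesis by simp
qed

text \<open>Both sides are continuous along the quantizers, where they agree.\<close>

lemma second_moment:
  assumes u: "continuous_on UNIV u" "\<And>x. cmod (u x) \<le> B" and v: "continuous_on UNIV v" "\<And>x. cmod (v x) \<le> B"
  shows "(LINT \<omega>|M. ctr W u \<omega> * ctr W v \<omega>) = corr_form q (wind W u) (wind W v)"
proof -
  let ?w = "\<lambda>b. if b then u else v" and ?F = "\<lambda>z. z True * z False"
  let ?K = "B * (1 + measure lborel W)"
  have "(\<lambda>k. LINT \<omega>|M. ?F (\<lambda>i. ctr W (\<lambda>x. ?w i (quantizer k x)) \<omega>)) \<longlonglongrightarrow> (LINT \<omega>|M. ?F (\<lambda>i. ctr W (?w i) \<omega>))"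
  proof (rule ctr_dominated_convergence(2)[where I = UNIV and C = "?K\<^sup>2" and B = B])
    fix z :: "bool \<Rightarrow> complex" and b :: real assume b: "1 \<le> b" and z: "\<And>i. i \<in> UNIV \<Longrightarrow> cmod (z i) \<le> ?K * b"
    have "norm (?F z) \<le> (?K * b) * (?K * b)"
      unfolding norm_mult using z order_trans[OF norm_ge_zero z] by (intro mult_mono) auto
    also have "\<dots> = ?K\<^sup>2 * b\<^sup>2" by (simp add: power2_eq_square)
    also have "\<dots> \<le> ?K\<^sup>2 * b ^ 4" using b by (intro mult_left_mono power_increasing) auto
    finally show "norm (?F z) \<le> ?K\<^sup>2 * b ^ 4" .
  qed (auto intro: u v tendsto_mult borel_measurable_times)
  then have "(\<lambda>k. corr_form q (wind W (\<lambda>x. u (quantizer k x))) (wind W (\<lambda>x. v (quantizer k x)))) \<longlonglongrightarrow> (LINT \<omega>|M. ctr W u \<omega> * ctr W v \<omega>)"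
    by (simp add: quantized_statistics(2)[OF W quantizer(1)])
  then show ?thesis
    using corr_form_wind_tendsto[OF u v] by (rule LIMSEQ_unique)
qed

lemma cnj_ctr: "cnj (ctr W v \<omega>) = ctr W (\<lambda>x. cnj (v x)) \<omega>"
proof -
  have "(LINT \<omega>|M. (\<Sum>x\<in>\<Phi> \<omega> \<inter> W. cnj (v x))) = (LINT \<omega>|M. cnj (\<Sum>x\<in>\<Phi> \<omega> \<inter> W. v x))"
    by (simp only: cnj_sum)
  also have "\<dots> = cnj (LINT \<omega>|M. (\<Sum>x\<in>\<Phi> \<omega> \<inter> W. v x))" by (rule integral_bounded_linear'[OF bounded_linear_cnj bounded_linear_cnj]) simp
  finally show ?thesis unfolding ctr_def tsum_def complex_cnj_diff cnj_sum by (simp only:)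
qed

lemma square_moment:
  assumes u: "continuous_on UNIV u" "\<And>x. cmod (u x) \<le> B"
  shows "of_real (LINT \<omega>|M. (cmod (ctr W u \<omega>))\<^sup>2) = corr_form q (wind W u) (wind W (\<lambda>x. cnj (u x)))"
proof -
  have "complex_of_real (LINT \<omega>|M. (cmod (ctr W u \<omega>))\<^sup>2) = (LINT \<omega>|M. ctr W u \<omega> * ctr W (\<lambda>x. cnj (u x)) \<omega>)"
    unfolding integral_complex_of_real[symmetric] complex_norm_square cnj_ctr ..
  also have "\<dots> = corr_form q (wind W u) (wind W (\<lambda>x. cnj (u x)))"
    by (rule second_moment[where B=B]) (use u in \<open>auto intro!: continuous_intros\<close>)
  finally show ?thesis .
qed

lemma fourth_moment:
  assumes I: "finite I" and fin: "gamma4_red \<gamma> < \<infinity>"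
    and v: "\<And>i. i \<in> I \<Longrightarrow> continuous_on UNIV (v i)" and \<rho>: "\<And>y. (\<Sum>i\<in>I. (cmod (v i y))\<^sup>2) \<le> \<rho>"
  shows "integrable M (\<lambda>\<omega>. (\<Sum>i\<in>I. (cmod (ctr W (v i) \<omega>))\<^sup>2)\<^sup>2)"
    and "(LINT \<omega>|M. (\<Sum>i\<in>I. (cmod (ctr W (v i) \<omega>))\<^sup>2)\<^sup>2)
      \<le> (\<Sum>i\<in>I. LINT \<omega>|M. (cmod (ctr W (v i) \<omega>))\<^sup>2)\<^sup>2
      + (\<Sum>i\<in>I. \<Sum>j\<in>I. (cmod (corr_form q (wind W (v i)) (wind W (v j))))\<^sup>2
          + (cmod (corr_form q (wind W (v i)) (wind W (\<lambda>x. cnj (v j x)))))\<^sup>2)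
      + \<rho>\<^sup>2 * (cumulant_mass * measure lborel W)"
proof -
  let ?B = "sqrt \<rho>" let ?K = "?B * (1 + measure lborel W)"
  have B: "cmod (v i x) \<le> ?B" if "i \<in> I" for i x
  proof (rule real_le_rsqrt)
    have "(cmod (v i x))\<^sup>2 \<le> (\<Sum>i\<in>I. (cmod (v i x))\<^sup>2)" using I that by (intro member_le_sum) auto
    then show "(cmod (v i x))\<^sup>2 \<le> \<rho>" using \<rho>[of x] by simp
  qed
  have B0: "0 \<le> \<rho>" using order_trans[OF sum_nonneg \<rho>] by simp
  let ?F4 = "\<lambda>z. (\<Sum>i\<in>I. (cmod (z i))\<^sup>2)\<^sup>2"
  have m4: "(\<lambda>\<omega>. ?F4 (\<lambda>i. f i \<omega>)) \<in> borel_measurable M" if "\<And>i. i \<in> I \<Longrightarrow> f i \<in> borel_measurable M" for f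
    using that by measurable
  have l4: "(\<lambda>k. ?F4 (z k)) \<longlonglongrightarrow> ?F4 z'" if "\<And>i. i \<in> I \<Longrightarrow> (\<lambda>k. z k i) \<longlonglongrightarrow> z' i" for z z'
    by (intro tendsto_intros that)
  note dc4 = ctr_dominated_convergence[where F = ?F4 and C = "(real (card I) * ?K\<^sup>2)\<^sup>2", OF v B m4 l4 sum_square_dominated[OF I]]
  show "integrable M (\<lambda>\<omega>. ?F4 (\<lambda>i. ctr W (v i) \<omega>))"
    by (rule dc4(1))
  have lim4: "(\<lambda>k. LINT \<omega>|M. ?F4 (\<lambda>i. ctr W (\<lambda>x. v i (quantizer k x)) \<omega>)) \<longlonglongrightarrow> (LINT \<omega>|M. ?F4 (\<lambda>i. ctr W (v i) \<omega>))"
    by (rule dc4(2))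
  have lim2: "(\<lambda>k. LINT \<omega>|M. (cmod (ctr W (\<lambda>x. v i (quantizer k x)) \<omega>))\<^sup>2) \<longlonglongrightarrow> (LINT \<omega>|M. (cmod (ctr W (v i) \<omega>))\<^sup>2)" if i: "i \<in> I" for i
  proof (rule ctr_dominated_convergence(2)[where F = "\<lambda>z. (cmod (z i))\<^sup>2" and I = "{i}" and C = "?K\<^sup>2" and B = ?B])
    fix z :: "'a \<Rightarrow> complex" and b :: real assume b: "1 \<le> b" and z: "\<And>j. j \<in> {i} \<Longrightarrow> cmod (z j) \<le> ?K * b"
    have "(cmod (z i))\<^sup>2 \<le> (?K * b)\<^sup>2" using z by (intro power_mono) auto
    also have "\<dots> = ?K\<^sup>2 * b\<^sup>2" by (rule power_mult_distrib)
    also have "\<dots> \<le> ?K\<^sup>2 * b ^ 4" using b by (intro mult_left_mono power_increasing) auto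
    finally show "norm ((cmod (z i))\<^sup>2) \<le> ?K\<^sup>2 * b ^ 4" by simp
  next
    fix f :: "'a \<Rightarrow> 'w \<Rightarrow> complex" assume "\<And>j. j \<in> {i} \<Longrightarrow> f j \<in> borel_measurable M"
    then have [measurable]: "f i \<in> borel_measurable M" by simp
    show "(\<lambda>\<omega>. (cmod (f i \<omega>))\<^sup>2) \<in> borel_measurable M" by measurable
  qed (use i v B in \<open>auto intro!: tendsto_intros\<close>)
  show "(LINT \<omega>|M. (\<Sum>i\<in>I. (cmod (ctr W (v i) \<omega>))\<^sup>2)\<^sup>2)
      \<le> (\<Sum>i\<in>I. LINT \<omega>|M. (cmod (ctr W (v i) \<omega>))\<^sup>2)\<^sup>2
      + (\<Sum>i\<in>I. \<Sum>j\<in>I. (cmod (corr_form q (wind W (v i)) (wind W (v j))))\<^sup>2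
          + (cmod (corr_form q (wind W (v i)) (wind W (\<lambda>x. cnj (v j x)))))\<^sup>2)
      + \<rho>\<^sup>2 * (cumulant_mass * measure lborel W)"
  proof (rule LIMSEQ_le[OF lim4])
    show "(\<lambda>k. (\<Sum>i\<in>I. LINT \<omega>|M. (cmod (ctr W (\<lambda>x. v i (quantizer k x)) \<omega>))\<^sup>2)\<^sup>2
      + (\<Sum>i\<in>I. \<Sum>j\<in>I. (cmod (corr_form q (wind W (\<lambda>x. v i (quantizer k x))) (wind W (\<lambda>x. v j (quantizer k x)))))\<^sup>2
          + (cmod (corr_form q (wind W (\<lambda>x. v i (quantizer k x))) (wind W (\<lambda>x. cnj (v j (quantizer k x))))))\<^sup>2)
      + \<rho>\<^sup>2 * (cumulant_mass * measure lborel W))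
      \<longlonglongrightarrow> (\<Sum>i\<in>I. LINT \<omega>|M. (cmod (ctr W (v i) \<omega>))\<^sup>2)\<^sup>2
      + (\<Sum>i\<in>I. \<Sum>j\<in>I. (cmod (corr_form q (wind W (v i)) (wind W (v j))))\<^sup>2
          + (cmod (corr_form q (wind W (v i)) (wind W (\<lambda>x. cnj (v j x)))))\<^sup>2)
      + \<rho>\<^sup>2 * (cumulant_mass * measure lborel W)"
      by (intro tendsto_add tendsto_power tendsto_sum tendsto_norm tendsto_const lim2 corr_form_wind_tendsto[where B = ?B]
          corr_form_wind_tendsto[where B = ?B and v = "\<lambda>x. cnj (v _ x)"] continuous_on_cnj v)
        (use B in auto)
    show "\<exists>N. \<forall>k\<ge>N. (LINT \<omega>|M. ?F4 (\<lambda>i. ctr W (\<lambda>x. v i (quantizer k x)) \<omega>))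
      \<le> (\<Sum>i\<in>I. LINT \<omega>|M. (cmod (ctr W (\<lambda>x. v i (quantizer k x)) \<omega>))\<^sup>2)\<^sup>2
      + (\<Sum>i\<in>I. \<Sum>j\<in>I. (cmod (corr_form q (wind W (\<lambda>x. v i (quantizer k x))) (wind W (\<lambda>x. v j (quantizer k x)))))\<^sup>2
          + (cmod (corr_form q (wind W (\<lambda>x. v i (quantizer k x))) (wind W (\<lambda>x. cnj (v j (quantizer k x))))))\<^sup>2)
      + \<rho>\<^sup>2 * (cumulant_mass * measure lborel W)"
      using quantized_statistics(3)[OF W quantizer(1) I fin, where w = v, OF \<rho>] by blast
  qed
qed

end

end

section \<open>Mean of the spectral estimator\<close>

lemma integrable_kernel_complex:
  fixes K :: "'a::euclidean_space \<Rightarrow> complex"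
  assumes K: "integrable lborel K" and a: "sq_int a" and b: "sq_int b"
  shows "integrable (lborel \<Otimes>\<^sub>M lborel) (\<lambda>z. K (fst z - snd z) * (a (fst z) * b (snd z)))"
proof -
  have [measurable]: "a \<in> borel_measurable borel" "b \<in> borel_measurable borel" "K \<in> borel_measurable borel"
    using a b borel_measurable_integrable[OF K] by (auto simp: sq_int_def)
  show ?thesis
  proof (rule Bochner_Integration.integrable_bound[OF integrable_norm[OF integrable_kernel[OF integrable_norm[OF K] a b]]])
    show "(\<lambda>z. K (fst z - snd z) * (a (fst z) * b (snd z))) \<in> borel_measurable (lborel \<Otimes>\<^sub>M lborel)" by measurable
  qed (auto simp: norm_mult)
qed

lemma integral_difference_kernel:
  fixes K :: "'a::euclidean_space \<Rightarrow> complex"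
  assumes K: "integrable lborel K" and a: "sq_int a" and b: "sq_int b"
  shows "(LINT z|(lborel \<Otimes>\<^sub>M lborel). K (fst z - snd z) * (a (fst z) * b (snd z)))
    = (LINT w|lborel. K w * (LINT y|lborel. a (y + w) * b y))"
proof -
  have [measurable]: "a \<in> borel_measurable borel" "b \<in> borel_measurable borel" "K \<in> borel_measurable borel"
    using a b borel_measurable_integrable[OF K] by (auto simp: sq_int_def)
  have int: "integrable (lborel \<Otimes>\<^sub>M lborel) (\<lambda>(x, y). K (x - y) * (a x * b y))"
    using integrable_kernel_complex[OF K a b] by (simp add: case_prod_unfold)
  have "(LINT z|(lborel \<Otimes>\<^sub>M lborel). K (fst z - snd z) * (a (fst z) * b (snd z)))
      = (LINT y|lborel. LINT x|lborel. K (x - y) * (a x * b y))"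
    using lborel_pair.integral_snd[OF int] by (simp add: case_prod_unfold)
  also have "\<dots> = (LINT y|lborel. LINT w|lborel. K w * (a (y + w) * b y))"
  proof (rule Bochner_Integration.integral_cong[OF refl])
    fix y :: 'a
    show "(LINT x|lborel. K (x - y) * (a x * b y)) = (LINT w|lborel. K w * (a (y + w) * b y))"
      using lborel_integral_affine(1)[of 1 "\<lambda>x. K (x - y) * (a x * b y)" y] by simp
  qed
  also have "\<dots> = (LINT w|lborel. LINT y|lborel. K w * (a (y + w) * b y))"
  proof (rule lborel_pair.Fubini_integral)
    have "(\<integral>\<^sup>+z. ennreal (norm (K (fst z - snd z) * (a (fst z) * b (snd z)))) \<partial>(lborel \<Otimes>\<^sub>M lborel)) < \<infinity>"
      using integrable_kernel_complex[OF K a b] by (simp add: integrable_iff_bounded)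
    also have "(\<integral>\<^sup>+z. ennreal (norm (K (fst z - snd z) * (a (fst z) * b (snd z)))) \<partial>(lborel \<Otimes>\<^sub>M lborel))
      = (\<integral>\<^sup>+z. ennreal (norm (K (fst z - snd z))) * (ennreal (norm (a (fst z))) * ennreal (norm (b (snd z)))) \<partial>(lborel \<Otimes>\<^sub>M lborel))"
      by (simp add: norm_mult ennreal_mult)
    also have "\<dots> = (\<integral>\<^sup>+w. ennreal (norm (K w)) * (\<integral>\<^sup>+y. ennreal (norm (a (y + w))) * ennreal (norm (b y)) \<partial>lborel) \<partial>lborel)"
      by (rule nn_integral_difference_kernel) measurable
    also have "\<dots> = (\<integral>\<^sup>+w. \<integral>\<^sup>+y. ennreal (norm (K w * (a (y + w) * b y))) \<partial>lborel \<partial>lborel)"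
      by (simp add: norm_mult ennreal_mult nn_integral_cmult)
    also have "\<dots> = (\<integral>\<^sup>+z. ennreal (norm (case z of (w, y) \<Rightarrow> K w * (a (y + w) * b y))) \<partial>(lborel \<Otimes>\<^sub>M lborel))"
      by (subst lborel.nn_integral_fst[symmetric]) auto
    finally show "integrable (lborel \<Otimes>\<^sub>M lborel) (\<lambda>(w, y). K w * (a (y + w) * b y))"
      by (intro integrableI_bounded) auto
  qed
  also have "\<dots> = (LINT w|lborel. K w * (LINT y|lborel. a (y + w) * b y))"
    by simp
  finally show ?thesis .
qed

lemma integrable_tensor:
  fixes a b :: "'a::euclidean_space \<Rightarrow> complex"
  assumes a: "integrable lborel a" and b: "integrable lborel b" and [measurable]: "e \<in> borel_measurable (lborel \<Otimes>\<^sub>M lborel)" and e: "\<And>z. cmod (e z) \<le> 1"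
  shows "integrable (lborel \<Otimes>\<^sub>M lborel) (\<lambda>z. a (fst z) * b (snd z) * e z)"
proof -
  have [measurable]: "a \<in> borel_measurable borel" "b \<in> borel_measurable borel"
    using a b by (auto dest: borel_measurable_integrable)
  have fin: "(\<integral>\<^sup>+x. ennreal (cmod (a x)) \<partial>lborel) < \<infinity>" "(\<integral>\<^sup>+x. ennreal (cmod (b x)) \<partial>lborel) < \<infinity>"
    using a b by (auto simp: integrable_iff_bounded)
  have "(\<integral>\<^sup>+z. ennreal (cmod (a (fst z) * b (snd z) * e z)) \<partial>(lborel \<Otimes>\<^sub>M lborel))
     \<le> (\<integral>\<^sup>+z. ennreal (cmod (a (fst z))) * ennreal (cmod (b (snd z))) \<partial>(lborel \<Otimes>\<^sub>M lborel))"
  proof (rule nn_integral_mono)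
    fix z :: "'a \<times> 'a"
    have "cmod (a (fst z)) * cmod (b (snd z)) * cmod (e z) \<le> cmod (a (fst z)) * cmod (b (snd z)) * 1"
      by (intro mult_left_mono e) auto
    then show "ennreal (cmod (a (fst z) * b (snd z) * e z)) \<le> ennreal (cmod (a (fst z))) * ennreal (cmod (b (snd z)))"
      by (simp add: norm_mult ennreal_leI flip: ennreal_mult)
  qed
  also have "\<dots> = (\<integral>\<^sup>+x. ennreal (cmod (a x)) \<partial>lborel) * (\<integral>\<^sup>+x. ennreal (cmod (b x)) \<partial>lborel)"
    by (subst lborel.nn_integral_fst[symmetric]) (simp_all add: nn_integral_cmult nn_integral_multc)
  also have "\<dots> < \<infinity>" using fin by (simp add: ennreal_mult_less_top)
  finally show ?thesis by (intro integrableI_bounded) auto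
qed

definition plane_wave :: "real ^ 'n \<Rightarrow> real ^ 'n \<Rightarrow> complex" where
  "plane_wave k x = exp (- \<i> * of_real (k \<bullet> x))"

lemma norm_plane_wave [simp]: "cmod (plane_wave k x) = 1"
  by (simp add: plane_wave_def norm_exp_eq_Re)

lemma continuous_plane_wave [continuous_intros]: "continuous_on A (plane_wave k)"
  unfolding plane_wave_def by (intro continuous_intros)

lemma measurable_plane_wave [measurable]: "plane_wave k \<in> borel_measurable borel"
  by (intro borel_measurable_continuous_onI continuous_intros)

definition mtaper :: "real ^ 'n \<Rightarrow> real \<Rightarrow> nat ^ 'n \<Rightarrow> real ^ 'n \<Rightarrow> complex" where
  "mtaper k r i x = plane_wave k x * of_real (hermite_taper r i x)"

lemma continuous_mtaper: "continuous_on A (mtaper k r i)"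
  unfolding mtaper_def[abs_def] by (intro continuous_intros)

lemma measurable_mtaper [measurable]: "mtaper k r i \<in> borel_measurable borel"
  by (rule borel_measurable_continuous_onI[OF continuous_mtaper])

lemma cmod_mtaper: "cmod (mtaper k r i x) = \<bar>hermite_taper r i x\<bar>"
  by (simp add: mtaper_def norm_mult)

lemma mtaper_norm:
  assumes "0 < r" shows "sq_int (mtaper k r i)" "l2 (mtaper k r i) = 1"
  using hermite_taper_orthonormal[OF assms, of i i] by (simp_all add: sq_int_def l2_def cmod_mtaper power2_eq_square)

lemma plane_wave_cnj: "plane_wave k x * cnj (plane_wave k y) = plane_wave k (x - y)"
  by (simp add: plane_wave_def exp_cnj exp_add[symmetric] inner_diff_right algebra_simps)

context point_process
begin

definition sfac :: "real ^ 'n \<Rightarrow> complex" where "sfac = structure_factor 1 g"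

lemma integrable_q_wave: "integrable lborel (\<lambda>x. of_real (q x) * plane_wave k x)"
  by (rule Bochner_Integration.integrable_bound[OF integrable_norm[OF integrable_q]]) (auto simp: norm_mult)

lemma sfac_eq: "sfac k = 1 + (LINT x|lborel. of_real (q x) * plane_wave k x)"
proof -
  have gm: "g \<in> borel_measurable borel"
    using standing by (simp add: standing_assumption_def has_pair_correlation_def)
  have "(LINT x|lborel. of_real (g x - 1) * exp (- \<i> * of_real (k \<bullet> x))) = (LINT x|lborel. of_real (q x) * plane_wave k x)"
  proof (rule integral_cong_AE)
    show "AE x in lborel. of_real (g x - 1) * exp (- \<i> * of_real (k \<bullet> x)) = of_real (q x) * plane_wave k x"
      using q_AE by eventually_elim (simp add: plane_wave_def)
  qed (use gm in measurable)
  then show ?thesis by (simp add: sfac_def structure_factor_def)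
qed

lemma sfac_bound: "cmod (sfac k) \<le> 1 + (LINT x|lborel. \<bar>q x\<bar>)"
proof -
  have "cmod (LINT x|lborel. of_real (q x) * plane_wave k x) \<le> (LINT x|lborel. \<bar>q x\<bar>)"
    using integral_norm_bound[of lborel "\<lambda>x. of_real (q x) * plane_wave k x"] by (simp add: norm_mult)
  then show ?thesis unfolding sfac_eq by (intro order_trans[OF norm_triangle_ineq]) simp
qed

lemma sfac_tendsto:
  assumes "k \<longlonglongrightarrow> k0" shows "(\<lambda>n. sfac (k n)) \<longlonglongrightarrow> sfac k0"
  unfolding sfac_eq
proof (intro tendsto_add tendsto_const integral_dominated_convergence[where w = "\<lambda>x. \<bar>q x\<bar>"])
  show "AE x in lborel. (\<lambda>n. of_real (q x) * plane_wave (k n) x) \<longlonglongrightarrow> of_real (q x) * plane_wave k0 x"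
    unfolding plane_wave_def by (intro AE_I2 tendsto_intros assms)
  show "integrable lborel (\<lambda>x. \<bar>q x\<bar>)" using integrable_q by simp
qed (auto simp: norm_mult)

lemma continuous_sfac: "continuous_on UNIV sfac"
  unfolding continuous_on_sequentially using sfac_tendsto by (auto simp: comp_def)

lemma measurable_sfac [measurable]: "sfac \<in> borel_measurable borel"
  by (rule borel_measurable_continuous_onI[OF continuous_sfac])

lemma integrable_sfac_average:
  "integrable lborel (\<lambda>\<xi>. complex_of_real ((hermite_fun i \<xi>)\<^sup>2) * sfac (k - c *\<^sub>R \<xi>))"
proof (rule Bochner_Integration.integrable_bound)
  let ?C = "1 + (LINT x|lborel. \<bar>q x\<bar>)"
  show "integrable lborel (\<lambda>\<xi>. (hermite_fun i \<xi>)\<^sup>2 * ?C)"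
    by (rule integrable_mult_left[OF hermite_fun_square_integral(1)])
  show "AE \<xi> in lborel. norm (complex_of_real ((hermite_fun i \<xi>)\<^sup>2) * sfac (k - c *\<^sub>R \<xi>)) \<le> norm ((hermite_fun i \<xi>)\<^sup>2 * ?C)"
  proof (rule AE_I2)
    fix \<xi>
    have "(hermite_fun i \<xi>)\<^sup>2 * cmod (sfac (k - c *\<^sub>R \<xi>)) \<le> (hermite_fun i \<xi>)\<^sup>2 * \<bar>?C\<bar>"
      by (intro mult_left_mono order_trans[OF sfac_bound abs_ge_self]) simp
    then show "norm (complex_of_real ((hermite_fun i \<xi>)\<^sup>2) * sfac (k - c *\<^sub>R \<xi>)) \<le> norm ((hermite_fun i \<xi>)\<^sup>2 * ?C)"
      unfolding norm_mult norm_of_real real_norm_def by simp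
  qed
qed measurable

text \<open>The spectral measure of a Hermite taper is a rescaled squared Hermite function, because the
  autocorrelation of a Hermite function is the Fourier transform of its square.\<close>

lemma corr_form_mtaper:
  assumes r: "0 < r"
  shows "corr_form q (mtaper k r i) (\<lambda>x. cnj (mtaper k r i x))
    = (LINT \<xi>|lborel. of_real ((hermite_fun i \<xi>)\<^sup>2) * sfac (k - (1 / r) *\<^sub>R \<xi>))"
proof -
  let ?f = "\<lambda>x. complex_of_real (hermite_taper r i x)"
  let ?H = "\<lambda>\<xi>. complex_of_real ((hermite_fun i \<xi>)\<^sup>2)"
  have f: "sq_int ?f"
    using mtaper_norm(1)[OF r, of 0 i] by (simp add: mtaper_def[abs_def] plane_wave_def)
  have H: "integrable lborel ?H" "(LINT \<xi>|lborel. ?H \<xi>) = 1"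
    by (rule integrable_of_real[OF hermite_fun_square_integral(1)])
      (simp only: integral_complex_of_real hermite_fun_square_integral(2) of_real_1)
  have "(LINT x|lborel. mtaper k r i x * cnj (mtaper k r i x)) = (LINT x|lborel. complex_of_real (hermite_taper r i x * hermite_taper r i x))"
    by (simp add: complex_norm_square[symmetric] cmod_mtaper power2_eq_square del: of_real_mult)
  also have "\<dots> = 1" unfolding integral_complex_of_real by (simp add: hermite_taper_orthonormal[OF r])
  finally have 1: "(LINT x|lborel. mtaper k r i x * cnj (mtaper k r i x)) = 1" .
  have "(LINT z|(lborel \<Otimes>\<^sub>M lborel). of_real (q (fst z - snd z)) * (mtaper k r i (fst z) * cnj (mtaper k r i (snd z))))
    = (LINT z|(lborel \<Otimes>\<^sub>M lborel). (of_real (q (fst z - snd z)) * plane_wave k (fst z - snd z)) * (?f (fst z) * ?f (snd z)))"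
    by (simp add: mtaper_def plane_wave_cnj[symmetric] mult_ac)
  also have "\<dots> = (LINT w|lborel. (of_real (q w) * plane_wave k w) * (LINT y|lborel. ?f (y + w) * ?f y))"
    by (rule integral_difference_kernel[OF integrable_q_wave f f])
  also have "\<dots> = (LINT w|lborel. LINT \<xi>|lborel. of_real (q w) * plane_wave k w * (?H \<xi> * exp (\<i> * of_real (w \<bullet> \<xi> / r))))"
  proof (rule Bochner_Integration.integral_cong[OF refl])
    fix w
    have "(LINT y|lborel. ?f (y + w) * ?f y) = (LINT \<xi>|lborel. ?H \<xi> * exp (\<i> * of_real (w \<bullet> \<xi> / r)))"
      unfolding of_real_mult[symmetric] integral_complex_of_real by (rule hermite_taper_autocorr[OF r])
    then show "(of_real (q w) * plane_wave k w) * (LINT y|lborel. ?f (y + w) * ?f y)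
      = (LINT \<xi>|lborel. of_real (q w) * plane_wave k w * (?H \<xi> * exp (\<i> * of_real (w \<bullet> \<xi> / r))))"
      by (simp only: integral_mult_right_zero)
  qed
  also have "\<dots> = (LINT \<xi>|lborel. LINT w|lborel. of_real (q w) * plane_wave k w * (?H \<xi> * exp (\<i> * of_real (w \<bullet> \<xi> / r))))"
  proof (rule lborel_pair.Fubini_integral[symmetric])
    have "integrable (lborel \<Otimes>\<^sub>M lborel) (\<lambda>z. (of_real (q (fst z)) * plane_wave k (fst z)) * ?H (snd z) * exp (\<i> * of_real (fst z \<bullet> snd z / r)))"
      by (rule integrable_tensor[OF integrable_q_wave H(1)]) (simp_all del: of_real_divide)
    then show "integrable (lborel \<Otimes>\<^sub>M lborel) (\<lambda>(w, \<xi>). of_real (q w) * plane_wave k w * (?H \<xi> * exp (\<i> * of_real (w \<bullet> \<xi> / r))))"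
      by (simp add: case_prod_unfold mult.assoc)
  qed
  also have "\<dots> = (LINT \<xi>|lborel. ?H \<xi> * (sfac (k - (1 / r) *\<^sub>R \<xi>) - 1))"
  proof (rule Bochner_Integration.integral_cong[OF refl])
    fix \<xi>
    have "plane_wave k w * exp (\<i> * of_real (w \<bullet> \<xi> / r)) = plane_wave (k - (1 / r) *\<^sub>R \<xi>) w" for w
      by (simp add: plane_wave_def exp_add[symmetric] inner_diff_left inner_commute algebra_simps)
    moreover have "a * p * (h * e) = h * (a * (p * e))" for a p h e :: complex by simp
    ultimately have "of_real (q w) * plane_wave k w * (?H \<xi> * exp (\<i> * of_real (w \<bullet> \<xi> / r))) = ?H \<xi> * (of_real (q w) * plane_wave (k - (1 / r) *\<^sub>R \<xi>) w)" for w
      by (simp only:)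
    then show "(LINT w|lborel. of_real (q w) * plane_wave k w * (?H \<xi> * exp (\<i> * of_real (w \<bullet> \<xi> / r)))) = ?H \<xi> * (sfac (k - (1 / r) *\<^sub>R \<xi>) - 1)"
      by (simp only: integral_mult_right_zero sfac_eq add_diff_cancel_left')
  qed
  also have "\<dots> = (LINT \<xi>|lborel. ?H \<xi> * sfac (k - (1 / r) *\<^sub>R \<xi>) - ?H \<xi>)"
    by (simp add: algebra_simps)
  also have "\<dots> = (LINT \<xi>|lborel. ?H \<xi> * sfac (k - (1 / r) *\<^sub>R \<xi>)) - 1"
  proof -
    have "integrable lborel (\<lambda>\<xi>. ?H \<xi> * sfac (k - (1 / r) *\<^sub>R \<xi>))" by (rule integrable_sfac_average)
    then show ?thesis using H by simp
  qed
  finally show ?thesis unfolding corr_form_def 1 by simp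
qed

text \<open>The form is bounded, so replacing the taper by its windowed version in either argument costs at most
  the norm of the part that is cut off.\<close>

lemma corr_form_wind_mtaper:
  assumes r: "0 < r" and W: "W \<in> sets borel"
    and tail: "(LINT x|lborel. indicator (- W) x * (hermite_taper r i x)\<^sup>2) \<le> \<delta>"
  shows "cmod (corr_form q (wind W (mtaper k r i)) (\<lambda>x. cnj (wind W (mtaper k r i) x))
      - corr_form q (mtaper k r i) (\<lambda>x. cnj (mtaper k r i x))) \<le> 2 * (1 + (LINT x|lborel. \<bar>q x\<bar>)) * sqrt \<delta>"
proof -
  note [measurable] = W
  let ?v = "mtaper k r i" let ?h = "wind W ?v" let ?t = "wind (- W) ?v"
  have split: "?v = (\<lambda>x. ?h x + ?t x)" by (auto simp: wind_def indicator_def fun_eq_iff)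
  have v: "sq_int ?v" by (rule mtaper_norm(1)[OF r])
  have h: "sq_int ?h" and t: "sq_int ?t" using W by (auto intro: sq_int_wind(1)[OF _ v])
  have l2h: "l2 ?h \<le> 1" using sq_int_wind(2)[OF W v] by (simp add: mtaper_norm(2)[OF r])
  have l2t: "l2 ?t \<le> sqrt \<delta>"
  proof -
    have "(cmod (?t x))\<^sup>2 = indicator (- W) x * (hermite_taper r i x)\<^sup>2" for x
      by (cases "x \<in> W") (simp_all add: wind_def cmod_mtaper)
    then show ?thesis using tail unfolding l2_def by simp
  qed
  have two: "(\<Sum>j\<in>(UNIV::bool set). F j) = F True + F False" for F :: "bool \<Rightarrow> complex"
    by (simp add: UNIV_bool)
  let ?w = "\<lambda>j::bool. if j then ?h else ?t"
  have sw: "sq_int (?w j)" for j using h t by simp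
  have L: "corr_form q ?v (\<lambda>x. cnj (?v x)) = corr_form q ?h (\<lambda>x. cnj (?v x)) + corr_form q ?t (\<lambda>x. cnj (?v x))"
  proof -
    have "corr_form q (\<lambda>x. \<Sum>j\<in>UNIV. 1 * ?w j x) (\<lambda>x. cnj (?v x)) = (\<Sum>j\<in>UNIV. 1 * corr_form q (?w j) (\<lambda>x. cnj (?v x)))"
      by (rule corr_form_sum_left[OF integrable_q]) (use v sw in \<open>auto simp: sq_int_cnj\<close>)
    then show ?thesis unfolding two using split by simp
  qed
  have R: "corr_form q ?h (\<lambda>x. cnj (?v x)) = corr_form q ?h (\<lambda>x. cnj (?h x)) + corr_form q ?h (\<lambda>x. cnj (?t x))"
  proof -
    have "corr_form q ?h (\<lambda>x. \<Sum>j\<in>UNIV. 1 * cnj (?w j x)) = (\<Sum>j\<in>UNIV. 1 * corr_form q ?h (\<lambda>x. cnj (?w j x)))"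
      by (rule corr_form_sum_right[OF integrable_q h]) (use sw in \<open>auto simp: sq_int_cnj\<close>)
    then show ?thesis unfolding two using arg_cong[OF split, of "\<lambda>f x. cnj (f x)"] by simp
  qed
  let ?Q = "1 + (LINT x|lborel. \<bar>q x\<bar>)"
  have Q: "0 \<le> ?Q" by (intro add_nonneg_nonneg integral_nonneg_AE) auto
  have \<delta>: "0 \<le> sqrt \<delta>" by (rule order_trans[OF l2_nonneg l2t])
  have "cmod (corr_form q ?t (\<lambda>x. cnj (?v x))) \<le> ?Q * (l2 ?t * l2 (\<lambda>x. cnj (?v x)))"
    by (rule corr_form_bound[OF integrable_q t]) (simp add: sq_int_cnj v)
  also have "\<dots> \<le> ?Q * (sqrt \<delta> * 1)"
    unfolding l2_cnj mtaper_norm(2)[OF r] by (intro mult_left_mono mult_right_mono l2t Q) simp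
  finally have T1: "cmod (corr_form q ?t (\<lambda>x. cnj (?v x))) \<le> ?Q * sqrt \<delta>" by simp
  have "cmod (corr_form q ?h (\<lambda>x. cnj (?t x))) \<le> ?Q * (l2 ?h * l2 (\<lambda>x. cnj (?t x)))"
    by (rule corr_form_bound[OF integrable_q h]) (simp add: sq_int_cnj t)
  also have "\<dots> \<le> ?Q * (1 * sqrt \<delta>)"
    unfolding l2_cnj by (intro mult_left_mono mult_mono l2t l2h Q) simp_all
  finally have T2: "cmod (corr_form q ?h (\<lambda>x. cnj (?t x))) \<le> ?Q * sqrt \<delta>" by simp
  have "corr_form q ?h (\<lambda>x. cnj (?h x)) - corr_form q ?v (\<lambda>x. cnj (?v x)) = - corr_form q ?t (\<lambda>x. cnj (?v x)) - corr_form q ?h (\<lambda>x. cnj (?t x))"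
    unfolding L R by simp
  moreover have "cmod (- a - b) \<le> 2 * x" if "cmod a \<le> x" "cmod b \<le> x" for a b x
    using norm_triangle_ineq4[of "- a" b] that by simp
  ultimately show ?thesis using T1 T2 by (simp only: mult.assoc)
qed

end

section \<open>Smoothness of the structure factor\<close>

lemma frechet_derivative_partial:
  fixes f :: "real ^ 'n \<Rightarrow> real"
  assumes "f differentiable (at y)"
  shows "frechet_derivative f (at y) x = (\<Sum>s\<in>UNIV. x $ s * partial_deriv s f y)"
proof -
  have lin: "linear (frechet_derivative f (at y))"
    using assms by (simp add: frechet_derivative_works has_derivative_linear)
  have "x = (\<Sum>s\<in>UNIV. x $ s *\<^sub>R axis s 1)"
    by (simp add: basis_expansion flip: scalar_mult_eq_scaleR)
  then have "frechet_derivative f (at y) x = frechet_derivative f (at y) (\<Sum>s\<in>UNIV. x $ s *\<^sub>R axis s 1)" by simp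
  also have "\<dots> = (\<Sum>s\<in>UNIV. x $ s * partial_deriv s f y)"
    by (simp add: linear_sum[OF lin] linear_scale[OF lin] partial_deriv_def)
  finally show ?thesis .
qed

text \<open>For \<open>\<beta> \<le> 1\<close> both first differences are small. For \<open>\<beta> > 1\<close> the mean value theorem along
  \<open>t \<mapsto> f (k + t x) + f (k - t x)\<close> produces a difference of two gradients at distance at most
  \<open>2 * norm x\<close>, because the first order terms cancel.\<close>

lemma Holder_symmetric_difference:
  fixes f :: "real ^ 'n \<Rightarrow> real"
  assumes f: "f \<in> Holder_class \<beta> L" and \<beta>: "0 < \<beta>" "\<beta> \<le> 2" and L: "0 < L"
  shows "\<bar>(f (k + x) + f (k - x)) / 2 - f k\<bar> \<le> 2 * real CARD('n) * L * norm x powr \<beta>"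
proof (cases "\<beta> \<le> 1")
  case True
  have "(GREATEST l::nat. real l < \<beta>) = 0"
    by (rule Greatest_equality) (use \<beta> True in auto)
  then have H: "\<bar>f a - f b\<bar> \<le> L * norm (a - b) powr \<beta>" for a b
    using f unfolding Holder_class_def by (simp add: Let_def)
  have "\<bar>f (k + x) - f k\<bar> \<le> L * norm x powr \<beta>" "\<bar>f (k - x) - f k\<bar> \<le> L * norm x powr \<beta>"
    using H[of "k + x" k] H[of "k - x" k] by simp_all
  moreover have "\<bar>(a + b) / 2 - c\<bar> \<le> m" if "\<bar>a - c\<bar> \<le> m" "\<bar>b - c\<bar> \<le> m" for a b c m :: real
  proof -
    from that have "a - c \<le> m" "c - a \<le> m" "b - c \<le> m" "c - b \<le> m" by linarith+
    then show ?thesis by (intro abs_leI; simp add: field_simps)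
  qed
  ultimately have "\<bar>(f (k + x) + f (k - x)) / 2 - f k\<bar> \<le> 1 * (L * norm x powr \<beta>)" by simp
  also have "\<dots> \<le> (2 * real CARD('n)) * (L * norm x powr \<beta>)"
  proof (intro mult_right_mono)
    have "1 \<le> CARD('n)" by (simp add: Suc_le_eq)
    then have "1 \<le> real CARD('n)" by simp
    then show "1 \<le> 2 * real CARD('n)" by linarith
  qed (use L in auto)
  finally show ?thesis by (simp add: mult.assoc)
next
  case False
  have "(GREATEST l::nat. real l < \<beta>) = 1"
    by (rule Greatest_equality) (use \<beta> False in auto)
  then have td: "times_differentiable (Suc 0) f"
    and H: "\<And>ss a b. length ss = Suc 0 \<Longrightarrow> \<bar>foldr partial_deriv ss f a - foldr partial_deriv ss f b\<bar> \<le> L * norm (a - b) powr (\<beta> - 1)"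
    using f unfolding Holder_class_def by (simp_all add: Let_def)
  have diff: "f differentiable (at y)" for y using td by simp
  have Hp: "\<bar>partial_deriv s f a - partial_deriv s f b\<bar> \<le> L * norm (a - b) powr (\<beta> - 1)" for s a b
    using H[of "[s]" a b] by simp
  let ?D = "\<lambda>y. frechet_derivative f (at y)"
  let ?\<phi> = "\<lambda>t::real. f (k + t *\<^sub>R x) + f (k - t *\<^sub>R x)"
  have der: "(?\<phi> has_real_derivative (?D (k + t *\<^sub>R x) x - ?D (k - t *\<^sub>R x) x)) (at t)" for t
  proof -
    have fd: "(f has_derivative ?D y) (at y)" for y using diff by (simp add: frechet_derivative_works[symmetric])
    have lin: "linear (?D y)" for y using fd by (rule has_derivative_linear)
    have 1: "((\<lambda>t. f (k + t *\<^sub>R x)) has_derivative (\<lambda>h. ?D (k + t *\<^sub>R x) (h *\<^sub>R x))) (at t)"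
      by (rule has_derivative_compose[OF _ fd, where f="\<lambda>t. k + t *\<^sub>R x"]) (auto intro!: derivative_eq_intros)
    have 2: "((\<lambda>t. f (k - t *\<^sub>R x)) has_derivative (\<lambda>h. ?D (k - t *\<^sub>R x) (- (h *\<^sub>R x)))) (at t)"
      by (rule has_derivative_compose[OF _ fd, where f="\<lambda>t. k - t *\<^sub>R x"]) (auto intro!: derivative_eq_intros)
    show ?thesis
      unfolding has_field_derivative_def
      by (rule has_derivative_eq_rhs[OF has_derivative_add[OF 1 2]])
        (auto simp: linear_scale[OF lin] linear_neg[OF lin] algebra_simps)
  qed
  \<comment> \<open>The two points of evaluation are \<open>2 * t * norm x\<close> apart.\<close>
  obtain t where t: "0 < t" "t < 1" and mvt: "?\<phi> 1 - ?\<phi> 0 = (1 - 0) * (?D (k + t *\<^sub>R x) x - ?D (k - t *\<^sub>R x) x)"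
    using MVT2[of 0 1 ?\<phi> "\<lambda>t. ?D (k + t *\<^sub>R x) x - ?D (k - t *\<^sub>R x) x"] der by auto
  have nrm: "norm ((k + t *\<^sub>R x) - (k - t *\<^sub>R x)) powr (\<beta> - 1) \<le> 2 * norm x powr (\<beta> - 1)"
  proof -
    have "(k + t *\<^sub>R x) - (k - t *\<^sub>R x) = (2 * t) *\<^sub>R x" by (simp add: scaleR_left_distrib[of t t, simplified mult_2[symmetric]])
    then have "norm ((k + t *\<^sub>R x) - (k - t *\<^sub>R x)) \<le> 2 * norm x" using t by (simp add: mult_left_le_one_le)
    then have "norm ((k + t *\<^sub>R x) - (k - t *\<^sub>R x)) powr (\<beta> - 1) \<le> (2 * norm x) powr (\<beta> - 1)"
      using False by (intro powr_mono2) auto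
    also have "\<dots> = 2 powr (\<beta> - 1) * norm x powr (\<beta> - 1)" by (simp add: powr_mult)
    also have "\<dots> \<le> 2 powr 1 * norm x powr (\<beta> - 1)" using \<beta> by (intro mult_right_mono powr_mono) auto
    finally show ?thesis by simp
  qed
  have "\<bar>?\<phi> 1 - ?\<phi> 0\<bar> = \<bar>\<Sum>s\<in>UNIV. x $ s * (partial_deriv s f (k + t *\<^sub>R x) - partial_deriv s f (k - t *\<^sub>R x))\<bar>"
    unfolding mvt frechet_derivative_partial[OF diff] by (simp add: sum_subtractf right_diff_distrib)
  also have "\<dots> \<le> (\<Sum>s\<in>UNIV. \<bar>x $ s\<bar> * \<bar>partial_deriv s f (k + t *\<^sub>R x) - partial_deriv s f (k - t *\<^sub>R x)\<bar>)"
    by (rule order_trans[OF sum_abs]) (simp add: abs_mult)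
  also have "\<dots> \<le> (\<Sum>s\<in>(UNIV::'n set). norm x * (L * (2 * norm x powr (\<beta> - 1))))"
  proof (intro sum_mono mult_mono)
    fix s
    show "\<bar>x $ s\<bar> \<le> norm x" by (rule component_le_norm_cart)
    show "\<bar>partial_deriv s f (k + t *\<^sub>R x) - partial_deriv s f (k - t *\<^sub>R x)\<bar> \<le> L * (2 * norm x powr (\<beta> - 1))"
      using L by (intro order_trans[OF Hp] mult_left_mono nrm) auto
  qed auto
  also have "\<dots> = 2 * real CARD('n) * L * (norm x * norm x powr (\<beta> - 1))" by simp
  also have "norm x * norm x powr (\<beta> - 1) = norm x powr \<beta>"
  proof (cases "x = 0")
    case False
    then show ?thesis using powr_add[of "norm x" 1 "\<beta> - 1"] by simp
  qed (use \<beta> in simp)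
  finally have le: "\<bar>?\<phi> 1 - ?\<phi> 0\<bar> \<le> 2 * real CARD('n) * L * norm x powr \<beta>" .
  have half: "\<bar>p / 2 - c\<bar> \<le> m" if "\<bar>p - 2 * c\<bar> \<le> m" for p c m :: real
  proof -
    from that have "p - 2 * c \<le> m" "2 * c - p \<le> m" by linarith+
    then show ?thesis by (intro abs_leI; simp add: field_simps)
  qed
  have "\<bar>(f (k + x) + f (k - x)) - 2 * f k\<bar> \<le> 2 * real CARD('n) * L * norm x powr \<beta>"
  proof -
    have "?\<phi> 1 - ?\<phi> 0 = (f (k + x) + f (k - x)) - 2 * f k" by simp
    with le show ?thesis by (simp only:)
  qed
  then show ?thesis by (rule half)
qed

text \<open>Interpolates the power \<open>\<beta> \<le> 2\<close> between the powers \<open>0\<close> and \<open>2\<close> at the scale \<open>M\<close>, so that second moments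
  of Hermite functions control it.\<close>

lemma powr_le_second_moment:
  fixes t M \<beta> :: real
  assumes "0 \<le> t" "0 < M" "0 < \<beta>" "\<beta> \<le> 2"
  shows "t powr \<beta> \<le> M powr \<beta> * (1 + t\<^sup>2 / M\<^sup>2)"
proof -
  have "(t / M) powr \<beta> \<le> 1 + (t / M)\<^sup>2"
  proof (cases "t / M \<le> 1")
    case True
    then have "(t / M) powr \<beta> \<le> 1 powr \<beta>" using assms by (intro powr_mono2) auto
    then have "(t / M) powr \<beta> \<le> 1" by simp
    moreover have "0 \<le> (t / M)\<^sup>2" by (rule zero_le_power2)
    ultimately show ?thesis by linarith
  next
    case False
    then have "(t / M) powr \<beta> \<le> (t / M) powr 2" using assms by (intro powr_mono) auto
    then show ?thesis using False assms by (simp add: powr_numeral)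
  qed
  then have "M powr \<beta> * (t / M) powr \<beta> \<le> M powr \<beta> * (1 + t\<^sup>2 / M\<^sup>2)"
    by (intro mult_left_mono) (simp_all add: power_divide)
  moreover have "M powr \<beta> * (t / M) powr \<beta> = t powr \<beta>"
    using assms by (simp add: powr_mult[symmetric])
  ultimately show ?thesis by simp
qed

context point_process
begin

lemma cmod_mtaper_le:
  fixes x k :: "real ^ 'n"
  assumes "0 < r" "i \<in> taper_indices N"
  shows "cmod (mtaper k r i x) \<le> sqrt ((sqrt (2 * real N) / r) ^ CARD('n))"
proof (rule real_le_rsqrt)
  have "(cmod (mtaper k r i x))\<^sup>2 \<le> (\<Sum>i\<in>taper_indices N. (hermite_taper r i x)\<^sup>2)"
    unfolding cmod_mtaper power2_abs using assms by (intro member_le_sum) auto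
  also note sum_hermite_taper_square_le[OF assms(1)]
  finally show "(cmod (mtaper k r i x))\<^sup>2 \<le> (sqrt (2 * real N) / r) ^ CARD('n)" .
qed

lemma cnj_wind: "(\<lambda>x. cnj (wind W u x)) = wind W (\<lambda>x. cnj (u x))"
  by (simp add: wind_def fun_eq_iff)

lemma window_facts: "window R \<in> sets (borel :: (real ^ 'n) measure)" "bounded (window R :: (real ^ 'n) set)"
  by (simp_all add: window_def)

text \<open>A bound for the structure factor and for the covariance form on \<open>L\<^sup>2\<close>.\<close>

definition Qnorm :: real where "Qnorm = 1 + (LINT x|lborel. \<bar>q x\<bar>)"

lemma Qnorm_ge_1: "1 \<le> Qnorm" by (simp add: Qnorm_def)

text \<open>The error of windowing a taper: twice the norm of the form times the norm of the part cut off.\<close>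

definition tail_bound :: "real \<Rightarrow> nat \<Rightarrow> real" where
  "tail_bound \<theta> N = 2 * Qnorm * sqrt (2 * real CARD('n) * exp (- (real N powr (3 * \<theta> / 2)) / 12))"

lemma mean_square_taper:
  assumes i: "i \<in> taper_indices N" and \<theta>: "0 < \<theta>" "\<theta> < 2 / 3" and r: "0 < r" "r * hermite_cutoff \<theta> N \<le> R"
  shows "cmod (of_real (LINT \<omega>|M. (cmod (ctr (window R) (mtaper k r i) \<omega>))\<^sup>2)
      - (LINT \<xi>|lborel. of_real ((hermite_fun i \<xi>)\<^sup>2) * sfac (k - (1 / r) *\<^sub>R \<xi>))) \<le> tail_bound \<theta> N"
proof -
  have "of_real (LINT \<omega>|M. (cmod (ctr (window R) (mtaper k r i) \<omega>))\<^sup>2)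
      = corr_form q (wind (window R) (mtaper k r i)) (\<lambda>x. cnj (wind (window R) (mtaper k r i) x))"
    unfolding cnj_wind by (rule square_moment[OF window_facts continuous_mtaper cmod_mtaper_le[OF r(1) i]])
  then show ?thesis
    using corr_form_wind_mtaper[OF r(1) window_facts(1) hermite_taper_tail[OF i \<theta> r], of k]
    unfolding corr_form_mtaper[OF r(1)] tail_bound_def Qnorm_def by simp
qed

lemma tail_bound_tendsto: "0 < \<theta> \<Longrightarrow> (\<lambda>m. tail_bound \<theta> m) \<longlonglongrightarrow> 0"
proof -
  assume "0 < \<theta>"
  then have p: "0 < 3 * \<theta> / 2" by simp
  have "(\<lambda>m. sqrt (exp (- (real m powr p) / 12))) \<longlonglongrightarrow> 0" if "0 < p" for p
    using that by real_asymp
  from tendsto_mult_right_zero[OF this[OF p], of "2 * Qnorm * sqrt (2 * real CARD('n))"]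
  show ?thesis unfolding tail_bound_def real_sqrt_mult[of "2 * real CARD('n)"] by (simp only: mult.assoc)
qed

text \<open>Averages of the structure factor against spectral measures of tapers are limits of second
  moments, hence real; the averages concentrate as the tapers get wider.\<close>

lemma sfac_real: "Im (sfac k) = 0"
proof -
  let ?i = "0 :: nat ^ 'n" let ?H = "\<lambda>\<xi>. complex_of_real ((hermite_fun ?i \<xi>)\<^sup>2)"
  \<comment> \<open>The taper of index \<open>0\<close> at scale \<open>Suc m\<close>, windowed at the cutoff for \<open>Suc m\<close> tapers; any exponent in
    \<open>(0, 2 / 3)\<close> makes the windowing error vanish.\<close>
  let ?J = "\<lambda>m::nat. LINT \<xi>|lborel. ?H \<xi> * sfac (k - (1 / real (Suc m)) *\<^sub>R \<xi>)"
  have Hint: "(LINT \<xi>|lborel. ?H \<xi> * sfac k) = sfac k"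
  proof -
    have "(LINT \<xi>|lborel. ?H \<xi> * sfac k) = (LINT \<xi>|lborel. ?H \<xi>) * sfac k" by (rule integral_mult_left_zero)
    also have "(LINT \<xi>|lborel. ?H \<xi>) = 1" by (simp only: integral_complex_of_real hermite_fun_square_integral of_real_1)
    finally show ?thesis by simp
  qed
  have "?J \<longlonglongrightarrow> (LINT \<xi>|lborel. ?H \<xi> * sfac k)"
  proof (rule integral_dominated_convergence[where w = "\<lambda>\<xi>. (hermite_fun ?i \<xi>)\<^sup>2 * Qnorm"])
    show "integrable lborel (\<lambda>\<xi>. (hermite_fun ?i \<xi>)\<^sup>2 * Qnorm)"
      by (rule integrable_mult_left[OF hermite_fun_square_integral(1)])
    show "AE \<xi> in lborel. norm (?H \<xi> * sfac (k - (1 / real (Suc m)) *\<^sub>R \<xi>)) \<le> (hermite_fun ?i \<xi>)\<^sup>2 * Qnorm" for m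
      unfolding norm_mult norm_of_real Qnorm_def by (intro AE_I2 mult_mono sfac_bound) auto
    have "(\<lambda>m. 1 / real (Suc m)) \<longlonglongrightarrow> 0" by real_asymp
    then have "(\<lambda>m. k - (1 / real (Suc m)) *\<^sub>R \<xi>) \<longlonglongrightarrow> k - 0 *\<^sub>R \<xi>" for \<xi> by (intro tendsto_intros)
    then show "AE \<xi> in lborel. (\<lambda>m. ?H \<xi> * sfac (k - (1 / real (Suc m)) *\<^sub>R \<xi>)) \<longlonglongrightarrow> ?H \<xi> * sfac k"
      by (intro AE_I2 tendsto_mult tendsto_const sfac_tendsto) simp
  qed measurable
  then have "(\<lambda>m. Im (?J m)) \<longlonglongrightarrow> Im (sfac k)" unfolding Hint by (rule tendsto_Im)
  moreover have "(\<lambda>m. Im (?J m)) \<longlonglongrightarrow> 0"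
  proof (rule Lim_null_comparison)
    show "(\<lambda>m. tail_bound (1 / 3) (Suc m)) \<longlonglongrightarrow> 0"
      using tail_bound_tendsto[of "1 / 3"] by (rule LIMSEQ_Suc) simp
    have "norm (Im (?J m)) \<le> tail_bound (1 / 3) (Suc m)" for m
    proof -
      let ?N = "Suc m" let ?R = "real (Suc m) * hermite_cutoff (1 / 3) (Suc m)"
      have i: "?i \<in> taper_indices ?N" by (simp add: taper_indices_eq)
      let ?e = "complex_of_real (LINT \<omega>|M. (cmod (ctr (window ?R) (mtaper k (real (Suc m)) ?i) \<omega>))\<^sup>2)"
      have le: "cmod (?e - ?J m) \<le> tail_bound (1 / 3) (Suc m)"
        by (rule mean_square_taper[OF i]) auto
      have "Im (?J m) = - Im (?e - ?J m)" by simp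
      then have "\<bar>Im (?J m)\<bar> \<le> cmod (?e - ?J m)" using abs_Im_le_cmod[of "?e - ?J m"] by (simp only: abs_minus_cancel)
      then show ?thesis using le by simp
    qed
    then show "eventually (\<lambda>m. norm (Im (?J m)) \<le> tail_bound (1 / 3) (Suc m)) sequentially" by simp
  qed
  ultimately show ?thesis by (rule LIMSEQ_unique)
qed

text \<open>The square of a Hermite function is even, so the average sees the structure factor only through its
  symmetric differences, and a second moment of order \<open>N\<close> sets the scale \<open>sqrt N\<close>.\<close>

lemma sfac_average_bias:
  assumes i: "i \<in> taper_indices N" and \<beta>: "0 < \<beta>" "\<beta> \<le> 2" and L: "0 < L"
    and H: "(\<lambda>k. Re (sfac k)) \<in> Holder_class \<beta> L" and r: "0 < r" and N: "1 \<le> N"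
  shows "\<bar>Re (LINT \<xi>|lborel. of_real ((hermite_fun i \<xi>)\<^sup>2) * sfac (k - (1 / r) *\<^sub>R \<xi>)) - Re (sfac k)\<bar>
    \<le> 2 * real CARD('n) * L * (1 + real CARD('n)) * (sqrt (real N) / r) powr \<beta>"
proof -
  let ?h = "\<lambda>\<xi>. (hermite_fun i \<xi>)\<^sup>2" and ?s = "\<lambda>k. Re (sfac k)"
  let ?d = "real CARD('n)" let ?M = "sqrt (real N)"
  let ?C = "2 * ?d * L * (1 / r) powr \<beta>"
  have M: "0 < ?M" using N by simp
  have intp: "integrable lborel (\<lambda>\<xi>. ?h \<xi> * ?s (k - c *\<^sub>R \<xi>))" for c
    using integrable_bounded_linear[OF bounded_linear_Re integrable_sfac_average[of i k c]] by simp
  have e1: "Re (LINT \<xi>|lborel. of_real (?h \<xi>) * sfac (k - (1 / r) *\<^sub>R \<xi>)) = (LINT \<xi>|lborel. ?h \<xi> * ?s (k - (1 / r) *\<^sub>R \<xi>))"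
    using integral_bounded_linear[OF bounded_linear_Re integrable_sfac_average[of i k "1 / r"]] by simp
  have e2: "(LINT \<xi>|lborel. ?h \<xi> * ?s (k - (1 / r) *\<^sub>R \<xi>)) = (LINT \<xi>|lborel. ?h \<xi> * ?s (k - (- (1 / r)) *\<^sub>R \<xi>))"
    using lborel_integral_affine(1)[of "-1" "\<lambda>\<xi>. ?h \<xi> * ?s (k - (1 / r) *\<^sub>R \<xi>)" 0] by (simp add: hermite_fun_square_minus)
  have e3: "(LINT \<xi>|lborel. ?h \<xi> * ?s k) = ?s k" by (simp add: hermite_fun_square_integral)
  have "Re (LINT \<xi>|lborel. of_real (?h \<xi>) * sfac (k - (1 / r) *\<^sub>R \<xi>)) - ?s k
    = ((LINT \<xi>|lborel. ?h \<xi> * ?s (k - (1 / r) *\<^sub>R \<xi>)) + (LINT \<xi>|lborel. ?h \<xi> * ?s (k - (- (1 / r)) *\<^sub>R \<xi>))) / 2 - (LINT \<xi>|lborel. ?h \<xi> * ?s k)"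
    unfolding e1 e2[symmetric] e3 by simp
  also have "\<dots> = (LINT \<xi>|lborel. (?h \<xi> * ?s (k - (1 / r) *\<^sub>R \<xi>) + ?h \<xi> * ?s (k - (- (1 / r)) *\<^sub>R \<xi>)) / 2 - ?h \<xi> * ?s k)"
    using intp[of "1 / r"] intp[of "- (1 / r)"] hermite_fun_square_integral(1)[of i]
    by (subst Bochner_Integration.integral_diff) (auto simp del: scaleR_minus_left)
  finally have eq: "Re (LINT \<xi>|lborel. of_real (?h \<xi>) * sfac (k - (1 / r) *\<^sub>R \<xi>)) - ?s k
    = (LINT \<xi>|lborel. (?h \<xi> * ?s (k - (1 / r) *\<^sub>R \<xi>) + ?h \<xi> * ?s (k - (- (1 / r)) *\<^sub>R \<xi>)) / 2 - ?h \<xi> * ?s k)" .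
  let ?g = "\<lambda>\<xi>. ?C * ?M powr \<beta> * (?h \<xi> + (norm \<xi>)\<^sup>2 * ?h \<xi> / ?M\<^sup>2)"
  have gint: "integrable lborel ?g"
    using hermite_fun_square_integral(1)[of i] hermite_fun_second_moment(1)[OF i] by auto
  have "\<bar>LINT \<xi>|lborel. (?h \<xi> * ?s (k - (1 / r) *\<^sub>R \<xi>) + ?h \<xi> * ?s (k - (- (1 / r)) *\<^sub>R \<xi>)) / 2 - ?h \<xi> * ?s k\<bar>
    \<le> (LINT \<xi>|lborel. ?g \<xi>)"
  proof (rule order_trans[OF integral_abs_bound integral_mono])
    show "integrable lborel (\<lambda>\<xi>. \<bar>(?h \<xi> * ?s (k - (1 / r) *\<^sub>R \<xi>) + ?h \<xi> * ?s (k - (- (1 / r)) *\<^sub>R \<xi>)) / 2 - ?h \<xi> * ?s k\<bar>)"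
      using intp[of "1 / r"] intp[of "- (1 / r)"] hermite_fun_square_integral(1)[of i]
      by (auto simp del: scaleR_minus_left)
    show "integrable lborel ?g" by (rule gint)
    fix \<xi>
    have "\<bar>(?h \<xi> * ?s (k - (1 / r) *\<^sub>R \<xi>) + ?h \<xi> * ?s (k - (- (1 / r)) *\<^sub>R \<xi>)) / 2 - ?h \<xi> * ?s k\<bar>
      = ?h \<xi> * \<bar>(?s (k + (1 / r) *\<^sub>R \<xi>) + ?s (k - (1 / r) *\<^sub>R \<xi>)) / 2 - ?s k\<bar>"
    proof -
      have "(h * a + h * b) / 2 - h * c = h * ((b + a) / 2 - c)" for a b c h :: real by (simp add: field_simps)
      then show ?thesis by (simp add: abs_mult)
    qed
    also have "\<dots> \<le> ?h \<xi> * (2 * ?d * L * norm ((1 / r) *\<^sub>R \<xi>) powr \<beta>)"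
      by (intro mult_left_mono Holder_symmetric_difference[OF H \<beta> L]) simp
    also have "norm ((1 / r) *\<^sub>R \<xi>) powr \<beta> = (1 / r) powr \<beta> * norm \<xi> powr \<beta>"
      using r by (simp add: powr_mult[symmetric])
    also have "?h \<xi> * (2 * ?d * L * ((1 / r) powr \<beta> * norm \<xi> powr \<beta>)) \<le> ?h \<xi> * (2 * ?d * L * ((1 / r) powr \<beta> * (?M powr \<beta> * (1 + (norm \<xi>)\<^sup>2 / ?M\<^sup>2))))"
      using L M \<beta> by (intro mult_left_mono powr_le_second_moment) auto
    also have "\<dots> = ?g \<xi>" by (simp add: algebra_simps)
    finally show "\<bar>(?h \<xi> * ?s (k - (1 / r) *\<^sub>R \<xi>) + ?h \<xi> * ?s (k - (- (1 / r)) *\<^sub>R \<xi>)) / 2 - ?h \<xi> * ?s k\<bar> \<le> ?g \<xi>" .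
  qed
  also have "(LINT \<xi>|lborel. ?g \<xi>) = ?C * ?M powr \<beta> * (1 + (LINT \<xi>|lborel. (norm \<xi>)\<^sup>2 * ?h \<xi>) / ?M\<^sup>2)"
    using hermite_fun_square_integral[of i] hermite_fun_second_moment(1)[OF i] by simp
  also have "\<dots> \<le> ?C * ?M powr \<beta> * (1 + ?d)"
  proof (intro mult_left_mono add_left_mono)
    have "(LINT \<xi>::real^'n|lborel. (norm \<xi>)\<^sup>2 * ?h \<xi>) / ?M\<^sup>2 \<le> (?d * real N) / ?M\<^sup>2"
      using hermite_fun_second_moment(2)[OF i] by (intro divide_right_mono) auto
    also have "\<dots> = ?d" using N by simp
    finally show "(LINT \<xi>|lborel. (norm \<xi>)\<^sup>2 * ?h \<xi>) / ?M\<^sup>2 \<le> ?d" .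
  qed (use L in auto)
  also have "\<dots> = 2 * ?d * L * (1 + ?d) * (?M / r) powr \<beta>"
  proof -
    have "(?M / r) powr \<beta> = (1 / r) powr \<beta> * ?M powr \<beta>" using r M by (simp add: powr_mult[symmetric])
    then show ?thesis by (simp add: mult_ac)
  qed
  finally show ?thesis unfolding eq .
qed

end

section \<open>Mean square error\<close>

context point_process
begin

lemma multitaper_eq:
  "multitaper M \<Phi> W I (hermite_taper r) k \<omega> = (\<Sum>i\<in>I. (cmod (ctr W (mtaper k r i) \<omega>))\<^sup>2) / real (card I)"
  by (simp add: multitaper_def centered_taper_sum_def ctr_def tsum_def taper_sum_def mtaper_def plane_wave_def)

text \<open>On the whole space the tapers are orthonormal and a unimodular factor is harmless; restriction to \<open>W\<close>
  can only decrease the norm.\<close>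

lemma wind_bessel:
  assumes r: "0 < r" and W: "W \<in> sets borel" and I: "finite I"
    and e: "\<And>x. cmod (e x) = 1" "e \<in> borel_measurable borel"
  shows "(l2 (\<lambda>x. \<Sum>j\<in>I. c j * wind W (\<lambda>x. e x * of_real (hermite_taper r j x)) x))\<^sup>2 \<le> (\<Sum>j\<in>I. (cmod (c j))\<^sup>2)"
proof -
  note [measurable] = W e(2)
  let ?f = "hermite_taper r"
  let ?F = "\<lambda>x. \<Sum>j\<in>I. c j * of_real (?f j x)"
  let ?G = "\<lambda>x. \<Sum>j\<in>I. c j * wind W (\<lambda>x. e x * of_real (?f j x)) x"
  have F: "(cmod (?F x))\<^sup>2 = (\<Sum>j\<in>I. \<Sum>l\<in>I. Re (c j * cnj (c l)) * (?f j x * ?f l x))" for x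
  proof -
    have "complex_of_real ((cmod (?F x))\<^sup>2) = (\<Sum>j\<in>I. \<Sum>l\<in>I. (c j * cnj (c l)) * of_real (?f j x * ?f l x))"
      unfolding complex_norm_square cnj_sum sum_product by (intro sum.cong refl) simp
    from arg_cong[OF this, of Re] show ?thesis
      by (simp only: Re_complex_of_real Re_sum) (simp add: mult.commute)
  qed
  have int: "integrable lborel (\<lambda>x. (cmod (?F x))\<^sup>2)"
    unfolding F by (intro Bochner_Integration.integrable_sum integrable_mult_right hermite_taper_orthonormal(1) r)
  have val: "(LINT x|lborel. (cmod (?F x))\<^sup>2) = (\<Sum>j\<in>I. (cmod (c j))\<^sup>2)"
  proof -
    have "(LINT x|lborel. (cmod (?F x))\<^sup>2) = (\<Sum>j\<in>I. \<Sum>l\<in>I. Re (c j * cnj (c l)) * (if j = l then 1 else 0))"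
      unfolding F using hermite_taper_orthonormal[OF r, where 'n='n]
      by (simp add: integral_sum Bochner_Integration.integrable_sum)
    also have "\<dots> = (\<Sum>j\<in>I. Re (c j * cnj (c j)))"
      using I by (simp add: if_distrib cong: if_cong)
    also have "\<dots> = (\<Sum>j\<in>I. (cmod (c j))\<^sup>2)"
      by (simp add: complex_mult_cnj cmod_power2)
    finally show ?thesis .
  qed
  have G: "?G x = of_real (indicator W x) * (e x * ?F x)" for x
    unfolding wind_def sum_distrib_left by (intro sum.cong refl) simp
  have le: "(cmod (?G x))\<^sup>2 \<le> (cmod (?F x))\<^sup>2" for x
    unfolding G norm_mult by (cases "x \<in> W") (simp_all add: e(1))
  have "(l2 ?G)\<^sup>2 \<le> (LINT x|lborel. (cmod (?F x))\<^sup>2)"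
    unfolding l2_square
  proof (rule integral_mono)
    show "integrable lborel (\<lambda>x. (cmod (?G x))\<^sup>2)"
    proof (rule Bochner_Integration.integrable_bound[OF int])
      show "(\<lambda>x. (cmod (?G x))\<^sup>2) \<in> borel_measurable lborel" unfolding wind_def by measurable
      show "AE x in lborel. norm ((cmod (?G x))\<^sup>2) \<le> norm ((cmod (?F x))\<^sup>2)" using le by (intro AE_I2) simp
    qed
  qed (use int le in auto)
  then show ?thesis unfolding val .
qed

lemma cnj_mtaper_sq_int: "0 < r \<Longrightarrow> sq_int (\<lambda>x. cnj (mtaper k r i x))"
  by (simp add: sq_int_cnj mtaper_norm)

text \<open>The Bessel inequality of the windowed tapers bounds the inner sum for every \<open>i\<close>; this replaces a bound
  of order \<open>(card I)\<^sup>2\<close> by one of order \<open>card I\<close>.\<close>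

lemma gaussian_part:
  assumes r: "0 < r" and W: "W \<in> sets borel" and I: "finite I"
  shows "(\<Sum>i\<in>I. \<Sum>j\<in>I. (cmod (corr_form q (wind W (mtaper k r i)) (wind W (mtaper k r j))))\<^sup>2
      + (cmod (corr_form q (wind W (mtaper k r i)) (wind W (\<lambda>x. cnj (mtaper k r j x)))))\<^sup>2) \<le> real (card I) * (2 * Qnorm\<^sup>2)"
proof -
  have "(\<Sum>j\<in>I. (cmod (corr_form q (wind W (mtaper k r i)) (wind W (mtaper k r j))))\<^sup>2
      + (cmod (corr_form q (wind W (mtaper k r i)) (wind W (\<lambda>x. cnj (mtaper k r j x)))))\<^sup>2) \<le> 2 * Qnorm\<^sup>2" for i
  proof -
    let ?u = "wind W (mtaper k r i)"
    have u: "sq_int ?u" "l2 ?u \<le> 1" using sq_int_wind[OF W mtaper_norm(1)[OF r, of k i]] mtaper_norm(2)[OF r, of k i] by simp_all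
    have Ql: "(Qnorm * l2 ?u)\<^sup>2 \<le> Qnorm\<^sup>2"
      using u(2) Qnorm_ge_1 by (intro power_mono) (auto simp: mult_left_le)
    have cm: "(\<lambda>x. cnj (mtaper k r j x)) = (\<lambda>x. cnj (plane_wave k x) * of_real (hermite_taper r j x))" for j
      by (simp add: mtaper_def fun_eq_iff)
    have mm: "mtaper k r j = (\<lambda>x. plane_wave k x * of_real (hermite_taper r j x))" for j
      by (simp add: mtaper_def fun_eq_iff)
    have 1: "(\<Sum>j\<in>I. (cmod (corr_form q ?u (wind W (mtaper k r j))))\<^sup>2) \<le> (Qnorm * l2 ?u)\<^sup>2"
      unfolding Qnorm_def
    proof (rule sum_corr_form_square_le[OF integrable_q u(1) I])
      show "sq_int (wind W (mtaper k r j))" for j by (rule sq_int_wind(1)[OF W mtaper_norm(1)[OF r]])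
      show "(l2 (\<lambda>x. \<Sum>j\<in>I. c j * wind W (mtaper k r j) x))\<^sup>2 \<le> (\<Sum>j\<in>I. (cmod (c j))\<^sup>2)" for c
        unfolding mm by (rule wind_bessel[OF r W I]) simp_all
    qed
    have 2: "(\<Sum>j\<in>I. (cmod (corr_form q ?u (wind W (\<lambda>x. cnj (mtaper k r j x)))))\<^sup>2) \<le> (Qnorm * l2 ?u)\<^sup>2"
      unfolding Qnorm_def
    proof (rule sum_corr_form_square_le[OF integrable_q u(1) I])
      show "sq_int (wind W (\<lambda>x. cnj (mtaper k r j x)))" for j by (rule sq_int_wind(1)[OF W cnj_mtaper_sq_int[OF r]])
      show "(l2 (\<lambda>x. \<Sum>j\<in>I. c j * wind W (\<lambda>x. cnj (mtaper k r j x)) x))\<^sup>2 \<le> (\<Sum>j\<in>I. (cmod (c j))\<^sup>2)" for c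
        unfolding cm by (rule wind_bessel[OF r W I]) simp_all
    qed
    show ?thesis unfolding sum.distrib using 1 2 Ql by linarith
  qed
  then have "(\<Sum>i\<in>I. \<Sum>j\<in>I. (cmod (corr_form q (wind W (mtaper k r i)) (wind W (mtaper k r j))))\<^sup>2
      + (cmod (corr_form q (wind W (mtaper k r i)) (wind W (\<lambda>x. cnj (mtaper k r j x)))))\<^sup>2) \<le> (\<Sum>i\<in>I. 2 * Qnorm\<^sup>2)"
    by (rule sum_mono)
  then show ?thesis by simp
qed

text \<open>Squared bias, Gaussian part and cumulant part of the mean square error, with the tapers uniformly
  close to their spectral averages.\<close>

lemma mean_square_error:
  fixes R r \<theta> \<beta> L :: real and N :: nat
  assumes fin: "gamma4_red \<gamma> < \<infinity>" and \<theta>: "0 < \<theta>" "\<theta> < 2 / 3" and \<beta>: "0 < \<beta>" "\<beta> \<le> 2" and L: "0 < L"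
    and H: "(\<lambda>k. Re (sfac k)) \<in> Holder_class \<beta> L" and N: "1 \<le> N" and r: "0 < r" "r * hermite_cutoff \<theta> N \<le> R"
  defines "I \<equiv> taper_indices N :: (nat ^ 'n) set"
    and "b \<equiv> 2 * real CARD('n) * L * (1 + real CARD('n)) * (sqrt (real N) / r) powr \<beta> + tail_bound \<theta> N"
  shows "integrable M (\<lambda>\<omega>. (multitaper M \<Phi> (window R) I (hermite_taper r) k \<omega> - Re (sfac k))\<^sup>2)"
    and "(LINT \<omega>|M. (multitaper M \<Phi> (window R) I (hermite_taper r) k \<omega> - Re (sfac k))\<^sup>2)
      \<le> b\<^sup>2 + 2 * Qnorm\<^sup>2 / real (card I)
        + ((sqrt (2 * real N) / r) ^ CARD('n))\<^sup>2 * (cumulant_mass * measure lborel (window R :: (real ^ 'n) set)) / (real (card I))\<^sup>2"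
proof -
  let ?W = "window R :: (real ^ 'n) set" let ?Z = "\<lambda>i. ctr ?W (mtaper k r i)" let ?s = "Re (sfac k)"
  let ?\<rho> = "(sqrt (2 * real N) / r) ^ CARD('n)"
  let ?V = "real (card I) * (2 * Qnorm\<^sup>2) + ?\<rho>\<^sup>2 * (cumulant_mass * measure lborel ?W)"
  define X where "X \<omega> = (\<Sum>i\<in>I. (cmod (?Z i \<omega>))\<^sup>2)" for \<omega>
  define n where "n = real (card I)"
  have I: "finite I" by (simp add: I_def)
  have n: "0 < n" using N by (simp add: n_def I_def card_taper_indices)
  have Zm: "?Z i \<in> borel_measurable M" for i by (rule measurable_ctr[OF window_facts continuous_mtaper])
  have Xm [measurable]: "X \<in> borel_measurable M" unfolding X_def using Zm by measurable
  have \<rho>: "(\<Sum>i\<in>I. (cmod (mtaper k r i y))\<^sup>2) \<le> ?\<rho>" for y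
    unfolding cmod_mtaper power2_abs I_def by (rule sum_hermite_taper_square_le[OF r(1)])
  note four = fourth_moment[OF window_facts[of R] I fin continuous_mtaper \<rho>]
  have X2: "integrable M (\<lambda>\<omega>. (X \<omega>)\<^sup>2)" unfolding X_def by (rule four(1))
  have X1: "integrable M X"
  proof (rule Bochner_Integration.integrable_bound)
    show "integrable M (\<lambda>\<omega>. 1 + (X \<omega>)\<^sup>2)" using X2 by simp
    show "AE \<omega> in M. norm (X \<omega>) \<le> norm (1 + (X \<omega>)\<^sup>2)"
    proof (rule AE_I2)
      fix \<omega>
      have "2 * \<bar>X \<omega>\<bar> \<le> 1 + (X \<omega>)\<^sup>2" using sum_squares_bound[of "\<bar>X \<omega>\<bar>" 1] by simp
      then show "norm (X \<omega>) \<le> norm (1 + (X \<omega>)\<^sup>2)" by simp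
    qed
  qed simp
  have Zi: "integrable M (\<lambda>\<omega>. (cmod (?Z i \<omega>))\<^sup>2)" if "i \<in> I" for i
  proof (rule Bochner_Integration.integrable_bound[OF X1])
    have "(cmod (?Z i \<omega>))\<^sup>2 \<le> X \<omega>" for \<omega>
      unfolding X_def using I that by (intro member_le_sum) auto
    then show "AE \<omega> in M. norm ((cmod (?Z i \<omega>))\<^sup>2) \<le> norm (X \<omega>)"
      by (intro AE_I2) (auto intro: order_trans[OF _ abs_ge_self])
  qed (use Zm[of i] in measurable)
  have EX: "(LINT \<omega>|M. X \<omega>) = (\<Sum>i\<in>I. LINT \<omega>|M. (cmod (?Z i \<omega>))\<^sup>2)"
    unfolding X_def by (rule Bochner_Integration.integral_sum[OF Zi])
  have "(LINT \<omega>|M. (X \<omega>)\<^sup>2) \<le> (LINT \<omega>|M. X \<omega>)\<^sup>2 + ?V"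
    using four(2) gaussian_part[OF r(1) window_facts(1)[of R] I, of k] unfolding X_def[symmetric] EX[symmetric] by linarith
  then have var: "(LINT \<omega>|M. (X \<omega>)\<^sup>2) \<le> (LINT \<omega>|M. X \<omega>)\<^sup>2 + ?V" .
  \<comment> \<open>Each squared taper sum is compared with its spectral average, and that average with the value at \<open>k\<close>.\<close>
  have bias_i: "\<bar>(LINT \<omega>|M. (cmod (?Z i \<omega>))\<^sup>2) - ?s\<bar> \<le> b" if i: "i \<in> I" for i
  proof -
    let ?J = "LINT \<xi>|lborel. of_real ((hermite_fun i \<xi>)\<^sup>2) * sfac (k - (1 / r) *\<^sub>R \<xi>)"
    let ?e = "LINT \<omega>|M. (cmod (?Z i \<omega>))\<^sup>2"
    have i': "i \<in> taper_indices N" using i by (simp add: I_def)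
    have "cmod (of_real ?e - ?J) \<le> tail_bound \<theta> N" by (rule mean_square_taper[OF i' \<theta> r])
    then have "\<bar>?e - Re ?J\<bar> \<le> tail_bound \<theta> N"
      using abs_Re_le_cmod[of "of_real ?e - ?J"] by simp
    moreover have "\<bar>Re ?J - ?s\<bar> \<le> 2 * real CARD('n) * L * (1 + real CARD('n)) * (sqrt (real N) / r) powr \<beta>"
      by (rule sfac_average_bias[OF i' \<beta> L H r(1) N])
    ultimately show ?thesis unfolding b_def by linarith
  qed
  have bias: "\<bar>(LINT \<omega>|M. X \<omega>) / n - ?s\<bar> \<le> b"
  proof -
    have "(LINT \<omega>|M. X \<omega>) - n * ?s = (\<Sum>i\<in>I. (LINT \<omega>|M. (cmod (?Z i \<omega>))\<^sup>2) - ?s)"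
      unfolding EX by (simp add: sum_subtractf n_def)
    then have "\<bar>(LINT \<omega>|M. X \<omega>) - n * ?s\<bar> \<le> (\<Sum>i\<in>I. b)"
      using order_trans[OF sum_abs sum_mono[OF bias_i]] by simp
    then have "\<bar>(LINT \<omega>|M. X \<omega>) - n * ?s\<bar> \<le> n * b" by (simp add: n_def)
    moreover have "(LINT \<omega>|M. X \<omega>) / n - ?s = ((LINT \<omega>|M. X \<omega>) - n * ?s) / n" using n by (simp add: field_simps)
    ultimately show ?thesis using n by (simp add: abs_divide pos_divide_le_eq mult.commute)
  qed
  have mt: "multitaper M \<Phi> ?W I (hermite_taper r) k \<omega> = X \<omega> / n" for \<omega>
    by (simp add: multitaper_eq X_def n_def)
  have expand: "(X \<omega> / n - ?s)\<^sup>2 = (1 / n\<^sup>2) * (X \<omega>)\<^sup>2 - (2 * ?s / n) * X \<omega> + ?s\<^sup>2" for \<omega>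
    by (simp add: power2_diff power_divide)
  show "integrable M (\<lambda>\<omega>. (multitaper M \<Phi> ?W I (hermite_taper r) k \<omega> - ?s)\<^sup>2)"
    unfolding mt expand using X1 X2 by simp
  have "(LINT \<omega>|M. (multitaper M \<Phi> ?W I (hermite_taper r) k \<omega> - ?s)\<^sup>2)
      = (1 / n\<^sup>2) * (LINT \<omega>|M. (X \<omega>)\<^sup>2) - (2 * ?s / n) * (LINT \<omega>|M. X \<omega>) + ?s\<^sup>2"
    unfolding mt expand using X1 X2 by (simp add: prob_space)
  also have "\<dots> \<le> (1 / n\<^sup>2) * ((LINT \<omega>|M. X \<omega>)\<^sup>2 + ?V) - (2 * ?s / n) * (LINT \<omega>|M. X \<omega>) + ?s\<^sup>2"
    using var by (intro add_right_mono diff_right_mono mult_left_mono) auto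
  also have "\<dots> = ((LINT \<omega>|M. X \<omega>) / n - ?s)\<^sup>2 + ?V / n\<^sup>2"
    by (simp add: power2_diff power_divide add_divide_distrib)
  also have "((LINT \<omega>|M. X \<omega>) / n - ?s)\<^sup>2 \<le> b\<^sup>2"
    using bias by (metis abs_ge_zero power2_abs power_mono)
  also have "b\<^sup>2 + ?V / n\<^sup>2 = b\<^sup>2 + 2 * Qnorm\<^sup>2 / n + ?\<rho>\<^sup>2 * (cumulant_mass * measure lborel ?W) / n\<^sup>2"
    using n unfolding n_def[symmetric] by (simp add: add_divide_distrib power2_eq_square)
  finally show "(LINT \<omega>|M. (multitaper M \<Phi> ?W I (hermite_taper r) k \<omega> - ?s)\<^sup>2)
      \<le> b\<^sup>2 + 2 * Qnorm\<^sup>2 / real (card I) + ?\<rho>\<^sup>2 * (cumulant_mass * measure lborel ?W) / (real (card I))\<^sup>2"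
    unfolding n_def by simp
qed

lemma measure_window: "0 \<le> R \<Longrightarrow> measure lborel (window R :: (real ^ 'n) set) = (2 * R) ^ CARD('n)"
  unfolding window_def by (subst content_cbox_cart) (auto simp: interval_eq_empty_cart)

definition unit_window :: "(real ^ 'n) set" where "unit_window = window (1 / 2)"

definition unit_moment :: real where "unit_moment = (LINT \<omega>|M. (1 + npts unit_window \<omega>) ^ 4)"

text \<open>For a window inside the unit cube only the number of points of the cube enters: the modulus of a
  taper is at most \<open>sqrt \<rho>\<close>.\<close>

lemma crude_error:
  fixes R r :: real and N :: nat
  assumes N: "1 \<le> N" and r: "0 < r" and R: "0 < R" "R \<le> 1 / 2"
  defines "I \<equiv> taper_indices N :: (nat ^ 'n) set"
    and "\<rho> \<equiv> (sqrt (2 * real N) / r) ^ CARD('n)"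
  shows "integrable M (\<lambda>\<omega>. (multitaper M \<Phi> (window R) I (hermite_taper r) k \<omega> - Re (sfac k))\<^sup>2)"
    and "(LINT \<omega>|M. (multitaper M \<Phi> (window R) I (hermite_taper r) k \<omega> - Re (sfac k))\<^sup>2) \<le> 32 * \<rho>\<^sup>2 * unit_moment + 2 * Qnorm\<^sup>2"
proof -
  let ?W = "window R :: (real ^ 'n) set" let ?Z = "\<lambda>i. ctr ?W (mtaper k r i)" let ?s = "Re (sfac k)"
  let ?mt = "\<lambda>\<omega>. multitaper M \<Phi> ?W I (hermite_taper r) k \<omega>"
  have n: "0 < real (card I)" using N by (simp add: I_def card_taper_indices)
  have Zm: "?Z i \<in> borel_measurable M" for i by (rule measurable_ctr[OF window_facts continuous_mtaper])
  have mtm: "?mt \<in> borel_measurable M"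
    unfolding multitaper_eq using Zm by measurable
  have unit: "unit_window \<in> sets borel" "bounded unit_window" unfolding unit_window_def by (rule window_facts)+
  have sub: "?W \<subseteq> unit_window"
    unfolding window_def unit_window_def using R(2) by (intro subset_box_imp) (simp add: Basis_vec_def inner_axis)
  have vol1: "measure lborel ?W \<le> 1"
    using R power_le_one[of "2 * R" "CARD('n)"] by (subst measure_window) (simp_all del: power_mult_distrib)
  have \<rho>0: "0 \<le> \<rho>" using r by (simp add: \<rho>_def)
  have le: "(?mt \<omega> - ?s)\<^sup>2 \<le> 32 * \<rho>\<^sup>2 * (1 + npts unit_window \<omega>) ^ 4 + 2 * Qnorm\<^sup>2" if \<omega>: "\<omega> \<in> space M" for \<omega>
  proof -
    let ?c = "1 + npts unit_window \<omega>"
    have c: "1 + npts ?W \<omega> \<le> ?c" using npts_mono[OF \<omega> sub unit(2)] by simp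
    have Zle: "(cmod (?Z i \<omega>))\<^sup>2 \<le> 4 * \<rho> * ?c\<^sup>2" if i: "i \<in> I" for i
    proof -
      have "cmod (mtaper k r i x) \<le> sqrt \<rho>" for x
        unfolding \<rho>_def using i r by (intro cmod_mtaper_le) (simp_all add: I_def)
      then have "cmod (?Z i \<omega>) \<le> sqrt \<rho> * (1 + measure lborel ?W) * (1 + npts ?W \<omega>)"
        by (rule ctr_bound[OF window_facts _ measurable_tsum[OF window_facts continuous_mtaper]])
      also have "\<dots> \<le> sqrt \<rho> * 2 * ?c"
        using \<rho>0 vol1 c by (intro mult_mono) auto
      finally have "(cmod (?Z i \<omega>))\<^sup>2 \<le> (sqrt \<rho> * 2 * ?c)\<^sup>2" by (intro power_mono) auto
      then have "(cmod (?Z i \<omega>))\<^sup>2 \<le> (sqrt \<rho>)\<^sup>2 * 2\<^sup>2 * ?c\<^sup>2" unfolding power_mult_distrib .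
      then show ?thesis using \<rho>0 by (simp add: mult.commute)
    qed
    have mt0: "0 \<le> ?mt \<omega>" unfolding multitaper_eq by (intro divide_nonneg_nonneg sum_nonneg) auto
    have "?mt \<omega> \<le> (\<Sum>i\<in>I. 4 * \<rho> * ?c\<^sup>2) / real (card I)"
      unfolding multitaper_eq using Zle by (intro divide_right_mono sum_mono) auto
    also have "\<dots> = 4 * \<rho> * ?c\<^sup>2" using n by simp
    finally have "(?mt \<omega>)\<^sup>2 \<le> (4 * \<rho> * ?c\<^sup>2)\<^sup>2" using mt0 by (intro power_mono)
    also have "\<dots> = 16 * \<rho>\<^sup>2 * ?c ^ 4" by (simp add: power_mult_distrib flip: power_mult)
    finally have m2: "(?mt \<omega>)\<^sup>2 \<le> 16 * \<rho>\<^sup>2 * ?c ^ 4" .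
    have "\<bar>?s\<bar> \<le> Qnorm" unfolding Qnorm_def by (rule order_trans[OF abs_Re_le_cmod sfac_bound])
    then have s2: "?s\<^sup>2 \<le> Qnorm\<^sup>2" by (metis abs_ge_zero power2_abs power_mono)
    have "(a - c)\<^sup>2 \<le> 2 * a\<^sup>2 + 2 * c\<^sup>2" for a c :: real
      using zero_le_power2[of "a + c"] by (simp add: power2_sum power2_diff)
    from this[of "?mt \<omega>" ?s] show ?thesis using m2 s2 by linarith
  qed
  have unit4: "integrable M (\<lambda>\<omega>. (1 + npts unit_window \<omega>) ^ 4)"
    using measurable_npts[OF unit] by (intro integrable_npts_polynomial[OF unit, where c=1]) auto
  have dom: "integrable M (\<lambda>\<omega>. 32 * \<rho>\<^sup>2 * (1 + npts unit_window \<omega>) ^ 4 + 2 * Qnorm\<^sup>2)"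
    using unit4 by simp
  show int: "integrable M (\<lambda>\<omega>. (?mt \<omega> - ?s)\<^sup>2)"
    by (rule Bochner_Integration.integrable_bound[OF dom])
      (use mtm le in \<open>auto intro!: AE_I2 order_trans[OF _ abs_ge_self]\<close>)
  have "(LINT \<omega>|M. (?mt \<omega> - ?s)\<^sup>2) \<le> (LINT \<omega>|M. 32 * \<rho>\<^sup>2 * (1 + npts unit_window \<omega>) ^ 4 + 2 * Qnorm\<^sup>2)"
    by (rule integral_mono[OF int dom le])
  also have "\<dots> = 32 * \<rho>\<^sup>2 * unit_moment + 2 * Qnorm\<^sup>2"
    using unit4 by (simp add: unit_moment_def prob_space)
  finally show "(LINT \<omega>|M. (?mt \<omega> - ?s)\<^sup>2) \<le> 32 * \<rho>\<^sup>2 * unit_moment + 2 * Qnorm\<^sup>2" .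
qed

text \<open>The structure factor is real, so its distance to the estimator is a real difference.\<close>

lemma L2_error_eq:
  assumes "integrable M (\<lambda>\<omega>. (X \<omega> - Re (sfac k))\<^sup>2)"
  shows "L2_error M X (sfac k) = ennreal (sqrt (LINT \<omega>|M. (X \<omega> - Re (sfac k))\<^sup>2))"
proof -
  have s: "sfac k = of_real (Re (sfac k))" using sfac_real[of k] by (simp add: complex_eq_iff)
  have "(cmod (of_real (X \<omega>) - sfac k))\<^sup>2 = (X \<omega> - Re (sfac k))\<^sup>2" for \<omega>
    by (subst s) (simp only: of_real_diff[symmetric] norm_of_real power2_abs)
  then have "(\<integral>\<^sup>+\<omega>. ennreal ((cmod (of_real (X \<omega>) - sfac k))\<^sup>2) \<partial>M) = ennreal (LINT \<omega>|M. (X \<omega> - Re (sfac k))\<^sup>2)"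
    using assms by (simp add: nn_integral_eq_integral)
  then show ?thesis by (simp add: L2_error_def ennreal_sqrt_def integral_nonneg_AE)
qed

end

section \<open>The rate of convergence\<close>

text \<open>Let \<open>A = V powr (2 * \<beta> / (2 * \<beta> + d))\<close>. Then \<open>T\<^sup>2 * A = 1\<close> and the hypothesis says that \<open>n\<close> is
  comparable to \<open>s * A\<close>. As \<open>n \<ge> 1\<close>, this bounds \<open>A\<close> and hence \<open>V\<close> from below, and the constant \<open>U\<close>
  absorbs the factor \<open>B = A / V\<close>, a negative power of \<open>V\<close>.\<close>

lemma window_scaling:
  fixes \<beta> d c2 c3 s V n :: real
  assumes pos: "0 < \<beta>" "0 < d" "0 < c2" "0 < s" "0 < V" "1 \<le> n"
    and n: "n * inverse (V powr (2 * \<beta> / (2 * \<beta> + d)) * s) \<in> {c2<..<c3}"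
  defines "T \<equiv> V powr (- (\<beta> / (2 * \<beta> + d)))" and "U \<equiv> (c3 * s) powr (d / (2 * \<beta>))"
  shows "1 / n \<le> T\<^sup>2 / (c2 * s)"
    and "1 / V \<le> U * T\<^sup>2"
    and "(n / V) powr (\<beta> / d) \<le> (c3 * s) powr (\<beta> / d) * T"
    and "n / V \<le> c3 * s * U"
proof -
  let ?p = "2 * \<beta> + d"
  define A where "A = V powr (2 * \<beta> / ?p)"
  define B where "B = V powr (- (d / ?p))"
  have p: "0 < ?p" using pos by simp
  have A: "0 < A" and B: "0 < B" and T: "0 < T" using pos by (simp_all add: A_def B_def T_def)
  have c3: "0 < c3" using pos n by auto
  have lo: "c2 * (A * s) < n" and hi: "n < c3 * (A * s)"
    using n A pos(4) unfolding A_def[symmetric] by (simp_all add: divide_inverse[symmetric] less_divide_eq divide_less_eq)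
  have T2: "T\<^sup>2 * A = 1"
  proof -
    have "T\<^sup>2 = V powr (- (2 * \<beta> / ?p))"
      unfolding T_def using pos(5) by (simp add: powr_powr mult.commute flip: powr_numeral)
    then show ?thesis unfolding A_def using pos(5) by (simp flip: powr_add)
  qed
  have AV: "A = B * V"
  proof -
    have "2 * \<beta> / ?p = - (d / ?p) + 1" using p by (simp add: field_simps)
    then show ?thesis unfolding A_def B_def using pos(5) by (simp only: powr_add powr_one)
  qed
  have BU: "B \<le> U"
  proof -
    have "1 < c3 * s * A" using hi pos(6) by (simp add: mult_ac)
    then have "1 / (c3 * s) \<le> A" using c3 pos(4) by (simp add: divide_le_eq mult_ac)
    then have "A powr (- (d / (2 * \<beta>))) \<le> (1 / (c3 * s)) powr (- (d / (2 * \<beta>)))"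
      using c3 pos by (intro powr_mono2') auto
    also have "\<dots> = U" unfolding U_def using c3 pos by (simp add: powr_minus powr_divide inverse_eq_divide)
    also have "A powr (- (d / (2 * \<beta>))) = B"
    proof -
      have "2 * \<beta> / ?p * (- (d / (2 * \<beta>))) = - (d / ?p)" using p pos(1) by (simp add: field_simps)
      then show ?thesis unfolding A_def B_def powr_powr by (simp only:)
    qed
    finally show ?thesis .
  qed
  show "1 / n \<le> T\<^sup>2 / (c2 * s)"
  proof -
    have "c2 * s * (T\<^sup>2 * A) \<le> T\<^sup>2 * n"
      using mult_left_mono[OF less_imp_le[OF lo], of "T\<^sup>2"] by (simp add: mult_ac)
    then show ?thesis using pos unfolding T2 by (simp add: field_simps)
  qed
  have inv: "1 / V = B * T\<^sup>2"
  proof -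
    have "1 = (B * T\<^sup>2) * V" using T2 AV by (simp add: mult_ac)
    then show ?thesis using pos(5) by (simp add: field_simps)
  qed
  show "1 / V \<le> U * T\<^sup>2" unfolding inv using BU by (intro mult_right_mono) auto
  have nV: "n / V \<le> c3 * s * B"
    using hi pos(5) unfolding AV by (simp add: divide_le_eq mult_ac)
  show "n / V \<le> c3 * s * U"
    by (rule order_trans[OF nV mult_left_mono[OF BU]]) (use c3 pos(4) in simp)
  have "(n / V) powr (\<beta> / d) \<le> (c3 * s * B) powr (\<beta> / d)"
    using nV pos by (intro powr_mono2) auto
  also have "\<dots> = (c3 * s) powr (\<beta> / d) * B powr (\<beta> / d)"
    using c3 pos B by (simp add: powr_mult)
  also have "B powr (\<beta> / d) = T"
  proof -
    have "- (d / ?p) * (\<beta> / d) = - (\<beta> / ?p)" using pos(2) by simp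
    then show ?thesis unfolding B_def T_def powr_powr by (simp only:)
  qed
  finally show "(n / V) powr (\<beta> / d) \<le> (c3 * s) powr (\<beta> / d) * T" .
qed

text \<open>The exponent \<open>1 / 3 + \<theta>\<close> is at most \<open>1\<close>, so the cutoff is of the order of the turning point.\<close>

lemma hermite_cutoff_le:
  assumes "\<theta> \<le> 2 / 3" "1 \<le> N"
  shows "hermite_cutoff \<theta> N \<le> sqrt 3 * sqrt (real N)"
proof -
  have "real N powr (1 / 3 + \<theta>) \<le> real N powr 1" using assms by (intro powr_mono) auto
  then have "2 * real N + real N powr (1 / 3 + \<theta>) \<le> 3 * real N" using assms by simp
  then show ?thesis unfolding hermite_cutoff_def real_sqrt_mult[symmetric] by (rule real_sqrt_le_mono)
qed

lemma taper_scale: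
  fixes R \<theta> d :: real
  assumes \<theta>: "\<theta> \<le> 2 / 3" and N: "1 \<le> N" and R: "0 < R" and D: "0 < D"
  defines "r \<equiv> R / hermite_cutoff \<theta> N" and "V \<equiv> (2 * R) ^ D" and "n \<equiv> real N ^ D"
  shows "0 < r" and "r * hermite_cutoff \<theta> N = R"
    and "0 \<le> \<beta> \<Longrightarrow> (sqrt (real N) / r) powr \<beta> \<le> (2 * sqrt 3) powr \<beta> * (n / V) powr (\<beta> / real D)"
    and "(sqrt (2 * real N) / r) ^ D \<le> (2 * sqrt 6) ^ D * (n / V)"
proof -
  have h: "0 < hermite_cutoff \<theta> N" using N by (simp add: hermite_cutoff_def add_pos_nonneg)
  show r: "0 < r" and "r * hermite_cutoff \<theta> N = R" using h R by (simp_all add: r_def)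
  have NR: "sqrt (real N) / r \<le> 2 * sqrt 3 * (real N / (2 * R))"
  proof -
    have "sqrt (real N) / r = sqrt (real N) * hermite_cutoff \<theta> N / R" using R h by (simp add: r_def)
    also have "\<dots> \<le> sqrt (real N) * (sqrt 3 * sqrt (real N)) / R"
      using R by (intro divide_right_mono mult_left_mono hermite_cutoff_le[OF \<theta> N]) auto
    also have "\<dots> = sqrt 3 * (sqrt (real N) * sqrt (real N)) / R" by (simp only: mult_ac)
    also have "sqrt (real N) * sqrt (real N) = real N" by simp
    finally show ?thesis by simp
  qed
  have nV: "(real N / (2 * R)) ^ D = n / V" by (simp add: n_def V_def power_divide)
  show "(sqrt (real N) / r) powr \<beta> \<le> (2 * sqrt 3) powr \<beta> * (n / V) powr (\<beta> / real D)" if "0 \<le> \<beta>"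
  proof -
    have q: "0 < real N / (2 * R)" using N R by simp
    have "(sqrt (real N) / r) powr \<beta> \<le> (2 * sqrt 3 * (real N / (2 * R))) powr \<beta>"
      using NR r that by (intro powr_mono2) auto
    also have "\<dots> = (2 * sqrt 3) powr \<beta> * (real N / (2 * R)) powr \<beta>" by (rule powr_mult)
    also have "(real N / (2 * R)) powr \<beta> = ((real N / (2 * R)) powr real D) powr (\<beta> / real D)"
      using D by (simp add: powr_powr)
    also have "(real N / (2 * R)) powr real D = n / V" unfolding powr_realpow[OF q] by (rule nV)
    finally show ?thesis .
  qed
  have "sqrt (2 * real N) / r = sqrt 2 * (sqrt (real N) / r)" by (simp add: real_sqrt_mult)
  also have "\<dots> \<le> sqrt 2 * (2 * sqrt 3 * (real N / (2 * R)))" by (intro mult_left_mono NR) simp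
  also have "\<dots> = 2 * sqrt 6 * (real N / (2 * R))"
  proof -
    have "sqrt 6 = sqrt 2 * sqrt 3" by (simp flip: real_sqrt_mult)
    then show ?thesis by (simp only: mult_ac)
  qed
  finally have "(sqrt (2 * real N) / r) ^ D \<le> (2 * sqrt 6 * (real N / (2 * R))) ^ D"
    using r by (intro power_mono) auto
  then show "(sqrt (2 * real N) / r) ^ D \<le> (2 * sqrt 6) ^ D * (n / V)"
    unfolding nV[symmetric] by (simp only: power_mult_distrib)
qed

lemma ennreal_sqrt_top_mult:
  assumes "0 < x" shows "ennreal_sqrt (\<infinity> * ennreal x) = \<infinity>"
proof -
  have "(\<infinity>::ennreal) * ennreal x = \<infinity>" using assms by (simp add: ennreal_top_mult infinity_ennreal_def)
  then show ?thesis unfolding ennreal_sqrt_def by (simp only: if_True refl)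
qed

definition optimal_tapers :: "nat \<Rightarrow> real \<Rightarrow> real \<Rightarrow> real \<Rightarrow> real \<Rightarrow> real \<Rightarrow> nat \<Rightarrow> bool" where
  "optimal_tapers D \<beta> s c2 c3 R N \<longleftrightarrow> 0 < R \<and> 1 \<le> N \<and>
     real N ^ D * inverse (((2 * R) ^ D) powr (2 * \<beta> / (2 * \<beta> + real D)) * s) \<in> {c2<..<c3}"

abbreviation rate :: "nat \<Rightarrow> real \<Rightarrow> real \<Rightarrow> real" where
  "rate D \<beta> R \<equiv> ((2 * R) ^ D) powr (- (\<beta> / (2 * \<beta> + real D)))"

context point_process
begin

text \<open>A stretched exponential beats every power of \<open>N\<close>.\<close>

lemma tail_bound_decay:
  assumes "0 < \<theta>"
  obtains C where "0 \<le> C" "\<And>N. 1 \<le> N \<Longrightarrow> tail_bound \<theta> N \<le> C * sqrt (1 / real N ^ CARD('n))"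
proof -
  let ?D = "CARD('n)"
  define h where "h m = tail_bound \<theta> m * sqrt (real m ^ ?D)" for m
  have "(\<lambda>m. sqrt (exp (- (real m powr p) / 12)) * sqrt (real m ^ D)) \<longlonglongrightarrow> 0" if "0 < p" for p :: real and D :: nat
    using that by real_asymp
  from tendsto_mult_right_zero[OF this[of "3 * \<theta> / 2" ?D], of "2 * Qnorm * sqrt (2 * real ?D)"]
  have "h \<longlonglongrightarrow> 0"
    unfolding h_def tail_bound_def real_sqrt_mult[of "2 * real ?D"] using assms by (simp add: mult.assoc)
  then have "Bseq h" by (intro convergent_imp_Bseq convergentI)
  then obtain C where C: "0 < C" "\<And>m. norm (h m) \<le> C" by (auto elim: BseqE)
  have "tail_bound \<theta> m \<le> C * sqrt (1 / real m ^ ?D)" if "1 \<le> m" for m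
  proof -
    have "0 < sqrt (real m ^ ?D)" using that by simp
    moreover have "tail_bound \<theta> m * sqrt (real m ^ ?D) \<le> C" using C(2)[of m] by (simp add: h_def)
    ultimately show ?thesis by (simp add: real_sqrt_divide pos_le_divide_eq)
  qed
  with C(1) show ?thesis by (intro that[of C]) auto
qed

abbreviation square_error :: "real \<Rightarrow> real \<Rightarrow> nat \<Rightarrow> real ^ 'n \<Rightarrow> 'w \<Rightarrow> real" where
  "square_error \<theta> R N k \<omega> \<equiv>
     (multitaper M \<Phi> (window R) (taper_indices N :: (nat ^ 'n) set)
        (hermite_taper (R / hermite_cutoff \<theta> N)) k \<omega> - Re (sfac k))\<^sup>2"

text \<open>All three parts of the mean square error are compared with the squared rate by \<open>window_scaling\<close>.\<close>

lemma mean_square_rate: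
  fixes \<theta> \<beta> L c2 c3 s :: real
  assumes fin: "gamma4_red \<gamma> < \<infinity>" and \<theta>: "0 < \<theta>" "\<theta> < 2 / 3" and \<beta>: "0 < \<beta>" "\<beta> \<le> 2" and L: "0 < L"
    and H: "(\<lambda>k. Re (sfac k)) \<in> Holder_class \<beta> L" and c2: "0 < c2" and s: "0 < s"
  obtains C where "0 \<le> C"
    "\<And>R N k. optimal_tapers CARD('n) \<beta> s c2 c3 R N \<Longrightarrow>
      integrable M (square_error \<theta> R N k) \<and> (LINT \<omega>|M. square_error \<theta> R N k \<omega>) \<le> C * (rate CARD('n) \<beta> R)\<^sup>2"
proof -
  let ?D = "CARD('n)" let ?d = "real CARD('n)"
  obtain Ct where Ct: "0 \<le> Ct" "\<And>N. 1 \<le> N \<Longrightarrow> tail_bound \<theta> N \<le> Ct * sqrt (1 / real N ^ ?D)"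
    using tail_bound_decay[OF \<theta>(1)] by blast
  define B where "B = 2 * ?d * L * (1 + ?d) * ((2 * sqrt 3) powr \<beta> * (c3 * s) powr (\<beta> / ?d)) + Ct / sqrt (c2 * s)"
  define U where "U = (c3 * s) powr (?d / (2 * \<beta>))"
  define C where "C = B\<^sup>2 + 2 * Qnorm\<^sup>2 / (c2 * s) + ((2 * sqrt 6) ^ ?D)\<^sup>2 * cumulant_mass * U"
  have mass: "0 \<le> cumulant_mass" by (simp add: cumulant_mass_def tv_def)
  have "integrable M (square_error \<theta> R N k) \<and> (LINT \<omega>|M. square_error \<theta> R N k \<omega>) \<le> C * (rate CARD('n) \<beta> R)\<^sup>2"
    if "optimal_tapers CARD('n) \<beta> s c2 c3 R N" for R N k
  proof -
    define r where "r = R / hermite_cutoff \<theta> N"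
    define V where "V = (2 * R) ^ ?D"
    define n where "n = real N ^ ?D"
    define T where "T = V powr (- (\<beta> / (2 * \<beta> + ?d)))"
    let ?\<rho> = "(sqrt (2 * real N) / r) ^ ?D"
    let ?b = "2 * ?d * L * (1 + ?d) * (sqrt (real N) / r) powr \<beta> + tail_bound \<theta> N"
    from that have R: "0 < R" and N: "1 \<le> N"
      and nn: "n * inverse (V powr (2 * \<beta> / (2 * \<beta> + ?d)) * s) \<in> {c2<..<c3}"
      by (simp_all add: optimal_tapers_def n_def V_def)
    have V: "0 < V" and n: "1 \<le> n" using R N by (simp_all add: V_def n_def)
    have T: "0 < T" using V by (simp add: T_def)
    note ws = window_scaling[OF \<beta>(1) _ c2 s V n nn, folded T_def U_def, simplified]
    have "\<theta> \<le> 2 / 3" using \<theta> by simp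
    note ts = taper_scale[OF this N R, of ?D, folded r_def V_def n_def, simplified]
    have card: "real (card (taper_indices N :: (nat ^ 'n) set)) = n" by (simp add: card_taper_indices n_def)
    have vol: "measure lborel (window R :: (real ^ 'n) set) = V" using R by (simp add: measure_window V_def)
    note mse = mean_square_error[OF fin \<theta> \<beta> L H N ts(1), of R k, unfolded card vol]
    have "?b \<le> B * T"
    proof -
      have "(sqrt (real N) / r) powr \<beta> \<le> (2 * sqrt 3) powr \<beta> * (n / V) powr (\<beta> / ?d)" using ts(3) \<beta> by simp
      also have "\<dots> \<le> (2 * sqrt 3) powr \<beta> * ((c3 * s) powr (\<beta> / ?d) * T)"
        by (intro mult_left_mono ws(3)) simp
      finally have 1: "2 * ?d * L * (1 + ?d) * (sqrt (real N) / r) powr \<beta>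
          \<le> 2 * ?d * L * (1 + ?d) * ((2 * sqrt 3) powr \<beta> * ((c3 * s) powr (\<beta> / ?d) * T))"
        using L by (intro mult_left_mono) auto
      have "tail_bound \<theta> N \<le> Ct * sqrt (1 / n)" using Ct(2)[OF N] by (simp add: n_def)
      also have "\<dots> \<le> Ct * sqrt (T\<^sup>2 / (c2 * s))"
        by (intro mult_left_mono real_sqrt_le_mono ws(1) Ct(1))
      also have "\<dots> = Ct / sqrt (c2 * s) * T" using T by (simp add: real_sqrt_divide)
      finally have 2: "tail_bound \<theta> N \<le> Ct / sqrt (c2 * s) * T" .
      have "B * T = 2 * ?d * L * (1 + ?d) * ((2 * sqrt 3) powr \<beta> * ((c3 * s) powr (\<beta> / ?d) * T)) + Ct / sqrt (c2 * s) * T"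
        unfolding B_def distrib_right by (simp only: mult.assoc)
      with 1 2 show ?thesis by linarith
    qed
    moreover have "0 \<le> ?b" using L Qnorm_ge_1 by (auto simp: tail_bound_def intro!: add_nonneg_nonneg)
    ultimately have b2: "?b\<^sup>2 \<le> (B * T)\<^sup>2" by (intro power_mono)
    have g2: "2 * Qnorm\<^sup>2 / n \<le> 2 * Qnorm\<^sup>2 / (c2 * s) * T\<^sup>2"
      using mult_left_mono[OF ws(1), of "2 * Qnorm\<^sup>2"] by simp
    have r2: "?\<rho>\<^sup>2 * (cumulant_mass * V) / n\<^sup>2 \<le> ((2 * sqrt 6) ^ ?D)\<^sup>2 * cumulant_mass * U * T\<^sup>2"
    proof -
      have "?\<rho>\<^sup>2 \<le> ((2 * sqrt 6) ^ ?D * (n / V))\<^sup>2" using ts(1,4) by (intro power_mono) auto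
      then have "?\<rho>\<^sup>2 * (cumulant_mass * V) / n\<^sup>2 \<le> ((2 * sqrt 6) ^ ?D * (n / V))\<^sup>2 * (cumulant_mass * V) / n\<^sup>2"
        using mass V by (intro divide_right_mono mult_right_mono) auto
      also have "\<dots> = ((2 * sqrt 6) ^ ?D)\<^sup>2 * cumulant_mass * (1 / V)"
        using V n unfolding power_mult_distrib[of _ "n / V"] power_divide[of n V]
        by (simp add: field_simps power2_eq_square)
      also have "\<dots> \<le> ((2 * sqrt 6) ^ ?D)\<^sup>2 * cumulant_mass * (U * T\<^sup>2)"
        using mass by (intro mult_left_mono ws(2)) auto
      finally show ?thesis by (simp only: mult.assoc)
    qed
    have "C * T\<^sup>2 = (B * T)\<^sup>2 + 2 * Qnorm\<^sup>2 / (c2 * s) * T\<^sup>2 + ((2 * sqrt 6) ^ ?D)\<^sup>2 * cumulant_mass * U * T\<^sup>2"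
      unfolding C_def distrib_right power_mult_distrib[of B T] ..
    with b2 g2 r2 mse(2) have "(LINT \<omega>|M. square_error \<theta> R N k \<omega>) \<le> C * T\<^sup>2"
      using ts(2) unfolding r_def[symmetric] by linarith
    moreover have "integrable M (square_error \<theta> R N k)"
      using mse(1) ts(2) unfolding r_def[symmetric] by simp
    ultimately show ?thesis unfolding T_def V_def by blast
  qed
  moreover have "0 \<le> C"
    unfolding C_def U_def using mass c2 s by (intro add_nonneg_nonneg mult_nonneg_nonneg divide_nonneg_nonneg) auto
  ultimately show ?thesis using that[of C] by blast
qed

text \<open>For small windows the crude bound suffices: the lower bound on the volume keeps \<open>\<rho>\<close> bounded, and the
  rate is at least \<open>1\<close>.\<close>

lemma mean_square_small_window:
  fixes \<theta> \<beta> c2 c3 s :: real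
  assumes \<theta>: "0 < \<theta>" "\<theta> < 2 / 3" and \<beta>: "0 < \<beta>" and c2: "0 < c2" and s: "0 < s"
  obtains C where "0 \<le> C"
    "\<And>R N k. optimal_tapers CARD('n) \<beta> s c2 c3 R N \<Longrightarrow> (2 * R) ^ CARD('n) \<le> 1 \<Longrightarrow>
      integrable M (square_error \<theta> R N k) \<and> (LINT \<omega>|M. square_error \<theta> R N k \<omega>) \<le> C * (rate CARD('n) \<beta> R)\<^sup>2"
proof -
  let ?D = "CARD('n)" let ?d = "real CARD('n)"
  define U where "U = (c3 * s) powr (?d / (2 * \<beta>))"
  define P where "P = (2 * sqrt 6) ^ ?D * (c3 * s * U)"
  define C where "C = 32 * P\<^sup>2 * unit_moment + 2 * Qnorm\<^sup>2"
  have um: "0 \<le> unit_moment" unfolding unit_moment_def by (intro integral_nonneg_AE AE_I2) simp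
  have C: "0 \<le> C" unfolding C_def using um by simp
  have "integrable M (square_error \<theta> R N k) \<and> (LINT \<omega>|M. square_error \<theta> R N k \<omega>) \<le> C * (rate CARD('n) \<beta> R)\<^sup>2"
    if o: "optimal_tapers CARD('n) \<beta> s c2 c3 R N" and small: "(2 * R) ^ ?D \<le> 1" for R N k
  proof -
    define r where "r = R / hermite_cutoff \<theta> N"
    define V where "V = (2 * R) ^ ?D"
    define n where "n = real N ^ ?D"
    let ?\<rho> = "(sqrt (2 * real N) / r) ^ ?D"
    from o have R: "0 < R" and N: "1 \<le> N"
      and nn: "n * inverse (V powr (2 * \<beta> / (2 * \<beta> + ?d)) * s) \<in> {c2<..<c3}"
      by (simp_all add: optimal_tapers_def n_def V_def)
    have V: "0 < V" and n: "1 \<le> n" using R N by (simp_all add: V_def n_def)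
    note ws = window_scaling[OF \<beta>(1) _ c2 s V n nn, folded U_def, simplified]
    have "\<theta> \<le> 2 / 3" using \<theta> by simp
    note ts = taper_scale[OF this N R, of ?D, folded r_def V_def n_def, simplified]
    have R1: "R \<le> 1 / 2"
    proof (rule ccontr)
      assume "\<not> R \<le> 1 / 2"
      then have "1 < (2 * R) ^ ?D" by (intro one_less_power) auto
      with small show False by simp
    qed
    note ce = crude_error[OF N ts(1) R R1, of k]
    have "?\<rho> \<le> P"
      using ts(4) mult_left_mono[OF ws(4), of "(2 * sqrt 6) ^ ?D"] unfolding P_def by simp
    then have "?\<rho>\<^sup>2 \<le> P\<^sup>2" using ts(1) by (intro power_mono) auto
    then have "32 * ?\<rho>\<^sup>2 * unit_moment + 2 * Qnorm\<^sup>2 \<le> C"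
      unfolding C_def using um by (intro add_right_mono mult_right_mono) auto
    with ce(2) have le: "(LINT \<omega>|M. square_error \<theta> R N k \<omega>) \<le> C" unfolding r_def by linarith
    have "V powr 0 \<le> rate CARD('n) \<beta> R"
      unfolding V_def[symmetric] using V small \<beta> by (intro powr_mono') (auto simp: V_def)
    then have "1 \<le> (rate CARD('n) \<beta> R)\<^sup>2" using V by (intro one_le_power) simp
    then have "C * 1 \<le> C * (rate CARD('n) \<beta> R)\<^sup>2" using C by (intro mult_left_mono)
    with le ce(1) show ?thesis unfolding r_def by linarith
  qed
  with C show ?thesis using that[of C] by blast
qed

end

theorem corollary5p1:
  fixes M :: "'w measure"
    and \<Phi> :: "'w \<Rightarrow> (real ^ 'n) set"
    and g :: "real ^ 'n \<Rightarrow> real"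
    and S :: "real ^ 'n \<Rightarrow> complex"
    and \<gamma> :: "nat \<Rightarrow> (nat \<Rightarrow> real ^ 'n) set \<Rightarrow> real"
    and \<beta> L \<theta> \<alpha> c\<^sub>2 c\<^sub>3 d :: real
  assumes "standing_assumption M \<Phi> 1 g"
    and "\<And>m. m \<in> {2, 3, 4} \<Longrightarrow> has_reduced_cumulant M \<Phi> m (\<gamma> m)"
    and "S = structure_factor 1 g"
    and "0 < \<beta>" and "\<beta> \<le> 2" and "0 < L"
    and "(\<lambda>k. Re (S k)) \<in> Holder_class \<beta> L"
    and "0 < \<theta>" and "\<theta> < 2 / 3"
    and "0 < c\<^sub>2" and "c\<^sub>2 \<le> c\<^sub>3"
    and "d = real CARD('n)"
    and "\<alpha> = 3 * \<beta> * \<theta> / (d * (2 * \<beta> + d))"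
  shows "\<exists>c>0. \<exists>K>0. \<forall>(R::real) (imax::nat) (r::real) (W::(real ^ 'n) set) (I::(nat ^ 'n) set) (vol::real).
    0 < R \<longrightarrow> 1 \<le> imax \<longrightarrow>
    r = R / sqrt (2 * real imax + real imax powr (1 / 3 + \<theta>)) \<longrightarrow>
    W = window R \<longrightarrow> I = taper_indices imax \<longrightarrow> vol = measure lborel W \<longrightarrow>
    real (card I) * inverse (vol powr (2 * \<beta> / (2 * \<beta> + d)) * (sup_norm S / L) powr (d / (2 * \<beta> + d)))
      \<in> {c\<^sub>2<..<c\<^sub>3} \<longrightarrow>
    (SUP k\<^sub>0. L2_error M (multitaper M \<Phi> W I (hermite_taper r) k\<^sub>0) (S k\<^sub>0))
      \<le> ennreal K *
         (ennreal ((L powr d * sup_norm S powr \<beta>) powr (1 / (2 * \<beta> + d)) / vol powr (\<beta> / (2 * \<beta> + d)))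
          + ennreal_sqrt (gamma4_red \<gamma> * ennreal (ln vol ^ CARD('n) / vol))
          + ennreal (exp (- c * vol powr \<alpha>)))"
proof -
  interpret point_process M \<Phi> g \<gamma> by (unfold_locales; fact assms)
  have S: "S = sfac" using assms(3) by (simp add: sfac_def)
  let ?D = "CARD('n)" let ?p = "2 * \<beta> + real ?D"
  let ?s = "(sup_norm S / L) powr (real ?D / ?p)"
  let ?K1 = "(L powr real ?D * sup_norm S powr \<beta>) powr (1 / ?p)"
  show ?thesis
  proof (cases "sup_norm S = 0")
    case True
    \<comment> \<open>Then the condition on the number of tapers reads \<open>0 \<in> {c\<^sub>2<..<c\<^sub>3}\<close> and cannot hold.\<close>
    then have "?s = 0" by simp
    then show ?thesis
      using assms(10) unfolding assms(12) by (intro exI[of _ 1] conjI zero_less_one allI impI) auto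
  next
    case False
    have s: "0 < ?s" using False assms(6) by simp
    have K1: "0 < ?K1" using False assms(6) by simp
    have H: "(\<lambda>k. Re (sfac k)) \<in> Holder_class \<beta> L" using assms(7) by (simp add: S)
    let ?dom = "\<lambda>R::real. gamma4_red \<gamma> < \<infinity> \<or> (2 * R) ^ ?D \<le> 1"
    obtain C where C: "0 \<le> C" and bound: "\<And>R N k. optimal_tapers CARD('n) \<beta> ?s c\<^sub>2 c\<^sub>3 R N \<Longrightarrow> ?dom R \<Longrightarrow>
      integrable M (square_error \<theta> R N k) \<and> (LINT \<omega>|M. square_error \<theta> R N k \<omega>) \<le> C * (rate CARD('n) \<beta> R)\<^sup>2"
    proof (cases "gamma4_red \<gamma> < \<infinity>")
      case True
      show ?thesis
        by (rule mean_square_rate[OF True assms(8,9,4,5,6) H assms(10) s]) (rule that; blast)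
    next
      case False
      show ?thesis
        by (rule mean_square_small_window[OF assms(8,9,4,10) s]) (rule that; use False in blast)
    qed
    \<comment> \<open>The summand \<open>1\<close> keeps \<open>K\<close> positive when \<open>C = 0\<close>.\<close>
    define K where "K = sqrt C / ?K1 + 1"
    have K: "0 < K" using C K1 by (simp add: K_def add_nonneg_pos)
    show ?thesis
    proof (rule exI[of _ 1], rule conjI[OF zero_less_one], rule exI[of _ K], rule conjI[OF K], intro allI impI, goal_cases)
      case (1 R N r W I vol)
      have vol: "vol = (2 * R) ^ ?D" using 1(1,4,6) by (simp add: measure_window)
      have vol0: "0 < vol" using 1(1) vol by simp
      have r: "r = R / hermite_cutoff \<theta> N" using 1(3) by (simp add: hermite_cutoff_def)
      have opt: "optimal_tapers CARD('n) \<beta> ?s c\<^sub>2 c\<^sub>3 R N"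
        using 1(1,2,5,7) unfolding optimal_tapers_def assms(12) vol by (simp add: card_taper_indices)
      let ?a = "ennreal (?K1 / vol powr (\<beta> / ?p))"
      let ?g = "ennreal_sqrt (gamma4_red \<gamma> * ennreal (ln vol ^ ?D / vol))"
      let ?e = "ennreal (exp (- 1 * vol powr \<alpha>))"
      show ?case
        unfolding assms(12)
      proof (cases "?dom R")
        case dom: True
        have "L2_error M (multitaper M \<Phi> W I (hermite_taper r) k) (S k) \<le> ennreal K * ?a" for k
        proof -
          note b = bound[OF opt dom, of k]
          have "L2_error M (multitaper M \<Phi> W I (hermite_taper r) k) (S k)
              = ennreal (sqrt (LINT \<omega>|M. square_error \<theta> R N k \<omega>))"
            unfolding S 1(4,5) r using b by (intro L2_error_eq) blast
          also have "\<dots> \<le> ennreal (sqrt (C * (rate CARD('n) \<beta> R)\<^sup>2))"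
            using b by (intro ennreal_leI real_sqrt_le_mono) blast
          also have "\<dots> \<le> ennreal (K * (?K1 / vol powr (\<beta> / ?p)))"
          proof (rule ennreal_leI)
            have "sqrt (C * (rate CARD('n) \<beta> R)\<^sup>2) = sqrt C * rate CARD('n) \<beta> R" by (simp add: real_sqrt_mult)
            also have "\<dots> = sqrt C / vol powr (\<beta> / ?p)" unfolding vol by (simp add: powr_minus divide_inverse)
            also have "\<dots> \<le> (K * ?K1) / vol powr (\<beta> / ?p)"
            proof (rule divide_right_mono)
              have "K * ?K1 = sqrt C + ?K1" using K1 by (simp add: K_def distrib_right)
              then show "sqrt C \<le> K * ?K1" using K1 by linarith
            qed simp
            finally show "sqrt (C * (rate CARD('n) \<beta> R)\<^sup>2) \<le> K * (?K1 / vol powr (\<beta> / ?p))" by simp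
          qed
          also have "\<dots> = ennreal K * ?a" using K by (intro ennreal_mult'') simp
          finally show ?thesis .
        qed
        then have "(SUP k. L2_error M (multitaper M \<Phi> W I (hermite_taper r) k) (S k)) \<le> ennreal K * ?a"
          by (rule SUP_least)
        also have "\<dots> \<le> ennreal K * (?a + ?g + ?e)" by (intro mult_left_mono) (simp_all add: add.assoc)
        finally show "(SUP k. L2_error M (multitaper M \<Phi> W I (hermite_taper r) k) (S k)) \<le> ennreal K * (?a + ?g + ?e)" .
      next
        case False
        then have inf: "gamma4_red \<gamma> = \<infinity>" unfolding infinity_ennreal_def less_top[symmetric] by simp
        from False have "1 < vol" unfolding vol by auto
        \<comment> \<open>The cumulant term of the bound is infinite.\<close>
        then have "0 < ln vol ^ ?D / vol" by simp
        then have "?g = \<infinity>" unfolding inf by (rule ennreal_sqrt_top_mult)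
        then have "ennreal K * (?a + ?g + ?e) = \<infinity>" using K by (simp add: ennreal_mult_top)
        then show "(SUP k. L2_error M (multitaper M \<Phi> W I (hermite_taper r) k) (S k)) \<le> ennreal K * (?a + ?g + ?e)"
          by simp
      qed
    qed
  qed
qed

end
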